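(* For every $\varepsilon>0$ there exists $\delta>0$ such that the following holds. If $\varphi:\mathrm{U}(n)\to\mathrm{U}(m)$ is a continuous group homomorphism which is $\delta$-surjective with respect to the normalized trace norm, then one of the following holds: (i) $m=1$, in which case $\varphi(v)=\det(v)^k$ for some $k\in\mathbb Z$. (ii) $n\le m\le(1+\varepsilon)n$, and there exist an integer $k\in\mathbb Z$ and $u\in\mathrm{U}(m)$ such that either $$\forall v\in\mathrm{U}(n)\qquad d^{\mathrm{HS}}_m\bigl(\varphi(v),\det(v)^k\,\mathrm{ad}_u(v\oplus I_{m-n})\bigr)\le\varepsilon,$$ or $$\forall v\in\mathrm{U}(n)\qquad d^{\mathrm{HS}}_m\bigl(\varphi(v),\det(v)^k\,\mathrm{ad}_u(\overline v\oplus I_{m-n})\bigr)\le\varepsilon.$$ In particular, in case (ii), if one imposes in addition the normalization $\varphi(zI_n)=zI_m$ for all $z\in\mathbb T$, then $k=0$, unless $(n,k)=(2,1)$.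
   Context: Here $n,m\ge 1$ are integers. For $k\ge 1$, $\mathrm{U}(k)$ is the group of unitary complex $k\times k$ matrices, the normalized trace norm on $\mathrm{M}_k(\mathbb C)$ is $\|x\|_{2,k}=(\frac1k\mathrm{tr}(x^*x))^{1/2}$, and $d^{\mathrm{HS}}_k(x,y)=\|x-y\|_{2,k}$ is the induced metric on $\mathrm{U}(k)$. $I_k$ is the $k\times k$ identity matrix, $\mathbb T=\{z\in\mathbb C:|z|=1\}$, $\overline v$ is the entrywise complex conjugate of $v$, and $\mathrm{ad}_u(x)=uxu^{-1}$. A map $f$ from a metric space $(M,d)$ to a metric space $(N,\partial)$ is $\delta$-surjective if for every $y\in N$ there exists $x\in M$ with $\partial(f(x),y)\le\delta$. *)

theory Defs
  imports
    "Jordan_Normal_Form.Schur_Decomposition"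
    "HOL-Algebra.Group"
    "HOL-Analysis.Abstract_Metric_Spaces"
    "HOL-Analysis.L2_Norm"
begin

definition unitary_group :: "nat \<Rightarrow> complex mat monoid" where
  "unitary_group n =
     \<lparr>carrier = {A \<in> carrier_mat n n. mat_adjoint A * A = 1\<^sub>m n \<and> A * mat_adjoint A = 1\<^sub>m n},
      monoid.mult = (*), one = 1\<^sub>m n\<rparr>"

abbreviation U :: "nat \<Rightarrow> complex mat set" where
  "U n \<equiv> carrier (unitary_group n)"

definition mat_trace :: "'a::comm_monoid_add mat \<Rightarrow> 'a" where
  "mat_trace A = (\<Sum>i<dim_row A. A $$ (i, i))"

text \<open>The trace of \<open>x\<^sup>* x\<close> is a nonnegative real; \<open>Re\<close> only changes its type.\<close>

definition hs_norm :: "nat \<Rightarrow> complex mat \<Rightarrow> real" where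
  "hs_norm k x = sqrt (Re (mat_trace (mat_adjoint x * x)) / real k)"

definition hs_dist :: "nat \<Rightarrow> complex mat \<Rightarrow> complex mat \<Rightarrow> real" where
  "hs_dist k x y = hs_norm k (x - y)"

text \<open>\<open>Metric_space\<close> demands symmetry and nonnegativity on the whole type, where subtraction of
  matrices of different sizes is junk; hence the cut-off outside the unitary group.\<close>

definition unitary_dist :: "nat \<Rightarrow> complex mat \<Rightarrow> complex mat \<Rightarrow> real" where
  "unitary_dist n x y = (if x \<in> U n \<and> y \<in> U n then hs_dist n x y else 0)"

definition unitary_topology :: "nat \<Rightarrow> complex mat topology" where
  "unitary_topology n = Metric_space.mtopology (U n) (unitary_dist n)"

definition delta_surjective ::
  "'a set \<Rightarrow> 'b set \<Rightarrow> ('b \<Rightarrow> 'b \<Rightarrow> real) \<Rightarrow> real \<Rightarrow> ('a \<Rightarrow> 'b) \<Rightarrow> bool" where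
  "delta_surjective M N d \<delta> f \<longleftrightarrow> (\<forall>y\<in>N. \<exists>x\<in>M. d (f x) y \<le> \<delta>)"

text \<open>\<open>pad m v\<close> is the block sum of \<open>v\<close> with an identity matrix, of total size \<open>m\<close>; it is
  meant for \<open>v\<close> of size at most \<open>m\<close> (natural subtraction truncates).\<close>

definition pad :: "nat \<Rightarrow> complex mat \<Rightarrow> complex mat" where
  "pad m v = (let n = dim_row v in
     four_block_mat v (0\<^sub>m n (m - n)) (0\<^sub>m (m - n) n) (1\<^sub>m (m - n)))"

definition ad :: "nat \<Rightarrow> complex mat \<Rightarrow> complex mat \<Rightarrow> complex mat" where
  "ad m u x = u * x * inv\<^bsub>unitary_group m\<^esub> u"

definition near_standard ::
  "real \<Rightarrow> nat \<Rightarrow> nat \<Rightarrow> (complex mat \<Rightarrow> complex mat) \<Rightarrow> int \<Rightarrow> complex mat \<Rightarrow> bool" where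
  "near_standard \<epsilon> n m \<phi> k u \<longleftrightarrow>
     (\<forall>v\<in>U n. hs_dist m (\<phi> v) (det v powi k \<cdot>\<^sub>m ad m u (pad m v)) \<le> \<epsilon>) \<or>
     (\<forall>v\<in>U n. hs_dist m (\<phi> v) (det v powi k \<cdot>\<^sub>m ad m u (pad m (map_mat cnj v))) \<le> \<epsilon>)"

definition centrally_normalized :: "nat \<Rightarrow> nat \<Rightarrow> (complex mat \<Rightarrow> complex mat) \<Rightarrow> bool" where
  "centrally_normalized n m \<phi> \<longleftrightarrow> (\<forall>z. cmod z = 1 \<longrightarrow> \<phi> (z \<cdot>\<^sub>m 1\<^sub>m n) = z \<cdot>\<^sub>m 1\<^sub>m m)"


lemma mat_adjoint_carrier: "A \<in> carrier_mat n m \<Longrightarrow> mat_adjoint A \<in> carrier_mat m n"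
  by (auto simp: mat_adjoint_def)

lemma mat_adjoint_index:
  "A \<in> carrier_mat n m \<Longrightarrow> i < m \<Longrightarrow> j < n \<Longrightarrow> mat_adjoint A $$ (i, j) = conjugate (A $$ (j, i))"
  by (auto simp: mat_adjoint_def mat_of_rows_def)

lemma mat_adjoint_adjoint:
  assumes "A \<in> carrier_mat n m" shows "mat_adjoint (mat_adjoint A) = A"
proof (rule eq_matI)
  note B = mat_adjoint_carrier[OF assms]
  note C = mat_adjoint_carrier[OF B]
  fix i j assume "i < dim_row A" "j < dim_col A"
  then show "mat_adjoint (mat_adjoint A) $$ (i, j) = A $$ (i, j)"
    using assms by (simp add: mat_adjoint_index[OF B] mat_adjoint_index[OF assms])
qed (use mat_adjoint_carrier[OF mat_adjoint_carrier[OF assms]] assms in auto)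

lemma mat_adjoint_mult:
  fixes A B :: "complex mat"
  assumes A: "A \<in> carrier_mat n m" and B: "B \<in> carrier_mat m l"
  shows "mat_adjoint (A * B) = mat_adjoint B * mat_adjoint A"
proof (rule eq_matI)
  note A' = mat_adjoint_carrier[OF A] and B' = mat_adjoint_carrier[OF B]
  have AB: "A * B \<in> carrier_mat n l" using A B by auto
  show "dim_row (mat_adjoint (A * B)) = dim_row (mat_adjoint B * mat_adjoint A)"
    "dim_col (mat_adjoint (A * B)) = dim_col (mat_adjoint B * mat_adjoint A)"
    using mat_adjoint_carrier[OF AB] A' B' by auto
  fix i j assume "i < dim_row (mat_adjoint B * mat_adjoint A)"
    "j < dim_col (mat_adjoint B * mat_adjoint A)"
  then have i: "i < l" and j: "j < n" using A' B' by auto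
  have "mat_adjoint (A * B) $$ (i, j) = cnj (\<Sum>k<m. A $$ (j, k) * B $$ (k, i))"
    using i j A B AB by (simp add: mat_adjoint_index[OF AB] scalar_prod_def atLeast0LessThan)
  also have "\<dots> = (\<Sum>k<m. mat_adjoint B $$ (i, k) * mat_adjoint A $$ (k, j))"
    using i j by (simp add: mat_adjoint_index[OF A] mat_adjoint_index[OF B] mult.commute)
  also have "\<dots> = (mat_adjoint B * mat_adjoint A) $$ (i, j)"
    using i j A' B' by (simp add: scalar_prod_def atLeast0LessThan)
  finally show "mat_adjoint (A * B) $$ (i, j) = (mat_adjoint B * mat_adjoint A) $$ (i, j)" .
qed

lemma mem_U:
  "A \<in> U n \<longleftrightarrow> A \<in> carrier_mat n n \<and> mat_adjoint A * A = 1\<^sub>m n \<and> A * mat_adjoint A = 1\<^sub>m n"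
  by (simp add: unitary_group_def)

lemma unitary_group_ops:
  "x \<otimes>\<^bsub>unitary_group n\<^esub> y = x * y" "\<one>\<^bsub>unitary_group n\<^esub> = 1\<^sub>m n"
  by (simp_all add: unitary_group_def)

lemma adjoint_mem_U: "A \<in> U n \<Longrightarrow> mat_adjoint A \<in> U n"
  by (auto simp: mem_U mat_adjoint_carrier mat_adjoint_adjoint)

lemma group_unitary_group: "group (unitary_group n)"
proof (rule groupI, unfold unitary_group_ops)
  fix x y assume x: "x \<in> U n" and y: "y \<in> U n"
  have cx: "x \<in> carrier_mat n n" and cy: "y \<in> carrier_mat n n" using x y by (auto simp: mem_U)
  note ax = mat_adjoint_carrier[OF cx] and ay = mat_adjoint_carrier[OF cy]
  have "(mat_adjoint y * mat_adjoint x) * (x * y) = mat_adjoint y * (mat_adjoint x * x * y)"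
    using cx cy ax ay by (simp add: assoc_mult_mat[of _ n n _ n _ n])
  also have "\<dots> = 1\<^sub>m n" using x y left_mult_one_mat[OF cy] by (simp add: mem_U)
  finally have 1: "(mat_adjoint y * mat_adjoint x) * (x * y) = 1\<^sub>m n" .
  have "(x * y) * (mat_adjoint y * mat_adjoint x) = x * (y * mat_adjoint y * mat_adjoint x)"
    using cx cy ax ay by (simp add: assoc_mult_mat[of _ n n _ n _ n])
  also have "\<dots> = 1\<^sub>m n" using x y left_mult_one_mat[OF ax] by (simp add: mem_U)
  finally have 2: "(x * y) * (mat_adjoint y * mat_adjoint x) = 1\<^sub>m n" .
  show "x * y \<in> U n" using 1 2 cx cy by (simp add: mem_U mat_adjoint_mult[OF cx cy])
  fix z assume "z \<in> U n"
  then show "x * y * z = x * (y * z)" using cx cy by (auto simp: mem_U)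
next
  have "mat_adjoint (1\<^sub>m n) = (1\<^sub>m n :: complex mat)"
  proof (rule eq_matI)
    fix i j assume "i < dim_row (1\<^sub>m n :: complex mat)" "j < dim_col (1\<^sub>m n :: complex mat)"
    then show "mat_adjoint (1\<^sub>m n) $$ (i, j) = (1\<^sub>m n :: complex mat) $$ (i, j)"
      by (auto simp: mat_adjoint_index[of _ n n])
  qed (use mat_adjoint_carrier[OF one_carrier_mat[of n]] in auto)
  then show "1\<^sub>m n \<in> U n" by (simp add: mem_U)
next
  fix x assume x: "x \<in> U n"
  then show "1\<^sub>m n * x = x" by (auto simp: mem_U intro: left_mult_one_mat)
  show "\<exists>y\<in>U n. y * x = 1\<^sub>m n" using adjoint_mem_U[OF x] x by (auto simp: mem_U)
qed

lemma inv_unitary_group: "u \<in> U n \<Longrightarrow> inv\<^bsub>unitary_group n\<^esub> u = mat_adjoint u"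
  using group.inv_equality[OF group_unitary_group, of n "mat_adjoint u" u] adjoint_mem_U[of u]
  by (auto simp: mem_U unitary_group_ops)

lemma hs_norm_eq_L2:
  assumes x: "x \<in> carrier_mat k k"
  shows "hs_norm k x = L2_set (\<lambda>p. cmod (x $$ p)) ({..<k} \<times> {..<k}) / sqrt (real k)"
proof -
  note a = mat_adjoint_carrier[OF x]
  have "mat_trace (mat_adjoint x * x) = (\<Sum>i<k. \<Sum>j<k. cnj (x $$ (j, i)) * x $$ (j, i))"
    using x a unfolding mat_trace_def
    by (auto simp: scalar_prod_def atLeast0LessThan mat_adjoint_index[OF x] intro!: sum.cong)
  also have "\<dots> = (\<Sum>j<k. \<Sum>i<k. cnj (x $$ (j, i)) * x $$ (j, i))"
    by (rule sum.swap)
  also have "\<dots> = of_real (\<Sum>p\<in>{..<k} \<times> {..<k}. (cmod (x $$ p))\<^sup>2)"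
    by (simp add: sum.cartesian_product mult.commute flip: complex_norm_square)
  finally show ?thesis
    by (simp add: hs_norm_def L2_set_def real_sqrt_divide)
qed

lemma hs_dist_eq_L2:
  assumes "x \<in> U n" "y \<in> U n"
  shows "hs_dist n x y = L2_set (\<lambda>p. cmod (x $$ p - y $$ p)) ({..<n} \<times> {..<n}) / sqrt (real n)"
proof -
  let ?I = "{..<n} \<times> {..<n}"
  have "x - y \<in> carrier_mat n n" using assms by (auto simp: mem_U)
  then have "hs_dist n x y = L2_set (\<lambda>p. cmod ((x - y) $$ p)) ?I / sqrt (real n)"
    by (simp add: hs_dist_def hs_norm_eq_L2)
  also have "L2_set (\<lambda>p. cmod ((x - y) $$ p)) ?I = L2_set (\<lambda>p. cmod (x $$ p - y $$ p)) ?I"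
    using assms by (intro L2_set_cong) (auto simp: mem_U)
  finally show ?thesis .
qed

lemma Metric_space_unitary: "Metric_space (U n) (unitary_dist n)"
proof
  let ?I = "{..<n} \<times> {..<n}"
  fix x y
  show "0 \<le> unitary_dist n x y"
    by (simp add: unitary_dist_def hs_dist_eq_L2)
  show "unitary_dist n x y = unitary_dist n y x"
    by (auto simp: unitary_dist_def hs_dist_eq_L2 norm_minus_commute)
  assume x: "x \<in> U n" and y: "y \<in> U n"
  have carr: "x \<in> carrier_mat n n" "y \<in> carrier_mat n n" using x y by (auto simp: mem_U)
  show "unitary_dist n x y = 0 \<longleftrightarrow> x = y"
  proof
    assume "unitary_dist n x y = 0"
    then have "\<forall>p\<in>?I. x $$ p = y $$ p"
      using x y by (cases "n = 0") (simp_all add: unitary_dist_def hs_dist_eq_L2 L2_set_eq_0_iff)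
    then show "x = y" using carr by (intro eq_matI) auto
  next
    assume "x = y"
    then show "unitary_dist n x y = 0"
      using x by (simp add: unitary_dist_def hs_dist_eq_L2 L2_set_eq_0_iff)
  qed
  fix z assume z: "z \<in> U n"
  have "L2_set (\<lambda>p. cmod (x $$ p - z $$ p)) ?I
      \<le> L2_set (\<lambda>p. cmod (x $$ p - y $$ p) + cmod (y $$ p - z $$ p)) ?I"
    by (rule L2_set_mono) (metis diff_add_cancel add_diff_eq norm_triangle_ineq, simp)
  also have "\<dots> \<le> L2_set (\<lambda>p. cmod (x $$ p - y $$ p)) ?I + L2_set (\<lambda>p. cmod (y $$ p - z $$ p)) ?I"
    by (rule L2_set_triangle_ineq)
  finally show "unitary_dist n x z \<le> unitary_dist n x y + unitary_dist n y z"
    using x y z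
    by (simp add: unitary_dist_def hs_dist_eq_L2 divide_right_mono flip: add_divide_distrib)
qed

end

theory Submission
  imports Defs "HOL-Combinatorics.Permutations"
begin

text \<open>
The range of \<open>\<phi>\<close> comes close to the unitary exchanging two blocks, so in every decomposition of the
representation into two invariant blocks one block is small. Hence \<open>\<phi>\<close> has an irreducible block
\<open>\<rho>\<close>, of dimension \<open>p\<close> close to \<open>m\<close>, whose range is nearly dense in \<open>U(p)\<close>.

Let \<open>L\<close> be the derivative of \<open>\<rho>\<close> and let \<open>l\<^sub>j\<^sub>k\<close> be the trace-free part of \<open>L(e\<^sub>j\<^sub>k)\<close>. The quadratic
form \<open>Q(x) = \<Sum> \<parallel>[l\<^sub>j\<^sub>k, x]\<parallel>\<^sup>2\<close> is invariant under conjugation by \<open>\<rho>(g)\<close>. Since the Casimir element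
\<open>\<Sum> l\<^sub>j\<^sub>k\<^sup>* l\<^sub>j\<^sub>k = c\<close> is a scalar and the \<open>l\<^sub>j\<^sub>k\<close> have trace zero, averaging over monomial unitaries shows
that every traceless \<open>x\<close> has a unitary conjugate \<open>z x z\<^sup>*\<close> with \<open>Q(z x z\<^sup>*) \<ge> 2 c \<parallel>x\<parallel>\<^sup>2\<close>; replacing \<open>z\<close> by a
nearby \<open>\<rho>(g)\<close> gives nearly the same bound for \<open>Q(x)\<close>. For \<open>x = \<rho>(t) - \<tau>\<close> with \<open>t\<close> diagonal and \<open>\<tau>\<close> the
normalized trace of \<open>\<rho>(t)\<close> this bounds \<open>|\<tau>|\<close> from below by the normalized trace of \<open>t\<close>. Averaging over
the torus with density \<open>\<Prod> (1 + cos \<theta>\<^sub>j)\<close>, which damps distant pairs of weights, shows that almost all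
pairs of distinct weights of \<open>\<rho>\<close> differ by a root. Near density also makes multiplicities small, and
together with the symmetry of the weights under permutations of the coordinates this leaves only
\<open>v + s e\<^sub>i\<close>, with \<open>s\<close> fixed in \<open>{1, -1}\<close>, for most weights.

If \<open>s = 1\<close>, counting dimensions yields a weight vector of weight \<open>v + e\<^sub>i\<close> that is killed by all
\<open>L(e\<^sub>j\<^sub>k)\<close> with \<open>k \<noteq> i\<close>, \<open>j \<noteq> k\<close>. It generates a copy of the standard representation twisted by
\<open>det\<^sup>v\<close>, which is all of \<open>\<rho>\<close> by irreducibility; \<open>s = -1\<close> reduces to this by complex conjugation.
\<close>

text \<open>What shapes the argument is that \<delta> may depend on \<epsilon> only, not on n and m.
  Write T for the trace of t and \<tau> for the normalized trace of \<rho>(t). The lower bound is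
  |\<tau>|^2 \<ge> (|T|^2 - 1) / (n^2 - 1) up to an error of order \<delta>; for the standard
  representation, where |\<tau>| = |T| / n, little is lost. Averaged over Haar measure the right
  side is only 1 / (n + 1), which the error swamps for large n. The product density of cosines keeps
  it at 1/4 + 3 / (4 (n + 1)), while on the left a pair of equal weights counts 1, a pair differing
  by a root 1/4, and any other pair at most 1/16. So once equal pairs are rare, almost all pairs
  must be root pairs. In bounded dimension the surplus 3 / (4 (n + 1)) even makes this count exact.
  No approximation survives from there on: \<rho> is exactly a twist of the standard representation
  or of its conjugate, and the final error comes from the small complementary block alone. All
  averages are finite sums over roots of unity whose order exceeds every occurring frequency, hence
  exact without integration.\<close>

abbreviation adj :: "complex mat \<Rightarrow> complex mat" where "adj \<equiv> mat_adjoint"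

abbreviation tr :: "complex mat \<Rightarrow> complex" where "tr \<equiv> mat_trace"

lemma adj_dim [simp]: "dim_row (adj A) = dim_col A" "dim_col (adj A) = dim_row A"
  by (simp_all add: mat_adjoint_def)

lemma adj_carrier [simp]: "A \<in> carrier_mat n m \<Longrightarrow> adj A \<in> carrier_mat m n"
  by (rule mat_adjoint_carrier)

lemma adj_index [simp]: "i < dim_col A \<Longrightarrow> j < dim_row A \<Longrightarrow> adj A $$ (i, j) = cnj (A $$ (j, i))"
  using mat_adjoint_index[of A "dim_row A" "dim_col A" i j] by simp

lemma adj_adj [simp]: "adj (adj A) = A"
  using mat_adjoint_adjoint[of A "dim_row A" "dim_col A"] by simp

lemma minus_cl [simp]: 
  fixes A B :: "complex mat"
  shows "A \<in> carrier_mat n m \<Longrightarrow> B \<in> carrier_mat n m \<Longrightarrow> A - B \<in> carrier_mat n m"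
  by (rule minus_carrier_mat)

lemma mult_cl [simp]: 
  fixes A B :: "complex mat"
  shows "A \<in> carrier_mat n n \<Longrightarrow> B \<in> carrier_mat n m \<Longrightarrow> A * B \<in> carrier_mat n m"
    "A \<in> carrier_mat n m \<Longrightarrow> B \<in> carrier_mat m m \<Longrightarrow> A * B \<in> carrier_mat n m"
  by (auto intro: mult_carrier_mat)

lemma adj_one [simp]: "adj (1\<^sub>m n) = 1\<^sub>m n"
  by (rule eq_matI) auto

lemma adj_add: "A \<in> carrier_mat n m \<Longrightarrow> B \<in> carrier_mat n m \<Longrightarrow> adj (A + B) = adj A + adj B"
  by (rule eq_matI) auto

lemma adj_minus: "A \<in> carrier_mat n m \<Longrightarrow> B \<in> carrier_mat n m \<Longrightarrow> adj (A - B) = adj A - adj B"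
  by (rule eq_matI) auto

lemma adj_smult: "adj (c \<cdot>\<^sub>m A) = cnj c \<cdot>\<^sub>m adj A"
  by (rule eq_matI) auto

lemma mult_index:
  fixes A B :: "complex mat"
  assumes "A \<in> carrier_mat n m" "B \<in> carrier_mat m l" "i < n" "j < l"
  shows "(A * B) $$ (i, j) = (\<Sum>k<m. A $$ (i, k) * B $$ (k, j))"
  using assms by (simp add: scalar_prod_def atLeast0LessThan)

lemma mult_index3:
  fixes A B C :: "complex mat"
  assumes "A \<in> carrier_mat n m" "B \<in> carrier_mat m l" "C \<in> carrier_mat l q" "i < n" "j < q"
  shows "(A * B * C) $$ (i, j) = (\<Sum>k<m. \<Sum>r<l. A $$ (i, k) * B $$ (k, r) * C $$ (r, j))"
proof -
  have "(A * B * C) $$ (i, j) = (\<Sum>r<l. (\<Sum>k<m. A $$ (i, k) * B $$ (k, r)) * C $$ (r, j))"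
    using assms by (subst mult_index[of _ n l _ q]) (auto simp: mult_index[of _ n m _ l] simp del: index_mult_mat)
  also have "\<dots> = (\<Sum>k<m. \<Sum>r<l. A $$ (i, k) * B $$ (k, r) * C $$ (r, j))"
    by (subst sum.swap) (simp add: sum_distrib_right)
  finally show ?thesis .
qed

subsection \<open>Trace and Frobenius norm\<close>

lemma tr_mult:
  assumes "A \<in> carrier_mat n m" "B \<in> carrier_mat m n"
  shows "tr (A * B) = (\<Sum>i<n. \<Sum>k<m. A $$ (i, k) * B $$ (k, i))"
  using assms unfolding mat_trace_def
  by (auto simp: mult_index[of _ n m _ n] simp del: index_mult_mat(1) intro!: sum.cong)

lemma tr_comm:
  assumes "A \<in> carrier_mat n m" "B \<in> carrier_mat m n"
  shows "tr (A * B) = tr (B * A)"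
  unfolding tr_mult[OF assms] tr_mult[OF assms(2,1)] by (subst sum.swap) (simp add: mult.commute)

text \<open>Unnormalized and allowed to be rectangular: block sums then add up
  (\<open>fr2_bsum\<close>), and an intertwiner between spaces of different dimension is covered as
  well.\<close>

definition fr2 :: "complex mat \<Rightarrow> real" where
  "fr2 A = (\<Sum>i<dim_row A. \<Sum>j<dim_col A. (cmod (A $$ (i, j)))\<^sup>2)"

lemma fr2_carrier: "A \<in> carrier_mat n m \<Longrightarrow> fr2 A = (\<Sum>i<n. \<Sum>j<m. (cmod (A $$ (i, j)))\<^sup>2)"
  by (simp add: fr2_def)

lemma fr2_nonneg [simp]: "fr2 A \<ge> 0"
  by (simp add: fr2_def sum_nonneg)

lemma fr2_tr:
  assumes "A \<in> carrier_mat n m"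
  shows "tr (adj A * A) = of_real (fr2 A)" "tr (A * adj A) = of_real (fr2 A)"
proof -
  show "tr (A * adj A) = of_real (fr2 A)"
    using assms carrier_matD[OF assms]
    by (subst tr_mult[of _ n m]) (simp_all add: fr2_carrier complex_norm_square del: of_real_power)
  then show "tr (adj A * A) = of_real (fr2 A)"
    using tr_comm[of "adj A" m n A] assms by simp
qed

lemma fr2_adj [simp]: "fr2 (adj A) = fr2 A"
  unfolding fr2_def by (subst sum.swap) simp

lemma fr2_eq_0: "A \<in> carrier_mat n m \<Longrightarrow> fr2 A = 0 \<longleftrightarrow> A = 0\<^sub>m n m"
  by (auto simp: fr2_def sum_nonneg_eq_0_iff sum_nonneg)

definition fr :: "complex mat \<Rightarrow> real" where
  "fr A = sqrt (fr2 A)"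

lemma fr_nonneg [simp]: "fr A \<ge> 0"
  by (simp add: fr_def)

lemma fr_sq [simp]: "(fr A)\<^sup>2 = fr2 A"
  by (simp add: fr_def)

lemma fr_L2: "A \<in> carrier_mat n m \<Longrightarrow> fr A = L2_set (\<lambda>p. cmod (A $$ p)) ({..<n} \<times> {..<m})"
  by (simp add: fr_def fr2_carrier L2_set_def sum.cartesian_product)

lemma fr_triangle:
  assumes "A \<in> carrier_mat n m" "B \<in> carrier_mat n m"
  shows "fr (A + B) \<le> fr A + fr B"
proof -
  have "fr (A + B) \<le> L2_set (\<lambda>p. cmod (A $$ p) + cmod (B $$ p)) ({..<n} \<times> {..<m})"
    using assms by (subst fr_L2[of _ n m]) (auto intro!: L2_set_mono norm_triangle_ineq)
  also have "\<dots> \<le> fr A + fr B"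
    using assms by (simp add: fr_L2[of _ n m] L2_set_triangle_ineq)
  finally show ?thesis .
qed

lemma fr_minus_commute:
  assumes "A \<in> carrier_mat n m" "B \<in> carrier_mat n m"
  shows "fr (A - B) = fr (B - A)"
  using assms unfolding fr_def fr2_def by (simp add: norm_minus_commute)

lemma fr_triangle3:
  assumes "A \<in> carrier_mat n m" "B \<in> carrier_mat n m" "C \<in> carrier_mat n m"
  shows "fr (A - C) \<le> fr (A - B) + fr (B - C)"
proof -
  have "A - C = (A - B) + (B - C)" using assms by (intro eq_matI) auto
  then show ?thesis using fr_triangle[of "A - B" n m "B - C"] assms by simp
qed

lemma entry_le_fr: "A \<in> carrier_mat n m \<Longrightarrow> i < n \<Longrightarrow> j < m \<Longrightarrow> cmod (A $$ (i, j)) \<le> fr A"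
  using member_le_L2_set[of "{..<n} \<times> {..<m}" "(i,j)" "\<lambda>p. cmod (A $$ p)"] fr_L2[of A n m]
  by simp

lemma hs_norm_fr: "x \<in> carrier_mat k k \<Longrightarrow> hs_norm k x = fr x / sqrt (real k)"
  by (simp add: hs_norm_eq_L2 fr_L2)

lemma hs_dist_fr: "x \<in> carrier_mat k k \<Longrightarrow> y \<in> carrier_mat k k \<Longrightarrow> hs_dist k x y = fr (x - y) / sqrt (real k)"
  by (simp add: hs_dist_def hs_norm_fr)

subsection \<open>Unitary matrices\<close>

lemma U_carrier [simp]: "A \<in> U n \<Longrightarrow> A \<in> carrier_mat n n"
  by (simp add: mem_U)

lemma U_adj [simp]: "A \<in> U n \<Longrightarrow> adj A \<in> U n"
  by (rule adjoint_mem_U)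

lemma U_left: "A \<in> U n \<Longrightarrow> adj A * A = 1\<^sub>m n" and U_right: "A \<in> U n \<Longrightarrow> A * adj A = 1\<^sub>m n"
  by (simp_all add: mem_U)

lemma U_mult [simp]: "A \<in> U n \<Longrightarrow> B \<in> U n \<Longrightarrow> A * B \<in> U n"
  using group.is_monoid[OF group_unitary_group, of n] monoid.m_closed[of "unitary_group n" A B]
  by (simp add: unitary_group_ops)

lemma U_one [simp]: "1\<^sub>m n \<in> U n"
  by (simp add: mem_U)

lemma U_intro: 
  assumes "A \<in> carrier_mat n n" "adj A * A = 1\<^sub>m n" shows "A \<in> U n"
  unfolding mem_U using assms mat_mult_left_right_inverse[OF adj_carrier[OF assms(1)] assms(1)] by blast

lemma U_left_cancel: 
  assumes "A \<in> U n" "B \<in> carrier_mat n m" shows "adj A * (A * B) = B" "A * (adj A * B) = B"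
  using assms by (auto simp: assoc_mult_mat[of _ n n _ n _ m, symmetric] U_left U_right)

lemma U_right_cancel: 
  assumes "A \<in> U n" "B \<in> carrier_mat m n" shows "B * A * adj A = B" "B * adj A * A = B"
  using assms by (auto simp: assoc_mult_mat[of _ m n _ n _ n] U_left U_right)

lemma U_row_sum: "A \<in> U n \<Longrightarrow> i < n \<Longrightarrow> (\<Sum>j<n. (cmod (A $$ (i, j)))\<^sup>2) = 1"
proof -
  assume A: "A \<in> U n" and i: "i < n"
  have "complex_of_real (\<Sum>j<n. (cmod (A $$ (i, j)))\<^sup>2) = (A * adj A) $$ (i, i)"
    using i carrier_matD[OF U_carrier[OF A]] A
    by (subst mult_index[of _ n n _ n]) (simp_all add: complex_norm_square del: of_real_power)
  then have "complex_of_real (\<Sum>j<n. (cmod (A $$ (i, j)))\<^sup>2) = 1" using A i by (simp add: U_right del: index_mult_mat)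
  then show ?thesis using of_real_eq_1_iff by blast
qed

lemma U_col_sum: "A \<in> U n \<Longrightarrow> j < n \<Longrightarrow> (\<Sum>i<n. (cmod (A $$ (i, j)))\<^sup>2) = 1"
  using U_row_sum[of "adj A" n j] carrier_matD[OF U_carrier[of A n]] by simp

lemma fr2_U_left:
  assumes "u \<in> U n" "A \<in> carrier_mat n m" shows "fr2 (u * A) = fr2 A"
proof -
  have "adj (u * A) * (u * A) = adj A * (adj u * (u * A))"
    using assms U_carrier[OF assms(1)]
    by (simp add: mat_adjoint_mult[of u n n A m]) (rule assoc_mult_mat[of _ m n _ n _ m], auto)
  then have "tr (adj (u * A) * (u * A)) = tr (adj A * A)"
    using assms by (simp add: U_left_cancel)
  then show ?thesis
    using fr2_tr(1)[of "u * A" n m] fr2_tr(1)[of A n m] assms U_carrier[OF assms(1)] by simp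
qed

lemma fr2_U_right:
  assumes "u \<in> U n" "A \<in> carrier_mat m n" shows "fr2 (A * u) = fr2 A"
proof -
  have "fr2 (A * u) = fr2 (adj (A * u))" by simp
  also have "adj (A * u) = adj u * adj A" using assms U_carrier[OF assms(1)] by (simp add: mat_adjoint_mult[of A m n u n])
  also have "fr2 \<dots> = fr2 A" using fr2_U_left[of "adj u" n "adj A" m] assms by simp
  finally show ?thesis .
qed

lemma fr_U_left: "u \<in> U n \<Longrightarrow> A \<in> carrier_mat n m \<Longrightarrow> fr (u * A) = fr A"
  and fr_U_right: "u \<in> U n \<Longrightarrow> B \<in> carrier_mat m n \<Longrightarrow> fr (B * u) = fr B"
  by (simp_all add: fr_def fr2_U_left fr2_U_right)

lemma mult_minus_left: 
  fixes A B C :: "complex mat"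
  shows "A \<in> carrier_mat n m \<Longrightarrow> B \<in> carrier_mat n m \<Longrightarrow> C \<in> carrier_mat m l \<Longrightarrow> (A - B) * C = A * C - B * C"
  by (rule minus_mult_distrib_mat)

lemma mult_minus_right: 
  fixes A B C :: "complex mat"
  shows "A \<in> carrier_mat n m \<Longrightarrow> B \<in> carrier_mat m l \<Longrightarrow> C \<in> carrier_mat m l \<Longrightarrow> A * (B - C) = A * B - A * C"
  by (rule mult_minus_distrib_mat)

text \<open>\<open>z\<close> is exchanged for \<open>h\<close> one factor at a time; in each
  exchange the remaining factors are unitary and do not change the Frobenius norm of
  \<open>z - h\<close>.\<close>

lemma fr_conj_diff:
  assumes "z \<in> U n" "h \<in> U n" "x \<in> U n"
  shows "fr (z * x * adj z - h * x * adj h) \<le> 2 * fr (z - h)"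
proof -
  note c = U_carrier[OF assms(1)] U_carrier[OF assms(2)] U_carrier[OF assms(3)]
  have 1: "fr (z * x * adj z - h * x * adj z) = fr (z - h)"
  proof -
    have "z * x * adj z - h * x * adj z = (z - h) * (x * adj z)"
      using c by (simp add: mult_minus_left[of _ n n _ _ n] assoc_mult_mat[of _ n n _ n _ n])
    then show ?thesis using fr_U_right[of "x * adj z" n "z - h" n] assms c by simp
  qed
  have 2: "fr (h * x * adj z - h * x * adj h) = fr (z - h)"
  proof -
    have "h * x * adj z - h * x * adj h = (h * x) * (adj (z - h))"
      using c by (simp add: mult_minus_right[of _ n n _ n] adj_minus[of _ n n])
    then show ?thesis using fr_U_left[of "h * x" n "adj (z - h)" n] assms c by (simp add: fr_def)
  qed
  show ?thesis
    using fr_triangle3[of "z * x * adj z" n n "h * x * adj z" "h * x * adj h"] 1 2 c by simp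
qed

subsection \<open>Diagonal and permutation matrices\<close>

definition diagm :: "nat \<Rightarrow> (nat \<Rightarrow> complex) \<Rightarrow> complex mat" where
  "diagm n d = Matrix.mat n n (\<lambda>(i, j). if i = j then d i else 0)"

lemma diagm_carrier [simp]: "diagm n d \<in> carrier_mat n n"
  and diagm_dim [simp]: "dim_row (diagm n d) = n" "dim_col (diagm n d) = n"
  and diagm_index [simp]: "i < n \<Longrightarrow> j < n \<Longrightarrow> diagm n d $$ (i, j) = (if i = j then d i else 0)"
  by (simp_all add: diagm_def)

lemma sum_single:
  fixes n :: nat and f :: "nat \<Rightarrow> 'b :: comm_monoid_add"
  assumes "i < n" "\<And>k. k < n \<Longrightarrow> k \<noteq> i \<Longrightarrow> f k = 0"
  shows "(\<Sum>k<n. f k) = f i"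
  using assms by (subst sum.remove[of _ i]) auto

lemma diagm_left: "A \<in> carrier_mat n m \<Longrightarrow> i < n \<Longrightarrow> j < m \<Longrightarrow> (diagm n d * A) $$ (i, j) = d i * A $$ (i, j)"
  by (subst mult_index[of _ n n _ m]; (subst sum_single[of i])?) auto

lemma diagm_right: "A \<in> carrier_mat m n \<Longrightarrow> i < m \<Longrightarrow> j < n \<Longrightarrow> (A * diagm n d) $$ (i, j) = A $$ (i, j) * d j"
  by (subst mult_index[of _ m n _ n]; (subst sum_single[of j])?) auto

lemma diagm_mult: "diagm n d * diagm n e = diagm n (\<lambda>i. d i * e i)"
  by (rule eq_matI) (auto simp: diagm_left[of _ n n] simp del: index_mult_mat(1))

lemma diagm_adj: "adj (diagm n d) = diagm n (\<lambda>i. cnj (d i))"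
  by (rule eq_matI) auto

lemma diagm_one: "diagm n (\<lambda>_. 1) = 1\<^sub>m n"
  by (rule eq_matI) auto

lemma diagm_cong: "(\<And>i. i < n \<Longrightarrow> d i = e i) \<Longrightarrow> diagm n d = diagm n e"
  by (rule eq_matI) auto

lemma diagm_const: "diagm n (\<lambda>_. c) = c \<cdot>\<^sub>m 1\<^sub>m n"
  by (rule eq_matI) auto

lemma diagm_U: 
  assumes "\<And>i. i < n \<Longrightarrow> cmod (d i) = 1" shows "diagm n d \<in> U n"
proof (rule U_intro)
  have "cnj (d i) * d i = 1" if "i < n" for i
    using assms[OF that] complex_norm_square[of "d i"] by (simp add: mult.commute)
  then show "adj (diagm n d) * diagm n d = 1\<^sub>m n"
    unfolding diagm_adj diagm_mult diagm_one[symmetric] by (intro diagm_cong)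
qed simp

lemma diagm_U_D: "diagm n d \<in> U n \<Longrightarrow> i < n \<Longrightarrow> cmod (d i) = 1"
proof -
  assume a: "diagm n d \<in> U n" "i < n"
  then have "(adj (diagm n d) * diagm n d) $$ (i, i) = 1" by (simp add: U_left del: index_mult_mat)
  then have "cnj (d i) * d i = 1" using a by (simp add: diagm_adj diagm_mult)
  then have "complex_of_real ((cmod (d i))\<^sup>2) = 1" using complex_norm_square[of "d i"] by (simp only: mult.commute)
  then have "(cmod (d i))\<^sup>2 = 1" using of_real_eq_1_iff by blast
  then show ?thesis by (simp add: power2_eq_1_iff)
    (smt (verit) norm_ge_zero)
qed

lemma diagm_tr: "tr (diagm n d) = (\<Sum>i<n. d i)"
  by (simp add: mat_trace_def)

text \<open>Column \<open>j\<close> has its one in row \<open>s j\<close>, so that conjugation by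
  this matrix moves the entry of \<open>A\<close> at \<open>(s i, s j)\<close> to
  \<open>(i, j)\<close>.\<close>

definition permm :: "nat \<Rightarrow> (nat \<Rightarrow> nat) \<Rightarrow> complex mat" where
  "permm n s = Matrix.mat n n (\<lambda>(i, j). if i = s j then 1 else 0)"

lemma permm_carrier [simp]: "permm n s \<in> carrier_mat n n"
  by (simp add: permm_def)

lemma permm_dim [simp]: "dim_row (permm n s) = n" "dim_col (permm n s) = n"
  by (simp_all add: permm_def)

lemma permm_index [simp]: "i < n \<Longrightarrow> j < n \<Longrightarrow> permm n s $$ (i, j) = (if i = s j then 1 else 0)"
  by (simp add: permm_def)

lemma perm_less [simp]: "s permutes {..<n} \<Longrightarrow> s i < n \<longleftrightarrow> i < n"
  using permutes_in_image[of s "{..<n}" i] by simp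

lemma permm_right:
  assumes s: "s permutes {..<n}" and A: "A \<in> carrier_mat m n" and ij: "i < m" "j < n"
  shows "(A * permm n s) $$ (i, j) = A $$ (i, s j)"
  using assms by (subst mult_index[of _ m n _ n]; (subst sum_single[of "s j"])?) auto

lemma permm_adj_left:
  assumes s: "s permutes {..<n}" and A: "A \<in> carrier_mat n m" and ij: "i < n" "j < m"
  shows "(adj (permm n s) * A) $$ (i, j) = A $$ (s i, j)"
  using assms by (subst mult_index[of _ n n _ m]; (subst sum_single[of "s i"])?) auto

lemma permm_U: assumes s: "s permutes {..<n}" shows "permm n s \<in> U n"
proof (rule U_intro)
  show "adj (permm n s) * permm n s = 1\<^sub>m n"
    using s by (intro eq_matI) (auto simp: permm_adj_left[of s n _ n] permutes_inj[THEN inj_eq] simp del: index_mult_mat(1))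
qed simp

lemma permm_conj:
  assumes s: "s permutes {..<n}" and A: "A \<in> carrier_mat n n" and ij: "i < n" "j < n"
  shows "(adj (permm n s) * A * permm n s) $$ (i, j) = A $$ (s i, s j)"
  using assms by (subst permm_right[of s n _ n]) (auto simp add: permm_adj_left[of s n _ n] simp del: index_mult_mat(1))

lemma permm_conj_diagm:
  assumes s: "s permutes {..<n}"
  shows "adj (permm n s) * diagm n d * permm n s = diagm n (\<lambda>i. d (s i))"
proof (rule eq_matI)
  fix i j assume "i < dim_row (diagm n (\<lambda>i. d (s i)))" "j < dim_col (diagm n (\<lambda>i. d (s i)))"
  then have "i < n" "j < n" by auto
  then show "(adj (permm n s) * diagm n d * permm n s) $$ (i, j) = diagm n (\<lambda>i. d (s i)) $$ (i, j)"
    using s by (subst permm_conj[OF s]) (auto simp: permutes_inj[OF s, THEN inj_eq])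
qed auto

subsection \<open>Block sums\<close>

definition bsum :: "complex mat \<Rightarrow> complex mat \<Rightarrow> complex mat" where
  "bsum A B = four_block_mat A (0\<^sub>m (dim_row A) (dim_col B)) (0\<^sub>m (dim_row B) (dim_col A)) B"

lemma bsum_dim [simp]: "dim_row (bsum A B) = dim_row A + dim_row B" "dim_col (bsum A B) = dim_col A + dim_col B"
  by (simp_all add: bsum_def)

lemma bsum_carrier [simp]: "A \<in> carrier_mat a b \<Longrightarrow> B \<in> carrier_mat c d \<Longrightarrow> bsum A B \<in> carrier_mat (a + c) (b + d)"
  by (auto simp: bsum_def)

lemma bsum_index:
  "A \<in> carrier_mat a b \<Longrightarrow> B \<in> carrier_mat c d \<Longrightarrow> i < a + c \<Longrightarrow> j < b + d \<Longrightarrow>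
   bsum A B $$ (i, j) = (if i < a then if j < b then A $$ (i, j) else 0
     else if j < b then 0 else B $$ (i - a, j - b))"
  by (auto simp: bsum_def)

lemma bsum_mult:
  assumes "A \<in> carrier_mat a b" "B \<in> carrier_mat c d" "A' \<in> carrier_mat b e" "B' \<in> carrier_mat d f"
  shows "bsum A B * bsum A' B' = bsum (A * A') (B * B')"
  using assms unfolding bsum_def
  by (subst mult_four_block_mat[of _ a b _ d _ c _ _ e _ f]) auto

lemma bsum_adj: "adj (bsum A B) = bsum (adj A) (adj B)"
  by (rule eq_matI) (auto simp: bsum_def)

lemma bsum_one: "bsum (1\<^sub>m a) (1\<^sub>m b) = 1\<^sub>m (a + b)"
  by (rule eq_matI) (auto simp: bsum_def)

lemma bsum_diagm: "bsum (diagm a d) (diagm b e) = diagm (a + b) (\<lambda>i. if i < a then d i else e (i - a))"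
  by (rule eq_matI) (auto simp: bsum_def)

lemma bsum_inject:
  assumes "A \<in> carrier_mat a b" "A' \<in> carrier_mat a b" "B \<in> carrier_mat c d" "B' \<in> carrier_mat c d"
    "bsum A B = bsum A' B'"
  shows "A = A'" "B = B'"
proof -
  show "A = A'"
  proof (rule eq_matI)
    fix i j assume "i < dim_row A'" "j < dim_col A'"
    then have "i < a" "j < b" using assms by auto
    then show "A $$ (i, j) = A' $$ (i, j)"
      using bsum_index[OF assms(1,3), of i j] bsum_index[OF assms(2,4), of i j] assms(5) by simp
  qed (use assms in auto)
  show "B = B'"
  proof (rule eq_matI)
    fix i j assume "i < dim_row B'" "j < dim_col B'"
    then have "i < c" "j < d" using assms by auto
    then show "B $$ (i, j) = B' $$ (i, j)"
      using bsum_index[OF assms(1,3), of "a + i" "b + j"] bsum_index[OF assms(2,4), of "a + i" "b + j"] assms(5) by simp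
  qed (use assms in auto)
qed

lemma bsum_U [simp]: "A \<in> U a \<Longrightarrow> B \<in> U b \<Longrightarrow> bsum A B \<in> U (a + b)"
  by (rule U_intro) (auto simp: bsum_adj bsum_mult[of _ a a _ b b _ a _ b] U_left bsum_one)

lemma bsum_U_D:
  assumes A: "A \<in> carrier_mat a a" and B: "B \<in> carrier_mat b b" and AB: "bsum A B \<in> U (a + b)"
  shows "A \<in> U a" "B \<in> U b"
proof -
  have "bsum (adj A * A) (adj B * B) = bsum (1\<^sub>m a) (1\<^sub>m b)"
    using U_left[OF AB] A B by (simp add: bsum_adj bsum_mult[of _ a a _ b b _ a _ b] bsum_one)
  from bsum_inject[OF _ _ _ _ this, of a a b b] A B show "A \<in> U a" "B \<in> U b"
    by (auto intro!: U_intro)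
qed

lemma sum_split_add:
  fixes f :: "nat \<Rightarrow> 'b :: comm_monoid_add"
  shows "(\<Sum>i<a + b. f i) = (\<Sum>i<a. f i) + (\<Sum>i<b. f (a + i))"
  by (induction b) (auto simp: add.assoc)

lemma fr2_bsum:
  assumes "A \<in> carrier_mat a b" "B \<in> carrier_mat c d"
  shows "fr2 (bsum A B) = fr2 A + fr2 B"
proof -
  have "fr2 (bsum A B) = (\<Sum>i<a + c. \<Sum>j<b + d. (cmod (bsum A B $$ (i, j)))\<^sup>2)"
    using assms by (intro fr2_carrier) auto
  also have "\<dots> = fr2 A + fr2 B"
    using assms by (simp add: sum_split_add bsum_index[of _ a b _ c d] fr2_carrier[of _ a b] fr2_carrier[of _ c d])
  finally show ?thesis .
qed

lemma bsum_minus: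
  assumes "A \<in> carrier_mat a b" "A' \<in> carrier_mat a b" "B \<in> carrier_mat c d" "B' \<in> carrier_mat c d"
  shows "bsum A B - bsum A' B' = bsum (A - A') (B - B')"
  using assms by (intro eq_matI) (auto simp: bsum_def)

lemma bsum_smult: "c \<cdot>\<^sub>m bsum A B = bsum (c \<cdot>\<^sub>m A) (c \<cdot>\<^sub>m B)"
  by (rule eq_matI) (auto simp: bsum_def)

lemma bsum_assoc:
  assumes "A \<in> carrier_mat a a" "B \<in> carrier_mat b b" "C \<in> carrier_mat c c"
  shows "bsum (bsum A B) C = bsum A (bsum B C)"
  using assms by (intro eq_matI) (auto simp: bsum_def)

lemma pad_bsum: "v \<in> carrier_mat n n \<Longrightarrow> pad m v = bsum v (1\<^sub>m (m - n))"
  by (simp add: pad_def bsum_def Let_def)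

subsection \<open>Diagonalization\<close>

text \<open>Gram-Schmidt applied to a completion of \<open>v\<close> to a basis keeps
  \<open>v\<close> in front, up to the final normalization of the columns. This is the change of
  basis that splits off an eigenvector.\<close>

lemma unitary_first_col:
  assumes v: "v \<in> carrier_vec n" and v0: "v \<noteq> 0\<^sub>v n"
  shows "\<exists>u\<in>U n. \<exists>c. \<forall>k<n. u $$ (k, 0) = c * v $ k"
proof -
  interpret cof_vec_space n "TYPE(complex)" .
  define ws where "ws = gram_schmidt n (basis_completion v)"
  note bc = basis_completion[OF v v0]
  have n: "0 < n" using v v0 by (cases n) auto
  from bc n have bne: "basis_completion v \<noteq> []" by auto
  from bne bc obtain vs where bv: "basis_completion v = v # vs" by (cases "basis_completion v") auto
  have ws: "set ws \<subseteq> carrier_vec n" "corthogonal ws" "length ws = n"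
    using gram_schmidt_result[of "basis_completion v" ws] bc by (auto simp: ws_def)
  have ws0: "ws ! 0 = v"
    using gram_schmidt_hd[OF v, of vs, folded bv] ws n unfolding ws_def[symmetric]
    by (cases ws) auto
  have wsc: "ws ! i \<in> carrier_vec n" if "i < n" for i using ws that by auto
  define g where "g i = (\<Sum>k<n. (cmod (ws ! i $ k))\<^sup>2)" for i
  have g0: "g i > 0" if i: "i < n" for i
  proof -
    have "ws ! i \<bullet>c ws ! i \<noteq> 0" using corthogonalD[OF ws(2), of i i] i ws(3) by auto
    moreover have "ws ! i \<bullet>c ws ! i = complex_of_real (g i)"
      using wsc[OF i] by (simp add: g_def scalar_prod_def atLeast0LessThan complex_norm_square del: of_real_power)
    ultimately have "g i \<noteq> 0" by auto
    then show ?thesis using sum_nonneg[of "{..<n}" "\<lambda>k. (cmod (ws ! i $ k))\<^sup>2"] by (auto simp: g_def less_le)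
  qed
  define u where "u = Matrix.mat n n (\<lambda>(k, j). ws ! j $ k / complex_of_real (sqrt (g j)))"
  have uc [simp]: "u \<in> carrier_mat n n" by (simp add: u_def)
  have "adj u * u = 1\<^sub>m n"
  proof (rule eq_matI)
    fix i j assume "i < dim_row (1\<^sub>m n :: complex mat)" "j < dim_col (1\<^sub>m n :: complex mat)"
    then have i: "i < n" and j: "j < n" by auto
    have "(adj u * u) $$ (i, j) = (\<Sum>k<n. cnj (u $$ (k, i)) * u $$ (k, j))"
      using i j carrier_matD[OF uc] by (subst mult_index[of _ n n _ n]) auto
    also have "\<dots> = (\<Sum>k<n. ws ! j $ k * cnj (ws ! i $ k) / complex_of_real (sqrt (g i) * sqrt (g j)))"
      using i j by (intro sum.cong) (auto simp: u_def mult.commute)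
    also have "\<dots> = (\<Sum>k<n. ws ! j $ k * cnj (ws ! i $ k)) / complex_of_real (sqrt (g i) * sqrt (g j))"
      by (simp add: sum_divide_distrib)
    also have "(\<Sum>k<n. ws ! j $ k * cnj (ws ! i $ k)) = ws ! j \<bullet>c ws ! i"
      using wsc[OF i] wsc[OF j] by (simp add: scalar_prod_def atLeast0LessThan)
    finally have eq: "(adj u * u) $$ (i, j) = ws ! j \<bullet>c ws ! i / complex_of_real (sqrt (g i) * sqrt (g j))" .
    show "(adj u * u) $$ (i, j) = 1\<^sub>m n $$ (i, j)"
    proof (cases "i = j")
      case True
      have "ws ! i \<bullet>c ws ! i = complex_of_real (g i)"
        using wsc[OF i] by (simp add: g_def scalar_prod_def atLeast0LessThan complex_norm_square del: of_real_power)
      moreover have "sqrt (g i) * sqrt (g i) = g i" using g0[OF i] by simp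
      ultimately show ?thesis using eq True i g0[OF i] by (simp del: of_real_mult real_sqrt_mult_self)
    next
      case False
      then have "ws ! j \<bullet>c ws ! i = 0" using corthogonalD[OF ws(2), of j i] i j ws(3) by auto
      then show ?thesis using eq False i j by simp
    qed
  qed (use carrier_matD[OF uc] in auto)
  then have "u \<in> U n" by (intro U_intro) auto
  moreover have "\<forall>k<n. u $$ (k, 0) = (1 / complex_of_real (sqrt (g 0))) * v $ k"
    using n ws0 by (auto simp: u_def)
  ultimately show ?thesis by blast
qed

text \<open>Induction on the dimension. A unitary whose first column is an eigenvector clears the
  first column of the conjugated matrix; self-adjointness then clears the first row and makes the
  eigenvalue real.\<close>

lemma hermitian_diagonalize:
  assumes "A \<in> carrier_mat n n" "adj A = A"
  shows "\<exists>u\<in>U n. \<exists>d :: nat \<Rightarrow> real. adj u * A * u = diagm n (\<lambda>i. complex_of_real (d i))"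
  using assms
proof (induction n arbitrary: A)
  case 0
  have "adj (1\<^sub>m 0) * A * 1\<^sub>m 0 = diagm 0 (\<lambda>i. complex_of_real 0)"
    using 0 by (intro eq_matI) auto
  then show ?case using U_one[of 0] by (intro bexI[of _ "1\<^sub>m 0"] exI[of _ "\<lambda>_. 0"]) auto
next
  case (Suc n A)
  have A: "A \<in> carrier_mat (Suc n) (Suc n)" and h: "adj A = A" using Suc by auto
  obtain as where as: "char_poly A = (\<Prod>a\<leftarrow>as. [:- a, 1:])" "length as = Suc n"
    using char_poly_factorized[OF A] by blast
  then obtain e es where "as = e # es" by (cases as) auto
  with as have "poly (char_poly A) e = 0" by simp
  then obtain v where v: "v \<in> carrier_vec (Suc n)" "v \<noteq> 0\<^sub>v (Suc n)" "A *\<^sub>v v = e \<cdot>\<^sub>v v"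
    using A by (auto simp: eigenvalue_root_char_poly[OF A, symmetric] eigenvalue_def eigenvector_def)
  obtain u c where u: "u \<in> U (Suc n)" and uv: "\<And>k. k < Suc n \<Longrightarrow> u $$ (k, 0) = c * v $ k"
    using unitary_first_col[OF v(1,2)] by blast
  note uc = U_carrier[OF u]
  have Au: "(A * u) $$ (k, 0) = e * u $$ (k, 0)" if k: "k < Suc n" for k
  proof -
    have "(A * u) $$ (k, 0) = c * (\<Sum>j<Suc n. A $$ (k, j) * v $ j)"
      using k A uc uv unfolding sum_distrib_left by (subst mult_index[of _ "Suc n" "Suc n" _ "Suc n"]) (auto simp: mult_ac)
    also have "(\<Sum>j<Suc n. A $$ (k, j) * v $ j) = (A *\<^sub>v v) $ k"
      using A v(1) k by (auto simp: scalar_prod_def atLeast0LessThan simp del: sum.lessThan_Suc)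
    also have "\<dots> = e * v $ k" using v k by simp
    finally show ?thesis using uv[OF k] by simp
  qed
  define B where "B = adj u * A * u"
  have Bc [simp]: "B \<in> carrier_mat (Suc n) (Suc n)" using A uc by (simp add: B_def)
  have Bh: "adj B = B"
    using A uc h unfolding B_def
    by (simp add: mat_adjoint_mult[of _ "Suc n" "Suc n" _ "Suc n"] assoc_mult_mat[of _ "Suc n" "Suc n" _ "Suc n" _ "Suc n"])
  have B0: "B $$ (i, 0) = (if i = 0 then e else 0)" if i: "i < Suc n" for i
  proof -
    have "B $$ (i, 0) = (adj u * (A * u)) $$ (i, 0)"
      using A uc by (simp add: B_def assoc_mult_mat[of _ "Suc n" "Suc n" _ "Suc n" _ "Suc n"])
    also have "\<dots> = (\<Sum>k<Suc n. adj u $$ (i, k) * (e * u $$ (k, 0)))"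
      using i A uc Au by (subst mult_index[of _ "Suc n" "Suc n" _ "Suc n"]) (auto simp del: sum.lessThan_Suc index_mult_mat(1))
    also have "\<dots> = e * (\<Sum>k<Suc n. adj u $$ (i, k) * u $$ (k, 0))"
      unfolding sum_distrib_left by (intro sum.cong) (auto simp: mult_ac)
    also have "(\<Sum>k<Suc n. adj u $$ (i, k) * u $$ (k, 0)) = (adj u * u) $$ (i, 0)"
      using i uc by (subst mult_index[of _ "Suc n" "Suc n" _ "Suc n"]) auto
    also have "\<dots> = (if i = 0 then 1 else 0)" using i u by (simp add: U_left del: index_mult_mat)
    finally show ?thesis by simp
  qed
  have Bsym: "B $$ (i, j) = cnj (B $$ (j, i))" if "i < Suc n" "j < Suc n" for i j
    using that carrier_matD[OF Bc] by (subst Bh[symmetric]) simp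
  define C where "C = Matrix.mat n n (\<lambda>(i, j). B $$ (Suc i, Suc j))"
  have Cc [simp]: "C \<in> carrier_mat n n" by (simp add: C_def)
  have e: "cnj e = e" using Bsym[of 0 0] B0[of 0] by simp
  have BC: "B = bsum (diagm 1 (\<lambda>_. e)) C"
  proof (rule eq_matI)
    fix i j assume "i < dim_row (bsum (diagm 1 (\<lambda>_. e)) C)" "j < dim_col (bsum (diagm 1 (\<lambda>_. e)) C)"
    then have ij: "i < Suc n" "j < Suc n" by (auto simp: C_def)
    have "B $$ (0, j) = (if j = 0 then e else 0)"
      using Bsym[of 0 j] B0[of j] ij e by auto
    then show "B $$ (i, j) = bsum (diagm 1 (\<lambda>_. e)) C $$ (i, j)"
      using B0[of i] ij by (auto simp: bsum_index[of _ 1 1 _ n n] C_def)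
  qed (auto simp: C_def B_def uc[THEN carrier_matD(2)])
  have "adj C = C"
    by (rule eq_matI) (auto simp: C_def intro: Bsym[symmetric])
  then obtain w d where w: "w \<in> U n" "adj w * C * w = diagm n (\<lambda>i. complex_of_real (d i))"
    using Suc.IH[of C] by auto
  define W where "W = bsum (1\<^sub>m 1) w"
  have WU: "W \<in> U (Suc n)" using bsum_U[of "1\<^sub>m 1" 1 w n] w by (simp add: W_def)
  obtain r where r: "e = complex_of_real r" using e by (metis Reals_cases Reals_cnj_iff)
  have "adj (u * W) * A * (u * W) = adj W * B * W"
    using A uc U_carrier[OF WU] unfolding B_def
    by (simp add: mat_adjoint_mult[of _ "Suc n" "Suc n" _ "Suc n"] assoc_mult_mat[of _ "Suc n" "Suc n" _ "Suc n" _ "Suc n"])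
  also have "\<dots> = bsum (diagm 1 (\<lambda>_. e)) (adj w * C * w)"
    using w(1)[THEN U_carrier] unfolding W_def BC
    by (simp add: bsum_adj bsum_mult[of _ 1 1 _ n n _ 1 _ n])
  also have "\<dots> = diagm (1 + n) (\<lambda>i. complex_of_real (if i < 1 then r else d (i - 1)))"
    unfolding w(2) bsum_diagm r by (rule diagm_cong) auto
  finally have "adj (u * W) * A * (u * W) = diagm (Suc n) (\<lambda>i. complex_of_real (if i < 1 then r else d (i - 1)))"
    by simp
  then show ?case using u WU by (intro bexI[of _ "u * W"]) auto
qed

text \<open>Serves to move a chosen set of basis vectors to the front, so that an eigenspace becomes
  the leading block.\<close>

lemma exists_partition_permutation:
  "\<exists>s. s permutes {..<n} \<and> (\<forall>i<n. P (s i) \<longleftrightarrow> i < card {i. i < n \<and> P i})"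
proof -
  let ?A = "{i. i < n \<and> P i}" and ?B = "{i. i < n \<and> \<not> P i}"
  let ?k = "card ?A"
  have fin: "finite ?A" "finite ?B" by auto
  have un: "?A \<union> ?B = {..<n}" "?A \<inter> ?B = {}" by auto
  have kn: "?k + card ?B = n" using card_Un_disjoint[OF fin un(2)] un(1) by simp
  obtain f where f: "bij_betw f {..<?k} ?A" using fin by (metis bij_betw_from_nat_into_finite card_lessThan finite_lessThan finite_same_card_bij)
  obtain g where g: "bij_betw g {?k..<n} ?B" using fin kn
    by (metis add_diff_cancel_left' card_atLeastLessThan finite_atLeastLessThan finite_same_card_bij)
  define s where "s i = (if i < n then if i < ?k then f i else g i else i)" for i
  have "bij_betw s ({..<?k} \<union> {?k..<n}) (?A \<union> ?B)"
  proof (rule bij_betw_combine)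
    show "bij_betw s {..<?k} ?A" using f kn by (subst bij_betw_cong[of _ _ f]) (auto simp: s_def)
    show "bij_betw s {?k..<n} ?B" using g kn by (subst bij_betw_cong[of _ _ g]) (auto simp: s_def)
  qed (use un in auto)
  moreover have "{..<?k} \<union> {?k..<n} = {..<n}" using kn by auto
  ultimately have bij: "bij_betw s {..<n} {..<n}" using un by simp
  have "s permutes {..<n}"
    by (rule bij_imp_permutes[OF bij]) (auto simp: s_def)
  moreover have "P (s i) \<longleftrightarrow> i < ?k" if "i < n" for i
  proof (cases "i < ?k")
    case True
    then have "s i \<in> ?A" using f that by (auto simp: s_def bij_betw_def)
    then show ?thesis using True by auto
  next
    case False
    then have "s i \<in> ?B" using g that by (auto simp: s_def bij_betw_def)
    then show ?thesis using False by auto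
  qed
  ultimately show ?thesis by blast
qed

text \<open>The eigenspace of one eigenvalue of \<open>A\<close>, here \<open>d 0\<close>, and the
  sum of the other eigenspaces are preserved by every matrix commuting with \<open>A\<close>; both
  are nonzero because \<open>A\<close> is not scalar. The same basis works for all \<open>B\<close>
  at once, which is what decomposes a whole representation.\<close>

lemma hermitian_split:
  assumes A: "A \<in> carrier_mat p p" "adj A = A" and ns: "\<nexists>c. A = c \<cdot>\<^sub>m 1\<^sub>m p"
  shows "\<exists>u\<in>U p. \<exists>a b. a > 0 \<and> b > 0 \<and> a + b = p \<and>
    (\<forall>B\<in>carrier_mat p p. A * B = B * A \<longrightarrow>
      (\<exists>B1\<in>carrier_mat a a. \<exists>B2\<in>carrier_mat b b. adj u * B * u = bsum B1 B2))"
proof -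
  obtain w d where w: "w \<in> U p" and wd: "adj w * A * w = diagm p (\<lambda>i. complex_of_real (d i))"
    using hermitian_diagonalize[OF A] by blast
  note wc = U_carrier[OF w]
  define K where "K = {i. i < p \<and> d i = d 0}"
  define a where "a = card K"
  obtain s where s: "s permutes {..<p}" and sK: "\<And>i. i < p \<Longrightarrow> d (s i) = d 0 \<longleftrightarrow> i < a"
    using exists_partition_permutation[of p "\<lambda>i. d i = d 0"] unfolding a_def K_def by blast
  have p0: "0 < p" 
  proof (rule ccontr)
    assume "\<not> 0 < p"
    then have "A = 1 \<cdot>\<^sub>m 1\<^sub>m p" using A by (intro eq_matI) auto
    then show False using ns by blast
  qed
  have a0: "a > 0" using p0 by (auto simp: a_def K_def card_gt_0_iff)
  have ap: "a < p"
  proof (rule ccontr)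
    assume "\<not> a < p"
    have all: "d i = d 0" if "i < p" for i
    proof -
      have "i \<in> s ` {..<p}" using permutes_image[OF s] that by simp
      then obtain j where "j < p" "s j = i" by auto
      then show ?thesis using sK[of j] \<open>\<not> a < p\<close> by auto
    qed
    have "A = w * (adj w * A * w) * adj w"
      using A wc w by (simp add: assoc_mult_mat[of _ p p _ p _ p] U_left_cancel[of w p _ p] U_right)
    also have "adj w * A * w = complex_of_real (d 0) \<cdot>\<^sub>m 1\<^sub>m p"
      unfolding wd diagm_const[symmetric] by (intro diagm_cong arg_cong[of _ _ complex_of_real] all)
    also have "w * \<dots> * adj w = complex_of_real (d 0) \<cdot>\<^sub>m 1\<^sub>m p"
      using w wc by (simp add: mult_smult_distrib[of _ p p _ p] mult_smult_assoc_mat[of _ p p _ p] U_right right_mult_one_mat[of _ p p])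
    finally have "A = complex_of_real (d 0) \<cdot>\<^sub>m 1\<^sub>m p" .
    then show False using ns by blast
  qed
  define u where "u = w * permm p s"
  have uU: "u \<in> U p" using w permm_U[OF s] by (simp add: u_def)
  note uc = U_carrier[OF uU]
  have ud: "adj u * A * u = diagm p (\<lambda>i. complex_of_real (d (s i)))"
  proof -
    have "adj u * A * u = adj (permm p s) * (adj w * A * w) * permm p s"
      using A(1) wc unfolding u_def
      by (simp add: mat_adjoint_mult[of _ p p _ p] assoc_mult_mat[of _ p p _ p _ p])
    also have "\<dots> = diagm p (\<lambda>i. complex_of_real (d (s i)))"
      unfolding wd by (rule permm_conj_diagm[OF s])
    finally show ?thesis .
  qed
  have "\<exists>B1\<in>carrier_mat a a. \<exists>B2\<in>carrier_mat (p - a) (p - a). adj u * B * u = bsum B1 B2"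
    if B: "B \<in> carrier_mat p p" and AB: "A * B = B * A" for B
  proof -
    define C where "C = adj u * B * u"
    have Cc: "C \<in> carrier_mat p p" using B uc by (simp add: C_def)
    have conj: "(adj u * X * u) * (adj u * Y * u) = adj u * (X * Y) * u"
      if "X \<in> carrier_mat p p" "Y \<in> carrier_mat p p" for X Y
      using that uc uU by (simp add: assoc_mult_mat[of _ p p _ p _ p] U_left_cancel[of u p _ p])
    have comm: "diagm p (\<lambda>i. complex_of_real (d (s i))) * C = C * diagm p (\<lambda>i. complex_of_real (d (s i)))"
      unfolding ud[symmetric] C_def using conj A B AB by simp
    have off: "C $$ (i, j) = 0" if "i < p" "j < p" "(i < a) \<noteq> (j < a)" for i j
    proof -
      have "complex_of_real (d (s i)) * C $$ (i, j) = C $$ (i, j) * complex_of_real (d (s j))"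
        using arg_cong[OF comm, of "\<lambda>M. M $$ (i, j)"]
        unfolding diagm_left[OF Cc that(1,2)] diagm_right[OF Cc that(1,2)] .
      moreover have "d (s i) \<noteq> d (s j)" using sK[of i] sK[of j] that by auto
      ultimately show ?thesis by (auto simp: mult.commute)
    qed
    let ?B1 = "Matrix.mat a a (\<lambda>(i, j). C $$ (i, j))"
    let ?B2 = "Matrix.mat (p - a) (p - a) (\<lambda>(i, j). C $$ (a + i, a + j))"
    have "C = bsum ?B1 ?B2"
    proof (rule eq_matI)
      fix i j assume "i < dim_row (bsum ?B1 ?B2)" "j < dim_col (bsum ?B1 ?B2)"
      then have ij: "i < a + (p - a)" "j < a + (p - a)" by auto
      show "C $$ (i, j) = bsum ?B1 ?B2 $$ (i, j)"
        using ij off[of i j] by (subst bsum_index[of _ a a _ "p - a" "p - a"]) auto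
    qed (use Cc ap in auto)
    then show ?thesis unfolding C_def[symmetric] by (intro bexI[of _ ?B1] bexI[of _ ?B2]) auto
  qed
  then show ?thesis
    using uU a0 ap by (intro bexI[of _ u] exI[of _ a] exI[of _ "p - a"]) auto
qed

subsection \<open>Unitary representations and block decompositions\<close>

definition circ :: "nat \<Rightarrow> nat \<Rightarrow> real \<Rightarrow> complex mat" where
  "circ n j s = diagm n (\<lambda>i. if i = j then cis s else 1)"

text \<open>Continuity is required along the coordinate circles only. This already yields integral
  weights on the diagonal torus, and since every unitary is conjugate into the torus, Lipschitz
  continuity and differentiability of \<rho> follow from the weights.\<close>

definition unitary_rep :: "nat \<Rightarrow> nat \<Rightarrow> (complex mat \<Rightarrow> complex mat) \<Rightarrow> bool" where
  "unitary_rep n p \<rho> \<longleftrightarrow> (\<forall>g\<in>U n. \<rho> g \<in> U p) \<and> (\<forall>g\<in>U n. \<forall>h\<in>U n. \<rho> (g * h) = \<rho> g * \<rho> h) \<and>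
     (\<forall>j<n. \<forall>a<p. \<forall>b<p. continuous_on UNIV (\<lambda>s. \<rho> (circ n j s) $$ (a, b)))"

text \<open>Irreducibility in the form of Schur's lemma: a proper invariant subspace corresponds to
  a commuting orthogonal projection, hence to a nonscalar self-adjoint commuting matrix.\<close>

definition irreducible_rep :: "nat \<Rightarrow> nat \<Rightarrow> (complex mat \<Rightarrow> complex mat) \<Rightarrow> bool" where
  "irreducible_rep n p \<rho> \<longleftrightarrow> (\<forall>A\<in>carrier_mat p p. adj A = A \<longrightarrow> (\<forall>g\<in>U n. A * \<rho> g = \<rho> g * A) \<longrightarrow>
     (\<exists>c. A = c \<cdot>\<^sub>m 1\<^sub>m p))"

text \<open>The radius refers to the unnormalized norm, so that the same radius serves after passing
  to a block; \<delta>-surjectivity corresponds to \<delta> times the square root of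
  \<open>m\<close>.\<close>

definition dense_within :: "nat \<Rightarrow> nat \<Rightarrow> (complex mat \<Rightarrow> complex mat) \<Rightarrow> real \<Rightarrow> bool" where
  "dense_within n p \<rho> c \<longleftrightarrow> (\<forall>z\<in>U p. \<exists>g\<in>U n. fr (\<rho> g - z) \<le> c)"

lemma circ_U [simp]: "circ n j s \<in> U n"
  unfolding circ_def by (rule diagm_U) auto

lemma fr2_diagm: "fr2 (diagm n d) = (\<Sum>i<n. (cmod (d i))\<^sup>2)"
  by (simp add: fr2_def if_distrib[of cmod] if_distrib[of "\<lambda>x. x\<^sup>2"] sum.delta cong: if_cong)

lemma diagm_minus: "diagm n d - diagm n e = diagm n (\<lambda>i. d i - e i)"
  by (rule eq_matI) auto

lemma rep_of_continuous_hom: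
  assumes hom: "\<phi> \<in> hom (unitary_group n) (unitary_group m)"
    and cont: "continuous_map (unitary_topology n) (unitary_topology m) \<phi>" and m: "m \<ge> 1" and n: "n \<ge> 1"
  shows "unitary_rep n m \<phi>"
proof -
  have 1: "\<phi> g \<in> U m" if "g \<in> U n" for g using hom that by (auto simp: hom_def)
  have 2: "\<phi> (g * h) = \<phi> g * \<phi> h" if "g \<in> U n" "h \<in> U n" for g h
    using hom that by (auto simp: hom_def unitary_group_ops)
  have ed: "\<exists>d>0. \<forall>x. x \<in> U n \<and> unitary_dist n g x < d \<longrightarrow> unitary_dist m (\<phi> g) (\<phi> x) < e"
    if "g \<in> U n" "e > 0" for g e
    using cont that unfolding unitary_topology_def Metric_space.metric_continuous_map[OF Metric_space_unitary Metric_space_unitary]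
    by blast
  have "continuous_on UNIV (\<lambda>s. \<phi> (circ n j s) $$ (a, b))" if j: "j < n" and ab: "a < m" "b < m" for j a b
    unfolding continuous_on_iff
  proof (intro ballI allI impI)
    fix s0 e :: real assume e: "0 < e"
    have e': "e / sqrt (real m) > 0" using e m by simp
    obtain d where d: "d > 0" and D: "\<And>x. x \<in> U n \<Longrightarrow> unitary_dist n (circ n j s0) x < d \<Longrightarrow>
        unitary_dist m (\<phi> (circ n j s0)) (\<phi> x) < e / sqrt (real m)"
      using ed[OF circ_U e'] by blast
    have "continuous_on UNIV cis" by (intro continuous_intros)
    then obtain d' where d': "d' > 0" and D': "\<And>s. dist s s0 < d' \<Longrightarrow> dist (cis s) (cis s0) < d"
      using d unfolding continuous_on_iff by (metis UNIV_I)
    show "\<exists>d>0. \<forall>s\<in>UNIV. dist s s0 < d \<longrightarrow> dist (\<phi> (circ n j s) $$ (a, b)) (\<phi> (circ n j s0) $$ (a, b)) < e"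
    proof (intro exI[of _ d'] conjI ballI impI d')
      fix s assume s: "dist s s0 < d'"
      have "fr2 (circ n j s0 - circ n j s) = (\<Sum>i<n. (cmod ((if i = j then cis s0 else 1) - (if i = j then cis s else 1)))\<^sup>2)"
        unfolding circ_def diagm_minus fr2_diagm by simp
      also have "\<dots> = (cmod (cis s0 - cis s))\<^sup>2"
        by (subst sum_single[OF j]) auto
      finally have "fr (circ n j s0 - circ n j s) = dist (cis s) (cis s0)"
        by (simp add: fr_def dist_norm norm_minus_commute)
      then have "unitary_dist n (circ n j s0) (circ n j s) = dist (cis s) (cis s0) / sqrt (real n)"
        by (simp add: unitary_dist_def hs_dist_fr)
      also have "\<dots> \<le> dist (cis s) (cis s0)" using n by (simp add: divide_le_eq mult_le_cancel_left1)
      also have "\<dots> < d" using D'[OF s] .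
      finally have "unitary_dist m (\<phi> (circ n j s0)) (\<phi> (circ n j s)) < e / sqrt (real m)"
        by (intro D) auto
      then have "fr (\<phi> (circ n j s0) - \<phi> (circ n j s)) < e"
        using m by (simp add: unitary_dist_def 1 hs_dist_fr divide_less_cancel split: if_splits)
      moreover have "cmod ((\<phi> (circ n j s0) - \<phi> (circ n j s)) $$ (a, b)) \<le> fr (\<phi> (circ n j s0) - \<phi> (circ n j s))"
        using ab 1[THEN U_carrier] by (intro entry_le_fr) auto
      ultimately show "dist (\<phi> (circ n j s) $$ (a, b)) (\<phi> (circ n j s0) $$ (a, b)) < e"
        using ab carrier_matD[OF U_carrier[OF 1[OF circ_U]]] by (simp add: dist_norm norm_minus_commute)
    qed
  qed
  then show ?thesis unfolding unitary_rep_def using 1 2 by blast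
qed

lemma inverse_permutes:
  assumes "\<And>x. r (s x) = x" "\<And>x. s (r x) = x" "\<And>x. x \<notin> S \<Longrightarrow> s x = x"
  shows "s permutes S"
  unfolding permutes_def using assms by metis

text \<open>The sizes \<open>a\<close> and \<open>b\<close> may be zero, so that the trivial
  splitting can start the search for a minimal block.\<close>

definition splits :: "nat \<Rightarrow> nat \<Rightarrow> (complex mat \<Rightarrow> complex mat) \<Rightarrow> nat \<Rightarrow> nat \<Rightarrow> bool" where
  "splits n m \<phi> a b \<longleftrightarrow> a + b = m \<and> (\<exists>u\<in>U m. \<forall>g\<in>U n. \<exists>B1\<in>carrier_mat a a. \<exists>B2\<in>carrier_mat b b.
      adj u * \<phi> g * u = bsum B1 B2)"

text \<open>The unitary exchanging \<open>min a b\<close> coordinates of the two blocks is far from all block diagonal matrices.\<close>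

lemma splits_small:
  assumes surj: "dense_within n m \<phi> c" and sp: "splits n m \<phi> a b"
    and ph: "\<And>g. g \<in> U n \<Longrightarrow> \<phi> g \<in> U m" and c: "c \<ge> 0"
  shows "2 * real (min a b) \<le> c\<^sup>2"
proof -
  obtain u where ab: "a + b = m" and u: "u \<in> U m" and
    B: "\<And>g. g \<in> U n \<Longrightarrow> \<exists>B1\<in>carrier_mat a a. \<exists>B2\<in>carrier_mat b b. adj u * \<phi> g * u = bsum B1 B2"
    using sp unfolding splits_def by blast
  define k where "k = min a b"
  define s where "s i = (if i < k then a + i else if a \<le> i \<and> i < a + k then i - a else i)" for i
  have s: "s permutes {..<m}"
    using ab by (intro inverse_permutes[of s]) (auto simp: s_def k_def)
  note uc = U_carrier[OF u]
  define y where "y = u * permm m s * adj u"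
  have yU: "y \<in> U m" using u permm_U[OF s] by (simp add: y_def)
  obtain g where g: "g \<in> U n" "fr (\<phi> g - y) \<le> c" using surj yU unfolding dense_within_def by blast
  obtain B1 B2 where B12: "B1 \<in> carrier_mat a a" "B2 \<in> carrier_mat b b" "adj u * \<phi> g * u = bsum B1 B2"
    using B[OF g(1)] by blast
  define E where "E = bsum B1 B2 - permm m s"
  have bc: "bsum B1 B2 \<in> carrier_mat m m" using B12 ab bsum_carrier by blast
  have Ec: "E \<in> carrier_mat m m" using bc by (simp add: E_def)
  note gc = U_carrier[OF ph[OF g(1)]]
  have yc: "adj u * y * u = permm m s"
    using uc u by (simp add: y_def assoc_mult_mat[of _ m m _ m _ m] U_left_cancel[of u m _ m] U_left)
  have "adj u * (\<phi> g - y) * u = E"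
    unfolding E_def B12(3)[symmetric] yc[symmetric] using uc gc U_carrier[OF yU]
    by (simp add: mult_minus_right[of _ m m _ m] mult_minus_left[of _ m m _ _ m])
  moreover have "fr2 (adj u * (\<phi> g - y) * u) = fr2 (\<phi> g - y)"
    using u uc gc U_carrier[OF yU] by (simp add: fr2_U_right[of u m _ m] fr2_U_left[of "adj u" m _ m])
  ultimately have "fr2 E \<le> c\<^sup>2" using g(2) c by (metis fr_sq fr_nonneg power_mono)
  moreover have "2 * real k \<le> fr2 E"
  proof -
    \<comment> \<open>In these rows the permutation leads into the other block, where the block sum
      vanishes and the permutation matrix has a one.\<close>
    have r: "1 \<le> (\<Sum>j<m. (cmod (E $$ (i, j)))\<^sup>2)" if i: "i < k \<or> (a \<le> i \<and> i < a + k)" for i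
    proof -
      have im: "i < m" using i ab by (auto simp: k_def)
      have sm: "s i < m" using s im by simp
      have ssi: "s (s i) = i" using i by (auto simp: s_def k_def)
      have "bsum B1 B2 $$ (i, s i) = 0"
        using B12 i im sm ab by (subst bsum_index[of _ a a _ b b]) (auto simp: s_def k_def)
      then have "E $$ (i, s i) = -1" using im sm ssi bc by (simp add: E_def)
      then have "1 = (cmod (E $$ (i, s i)))\<^sup>2" by simp
      also have "\<dots> \<le> (\<Sum>j<m. (cmod (E $$ (i, j)))\<^sup>2)" using sm by (intro member_le_sum) auto
      finally show ?thesis .
    qed
    have "2 * real k = (\<Sum>i\<in>{..<k} \<union> {a..<a + k}. 1)"
      by (subst sum.union_disjoint) (auto simp: k_def)
    also have "\<dots> \<le> (\<Sum>i\<in>{..<k} \<union> {a..<a + k}. \<Sum>j<m. (cmod (E $$ (i, j)))\<^sup>2)"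
      using r by (intro sum_mono) auto
    also have "\<dots> \<le> (\<Sum>i<m. \<Sum>j<m. (cmod (E $$ (i, j)))\<^sup>2)"
      using ab by (intro sum_mono2) (auto simp: k_def sum_nonneg)
    also have "\<dots> = fr2 E" using Ec by (simp add: fr2_carrier)
    finally show ?thesis .
  qed
  ultimately show ?thesis by (simp add: k_def)
qed

lemma block_swap:
  "\<exists>s\<in>U (a + b). \<forall>A\<in>carrier_mat a a. \<forall>B\<in>carrier_mat b b. adj s * bsum A B * s = bsum B A"
proof -
  define s where "s i = (if i < b then a + i else if i < a + b then i - b else i)" for i
  define r where "r i = (if i < a then b + i else if i < a + b then i - a else i)" for i
  have rs: "r (s x) = x" "s (r x) = x" for x by (auto simp: s_def r_def)
  have s: "s permutes {..<a + b}"
    using rs by (intro inverse_permutes[of r]) (auto simp: s_def)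
  have "adj (permm (a + b) s) * bsum A B * permm (a + b) s = bsum B A" if "A \<in> carrier_mat a a" "B \<in> carrier_mat b b" for A B
  proof (rule eq_matI)
    fix i j assume "i < dim_row (bsum B A)" "j < dim_col (bsum B A)"
    then have ij: "i < b + a" "j < b + a" using that by auto
    have "(adj (permm (a + b) s) * bsum A B * permm (a + b) s) $$ (i, j) = bsum A B $$ (s i, s j)"
      using that ij by (intro permm_conj[OF s]) auto
    also have "\<dots> = bsum B A $$ (i, j)"
      using ij perm_less[OF s, of i] perm_less[OF s, of j]
      by (simp add: bsum_index[OF that] bsum_index[OF that(2,1)]) (auto simp: s_def)
    finally show "(adj (permm (a + b) s) * bsum A B * permm (a + b) s) $$ (i, j) = bsum B A $$ (i, j)" .
  qed (use that in auto)
  then show ?thesis using permm_U[OF s] by blast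
qed

text \<open>The larger part is put first, because the minimality argument for the irreducible block
  follows the larger part.\<close>

lemma hermitian_split_large:
  assumes A: "A \<in> carrier_mat p p" "adj A = A" and ns: "\<nexists>c. A = c \<cdot>\<^sub>m 1\<^sub>m p"
  shows "\<exists>u\<in>U p. \<exists>a b. b > 0 \<and> a + b = p \<and> b \<le> a \<and>
    (\<forall>B\<in>carrier_mat p p. A * B = B * A \<longrightarrow>
      (\<exists>B1\<in>carrier_mat a a. \<exists>B2\<in>carrier_mat b b. adj u * B * u = bsum B1 B2))"
proof -
  obtain u a b where u: "u \<in> U p" and ab: "a > 0" "b > 0" "a + b = p" and
    H: "\<And>B. B \<in> carrier_mat p p \<Longrightarrow> A * B = B * A \<Longrightarrow>
      (\<exists>B1\<in>carrier_mat a a. \<exists>B2\<in>carrier_mat b b. adj u * B * u = bsum B1 B2)"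
    using hermitian_split[OF A ns] by blast
  show ?thesis
  proof (cases "b \<le> a")
    case True
    then show ?thesis using u ab H by blast
  next
    case False
    obtain s where s: "s \<in> U p" and S: "\<And>A B. A \<in> carrier_mat a a \<Longrightarrow> B \<in> carrier_mat b b \<Longrightarrow>
        adj s * bsum A B * s = bsum B A"
      using block_swap[of a b] ab by blast
    have *: "\<exists>B1\<in>carrier_mat b b. \<exists>B2\<in>carrier_mat a a. adj (u * s) * B * (u * s) = bsum B1 B2"
      if B: "B \<in> carrier_mat p p" "A * B = B * A" for B
    proof -
      obtain B1 B2 where B12: "B1 \<in> carrier_mat a a" "B2 \<in> carrier_mat b b" "adj u * B * u = bsum B1 B2"
        using H[OF B] by blast
      have "adj (u * s) * B * (u * s) = adj s * (adj u * B * u) * s"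
        using B U_carrier[OF u] U_carrier[OF s]
        by (simp add: mat_adjoint_mult[of _ p p _ p] assoc_mult_mat[of _ p p _ p _ p])
      also have "\<dots> = bsum B2 B1" unfolding B12(3) by (rule S[OF B12(1,2)])
      finally show ?thesis using B12 by blast
    qed
    have us: "u * s \<in> U p" using u s by simp
    show ?thesis
    proof (rule bexI[OF _ us], rule exI[of _ b], rule exI[of _ a], intro conjI ballI impI)
      fix B assume "B \<in> carrier_mat p p" "A * B = B * A"
      then show "\<exists>B1\<in>carrier_mat b b. \<exists>B2\<in>carrier_mat a a. adj (u * s) * B * (u * s) = bsum B1 B2" by (rule *)
    qed (use ab False in simp_all)
  qed
qed

text \<open>Take the smallest \<open>p\<close> with \<open>m < 2 * p\<close> for which \<phi> splits
  into blocks of sizes \<open>p\<close> and \<open>m - p\<close>. If the block of size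
  \<open>p\<close> were reducible, its larger part, of size \<open>a\<close> with
  \<open>p \<le> 2 * a\<close>, would be a block of \<phi>: either \<open>m < 2 * a\<close>, against
  minimality, or 2 a \<le> c^2 by the swap argument, and then 2 p \<le> 4 a \<le> 2 c^2 \<le> m,
  against the choice of \<open>p\<close>.\<close>

lemma exists_irreducible_block:
  assumes rep: "unitary_rep n m \<phi>" and dense: "dense_within n m \<phi> c" and c: "0 \<le> c" "2 * c\<^sup>2 \<le> real m" and m: "m \<ge> 1"
  shows "\<exists>p \<rho> \<rho>' u. p \<le> m \<and> m < 2 * p \<and> 2 * real (m - p) \<le> c\<^sup>2 \<and> u \<in> U m \<and>
    (\<forall>g\<in>U n. adj u * \<phi> g * u = bsum (\<rho> g) (\<rho>' g)) \<and> (\<forall>g\<in>U n. \<rho>' g \<in> U (m - p)) \<and>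
    unitary_rep n p \<rho> \<and> irreducible_rep n p \<rho> \<and> dense_within n p \<rho> c"
proof -
  have ph: "\<phi> g \<in> U m" if "g \<in> U n" for g using rep that by (simp add: unitary_rep_def)
  note phc = U_carrier[OF ph]
  define Q where "Q p \<longleftrightarrow> p \<le> m \<and> m < 2 * p \<and> splits n m \<phi> p (m - p)" for p
  have "\<exists>B1\<in>carrier_mat m m. \<exists>B2\<in>carrier_mat (m - m) (m - m). adj (1\<^sub>m m) * \<phi> g * 1\<^sub>m m = bsum B1 B2"
    if g: "g \<in> U n" for g
  proof -
    have "adj (1\<^sub>m m) * \<phi> g * 1\<^sub>m m = \<phi> g"
      using phc[OF g] by (simp add: left_mult_one_mat[of _ m m] right_mult_one_mat[of _ m m])
    also have "\<phi> g = bsum (\<phi> g) (0\<^sub>m 0 0)"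
      using phc[OF g] by (intro eq_matI) (auto simp: bsum_index[of _ m m _ 0 0])
    finally show ?thesis
      using phc[OF g] by (intro bexI[of _ "\<phi> g"] bexI[of _ "0\<^sub>m 0 0"]) auto
  qed
  then have "splits n m \<phi> m (m - m)"
    unfolding splits_def by (intro conjI bexI[OF _ U_one] ballI) simp_all
  then have "Q m" unfolding Q_def using m by simp
  define p where "p = (LEAST p. Q p)"
  have Qp: "Q p" unfolding p_def by (rule LeastI[of Q, OF \<open>Q m\<close>])
  have least: "\<not> Q q" if "q < p" for q using that unfolding p_def by (rule not_less_Least)
  have pm: "p \<le> m" "m < 2 * p" and sp: "splits n m \<phi> p (m - p)" using Qp by (auto simp: Q_def)
  have small: "2 * real (m - p) \<le> c\<^sup>2"
    using splits_small[OF dense sp ph c(1)] pm by (simp add: min_def split: if_splits)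
  obtain u where u: "u \<in> U m" and
    B: "\<And>g. g \<in> U n \<Longrightarrow> \<exists>B1\<in>carrier_mat p p. \<exists>B2\<in>carrier_mat (m - p) (m - p). adj u * \<phi> g * u = bsum B1 B2"
    using sp unfolding splits_def by blast
  obtain \<rho> where "\<forall>g\<in>U n. \<rho> g \<in> carrier_mat p p \<and> (\<exists>B2\<in>carrier_mat (m - p) (m - p). adj u * \<phi> g * u = bsum (\<rho> g) B2)"
    using B by (metis (lifting) bchoice)
  then obtain \<rho>' where R: "\<And>g. g \<in> U n \<Longrightarrow> \<rho> g \<in> carrier_mat p p \<and> \<rho>' g \<in> carrier_mat (m - p) (m - p) \<and>
      adj u * \<phi> g * u = bsum (\<rho> g) (\<rho>' g)"
    by (metis (lifting) bchoice)
  note uc = U_carrier[OF u]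
  have rc: "\<rho> g \<in> carrier_mat p p" and rc': "\<rho>' g \<in> carrier_mat (m - p) (m - p)"
    and req: "adj u * \<phi> g * u = bsum (\<rho> g) (\<rho>' g)" if "g \<in> U n" for g
    using R[OF that] by auto
  have pmm: "p + (m - p) = m" using pm by simp
  have bU: "bsum (\<rho> g) (\<rho>' g) \<in> U (p + (m - p))" if "g \<in> U n" for g
    using R[OF that] u ph[OF that] unfolding pmm by (metis U_adj U_mult)
  have rU: "\<rho> g \<in> U p" and rU': "\<rho>' g \<in> U (m - p)" if "g \<in> U n" for g
    using bsum_U_D[of "\<rho> g" p "\<rho>' g" "m - p"] R[OF that] bU[OF that] by auto
  have mult: "\<rho> (g * h) = \<rho> g * \<rho> h" if gh: "g \<in> U n" "h \<in> U n" for g h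
  proof -
    have "bsum (\<rho> (g * h)) (\<rho>' (g * h)) = adj u * (\<phi> g * \<phi> h) * u"
      using R[of "g * h"] gh rep by (simp add: unitary_rep_def)
    also have "\<dots> = (adj u * \<phi> g * u) * (adj u * \<phi> h * u)"
      using uc u phc gh by (simp add: assoc_mult_mat[of _ m m _ m _ m] U_left_cancel[of u m _ m])
    also have "\<dots> = bsum (\<rho> g * \<rho> h) (\<rho>' g * \<rho>' h)"
      using R[OF gh(1)] R[OF gh(2)] by (simp add: bsum_mult[of _ p p _ "m - p" "m - p" _ p _ "m - p"])
    finally have eq: "bsum (\<rho> (g * h)) (\<rho>' (g * h)) = bsum (\<rho> g * \<rho> h) (\<rho>' g * \<rho>' h)" .
    show ?thesis
      by (rule bsum_inject(1)[OF _ _ _ _ eq, of p p "m - p" "m - p"]) (simp_all add: rc rc' gh)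
  qed
  have cont: "continuous_on UNIV (\<lambda>s. \<rho> (circ n j s) $$ (a, b))" if j: "j < n" and ab: "a < p" "b < p" for j a b
  proof -
    have "\<rho> (circ n j s) $$ (a, b) = (\<Sum>k<m. \<Sum>r<m. adj u $$ (a, k) * \<phi> (circ n j s) $$ (k, r) * u $$ (r, b))" for s
    proof -
      have "\<rho> (circ n j s) $$ (a, b) = bsum (\<rho> (circ n j s)) (\<rho>' (circ n j s)) $$ (a, b)"
        using R[of "circ n j s"] ab by (subst bsum_index[of _ p p _ "m - p" "m - p"]) auto
      also have "\<dots> = (adj u * \<phi> (circ n j s) * u) $$ (a, b)" using R[of "circ n j s"] by simp
      also have "\<dots> = (\<Sum>k<m. \<Sum>r<m. adj u $$ (a, k) * \<phi> (circ n j s) $$ (k, r) * u $$ (r, b))"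
        using uc phc ab pm by (intro mult_index3[of _ m m _ m _ m]) auto
      finally show ?thesis .
    qed
    moreover have "continuous_on UNIV (\<lambda>s. \<Sum>k<m. \<Sum>r<m. adj u $$ (a, k) * \<phi> (circ n j s) $$ (k, r) * u $$ (r, b))"
      using rep j by (intro continuous_intros) (auto simp: unitary_rep_def)
    ultimately show ?thesis by simp
  qed
  have rep': "unitary_rep n p \<rho>" unfolding unitary_rep_def using rU mult cont by blast
  have dense': "dense_within n p \<rho> c"
    unfolding dense_within_def
  proof
    fix z assume z: "z \<in> U p"
    \<comment> \<open>The target \<open>z\<close> is extended by an identity block; dropping the
      second block afterwards can only decrease the distance.\<close>
    define w where "w = bsum z (1\<^sub>m (m - p))"
    have w: "w \<in> U m" using bsum_U[OF z, of "1\<^sub>m (m - p)" "m - p"] pmm by (simp add: w_def)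
    then have "u * w * adj u \<in> U m" using u by simp
    then obtain g where g: "g \<in> U n" "fr (\<phi> g - u * w * adj u) \<le> c"
      using dense unfolding dense_within_def by blast
    note gc = phc[OF g(1)] and wc = U_carrier[OF w]
    have "adj u * (\<phi> g - u * w * adj u) * u = adj u * \<phi> g * u - w"
      using uc u gc wc
      by (simp add: mult_minus_right[of _ m m _ m] mult_minus_left[of _ m m _ _ m] assoc_mult_mat[of _ m m _ m _ m]
          U_left_cancel[of u m _ m] U_left right_mult_one_mat[of _ m m])
    then have "fr2 (\<phi> g - u * w * adj u) = fr2 (adj u * \<phi> g * u - w)"
      using u uc gc wc fr2_U_right[of u m "adj u * (\<phi> g - u * w * adj u)" m] fr2_U_left[of "adj u" m "\<phi> g - u * w * adj u" m]
      by simp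
    also have "adj u * \<phi> g * u - w = bsum (\<rho> g - z) (\<rho>' g - 1\<^sub>m (m - p))"
      using R[OF g(1)] U_carrier[OF z] unfolding w_def by (simp add: bsum_minus[of _ p p _ _ "m - p" "m - p"])
    also have "fr2 \<dots> = fr2 (\<rho> g - z) + fr2 (\<rho>' g - 1\<^sub>m (m - p))"
      using R[OF g(1)] U_carrier[OF z] by (intro fr2_bsum[of _ p p _ "m - p" "m - p"]) auto
    finally have "fr2 (\<rho> g - z) \<le> fr2 (\<phi> g - u * w * adj u)" by simp
    then have "fr (\<rho> g - z) \<le> c" using g(2) unfolding fr_def by (meson order_trans real_sqrt_le_mono)
    then show "\<exists>g\<in>U n. fr (\<rho> g - z) \<le> c" using g(1) by blast
  qed
  have irr: "irreducible_rep n p \<rho>"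
    unfolding irreducible_rep_def
  proof (intro ballI impI, rule ccontr)
    fix A assume A: "A \<in> carrier_mat p p" "adj A = A" and comm: "\<forall>g\<in>U n. A * \<rho> g = \<rho> g * A"
      and "\<nexists>c. A = c \<cdot>\<^sub>m 1\<^sub>m p"
    then obtain w a b where w: "w \<in> U p" and ab: "b > 0" "a + b = p" "b \<le> a" and
      H: "\<And>B. B \<in> carrier_mat p p \<Longrightarrow> A * B = B * A \<Longrightarrow>
        (\<exists>B1\<in>carrier_mat a a. \<exists>B2\<in>carrier_mat b b. adj w * B * w = bsum B1 B2)"
      using hermitian_split_large[of A p] by blast
    define W where "W = bsum w (1\<^sub>m (m - p))"
    have W: "W \<in> U m" using bsum_U[OF w, of "1\<^sub>m (m - p)" "m - p"] pmm by (simp add: W_def)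
    note wc = U_carrier[OF w] and Wc = U_carrier[OF W]
    have *: "\<exists>B1\<in>carrier_mat a a. \<exists>B2\<in>carrier_mat (m - a) (m - a). adj (u * W) * \<phi> g * (u * W) = bsum B1 B2"
      if g: "g \<in> U n" for g
    proof -
      obtain B1 B2 where B12: "B1 \<in> carrier_mat a a" "B2 \<in> carrier_mat b b" "adj w * \<rho> g * w = bsum B1 B2"
        using H[of "\<rho> g"] R[OF g] comm g by blast
      have "adj (u * W) * \<phi> g * (u * W) = adj W * (adj u * \<phi> g * u) * W"
        using uc Wc phc[OF g] by (simp add: mat_adjoint_mult[of _ m m _ m] assoc_mult_mat[of _ m m _ m _ m])
      also have "\<dots> = bsum (adj w * \<rho> g * w) (\<rho>' g)"
        using R[OF g] wc unfolding W_def
        by (simp add: bsum_adj bsum_mult[of _ p p _ "m - p" "m - p" _ p _ "m - p"] right_mult_one_mat[of _ "m - p" "m - p"]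
            left_mult_one_mat[of _ "m - p" "m - p"])
      also have "\<dots> = bsum B1 (bsum B2 (\<rho>' g))"
        unfolding B12(3) using B12 R[OF g] by (intro bsum_assoc[of _ a _ b _ "m - p"]) auto
      finally have eq: "adj (u * W) * \<phi> g * (u * W) = bsum B1 (bsum B2 (\<rho>' g))" .
      have "b + (m - p) = m - a" using ab pm by simp
      then have "bsum B2 (\<rho>' g) \<in> carrier_mat (m - a) (m - a)"
        using bsum_carrier[OF B12(2) rc'[OF g]] by simp
      with eq B12(1) show ?thesis by blast
    qed
    have "u * W \<in> U m" using u W by simp
    then have "splits n m \<phi> a (m - a)" unfolding splits_def using * ab pm by auto
    moreover from this have "2 * real (min a (m - a)) \<le> c\<^sup>2" by (rule splits_small[OF dense _ ph c(1)])
    moreover have "\<not> m < 2 * a" using least[of a] ab pm calculation(1) by (auto simp: Q_def)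
    ultimately have "2 * real a \<le> c\<^sup>2" by (simp add: min_def split: if_splits)
    then have "2 * real p \<le> real m" using ab c(2) by linarith
    then show False using pm(2) by linarith
  qed
  show ?thesis
    using pm small u R rU' rep' irr dense' by blast
qed

subsection \<open>Simultaneous diagonalization and weights\<close>

text \<open>The family may be infinite, so the induction runs on the dimension: one nonscalar member
  gives a nonscalar self-adjoint matrix commuting with the family, hence a common block
  decomposition, and both blocks carry commuting families of smaller size.\<close>

lemma commuting_unitaries_diagonalize:
  assumes "\<And>t. t \<in> S \<Longrightarrow> F t \<in> U p" "\<And>s t. s \<in> S \<Longrightarrow> t \<in> S \<Longrightarrow> F s * F t = F t * F s"
  shows "\<exists>w\<in>U p. \<forall>t\<in>S. \<exists>d. adj w * F t * w = diagm p d"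
  using assms
proof (induction p arbitrary: F rule: less_induct)
  case (less p F)
  note FU = less.prems(1) and comm = less.prems(2)
  note Fc = U_carrier[OF FU]
  show ?case
  proof (cases "\<forall>t\<in>S. \<exists>c. F t = c \<cdot>\<^sub>m 1\<^sub>m p")
    case True
    have "\<exists>d. adj (1\<^sub>m p) * F t * 1\<^sub>m p = diagm p d" if t: "t \<in> S" for t
    proof -
      obtain c where "F t = c \<cdot>\<^sub>m 1\<^sub>m p" using True t by blast
      then have "adj (1\<^sub>m p) * F t * 1\<^sub>m p = diagm p (\<lambda>_. c)"
        using Fc[OF t] by (simp add: left_mult_one_mat[of _ p p] right_mult_one_mat[of _ p p] diagm_const)
      then show ?thesis by blast
    qed
    then show ?thesis using U_one[of p] by blast
  next
    case False
    then obtain t0 where t0: "t0 \<in> S" and ns: "\<nexists>c. F t0 = c \<cdot>\<^sub>m 1\<^sub>m p" by blast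
    define A where "A = F t0"
    have AU: "A \<in> U p" using FU[OF t0] by (simp add: A_def)
    note Ac = U_carrier[OF AU]
    \<comment> \<open>Since \<open>A\<close> is unitary, its adjoint is its inverse and commutes
      with the family too.\<close>
    have adjc: "adj A * F t = F t * adj A" if t: "t \<in> S" for t
    proof -
      have "adj A * F t = adj A * (F t * A) * adj A"
        using Ac Fc[OF t] AU by (simp add: assoc_mult_mat[of _ p p _ p _ p] U_right right_mult_one_mat[of _ p p])
      also have "F t * A = A * F t" unfolding A_def by (rule comm[OF t t0])
      also have "adj A * (A * F t) * adj A = F t * adj A"
        using AU Fc[OF t] by (simp add: U_left_cancel[of A p _ p])
      finally show ?thesis .
    qed
    \<comment> \<open>For \<open>e\<close> equal to 1 and to the imaginary unit this is, up to
      factors, the real and the imaginary part of \<open>A\<close>; if both were scalar, so would be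
      \<open>A\<close>.\<close>
    define H where "H e = e \<cdot>\<^sub>m A + cnj e \<cdot>\<^sub>m adj A" for e
    have Hc: "H e \<in> carrier_mat p p" for e using Ac by (simp add: H_def)
    have Hh: "adj (H e) = H e" for e
      unfolding H_def using Ac by (intro eq_matI) (auto simp: add.commute)
    have Hcomm: "H e * F t = F t * H e" if "t \<in> S" for e t
    proof -
      have "A * F t = F t * A" unfolding A_def by (rule comm[OF t0 that])
      then show ?thesis
        using Ac Fc[OF that] adjc[OF that]
        by (simp add: H_def add_mult_distrib_mat[of _ p p _ _ p] mult_add_distrib_mat[of _ p p _ p]
            mult_smult_distrib[of _ p p _ p] mult_smult_assoc_mat[of _ p p _ p])
    qed
    have "\<exists>e. \<nexists>c. H e = c \<cdot>\<^sub>m 1\<^sub>m p"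
    proof (rule ccontr)
      assume "\<nexists>e. \<nexists>c. H e = c \<cdot>\<^sub>m 1\<^sub>m p"
      then obtain c1 c2 where c: "H 1 = c1 \<cdot>\<^sub>m 1\<^sub>m p" "H \<i> = c2 \<cdot>\<^sub>m 1\<^sub>m p" by metis
      have "A = ((c1 - \<i> * c2) / 2) \<cdot>\<^sub>m 1\<^sub>m p"
      proof (rule eq_matI)
        fix i j assume "i < dim_row (((c1 - \<i> * c2) / 2) \<cdot>\<^sub>m 1\<^sub>m p)" "j < dim_col (((c1 - \<i> * c2) / 2) \<cdot>\<^sub>m 1\<^sub>m p)"
        then have ij: "i < p" "j < p" by auto
        have 1: "A $$ (i, j) + cnj (A $$ (j, i)) = c1 * (1\<^sub>m p :: complex mat) $$ (i, j)"
          using arg_cong[OF c(1), of "\<lambda>M. M $$ (i, j)"] ij carrier_matD[OF Ac] by (simp add: H_def)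
        have 2: "\<i> * A $$ (i, j) - \<i> * cnj (A $$ (j, i)) = c2 * (1\<^sub>m p :: complex mat) $$ (i, j)"
          using arg_cong[OF c(2), of "\<lambda>M. M $$ (i, j)"] ij carrier_matD[OF Ac] by (simp add: H_def)
        have "2 * A $$ (i, j) = (A $$ (i, j) + cnj (A $$ (j, i))) - \<i> * (\<i> * A $$ (i, j) - \<i> * cnj (A $$ (j, i)))"
          by (simp add: algebra_simps flip: mult.assoc)
        also have "\<dots> = (c1 - \<i> * c2) * (1\<^sub>m p :: complex mat) $$ (i, j)"
          unfolding 1 2 by (simp add: algebra_simps)
        finally show "A $$ (i, j) = (((c1 - \<i> * c2) / 2) \<cdot>\<^sub>m 1\<^sub>m p) $$ (i, j)"
          using ij by (simp add: field_simps)
      qed (use Ac in auto)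
      then show False using ns unfolding A_def by blast
    qed
    then obtain e where nsH: "\<nexists>c. H e = c \<cdot>\<^sub>m 1\<^sub>m p" by blast
    obtain u a b where u: "u \<in> U p" and ab: "a > 0" "b > 0" "a + b = p" and
      B: "\<And>B. B \<in> carrier_mat p p \<Longrightarrow> H e * B = B * H e \<Longrightarrow>
      (\<exists>B1\<in>carrier_mat a a. \<exists>B2\<in>carrier_mat b b. adj u * B * u = bsum B1 B2)"
      using hermitian_split[OF Hc Hh nsH] by blast
    note uc = U_carrier[OF u]
    have "\<forall>t\<in>S. \<exists>B1. B1 \<in> carrier_mat a a \<and> (\<exists>B2\<in>carrier_mat b b. adj u * F t * u = bsum B1 B2)"
      using B[OF Fc Hcomm] by blast
    then obtain F1 where "\<forall>t\<in>S. F1 t \<in> carrier_mat a a \<and> (\<exists>B2. B2\<in>carrier_mat b b \<and> adj u * F t * u = bsum (F1 t) B2)"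
      by (metis (lifting) bchoice)
    then obtain F2 where R: "\<And>t. t \<in> S \<Longrightarrow> F1 t \<in> carrier_mat a a \<and> F2 t \<in> carrier_mat b b \<and>
        adj u * F t * u = bsum (F1 t) (F2 t)"
      by (metis (lifting) bchoice)
    have F1c: "F1 t \<in> carrier_mat a a" and F2c: "F2 t \<in> carrier_mat b b"
      and Feq: "adj u * F t * u = bsum (F1 t) (F2 t)" if "t \<in> S" for t
      using R[OF that] by auto
    have bU: "bsum (F1 t) (F2 t) \<in> U (a + b)" if "t \<in> S" for t
      unfolding Feq[OF that, symmetric] ab(3) using u FU[OF that] by simp
    have F1U: "F1 t \<in> U a" and F2U: "F2 t \<in> U b" if "t \<in> S" for t
      using bsum_U_D[OF F1c[OF that] F2c[OF that] bU[OF that]] by auto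
    have eq: "bsum (F1 s * F1 t) (F2 s * F2 t) = bsum (F1 t * F1 s) (F2 t * F2 s)" if st: "s \<in> S" "t \<in> S" for s t
    proof -
      have *: "bsum (F1 s * F1 t) (F2 s * F2 t) = adj u * (F s * F t) * u" if st: "s \<in> S" "t \<in> S" for s t
      proof -
        have "bsum (F1 s * F1 t) (F2 s * F2 t) = bsum (F1 s) (F2 s) * bsum (F1 t) (F2 t)"
          using F1c F2c st by (simp add: bsum_mult[of _ a a _ b b _ a _ b])
        also have "\<dots> = adj u * (F s * F t) * u"
          unfolding Feq[OF st(1), symmetric] Feq[OF st(2), symmetric] using uc u Fc st
          by (simp add: assoc_mult_mat[of _ p p _ p _ p] U_left_cancel[of u p _ p])
        finally show ?thesis .
      qed
      show ?thesis unfolding *[OF st] *[OF st(2,1)] comm[OF st] ..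
    qed
    have c1: "F1 s * F1 t = F1 t * F1 s" and c2: "F2 s * F2 t = F2 t * F2 s" if st: "s \<in> S" "t \<in> S" for s t
      using bsum_inject[OF _ _ _ _ eq[OF st], of a a b b] F1c F2c st by simp_all
    obtain w1 where w1: "w1 \<in> U a" and D1: "\<And>t. t \<in> S \<Longrightarrow> \<exists>d. adj w1 * F1 t * w1 = diagm a d"
      using less.IH[of a F1] ab F1U c1 by auto
    obtain w2 where w2: "w2 \<in> U b" and D2: "\<And>t. t \<in> S \<Longrightarrow> \<exists>d. adj w2 * F2 t * w2 = diagm b d"
      using less.IH[of b F2] ab F2U c2 by auto
    define W where "W = bsum w1 w2"
    have W: "W \<in> U p" using bsum_U[OF w1 w2] ab by (simp add: W_def)
    have "\<exists>d. adj (u * W) * F t * (u * W) = diagm p d" if t: "t \<in> S" for t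
    proof -
      obtain d1 d2 where d: "adj w1 * F1 t * w1 = diagm a d1" "adj w2 * F2 t * w2 = diagm b d2"
        using D1[OF t] D2[OF t] by blast
      have "adj (u * W) * F t * (u * W) = adj W * (adj u * F t * u) * W"
        using uc U_carrier[OF W] Fc[OF t] by (simp add: mat_adjoint_mult[of _ p p _ p] assoc_mult_mat[of _ p p _ p _ p])
      also have "\<dots> = bsum (adj w1 * F1 t * w1) (adj w2 * F2 t * w2)"
        unfolding Feq[OF t] W_def using F1c[OF t] F2c[OF t] w1[THEN U_carrier] w2[THEN U_carrier]
        by (simp add: bsum_adj bsum_mult[of _ a a _ b b _ a _ b])
      also have "\<dots> = diagm p (\<lambda>i. if i < a then d1 i else d2 (i - a))"
        unfolding d bsum_diagm ab(3) ..
      finally show ?thesis by blast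
    qed
    moreover have "u * W \<in> U p" using u W by simp
    ultimately show ?thesis by blast
  qed
qed

text \<open>Near 0 the values of \<open>f\<close> lie in the right half plane, where square roots
  are unique. Repeated halving therefore determines \<open>f\<close> at all dyadic multiples of a
  small \<open>e\<close>, continuity extends the formula to all reals, and the period forces an
  integral exponent.\<close>

lemma circle_character:
  fixes f :: "real \<Rightarrow> complex"
  assumes cont: "continuous_on UNIV f" and mult: "\<And>s t. f (s + t) = f s * f t"
    and unit: "\<And>s. cmod (f s) = 1" and per: "f (2 * pi) = 1"
  shows "\<exists>k :: int. \<forall>s. f s = cis (of_int k * s)"
proof -
  have f0: "f 0 = 1"
    using mult[of 0 0] unit[of 0] by auto
  have pw: "f (real m * s) = f s ^ m" for m s
    by (induction m) (auto simp: f0 mult algebra_simps)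
  obtain d where d: "d > 0" and D: "\<And>s. dist s 0 < d \<Longrightarrow> dist (f s) (f 0) < 1"
    using cont[unfolded continuous_on_iff, rule_format, of 0 1] by auto
  have re: "Re (f s) > 0" if "\<bar>s\<bar> < d" for s
    using D[of s] that f0 abs_Re_le_cmod[of "f s - 1"] by (auto simp: dist_norm)
  define e where "e = d / 2"
  have e: "0 < e" "e < d" using d by (auto simp: e_def)
  \<comment> \<open>As \<open>f e\<close> has positive real part and modulus 1, the arcsine of its
    imaginary part is its argument.\<close>
  define \<theta> where "\<theta> = arcsin (Im (f e))"
  have rim: "(Re (f s))\<^sup>2 + (Im (f s))\<^sup>2 = 1" for s
    using unit[of s] by (metis cmod_power2 one_power2)
  have im: "\<bar>Im (f e)\<bar> \<le> 1" using abs_Im_le_cmod[of "f e"] unit by simp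
  have th: "f e = cis \<theta>"
  proof (rule complex_eqI)
    show "Im (f e) = Im (cis \<theta>)" using im by (simp add: \<theta>_def arcsin)
    have "cos \<theta> = sqrt (1 - (Im (f e))\<^sup>2)" using im by (simp add: \<theta>_def cos_arcsin abs_le_iff)
    also have "1 - (Im (f e))\<^sup>2 = (Re (f e))\<^sup>2" using rim[of e] by simp
    also have "sqrt \<dots> = Re (f e)" using re[of e] e by simp
    finally show "Re (f e) = Re (cis \<theta>)" by simp
  qed
  have thb: "\<bar>\<theta>\<bar> \<le> pi / 2" using im arcsin_bounded[of "Im (f e)"] by (auto simp: \<theta>_def abs_le_iff)
  have dy: "f (e / 2 ^ k) = cis (\<theta> / 2 ^ k)" for k
  proof (induction k)
    case 0
    then show ?case using th by simp
  next
    case (Suc k)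
    let ?x = "f (e / 2 ^ Suc k)" and ?y = "cis (\<theta> / 2 ^ Suc k)"
    have "?x * ?x = f (e / 2 ^ k)" by (simp flip: mult)
    moreover have "?y * ?y = cis (\<theta> / 2 ^ k)" by (simp add: cis_mult)
    ultimately have "(?x - ?y) * (?x + ?y) = 0" using Suc by (simp add: algebra_simps)
    moreover have "?x + ?y \<noteq> 0"
    proof -
      have "(1::real) \<le> 2 ^ Suc k" by (rule one_le_power) simp
      then have "e / 2 ^ Suc k \<le> e / 1" using e by (intro divide_left_mono) auto
      moreover have "e / 2 ^ Suc k > 0" using e by (intro divide_pos_pos) auto
      ultimately have "Re ?x > 0" using e by (intro re) auto
      have "(1::real) < 2 ^ Suc k" by (rule one_less_power) auto
      then have "(pi / 2) * 1 < (pi / 2) * 2 ^ Suc k" using pi_gt_zero by (intro mult_strict_left_mono) auto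
      then have "\<bar>\<theta>\<bar> < (pi / 2) * 2 ^ Suc k" using thb by linarith
      then have "\<bar>\<theta> / 2 ^ Suc k\<bar> < pi / 2" by (simp add: abs_divide divide_less_eq del: power_Suc)
      then have "0 < cos (\<theta> / 2 ^ Suc k)" by (intro cos_gt_zero_pi) linarith+
      then have "Re ?y > 0" by (simp del: power_Suc)
      with \<open>Re ?x > 0\<close> have "Re (?x + ?y) > 0" by simp
      then show ?thesis by (metis less_irrefl zero_complex.sel(1))
    qed
    ultimately show ?case by simp
  qed
  define c where "c = \<theta> / e"
  have nat: "f (real m * (e / 2 ^ k)) = cis (c * (real m * (e / 2 ^ k)))" for m k
  proof -
    have "f (real m * (e / 2 ^ k)) = cis (\<theta> / 2 ^ k) ^ m" by (simp only: pw dy)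
    also have "\<dots> = cis (real m * (\<theta> / 2 ^ k))" by (rule DeMoivre)
    also have "real m * (\<theta> / 2 ^ k) = c * (real m * (e / 2 ^ k))" using e by (simp add: c_def)
    finally show ?thesis .
  qed
  have neg: "f (- s) = cnj (f s)" for s
  proof -
    have "f s * f (-s) = 1" using mult[of s "-s"] f0 by simp
    moreover have "f s * cnj (f s) = 1" using unit[of s] complex_norm_square[of "f s"] by simp
    ultimately show ?thesis by (metis mult_left_cancel unit norm_zero zero_neq_one)
  qed
  have pos: "f s = cis (c * s)" if s: "s \<ge> 0" for s
  proof -
    \<comment> \<open>Approximation of \<open>s\<close> from below by multiples of
      \<open>e / 2 ^ k\<close>.\<close>
    define x where "x k = real (nat \<lfloor>s * 2 ^ k / e\<rfloor>) * (e / 2 ^ k)" for k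
    have bnd: "x k \<le> s \<and> s - e / 2 ^ k \<le> x k" for k
    proof -
      have nn: "0 \<le> s * 2 ^ k / e" using s e by simp
      then have r: "real (nat \<lfloor>s * 2 ^ k / e\<rfloor>) = of_int \<lfloor>s * 2 ^ k / e\<rfloor>" by simp
      have pos: "0 \<le> e / 2 ^ k" using e by (intro divide_nonneg_nonneg) auto
      have seq: "s * 2 ^ k / e * (e / 2 ^ k) = s" using e by simp
      have "of_int \<lfloor>s * 2 ^ k / e\<rfloor> * (e / 2 ^ k) \<le> s * 2 ^ k / e * (e / 2 ^ k)"
        using pos by (intro mult_right_mono) auto
      moreover have "(s * 2 ^ k / e - 1) * (e / 2 ^ k) \<le> of_int \<lfloor>s * 2 ^ k / e\<rfloor> * (e / 2 ^ k)"
        using pos by (intro mult_right_mono) linarith+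
      ultimately show ?thesis unfolding x_def r seq left_diff_distrib by simp
    qed
    have "(\<lambda>k. e / 2 ^ k) \<longlonglongrightarrow> 0"
      using tendsto_mult[OF tendsto_const[of e] LIMSEQ_power_zero[of "1/2 :: real"]] by (simp add: power_divide)
    then have "(\<lambda>k. s - e / 2 ^ k) \<longlonglongrightarrow> s - 0" by (intro tendsto_intros)
    then have lim: "x \<longlonglongrightarrow> s"
      by (intro tendsto_sandwich[of "\<lambda>k. s - e / 2 ^ k" x _ "\<lambda>_. s"]) (use bnd in auto)
    have "(\<lambda>k. f (x k)) \<longlonglongrightarrow> f s"
      using continuous_on_tendsto_compose[OF cont lim] by simp
    moreover have "(\<lambda>k. cis (c * x k)) \<longlonglongrightarrow> cis (c * s)"
      by (intro tendsto_intros lim)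
    moreover have "f (x k) = cis (c * x k)" for k unfolding x_def by (rule nat)
    ultimately show ?thesis using LIMSEQ_unique by simp
  qed
  have all: "f s = cis (c * s)" for s
    using pos[of s] pos[of "-s"] neg[of "-s"] by (cases "s \<ge> 0") (auto simp: cis_cnj)
  have "cis (c * (2 * pi)) = 1" using all per by metis
  then have "cos (c * (2 * pi)) = 1" by (metis cis.sel(1) one_complex.sel(1))
  then obtain k :: int where "c * (2 * pi) = of_int k * 2 * pi" using cos_one_2pi_int by blast
  then have "c = of_int k" by simp
  then show ?thesis using all by blast
qed

lemma hom_one_adj:
  assumes U: "\<And>g. g \<in> U n \<Longrightarrow> \<rho> g \<in> U p"
    and m: "\<And>g h. g \<in> U n \<Longrightarrow> h \<in> U n \<Longrightarrow> \<rho> (g * h) = \<rho> g * \<rho> h"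
  shows "\<rho> (1\<^sub>m n) = 1\<^sub>m p" "g \<in> U n \<Longrightarrow> \<rho> (adj g) = adj (\<rho> g)"
proof -
  have "\<rho> (1\<^sub>m n) = \<rho> (1\<^sub>m n) * \<rho> (1\<^sub>m n)" using m[of "1\<^sub>m n" "1\<^sub>m n"] by simp
  then have "adj (\<rho> (1\<^sub>m n)) * \<rho> (1\<^sub>m n) = adj (\<rho> (1\<^sub>m n)) * (\<rho> (1\<^sub>m n) * \<rho> (1\<^sub>m n))" by simp
  then show 1: "\<rho> (1\<^sub>m n) = 1\<^sub>m p" using U[of "1\<^sub>m n"] by (simp add: U_left U_left_cancel[of _ p _ p])
  assume g: "g \<in> U n"
  have "\<rho> (adj g) * \<rho> g = 1\<^sub>m p" using m[of "adj g" g] g 1 by (simp add: U_left)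
  then have "\<rho> (adj g) * \<rho> g * adj (\<rho> g) = adj (\<rho> g)" using U[OF g] by (simp add: left_mult_one_mat[of _ p p])
  then show "\<rho> (adj g) = adj (\<rho> g)" using U[OF g] U[of "adj g"] g by (simp add: U_right_cancel[of _ p _ p])
qed

text \<open>The commuting images of the diagonal torus are diagonalized together. Each diagonal
  entry, restricted to a coordinate circle, is a continuous character and hence a power;
  multiplicativity assembles the coordinates.\<close>

lemma exists_weights:
  assumes rep: "unitary_rep n p \<rho>"
  shows "\<exists>w\<in>U p. \<exists>\<mu> :: nat \<Rightarrow> nat \<Rightarrow> int. \<forall>t. (\<forall>j<n. cmod (t j) = 1) \<longrightarrow>
    adj w * \<rho> (diagm n t) * w = diagm p (\<lambda>a. \<Prod>j<n. t j powi \<mu> a j)"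
proof -
  have U: "\<rho> g \<in> U p" if "g \<in> U n" for g using rep that by (simp add: unitary_rep_def)
  have m: "\<rho> (g * h) = \<rho> g * \<rho> h" if "g \<in> U n" "h \<in> U n" for g h
    using rep that by (simp add: unitary_rep_def)
  let ?S = "{t. \<forall>j<n. cmod (t j) = 1}"
  have "\<exists>w\<in>U p. \<forall>t\<in>?S. \<exists>d. adj w * \<rho> (diagm n t) * w = diagm p d"
  proof (rule commuting_unitaries_diagonalize)
    fix t assume t: "t \<in> ?S"
    show "\<rho> (diagm n t) \<in> U p" using t by (intro U diagm_U) auto
    fix s assume s: "s \<in> ?S"
    have "\<rho> (diagm n s) * \<rho> (diagm n t) = \<rho> (diagm n s * diagm n t)" using s t by (subst m) (auto intro: diagm_U)
    also have "diagm n s * diagm n t = diagm n t * diagm n s" by (simp add: diagm_mult mult.commute)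
    also have "\<rho> \<dots> = \<rho> (diagm n t) * \<rho> (diagm n s)" using s t by (subst m) (auto intro: diagm_U)
    finally show "\<rho> (diagm n s) * \<rho> (diagm n t) = \<rho> (diagm n t) * \<rho> (diagm n s)" .
  qed
  then obtain w where w: "w \<in> U p" and W: "\<And>t. t \<in> ?S \<Longrightarrow> \<exists>d. adj w * \<rho> (diagm n t) * w = diagm p d"
    by blast
  note wc = U_carrier[OF w]
  define D where "D t a = (adj w * \<rho> (diagm n t) * w) $$ (a, a)" for t a
  have D: "adj w * \<rho> (diagm n t) * w = diagm p (D t)" if t: "t \<in> ?S" for t
  proof -
    obtain d where "adj w * \<rho> (diagm n t) * w = diagm p d" using W[OF t] by blast
    then show ?thesis by (auto simp: D_def intro!: diagm_cong)
  qed
  have DU: "cmod (D t a) = 1" if "t \<in> ?S" "a < p" for t a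
  proof -
    have "adj w * \<rho> (diagm n t) * w \<in> U p" using w U[of "diagm n t"] that diagm_U[of n t] by simp
    then show ?thesis using diagm_U_D D[OF that(1)] that(2) by metis
  qed
  have Dm: "D (\<lambda>j. s j * t j) a = D s a * D t a" if s: "s \<in> ?S" and t: "t \<in> ?S" and a: "a < p" for s t a
  proof -
    have st: "(\<lambda>j. s j * t j) \<in> ?S" using s t by (auto simp: norm_mult)
    note c = U_carrier[OF U[OF diagm_U[of n s]]] U_carrier[OF U[OF diagm_U[of n t]]]
    have "diagm p (D (\<lambda>j. s j * t j)) = adj w * (\<rho> (diagm n s) * \<rho> (diagm n t)) * w"
      using s t D[OF st] m[OF diagm_U[of n s] diagm_U[of n t]] by (simp add: diagm_mult)
    also have "\<dots> = (adj w * \<rho> (diagm n s) * w) * (adj w * \<rho> (diagm n t) * w)"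
      using wc w c s t by (simp add: assoc_mult_mat[of _ p p _ p _ p] U_left_cancel[of w p _ p])
    also have "\<dots> = diagm p (\<lambda>a. D s a * D t a)" unfolding D[OF s] D[OF t] diagm_mult ..
    finally have "diagm p (D (\<lambda>j. s j * t j)) $$ (a, a) = diagm p (\<lambda>a. D s a * D t a) $$ (a, a)" by simp
    then show ?thesis using a by simp
  qed
  define z where "z j s = (\<lambda>i. if i = j then cis s else 1)" for j :: nat and s :: real
  have zS: "z j s \<in> ?S" for j s by (auto simp: z_def)
  have "\<exists>k :: int. \<forall>s. D (z j s) a = cis (of_int k * s)" if j: "j < n" and a: "a < p" for j a
  proof (rule circle_character)
    have "D (z j s) a = (\<Sum>k<p. \<Sum>r<p. adj w $$ (a, k) * \<rho> (circ n j s) $$ (k, r) * w $$ (r, a))" for s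
      unfolding D_def z_def circ_def[symmetric] using wc U[OF circ_U] a by (intro mult_index3[of _ p p _ p _ p]) auto
    moreover have "continuous_on UNIV (\<lambda>s. \<Sum>k<p. \<Sum>r<p. adj w $$ (a, k) * \<rho> (circ n j s) $$ (k, r) * w $$ (r, a))"
      using rep j by (intro continuous_intros) (auto simp: unitary_rep_def)
    ultimately show "continuous_on UNIV (\<lambda>s. D (z j s) a)" by simp
    show "cmod (D (z j s) a) = 1" for s by (rule DU[OF zS a])
    show "D (z j (s + t)) a = D (z j s) a * D (z j t) a" for s t
    proof -
      have "z j (s + t) = (\<lambda>i. z j s i * z j t i)" by (auto simp: z_def cis_mult)
      then show ?thesis using Dm[OF zS zS a] by simp
    qed
    have "diagm n (z j (2 * pi)) = 1\<^sub>m n" by (subst diagm_one[symmetric], rule diagm_cong) (simp add: z_def cis_2pi)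
    then have "D (z j (2 * pi)) a = (1\<^sub>m p :: complex mat) $$ (a, a)"
      unfolding D_def using hom_one_adj(1)[of n \<rho> p, OF U m] w wc by (simp add: right_mult_one_mat[of _ p p] U_left del: index_mult_mat)
    then show "D (z j (2 * pi)) a = 1" using a by simp
  qed
  then have ex: "\<exists>k :: int. \<forall>s. D (z j s) a = cis (of_int k * s)" if "j < n" "a < p" for j a
    using that by blast
  define \<mu> :: "nat \<Rightarrow> nat \<Rightarrow> int" where "\<mu> a j = (SOME k. \<forall>s. D (z j s) a = cis (of_int k * s))" for a j
  have mu: "D (z j s) a = cis (of_int (\<mu> a j) * s)" if "j < n" "a < p" for j a s
    using someI_ex[OF ex[OF that]] unfolding \<mu>_def by blast
  \<comment> \<open>Torus elements are built up one coordinate at a time, the remaining coordinates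
    staying at 1.\<close>
  have part: "D (\<lambda>j. if j < l then t j else 1) a = (\<Prod>j<l. t j powi \<mu> a j)" if t: "t \<in> ?S" and a: "a < p" and l: "l \<le> n" for t a l
    using l
  proof (induction l)
    case 0
    have "diagm n (\<lambda>j. if j < 0 then t j else 1) = 1\<^sub>m n" by (subst diagm_one[symmetric], rule diagm_cong) simp
    then have "D (\<lambda>j. if j < 0 then t j else 1) a = (1\<^sub>m p :: complex mat) $$ (a, a)"
      unfolding D_def using hom_one_adj(1)[of n \<rho> p, OF U m] w wc by (simp add: right_mult_one_mat[of _ p p] U_left del: index_mult_mat)
    then show ?case using a by simp
  next
    case (Suc l)
    define s where "s = Arg (t l)"
    have "cmod (t l) = 1" using t Suc by auto
    then have s: "t l = cis s" unfolding s_def by (metis cis_Arg norm_zero zero_neq_one sgn_div_norm div_by_1 scaleR_one inverse_1 sgn_eq divide_inverse of_real_1)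
    have "(\<lambda>j. if j < Suc l then t j else 1) = (\<lambda>j. (if j < l then t j else 1) * z l s j)"
      using s by (auto simp: z_def)
    moreover have "(\<lambda>j. if j < l then t j else 1) \<in> ?S" using t by auto
    ultimately have "D (\<lambda>j. if j < Suc l then t j else 1) a = D (\<lambda>j. if j < l then t j else 1) a * D (z l s) a"
      using Dm[OF _ zS a] by simp
    also have "D (z l s) a = t l powi \<mu> a l"
      using mu[of l a s] Suc a s by (simp add: cis_power_int)
    finally show ?case using Suc by simp
  qed
  have "adj w * \<rho> (diagm n t) * w = diagm p (\<lambda>a. \<Prod>j<n. t j powi \<mu> a j)" if t: "t \<in> ?S" for t
  proof -
    have "D t a = (\<Prod>j<n. t j powi \<mu> a j)" if a: "a < p" for a
    proof -
      have "diagm n t = diagm n (\<lambda>j. if j < n then t j else 1)" by (rule diagm_cong) simp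
      then have "D t a = D (\<lambda>j. if j < n then t j else 1) a" by (simp add: D_def)
      then show ?thesis using part[OF t a, of n] by simp
    qed
    then show ?thesis unfolding D[OF t] by (intro diagm_cong)
  qed
  then show ?thesis using w by blast
qed

subsection \<open>Entrywise derivatives\<close>

text \<open>Derivatives at 0 are enough, since the curves considered start at the identity; taking
  them entrywise reduces the product rule to that for complex functions.\<close>

definition mderiv :: "nat \<Rightarrow> (real \<Rightarrow> complex mat) \<Rightarrow> complex mat \<Rightarrow> bool" where
  "mderiv p A D \<longleftrightarrow> (\<forall>a<p. \<forall>b<p. ((\<lambda>s. A s $$ (a, b)) has_vector_derivative D $$ (a, b)) (at 0))"

lemma mderivD: "mderiv p A D \<Longrightarrow> a < p \<Longrightarrow> b < p \<Longrightarrow> ((\<lambda>s. A s $$ (a, b)) has_vector_derivative D $$ (a, b)) (at 0)"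
  by (simp add: mderiv_def)

lemma mderiv_unique:
  assumes "mderiv p A D" "mderiv p A E" "D \<in> carrier_mat p p" "E \<in> carrier_mat p p"
  shows "D = E"
proof (rule eq_matI)
  fix a b assume "a < dim_row E" "b < dim_col E"
  then have "((\<lambda>s. A s $$ (a, b)) has_vector_derivative D $$ (a, b)) (at 0)"
    "((\<lambda>s. A s $$ (a, b)) has_vector_derivative E $$ (a, b)) (at 0)"
    using assms by (auto simp: mderiv_def)
  then have "(\<lambda>x. x *\<^sub>R D $$ (a, b)) = (\<lambda>x. x *\<^sub>R E $$ (a, b))"
    unfolding has_vector_derivative_def by (rule has_derivative_unique)
  from fun_cong[OF this, of 1] show "D $$ (a, b) = E $$ (a, b)" by simp
qed (use assms in auto)

lemma mderiv_const: "mderiv p (\<lambda>_. A) (0\<^sub>m p p)"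
  by (simp add: mderiv_def)

lemma mderiv_mult:
  assumes A: "\<And>s. A s \<in> carrier_mat p p" and B: "\<And>s. B s \<in> carrier_mat p p"
    and D: "D \<in> carrier_mat p p" and E: "E \<in> carrier_mat p p"
    and "mderiv p A D" "mderiv p B E"
  shows "mderiv p (\<lambda>s. A s * B s) (D * B 0 + A 0 * E)"
  unfolding mderiv_def
proof (intro allI impI)
  fix a b assume ab: "a < p" "b < p"
  have "((\<lambda>s. \<Sum>k<p. A s $$ (a, k) * B s $$ (k, b)) has_vector_derivative
      (\<Sum>k<p. A 0 $$ (a, k) * E $$ (k, b) + D $$ (a, k) * B 0 $$ (k, b))) (at 0)"
    using assms(5,6) ab by (intro has_vector_derivative_sum has_vector_derivative_mult) (auto simp: mderiv_def)
  also have "(\<Sum>k<p. A 0 $$ (a, k) * E $$ (k, b) + D $$ (a, k) * B 0 $$ (k, b)) = (D * B 0 + A 0 * E) $$ (a, b)"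
  proof -
    have "(D * B 0 + A 0 * E) $$ (a, b) = (D * B 0) $$ (a, b) + (A 0 * E) $$ (a, b)"
      using ab A[of 0] B[of 0] D E by (intro index_add_mat) auto
    then show ?thesis
      unfolding mult_index[OF D B ab] mult_index[OF A E ab] by (simp add: sum.distrib add.commute)
  qed
  finally show "((\<lambda>s. (A s * B s) $$ (a, b)) has_vector_derivative (D * B 0 + A 0 * E) $$ (a, b)) (at 0)"
    unfolding mult_index[OF A B ab] .
qed

lemma mderiv_mult_left:
  assumes A: "A \<in> carrier_mat p p" and B: "\<And>s. B s \<in> carrier_mat p p" and E: "E \<in> carrier_mat p p" "mderiv p B E"
  shows "mderiv p (\<lambda>s. A * B s) (A * E)"
proof -
  have "0\<^sub>m p p * B 0 + A * E = A * E" using A B[of 0] E by simp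
  then show ?thesis using mderiv_mult[OF _ B _ E(1) mderiv_const E(2), of A] A by simp
qed

lemma mderiv_mult_right:
  assumes A: "A \<in> carrier_mat p p" and B: "\<And>s. B s \<in> carrier_mat p p" and E: "E \<in> carrier_mat p p" "mderiv p B E"
  shows "mderiv p (\<lambda>s. B s * A) (E * A)"
proof -
  have "E * A + B 0 * 0\<^sub>m p p = E * A" using A B[of 0] E by simp
  then show ?thesis using mderiv_mult[OF B _ E(1) _ E(2) mderiv_const, of A] A by simp
qed

lemma mderiv_adj:
  assumes A: "\<And>s. A s \<in> carrier_mat p p" and D: "D \<in> carrier_mat p p" "mderiv p A D"
  shows "mderiv p (\<lambda>s. adj (A s)) (adj D)"
  unfolding mderiv_def
proof (intro allI impI)
  fix a b assume ab: "a < p" "b < p"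
  have "((\<lambda>s. cnj (A s $$ (b, a))) has_vector_derivative cnj (D $$ (b, a))) (at 0)"
    using D(2) ab by (intro has_vector_derivative_cnj) (auto simp: mderiv_def)
  then show "((\<lambda>s. adj (A s) $$ (a, b)) has_vector_derivative adj D $$ (a, b)) (at 0)"
    using ab carrier_matD[OF A] carrier_matD[OF D(1)] by simp
qed

lemma mderiv_diagm_cis: "mderiv p (\<lambda>s. diagm p (\<lambda>b. cis (s * c b))) (\<i> \<cdot>\<^sub>m diagm p (\<lambda>b. complex_of_real (c b)))"
  unfolding mderiv_def
proof (intro allI impI)
  fix a b assume ab: "a < p" "b < p"
  have "((\<lambda>s. cis (s * c a)) has_vector_derivative \<i> * complex_of_real (c a)) (at 0)"
  proof -
    have "((\<lambda>s :: real. \<i> * complex_of_real (s * c a)) has_derivative (\<lambda>s. \<i> * complex_of_real (s * c a))) (at 0)"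
      by (intro bounded_linear_imp_has_derivative bounded_linear_mult_right[THEN bounded_linear_compose]
          bounded_linear_of_real[THEN bounded_linear_compose] bounded_linear_mult_left)
    moreover have "(exp has_derivative (\<lambda>x. x)) (at (\<i> * complex_of_real (0 * c a)))"
      using DERIV_exp[of "0 :: complex"] by (simp add: has_field_derivative_def lambda_one)
    ultimately have "((\<lambda>s :: real. exp (\<i> * complex_of_real (s * c a))) has_derivative (\<lambda>s. \<i> * complex_of_real (s * c a))) (at 0)"
      by (rule has_derivative_compose)
    then show ?thesis
      by (simp add: cis_conv_exp has_vector_derivative_def scaleR_conv_of_real mult_ac)
  qed
  then show "((\<lambda>s. diagm p (\<lambda>b. cis (s * c b)) $$ (a, b)) has_vector_derivative
      (\<i> \<cdot>\<^sub>m diagm p (\<lambda>b. complex_of_real (c b))) $$ (a, b)) (at 0)"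
    using ab by (cases "a = b") auto
qed

lemma vector_derivative_zero_squeeze:
  fixes f :: "real \<Rightarrow> complex" and h :: "real \<Rightarrow> real"
  assumes "f 0 = 0" and "\<And>s. cmod (f s) \<le> h s" and "((\<lambda>s. h s / \<bar>s\<bar>) \<longlongrightarrow> 0) (at 0)"
  shows "(f has_vector_derivative 0) (at 0)"
  unfolding has_vector_derivative_def has_derivative_iff_norm
proof (intro conjI)
  show "((\<lambda>y. norm (f y - f 0 - (y - 0) *\<^sub>R 0) / norm (y - 0)) \<longlongrightarrow> 0) (at 0)"
  proof (rule tendsto_sandwich[OF _ _ tendsto_const assms(3)])
    show "\<forall>\<^sub>F s in at 0. norm (f s - f 0 - (s - 0) *\<^sub>R 0) / norm (s - 0) \<le> h s / \<bar>s\<bar>"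
      using assms(1,2) by (intro always_eventually allI) (auto simp: divide_right_mono)
  qed (intro always_eventually allI, simp)
qed simp

lemma mderiv_fr_tendsto:
  assumes A: "\<And>s. A s \<in> carrier_mat p p" and D: "mderiv p A (0\<^sub>m p p)" and A0: "A 0 = 0\<^sub>m p p"
  shows "((\<lambda>s. fr (A s) / \<bar>s\<bar>) \<longlongrightarrow> 0) (at 0)"
proof -
  have e: "((\<lambda>s. cmod (A s $$ (a, b)) / \<bar>s\<bar>) \<longlongrightarrow> 0) (at 0)" if ab: "a < p" "b < p" for a b
    using mderivD[OF D ab] ab A0 unfolding has_vector_derivative_def has_derivative_iff_norm by simp
  have lim: "((\<lambda>s. sqrt (\<Sum>a<p. \<Sum>b<p. (cmod (A s $$ (a, b)) / \<bar>s\<bar>)\<^sup>2)) \<longlongrightarrow> sqrt (\<Sum>a<p. \<Sum>b<p. 0\<^sup>2)) (at 0)"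
    by (intro tendsto_intros e) auto
  have "fr (A s) / \<bar>s\<bar> = sqrt (\<Sum>a<p. \<Sum>b<p. (cmod (A s $$ (a, b)) / \<bar>s\<bar>)\<^sup>2)" for s
    by (simp add: fr_def fr2_carrier[OF A] power_divide flip: sum_divide_distrib) (simp add: real_sqrt_divide)
  then show ?thesis using lim by simp
qed

lemma hermitian_spectral:
  assumes "X \<in> carrier_mat n n" "adj X = X"
  shows "\<exists>u a. u \<in> U n \<and> X = u * diagm n (\<lambda>i. complex_of_real (a i)) * adj u"
proof -
  obtain u d where u: "u \<in> U n" and d: "adj u * X * u = diagm n (\<lambda>i. complex_of_real (d i))"
    using hermitian_diagonalize[OF assms] by blast
  have "X = u * (adj u * X * u) * adj u"
    using assms(1) u U_carrier[OF u]
    by (simp add: assoc_mult_mat[of _ n n _ n _ n] U_left_cancel[of u n _ n] U_right right_mult_one_mat[of _ n n])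
  then show ?thesis unfolding d using u by blast
qed

lemma unitary_spectral:
  assumes g: "g \<in> U n"
  shows "\<exists>u t. u \<in> U n \<and> (\<forall>j<n. cmod (t j) = 1) \<and> g = u * diagm n t * adj u"
proof -
  obtain u d where u: "u \<in> U n" and d: "adj u * g * u = diagm n d"
    using commuting_unitaries_diagonalize[of "{()}" "\<lambda>_. g" n] g by auto
  have "g = u * (adj u * g * u) * adj u"
    using U_carrier[OF g] u U_carrier[OF u]
    by (simp add: assoc_mult_mat[of _ n n _ n _ n] U_left_cancel[of u n _ n] U_right right_mult_one_mat[of _ n n])
  moreover have "adj u * g * u \<in> U n" using u g by simp
  then have "\<forall>j<n. cmod (d j) = 1" unfolding d using diagm_U_D by blast
  ultimately show ?thesis unfolding d using u by blast
qed

subsection \<open>Representations in a weight basis\<close>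

text \<open>The character of the diagonal torus with exponent vector \<open>d\<close>. Only
  coordinates below \<open>n\<close> enter, so weights are compared there and not as
  functions.\<close>

definition chi :: "nat \<Rightarrow> (nat \<Rightarrow> complex) \<Rightarrow> (nat \<Rightarrow> int) \<Rightarrow> complex" where
  "chi n t d = (\<Prod>j<n. t j powi d j)"

lemma norm_chi: "(\<And>j. j < n \<Longrightarrow> cmod (t j) = 1) \<Longrightarrow> cmod (chi n t d) = 1"
  by (simp add: chi_def norm_power_int flip: prod_norm)

lemma chi_add: 
  assumes "\<And>j. j < n \<Longrightarrow> cmod (t j) = 1" shows "chi n t (\<lambda>j. d j + e j) = chi n t d * chi n t e"
proof -
  have "t j \<noteq> 0" if "j < n" for j using assms[OF that] by auto
  then show ?thesis unfolding chi_def prod.distrib[symmetric] by (intro prod.cong refl power_int_add) auto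
qed

lemma cnj_powi:
  assumes "cmod z = 1" shows "cnj (z powi d) = z powi (- d)"
proof -
  have "z * cnj z = 1" using complex_norm_square[of z] assms by simp
  then have "inverse z = cnj z" by (rule inverse_unique)
  then show ?thesis by (simp add: power_int_minus flip: power_int_inverse)
qed

lemma cnj_chi: "(\<And>j. j < n \<Longrightarrow> cmod (t j) = 1) \<Longrightarrow> cnj (chi n t d) = chi n t (\<lambda>j. - d j)"
  by (simp add: chi_def cnj_powi del: complex_cnj_power_int)

lemma chi_diff: 
  assumes "\<And>j. j < n \<Longrightarrow> cmod (t j) = 1" shows "chi n t (\<lambda>j. d j - e j) = chi n t d * cnj (chi n t e)"
  using chi_add[OF assms, where d = d and e = "\<lambda>j. - e j"] cnj_chi[OF assms] by simp

lemma chi_cis: "chi n (\<lambda>j. cis (s * a j)) d = cis (s * (\<Sum>j<n. of_int (d j) * a j))"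
proof -
  have "(\<Prod>j<n. cis (f j)) = cis (\<Sum>j<n. f j)" for f by (induction n) (auto simp: cis_mult)
  then show ?thesis by (simp add: chi_def cis_power_int sum_distrib_left mult_ac)
qed

lemma chi_separates:
  assumes "\<And>t. (\<And>j. j < n \<Longrightarrow> cmod (t j) = 1) \<Longrightarrow> chi n t d = chi n t e" and j: "j < n"
  shows "d j = e j"
proof (rule ccontr)
  assume ne: "d j \<noteq> e j"
  \<comment> \<open>With this angle in coordinate \<open>j\<close> the two characters differ by the
    factor cis pi = -1.\<close>
  define th where "th = pi / of_int (d j - e j)"
  define t where "t i = (if i = j then cis th else 1)" for i
  have t: "cmod (t i) = 1" for i by (simp add: t_def)
  have "chi n t (\<lambda>i. d i - e i) = 1" using assms(1)[of t] t norm_chi[of n t e]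
    by (simp add: chi_diff complex_norm_square[symmetric])
  moreover have "chi n t (\<lambda>i. d i - e i) = (\<Prod>i\<in>{j}. cis th powi (d i - e i))"
    unfolding chi_def t_def using j by (intro prod.mono_neutral_cong_right) auto
  ultimately have "cis (of_int (d j - e j) * th) = 1" by (simp add: cis_power_int)
  moreover have "of_int (d j - e j) * th = pi" using ne by (simp add: th_def)
  ultimately show False by simp
qed

lemma norm_powi_minus_one:
  assumes "cmod z = 1" shows "cmod (z powi k - 1) \<le> of_int \<bar>k\<bar> * cmod (z - 1)"
proof -
  have nat: "cmod (z ^ m - 1) \<le> of_nat m * cmod (z - 1)" for m
  proof (induction m)
    case (Suc m)
    have "z ^ Suc m - 1 = z * (z ^ m - 1) + (z - 1)" by (simp add: algebra_simps)
    then have "cmod (z ^ Suc m - 1) \<le> cmod (z * (z ^ m - 1)) + cmod (z - 1)" by (metis norm_triangle_ineq)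
    also have "cmod (z * (z ^ m - 1)) = cmod (z ^ m - 1)" using assms by (simp add: norm_mult)
    finally show ?case using Suc by (simp add: algebra_simps)
  qed simp
  show ?thesis
  proof (cases "k \<ge> 0")
    case True
    then show ?thesis using nat[of "nat k"] by (simp add: power_int_def)
  next
    case False
    then have "cmod (z powi k - 1) = cmod (cnj (z powi (- k) - 1))" using cnj_powi[OF assms, of "- k"] by simp
    also have "\<dots> = cmod (z powi (- k) - 1)" by (rule complex_mod_cnj)
    finally show ?thesis using nat[of "nat (- k)"] False by (simp add: power_int_def)
  qed
qed

lemma norm_prod_minus_one:
  fixes f :: "nat \<Rightarrow> complex"
  assumes "\<And>j. j < n \<Longrightarrow> cmod (f j) = 1"
  shows "cmod ((\<Prod>j<n. f j) - 1) \<le> (\<Sum>j<n. cmod (f j - 1))"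
  using assms
proof (induction n)
  case (Suc n)
  have "(\<Prod>j<Suc n. f j) - 1 = (\<Prod>j<n. f j) * (f n - 1) + ((\<Prod>j<n. f j) - 1)" by (simp add: algebra_simps)
  then have "cmod ((\<Prod>j<Suc n. f j) - 1) \<le> cmod ((\<Prod>j<n. f j) * (f n - 1)) + cmod ((\<Prod>j<n. f j) - 1)"
    by (metis norm_triangle_ineq)
  also have "cmod ((\<Prod>j<n. f j) * (f n - 1)) = cmod (f n - 1)" using Suc.prems by (simp add: norm_mult flip: prod_norm)
  finally show ?case using Suc by simp
qed simp

text \<open>A representation written in a basis of weight vectors: \<open>\<mu> a j\<close> is the
  \<open>j\<close>-th coordinate of the weight of the \<open>a\<close>-th basis vector, so weights
  are listed with multiplicity.\<close>

locale weight_rep =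
  fixes n p :: nat and \<rho> :: "complex mat \<Rightarrow> complex mat" and \<mu> :: "nat \<Rightarrow> nat \<Rightarrow> int"
  assumes rU [simp]: "g \<in> U n \<Longrightarrow> \<rho> g \<in> U p"
    and rmult: "g \<in> U n \<Longrightarrow> h \<in> U n \<Longrightarrow> \<rho> (g * h) = \<rho> g * \<rho> h"
    and rdiag: "(\<And>j. j < n \<Longrightarrow> cmod (t j) = 1) \<Longrightarrow> \<rho> (diagm n t) = diagm p (\<lambda>a. chi n t (\<mu> a))"
begin

lemma rc [simp]: "g \<in> U n \<Longrightarrow> \<rho> g \<in> carrier_mat p p"
  by (rule U_carrier) simp

lemma rone: "\<rho> (1\<^sub>m n) = 1\<^sub>m p"
  by (rule hom_one_adj(1)[OF rU rmult])

lemma radj: "g \<in> U n \<Longrightarrow> \<rho> (adj g) = adj (\<rho> g)"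
  by (rule hom_one_adj(2)[OF rU rmult])

lemma rconj: 
  assumes "u \<in> U n" "\<And>j. j < n \<Longrightarrow> cmod (t j) = 1"
  shows "\<rho> (u * diagm n t * adj u) = \<rho> u * diagm p (\<lambda>a. chi n t (\<mu> a)) * adj (\<rho> u)"
  using assms diagm_U[of n t] by (simp add: rmult radj rdiag)

lemma fr_minus_one_conj:
  assumes u: "u \<in> U q" and A: "A \<in> carrier_mat q q"
  shows "fr (u * A * adj u - 1\<^sub>m q) = fr (A - 1\<^sub>m q)"
proof -
  have "u * A * adj u - 1\<^sub>m q = u * (A - 1\<^sub>m q) * adj u"
    using u A U_carrier[OF u]
    by (simp add: mult_minus_right[of _ q q _ q] mult_minus_left[of _ q q _ _ q] U_right right_mult_one_mat[of _ q q])
  then show ?thesis using u A U_carrier[OF u] by (simp add: fr_U_right[of _ q _ q] fr_U_left[of _ q _ q])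
qed

text \<open>Diagonalizing \<open>g\<close> diagonalizes \<open>\<rho> g\<close> through the weights,
  and a character leaves 1 at most as fast as its exponents allow. All differentiability of \<rho>
  rests on this bound.\<close>

lemma lipschitz_one:
  assumes g: "g \<in> U n"
  shows "fr (\<rho> g - 1\<^sub>m p) \<le> (\<Sum>a<p. \<Sum>j<n. of_int \<bar>\<mu> a j\<bar>) * fr (g - 1\<^sub>m n)"
proof -
  obtain u t where u: "u \<in> U n" and t: "\<And>j. j < n \<Longrightarrow> cmod (t j) = 1" and gt: "g = u * diagm n t * adj u"
    using unitary_spectral[OF g] by blast
  have 1: "fr (g - 1\<^sub>m n) = fr (diagm n (\<lambda>j. t j - 1))"
    unfolding gt by (subst fr_minus_one_conj[OF u]) (simp_all add: diagm_minus flip: diagm_one)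
  have rg: "\<rho> g = \<rho> u * diagm p (\<lambda>a. chi n t (\<mu> a)) * adj (\<rho> u)"
    unfolding gt by (rule rconj[OF u t])
  have 2: "fr (\<rho> g - 1\<^sub>m p) = fr (diagm p (\<lambda>a. chi n t (\<mu> a) - 1))"
    unfolding rg by (subst fr_minus_one_conj) (use u in \<open>simp_all add: diagm_minus flip: diagm_one\<close>)
  have tj: "cmod (t j - 1) \<le> fr (g - 1\<^sub>m n)" if "j < n" for j
    using entry_le_fr[of "diagm n (\<lambda>j. t j - 1)" n n j j] that unfolding 1 by simp
  have "fr (\<rho> g - 1\<^sub>m p) = L2_set (\<lambda>a. cmod (chi n t (\<mu> a) - 1)) {..<p}"
    unfolding 2 by (simp add: fr_def fr2_diagm L2_set_def)
  also have "\<dots> \<le> (\<Sum>a<p. cmod (chi n t (\<mu> a) - 1))"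
    by (rule L2_set_le_sum) simp
  also have "\<dots> \<le> (\<Sum>a<p. \<Sum>j<n. of_int \<bar>\<mu> a j\<bar> * fr (g - 1\<^sub>m n))"
  proof (intro sum_mono)
    fix a
    have "cmod (chi n t (\<mu> a) - 1) \<le> (\<Sum>j<n. cmod (t j powi \<mu> a j - 1))"
      unfolding chi_def by (intro norm_prod_minus_one) (simp add: t norm_power_int)
    also have "\<dots> \<le> (\<Sum>j<n. of_int \<bar>\<mu> a j\<bar> * fr (g - 1\<^sub>m n))"
    proof (intro sum_mono)
      fix j assume "j \<in> {..<n}"
      then have j: "j < n" by simp
      have "cmod (t j powi \<mu> a j - 1) \<le> of_int \<bar>\<mu> a j\<bar> * cmod (t j - 1)" by (rule norm_powi_minus_one[OF t[OF j]])
      also have "\<dots> \<le> of_int \<bar>\<mu> a j\<bar> * fr (g - 1\<^sub>m n)" by (intro mult_left_mono tj j) auto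
      finally show "cmod (t j powi \<mu> a j - 1) \<le> of_int \<bar>\<mu> a j\<bar> * fr (g - 1\<^sub>m n)" .
    qed
    finally show "cmod (chi n t (\<mu> a) - 1) \<le> (\<Sum>j<n. of_int \<bar>\<mu> a j\<bar> * fr (g - 1\<^sub>m n))" .
  qed
  finally show ?thesis by (simp add: sum_distrib_right)
qed

text \<open>Right translation by the inverse of \<open>h\<close> is isometric on both sides and
  reduces the claim to the bound at the identity.\<close>

lemma lipschitz:
  assumes g: "g \<in> U n" and h: "h \<in> U n"
  shows "fr (\<rho> g - \<rho> h) \<le> (\<Sum>a<p. \<Sum>j<n. of_int \<bar>\<mu> a j\<bar>) * fr (g - h)"
proof -
  have *: "fr (A - B) = fr (A * adj B - 1\<^sub>m q)" if A: "A \<in> U q" and B: "B \<in> U q" for A B q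
  proof -
    have "A * adj B - 1\<^sub>m q = (A - B) * adj B"
      using A B U_carrier[OF A] U_carrier[OF B] by (simp add: mult_minus_left[of _ q q _ _ q] U_right)
    then show ?thesis using A B by (simp add: fr_U_right[of "adj B" q "A - B" q])
  qed
  have "fr (\<rho> g - \<rho> h) = fr (\<rho> (g * adj h) - 1\<^sub>m p)"
    using g h by (simp add: *[OF rU rU] rmult radj)
  also have "\<dots> \<le> (\<Sum>a<p. \<Sum>j<n. of_int \<bar>\<mu> a j\<bar>) * fr (g * adj h - 1\<^sub>m n)"
    using g h by (intro lipschitz_one) simp
  also have "fr (g * adj h - 1\<^sub>m n) = fr (g - h)" using *[OF g h] by simp
  finally show ?thesis .
qed

end

subsection \<open>The infinitesimal representation\<close>

text \<open>This is exp(\<i> s X) for the Hermitian matrix X with eigenbasis \<open>u\<close> and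
  eigenvalues \<open>a\<close>.\<close>

definition hexp :: "nat \<Rightarrow> complex mat \<Rightarrow> (nat \<Rightarrow> real) \<Rightarrow> real \<Rightarrow> complex mat" where
  "hexp n u a s = u * diagm n (\<lambda>j. cis (s * a j)) * adj u"

lemma hexp_U [simp]: "u \<in> U n \<Longrightarrow> hexp n u a s \<in> U n"
  unfolding hexp_def by (intro U_mult diagm_U U_adj) auto

lemma hexp_0: "u \<in> U n \<Longrightarrow> hexp n u a 0 = 1\<^sub>m n"
  by (simp add: hexp_def diagm_one U_right right_mult_one_mat[of _ n n])

lemma smult_mult_mult:
  fixes A B C :: "complex mat"
  assumes "A \<in> carrier_mat q q" "B \<in> carrier_mat q q" "C \<in> carrier_mat q q"
  shows "A * (c \<cdot>\<^sub>m B) * C = c \<cdot>\<^sub>m (A * B * C)"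
  using assms by (simp add: mult_smult_distrib[of _ q q _ q] mult_smult_assoc_mat[of _ q q _ q])

lemma mderiv_conj_diag:
  assumes u: "u \<in> carrier_mat q q" and w: "w \<in> carrier_mat q q"
  shows "mderiv q (\<lambda>s. u * diagm q (\<lambda>j. cis (s * a j)) * w) (\<i> \<cdot>\<^sub>m (u * diagm q (\<lambda>j. complex_of_real (a j)) * w))"
proof -
  have "mderiv q (\<lambda>s. u * diagm q (\<lambda>j. cis (s * a j)) * w) (u * (\<i> \<cdot>\<^sub>m diagm q (\<lambda>j. complex_of_real (a j))) * w)"
    using u w by (intro mderiv_mult_right mderiv_mult_left mderiv_diagm_cis) auto
  then show ?thesis using u w by (simp add: smult_mult_mult[of _ q])
qed

lemma mderiv_hexp:
  assumes "u \<in> U n"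
  shows "mderiv n (hexp n u a) (\<i> \<cdot>\<^sub>m (u * diagm n (\<lambda>j. complex_of_real (a j)) * adj u))"
  unfolding hexp_def using assms by (intro mderiv_conj_diag) auto

lemma smult_smult: "c \<cdot>\<^sub>m (d \<cdot>\<^sub>m A) = (c * d :: complex) \<cdot>\<^sub>m A"
  by (rule eq_matI) auto

lemma smult_i_cancel:
  assumes "\<i> \<cdot>\<^sub>m A = \<i> \<cdot>\<^sub>m B" "A \<in> carrier_mat q q" "B \<in> carrier_mat q q"
  shows "A = (B :: complex mat)"
proof (rule eq_matI)
  fix i j assume "i < dim_row B" "j < dim_col B"
  then show "A $$ (i, j) = B $$ (i, j)"
    using arg_cong[OF assms(1), of "\<lambda>M. M $$ (i, j)"] assms(2,3) by simp
qed (use assms in auto)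

context weight_rep
begin

text \<open>Two curves with the same value and velocity at 0 are o(s) apart, and by the Lipschitz
  bound so are their images. Hence the velocity of the image depends only on the velocity of the
  curve.\<close>

lemma mderiv_rho_cong:
  assumes g: "\<And>s. g s \<in> U n" and h: "\<And>s. h s \<in> U n" and gh: "g 0 = h 0"
    and D: "mderiv n g X" "mderiv n h X" and Y: "mderiv p (\<lambda>s. \<rho> (h s)) Y"
  shows "mderiv p (\<lambda>s. \<rho> (g s)) Y"
  unfolding mderiv_def
proof (intro allI impI)
  fix a b assume ab: "a < p" "b < p"
  let ?K = "\<Sum>a<p. \<Sum>j<n. of_int \<bar>\<mu> a j\<bar> :: real"
  have K: "?K \<ge> 0" by (intro sum_nonneg) auto
  note gc = U_carrier[OF g] and hc = U_carrier[OF h]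
  have "mderiv n (\<lambda>s. g s - h s) (0\<^sub>m n n)"
    unfolding mderiv_def
  proof (intro allI impI)
    fix i j assume ij: "i < n" "j < n"
    have "((\<lambda>s. g s $$ (i, j) - h s $$ (i, j)) has_vector_derivative X $$ (i, j) - X $$ (i, j)) (at 0)"
      using D ij by (intro has_vector_derivative_diff) (auto simp: mderiv_def)
    then show "((\<lambda>s. (g s - h s) $$ (i, j)) has_vector_derivative 0\<^sub>m n n $$ (i, j)) (at 0)"
      using ij carrier_matD[OF gc] carrier_matD[OF hc] by simp
  qed
  moreover have "g 0 - h 0 = 0\<^sub>m n n" using gh gc[of 0] hc[of 0] by auto
  ultimately have lim: "((\<lambda>s. fr (g s - h s) / \<bar>s\<bar>) \<longlongrightarrow> 0) (at 0)"
    using gc hc by (intro mderiv_fr_tendsto[of _ n]) auto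
  have "((\<lambda>s. \<rho> (g s) $$ (a, b) - \<rho> (h s) $$ (a, b)) has_vector_derivative 0) (at 0)"
  proof (rule vector_derivative_zero_squeeze[where h = "\<lambda>s. ?K * fr (g s - h s)"])
    show "\<rho> (g 0) $$ (a, b) - \<rho> (h 0) $$ (a, b) = 0" using gh by simp
    show "cmod (\<rho> (g s) $$ (a, b) - \<rho> (h s) $$ (a, b)) \<le> ?K * fr (g s - h s)" for s
    proof -
      have "cmod (\<rho> (g s) $$ (a, b) - \<rho> (h s) $$ (a, b)) = cmod ((\<rho> (g s) - \<rho> (h s)) $$ (a, b))"
        using ab g h carrier_matD[OF rc[OF h]] by simp
      also have "\<dots> \<le> fr (\<rho> (g s) - \<rho> (h s))" using ab g h by (intro entry_le_fr) auto
      also have "\<dots> \<le> ?K * fr (g s - h s)" by (rule lipschitz[OF g h])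
      finally show ?thesis .
    qed
    show "((\<lambda>s. ?K * fr (g s - h s) / \<bar>s\<bar>) \<longlongrightarrow> 0) (at 0)"
      using tendsto_mult[OF tendsto_const[of ?K] lim] by simp
  qed
  from has_vector_derivative_add[OF this mderivD[OF Y ab]]
  show "((\<lambda>s. \<rho> (g s) $$ (a, b)) has_vector_derivative Y $$ (a, b)) (at 0)" by simp
qed

lemma mderiv_rho_hexp:
  assumes u: "u \<in> U n"
  shows "mderiv p (\<lambda>s. \<rho> (hexp n u a s))
    (\<i> \<cdot>\<^sub>m (\<rho> u * diagm p (\<lambda>b. complex_of_real (\<Sum>j<n. of_int (\<mu> b j) * a j)) * adj (\<rho> u)))"
proof -
  have "\<rho> (hexp n u a s) = \<rho> u * diagm p (\<lambda>b. cis (s * (\<Sum>j<n. of_int (\<mu> b j) * a j))) * adj (\<rho> u)" for s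
    unfolding hexp_def by (subst rconj[OF u]) (auto simp: chi_cis)
  then show ?thesis using u by (simp only:) (intro mderiv_conj_diag, auto)
qed

text \<open>For Hermitian \<open>X\<close>, \<open>\<i> Lh X\<close> is the derivative of \<open>\<rho> (exp (\<i> s X))\<close> at \<open>s = 0\<close>, written out in an
  eigenbasis of \<open>X\<close>; it is junk for other \<open>X\<close>. The Lipschitz bound for \<open>\<rho>\<close> makes it additive, as
  \<open>exp (\<i> s X) exp (\<i> s Y)\<close> and \<open>exp (\<i> s (X + Y))\<close> agree to first order.\<close>

definition Lh :: "complex mat \<Rightarrow> complex mat" where
  "Lh X = (let (u, a) = SOME (u, a). u \<in> U n \<and> X = u * diagm n (\<lambda>j. complex_of_real (a j)) * adj u in
     \<rho> u * diagm p (\<lambda>b. complex_of_real (\<Sum>j<n. of_int (\<mu> b j) * a j)) * adj (\<rho> u))"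

lemma Lh_choice:
  assumes "X \<in> carrier_mat n n" "adj X = X"
  shows "\<exists>u a. u \<in> U n \<and> X = u * diagm n (\<lambda>j. complex_of_real (a j)) * adj u \<and>
    Lh X = \<rho> u * diagm p (\<lambda>b. complex_of_real (\<Sum>j<n. of_int (\<mu> b j) * a j)) * adj (\<rho> u)"
proof -
  define P where "P = (\<lambda>(u, a :: nat \<Rightarrow> real). u \<in> U n \<and> X = u * diagm n (\<lambda>j. complex_of_real (a j)) * adj u)"
  have "\<exists>x. P x" using hermitian_spectral[OF assms] unfolding P_def by auto
  then have "P (SOME x. P x)" by (rule someI_ex)
  moreover obtain u a where ua: "(SOME x. P x) = (u, a)" by fastforce
  ultimately have "P (u, a)" by simp
  moreover have "Lh X = \<rho> u * diagm p (\<lambda>b. complex_of_real (\<Sum>j<n. of_int (\<mu> b j) * a j)) * adj (\<rho> u)"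
    unfolding Lh_def P_def[symmetric] ua by simp
  ultimately show ?thesis unfolding P_def by auto
qed

lemma Lh_carrier [simp]: "X \<in> carrier_mat n n \<Longrightarrow> adj X = X \<Longrightarrow> Lh X \<in> carrier_mat p p"
  using Lh_choice[of X] by auto

lemma mderiv_rho:
  assumes X: "X \<in> carrier_mat n n" "adj X = X" and g: "\<And>s. g s \<in> U n" "g 0 = 1\<^sub>m n" "mderiv n g (\<i> \<cdot>\<^sub>m X)"
  shows "mderiv p (\<lambda>s. \<rho> (g s)) (\<i> \<cdot>\<^sub>m Lh X)"
proof -
  obtain u a where u: "u \<in> U n" and Xu: "X = u * diagm n (\<lambda>j. complex_of_real (a j)) * adj u" and
    L: "Lh X = \<rho> u * diagm p (\<lambda>b. complex_of_real (\<Sum>j<n. of_int (\<mu> b j) * a j)) * adj (\<rho> u)"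
    using Lh_choice[OF X] by blast
  show ?thesis
  proof (rule mderiv_rho_cong[where h = "hexp n u a" and X = "\<i> \<cdot>\<^sub>m X"])
    show "mderiv n (hexp n u a) (\<i> \<cdot>\<^sub>m X)" unfolding Xu by (rule mderiv_hexp[OF u])
    show "mderiv p (\<lambda>s. \<rho> (hexp n u a s)) (\<i> \<cdot>\<^sub>m Lh X)" unfolding L by (rule mderiv_rho_hexp[OF u])
  qed (use u g in \<open>auto simp: hexp_0\<close>)
qed

text \<open>The derivative may be computed along any curve through the identity with the right
  velocity; additivity, for instance, comes from a product of two one-parameter groups.\<close>

lemma Lh_eqI:
  assumes X: "X \<in> carrier_mat n n" "adj X = X" and g: "\<And>s. g s \<in> U n" "g 0 = 1\<^sub>m n" "mderiv n g (\<i> \<cdot>\<^sub>m X)"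
    and Y: "Y \<in> carrier_mat p p" "mderiv p (\<lambda>s. \<rho> (g s)) (\<i> \<cdot>\<^sub>m Y)"
  shows "Lh X = Y"
proof (rule smult_i_cancel[of _ _ p])
  show "\<i> \<cdot>\<^sub>m Lh X = \<i> \<cdot>\<^sub>m Y"
    by (rule mderiv_unique[OF mderiv_rho[OF X g] Y(2)]) (simp_all add: X Y(1))
qed (simp_all add: X Y(1))

lemma hermitian_conj_diag:
  "u \<in> carrier_mat q q \<Longrightarrow> adj (u * diagm q (\<lambda>j. complex_of_real (a j)) * adj u) = u * diagm q (\<lambda>j. complex_of_real (a j)) * adj u"
  by (simp add: mat_adjoint_mult[of _ q q _ q] diagm_adj assoc_mult_mat[of _ q q _ q _ q])

lemma Lh_formula:
  assumes u: "u \<in> U n"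
  shows "Lh (u * diagm n (\<lambda>j. complex_of_real (a j)) * adj u) =
    \<rho> u * diagm p (\<lambda>b. complex_of_real (\<Sum>j<n. of_int (\<mu> b j) * a j)) * adj (\<rho> u)"
  using u mderiv_hexp[OF u] mderiv_rho_hexp[OF u]
  by (intro Lh_eqI[where g = "hexp n u a"]) (simp_all add: hermitian_conj_diag hexp_0)

lemma Lh_diag: "Lh (diagm n (\<lambda>j. complex_of_real (a j))) = diagm p (\<lambda>b. complex_of_real (\<Sum>j<n. of_int (\<mu> b j) * a j))"
  using Lh_formula[OF U_one, of a] by (simp add: rone left_mult_one_mat[of _ n n] right_mult_one_mat[of _ n n]
      left_mult_one_mat[of _ p p] right_mult_one_mat[of _ p p])

lemma Lh_herm:
  assumes "X \<in> carrier_mat n n" "adj X = X" shows "adj (Lh X) = Lh X"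
proof -
  obtain u a where u: "u \<in> U n" and
    L: "Lh X = \<rho> u * diagm p (\<lambda>b. complex_of_real (\<Sum>j<n. of_int (\<mu> b j) * a j)) * adj (\<rho> u)"
    using Lh_choice[OF assms] by blast
  show ?thesis unfolding L using u by (intro hermitian_conj_diag) simp
qed

lemma conj_diag_scale:
  assumes u: "u \<in> carrier_mat q q"
  shows "complex_of_real c \<cdot>\<^sub>m (u * diagm q (\<lambda>j. complex_of_real (a j)) * adj u) =
    u * diagm q (\<lambda>j. complex_of_real (c * a j)) * adj u"
proof -
  have "diagm q (\<lambda>j. complex_of_real (c * a j)) = complex_of_real c \<cdot>\<^sub>m diagm q (\<lambda>j. complex_of_real (a j))"
    by (rule eq_matI) auto
  then show ?thesis using u by (simp add: smult_mult_mult[of _ q])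
qed

lemma Lh_scale:
  assumes "X \<in> carrier_mat n n" "adj X = X"
  shows "Lh (complex_of_real c \<cdot>\<^sub>m X) = complex_of_real c \<cdot>\<^sub>m Lh X"
proof -
  obtain u a where u: "u \<in> U n" and X: "X = u * diagm n (\<lambda>j. complex_of_real (a j)) * adj u"
    using hermitian_spectral[OF assms] by blast
  have "(\<Sum>j<n. of_int (\<mu> b j) * (c * a j)) = c * (\<Sum>j<n. of_int (\<mu> b j) * a j)" for b
    by (simp add: sum_distrib_left mult_ac)
  then show ?thesis
    unfolding X conj_diag_scale[OF U_carrier[OF u]] Lh_formula[OF u] conj_diag_scale[OF rc[OF u]] by simp
qed

lemma Lh_conj:
  assumes w: "w \<in> U n" and X: "X \<in> carrier_mat n n" "adj X = X"
  shows "Lh (w * X * adj w) = \<rho> w * Lh X * adj (\<rho> w)"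
proof -
  obtain u a where u: "u \<in> U n" and X: "X = u * diagm n (\<lambda>j. complex_of_real (a j)) * adj u"
    using hermitian_spectral[OF X] by blast
  have *: "w * (u * D * adj u) * adj w = (w * u) * D * adj (w * u)"
    if "w \<in> carrier_mat q q" "u \<in> carrier_mat q q" "D \<in> carrier_mat q q" for w u D q
    using that by (simp add: mat_adjoint_mult[of _ q q _ q] assoc_mult_mat[of _ q q _ q _ q])
  have wu: "w * u \<in> U n" using w u by simp
  have "Lh (w * X * adj w) = Lh ((w * u) * diagm n (\<lambda>j. complex_of_real (a j)) * adj (w * u))"
    unfolding X using w u by (subst *[of _ n]) auto
  also have "\<dots> = \<rho> (w * u) * diagm p (\<lambda>b. complex_of_real (\<Sum>j<n. of_int (\<mu> b j) * a j)) * adj (\<rho> (w * u))"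
    by (rule Lh_formula[OF wu])
  also have "\<dots> = \<rho> w * Lh X * adj (\<rho> w)"
    unfolding X Lh_formula[OF u] rmult[OF w u] using w u by (subst *[of _ p]) auto
  finally show ?thesis .
qed

lemma Lh_add:
  assumes X: "X \<in> carrier_mat n n" "adj X = X" and Y: "Y \<in> carrier_mat n n" "adj Y = Y"
  shows "Lh (X + Y) = Lh X + Lh Y"
proof -
  obtain u a where u: "u \<in> U n" and Xu: "X = u * diagm n (\<lambda>j. complex_of_real (a j)) * adj u"
    using hermitian_spectral[OF X] by blast
  obtain w b where w: "w \<in> U n" and Yw: "Y = w * diagm n (\<lambda>j. complex_of_real (b j)) * adj w"
    using hermitian_spectral[OF Y] by blast
  have dX: "mderiv n (hexp n u a) (\<i> \<cdot>\<^sub>m X)" unfolding Xu by (rule mderiv_hexp[OF u])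
  have dY: "mderiv n (hexp n w b) (\<i> \<cdot>\<^sub>m Y)" unfolding Yw by (rule mderiv_hexp[OF w])
  have rX: "mderiv p (\<lambda>s. \<rho> (hexp n u a s)) (\<i> \<cdot>\<^sub>m Lh X)"
    by (rule mderiv_rho[OF X hexp_U[OF u] hexp_0[OF u] dX])
  have rY: "mderiv p (\<lambda>s. \<rho> (hexp n w b s)) (\<i> \<cdot>\<^sub>m Lh Y)"
    by (rule mderiv_rho[OF Y hexp_U[OF w] hexp_0[OF w] dY])
  show ?thesis
  proof (rule Lh_eqI[where g = "\<lambda>s. hexp n u a s * hexp n w b s"])
    have "mderiv n (\<lambda>s. hexp n u a s * hexp n w b s) (\<i> \<cdot>\<^sub>m X * hexp n w b 0 + hexp n u a 0 * (\<i> \<cdot>\<^sub>m Y))"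
      using X Y u w by (intro mderiv_mult dX dY) auto
    also have "\<i> \<cdot>\<^sub>m X * hexp n w b 0 + hexp n u a 0 * (\<i> \<cdot>\<^sub>m Y) = \<i> \<cdot>\<^sub>m (X + Y)"
      using X Y u w by (simp add: hexp_0 add_smult_distrib_left_mat[of _ n n] right_mult_one_mat[of _ n n] left_mult_one_mat[of _ n n])
    finally show "mderiv n (\<lambda>s. hexp n u a s * hexp n w b s) (\<i> \<cdot>\<^sub>m (X + Y))" .
    have "mderiv p (\<lambda>s. \<rho> (hexp n u a s) * \<rho> (hexp n w b s)) (\<i> \<cdot>\<^sub>m Lh X * \<rho> (hexp n w b 0) + \<rho> (hexp n u a 0) * (\<i> \<cdot>\<^sub>m Lh Y))"
      using X Y u w by (intro mderiv_mult rX rY) auto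
    also have "\<i> \<cdot>\<^sub>m Lh X * \<rho> (hexp n w b 0) + \<rho> (hexp n u a 0) * (\<i> \<cdot>\<^sub>m Lh Y) = \<i> \<cdot>\<^sub>m (Lh X + Lh Y)"
      using X Y u w by (simp add: hexp_0 rone add_smult_distrib_left_mat[of _ p p] right_mult_one_mat[of _ p p] left_mult_one_mat[of _ p p])
    finally show "mderiv p (\<lambda>s. \<rho> (hexp n u a s * hexp n w b s)) (\<i> \<cdot>\<^sub>m (Lh X + Lh Y))"
      using u w by (simp add: rmult)
  qed (use X Y u w in \<open>auto simp: hexp_0 adj_add[of _ n n]\<close>)
qed

definition reP :: "complex mat \<Rightarrow> complex mat" where "reP X = (1 / 2) \<cdot>\<^sub>m (X + adj X)"

definition imP :: "complex mat \<Rightarrow> complex mat" where "imP X = (- \<i> / 2) \<cdot>\<^sub>m (X - adj X)"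

text \<open>Complex-linear extension of \<open>Lh\<close> through the Hermitian real and imaginary
  parts; it makes sense of \<rho> infinitesimally on matrix units, which give the raising and
  lowering operators.\<close>

definition L :: "complex mat \<Rightarrow> complex mat" where "L X = Lh (reP X) + \<i> \<cdot>\<^sub>m Lh (imP X)"

lemma reP_carrier [simp]: "X \<in> carrier_mat q q \<Longrightarrow> reP X \<in> carrier_mat q q"
  and imP_carrier [simp]: "X \<in> carrier_mat q q \<Longrightarrow> imP X \<in> carrier_mat q q"
  by (simp_all add: reP_def imP_def)

lemma reP_herm [simp]: "X \<in> carrier_mat q q \<Longrightarrow> adj (reP X) = reP X"
  and imP_herm [simp]: "X \<in> carrier_mat q q \<Longrightarrow> adj (imP X) = imP X"
  by (rule eq_matI; auto simp: reP_def imP_def algebra_simps)+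

lemma reP_imP: "X \<in> carrier_mat q q \<Longrightarrow> X = reP X + \<i> \<cdot>\<^sub>m imP X"
  by (rule eq_matI) (auto simp: reP_def imP_def field_simps)

lemma L_carrier [simp]: "X \<in> carrier_mat n n \<Longrightarrow> L X \<in> carrier_mat p p"
  by (simp add: L_def)

lemma L_herm: "X \<in> carrier_mat n n \<Longrightarrow> adj X = X \<Longrightarrow> L X = Lh X"
proof -
  assume X: "X \<in> carrier_mat n n" "adj X = X"
  have 1: "reP X = X" using X by (intro eq_matI) (auto simp: reP_def)
  have 2: "imP X = complex_of_real 0 \<cdot>\<^sub>m X" using X by (intro eq_matI) (auto simp: imP_def)
  show ?thesis unfolding L_def 1 2 Lh_scale[OF X] using X by (intro eq_matI) auto
qed

lemma L_add: 
  assumes "X \<in> carrier_mat n n" "Y \<in> carrier_mat n n" shows "L (X + Y) = L X + L Y"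
proof -
  have 1: "reP (X + Y) = reP X + reP Y" "imP (X + Y) = imP X + imP Y"
    using assms by (auto simp: reP_def imP_def field_simps intro!: eq_matI)
  have *: "(A + B) + \<i> \<cdot>\<^sub>m (C + D) = (A + \<i> \<cdot>\<^sub>m C) + (B + \<i> \<cdot>\<^sub>m D)"
    if "A \<in> carrier_mat p p" "B \<in> carrier_mat p p" "C \<in> carrier_mat p p" "D \<in> carrier_mat p p" for A B C D :: "complex mat"
    using that by (intro eq_matI) (auto simp: algebra_simps)
  show ?thesis unfolding L_def 1 using assms by (subst Lh_add, simp_all, subst Lh_add, simp_all, subst *, simp_all)
qed

lemma L_scale_real: 
  assumes "X \<in> carrier_mat n n" shows "L (complex_of_real c \<cdot>\<^sub>m X) = complex_of_real c \<cdot>\<^sub>m L X"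
proof -
  have 1: "reP (complex_of_real c \<cdot>\<^sub>m X) = complex_of_real c \<cdot>\<^sub>m reP X" "imP (complex_of_real c \<cdot>\<^sub>m X) = complex_of_real c \<cdot>\<^sub>m imP X"
    using assms by (auto simp: reP_def imP_def field_simps intro!: eq_matI)
  have *: "c \<cdot>\<^sub>m A + \<i> \<cdot>\<^sub>m (c \<cdot>\<^sub>m B) = c \<cdot>\<^sub>m (A + \<i> \<cdot>\<^sub>m B)"
    if "A \<in> carrier_mat p p" "B \<in> carrier_mat p p" for c A B
    using that by (intro eq_matI) (auto simp: algebra_simps)
  show ?thesis unfolding L_def 1 using assms by (subst Lh_scale, simp_all, subst Lh_scale, simp_all, subst *, simp_all)
qed

lemma L_scale_i: 
  assumes "X \<in> carrier_mat n n" shows "L (\<i> \<cdot>\<^sub>m X) = \<i> \<cdot>\<^sub>m L X"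
proof -
  have 1: "reP (\<i> \<cdot>\<^sub>m X) = complex_of_real (-1) \<cdot>\<^sub>m imP X" "imP (\<i> \<cdot>\<^sub>m X) = reP X"
    using assms by (auto simp: reP_def imP_def field_simps intro!: eq_matI)
  have *: "complex_of_real (-1) \<cdot>\<^sub>m A + \<i> \<cdot>\<^sub>m B = \<i> \<cdot>\<^sub>m (B + \<i> \<cdot>\<^sub>m A)"
    if "A \<in> carrier_mat p p" "B \<in> carrier_mat p p" for A B
    using that by (intro eq_matI) (auto simp: algebra_simps)
  have "Lh (complex_of_real (-1) \<cdot>\<^sub>m imP X) = complex_of_real (-1) \<cdot>\<^sub>m Lh (imP X)"
    using assms by (intro Lh_scale) auto
  then show ?thesis unfolding L_def 1 using assms by (simp only:) (intro *, simp_all)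
qed

lemma L_smult: 
  assumes X: "X \<in> carrier_mat n n" shows "L (c \<cdot>\<^sub>m X) = c \<cdot>\<^sub>m L X"
proof -
  have *: "c \<cdot>\<^sub>m Y = complex_of_real (Re c) \<cdot>\<^sub>m Y + complex_of_real (Im c) \<cdot>\<^sub>m (\<i> \<cdot>\<^sub>m Y)" for Y
  proof (rule eq_matI)
    fix i j assume "i < dim_row (complex_of_real (Re c) \<cdot>\<^sub>m Y + complex_of_real (Im c) \<cdot>\<^sub>m (\<i> \<cdot>\<^sub>m Y))"
      "j < dim_col (complex_of_real (Re c) \<cdot>\<^sub>m Y + complex_of_real (Im c) \<cdot>\<^sub>m (\<i> \<cdot>\<^sub>m Y))"
    moreover have "c * y = complex_of_real (Re c) * y + complex_of_real (Im c) * (\<i> * y)" for y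
      by (subst complex_eq[of c]) (simp add: algebra_simps)
    ultimately show "(c \<cdot>\<^sub>m Y) $$ (i, j) = (complex_of_real (Re c) \<cdot>\<^sub>m Y + complex_of_real (Im c) \<cdot>\<^sub>m (\<i> \<cdot>\<^sub>m Y)) $$ (i, j)"
      by simp
  qed auto
  have "L (c \<cdot>\<^sub>m X) = L (complex_of_real (Re c) \<cdot>\<^sub>m X) + L (complex_of_real (Im c) \<cdot>\<^sub>m (\<i> \<cdot>\<^sub>m X))"
    unfolding *[of X] using X by (intro L_add) auto
  also have "\<dots> = complex_of_real (Re c) \<cdot>\<^sub>m L X + complex_of_real (Im c) \<cdot>\<^sub>m (\<i> \<cdot>\<^sub>m L X)"
    using X L_scale_real[of "\<i> \<cdot>\<^sub>m X"] by (simp add: L_scale_real L_scale_i)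
  finally show ?thesis unfolding *[of "L X"] .
qed

lemma L_adj: 
  assumes X: "X \<in> carrier_mat n n" shows "L (adj X) = adj (L X)"
proof -
  have 1: "reP (adj X) = reP X" "imP (adj X) = complex_of_real (-1) \<cdot>\<^sub>m imP X"
    using X by (auto simp: reP_def imP_def field_simps intro!: eq_matI)
  have "adj (L X) = adj (Lh (reP X)) + adj (\<i> \<cdot>\<^sub>m Lh (imP X))"
    unfolding L_def using X by (intro adj_add[of _ p p]) auto
  also have "\<dots> = Lh (reP X) + \<i> \<cdot>\<^sub>m (complex_of_real (-1) \<cdot>\<^sub>m Lh (imP X))"
    using X by (simp add: adj_smult Lh_herm smult_smult)
  also have "complex_of_real (-1) \<cdot>\<^sub>m Lh (imP X) = Lh (complex_of_real (-1) \<cdot>\<^sub>m imP X)"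
    using X by (intro Lh_scale[symmetric]) auto
  finally show ?thesis unfolding L_def 1 by simp
qed

lemma L_conj:
  assumes w: "w \<in> U n" and X: "X \<in> carrier_mat n n"
  shows "L (w * X * adj w) = \<rho> w * L X * adj (\<rho> w)"
proof -
  note wc = U_carrier[OF w]
  have cr: "w * reP X * adj w \<in> carrier_mat n n" "w * imP X * adj w \<in> carrier_mat n n" using wc X by auto
  have h: "adj (w * Y * adj w) = w * Y * adj w" if "adj Y = Y" "Y \<in> carrier_mat n n" for Y
    using that wc by (simp add: mat_adjoint_mult[of _ n n _ n] assoc_mult_mat[of _ n n _ n _ n])
  have split: "A * (Y + \<i> \<cdot>\<^sub>m Z) * B = A * Y * B + \<i> \<cdot>\<^sub>m (A * Z * B)"
    if "A \<in> carrier_mat q q" "B \<in> carrier_mat q q" "Y \<in> carrier_mat q q" "Z \<in> carrier_mat q q" for A B Y Z :: "complex mat" and q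
    using that by (simp add: mult_add_distrib_mat[of _ q q _ q] add_mult_distrib_mat[of _ q q _ _ q] 
        mult_smult_distrib[of _ q q _ q] mult_smult_assoc_mat[of _ q q _ q])
  have "L (w * X * adj w) = L (w * reP X * adj w + \<i> \<cdot>\<^sub>m (w * imP X * adj w))"
    by (subst reP_imP[OF X], subst split[of _ n]) (use wc X in auto)
  also have "\<dots> = L (w * reP X * adj w) + \<i> \<cdot>\<^sub>m L (w * imP X * adj w)"
    using cr by (simp add: L_add L_smult)
  also have "\<dots> = \<rho> w * Lh (reP X) * adj (\<rho> w) + \<i> \<cdot>\<^sub>m (\<rho> w * Lh (imP X) * adj (\<rho> w))"
    using cr X w by (simp add: L_herm h Lh_conj)
  also have "\<dots> = \<rho> w * L X * adj (\<rho> w)"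
    unfolding L_def using w X by (subst split[of _ p]) auto
  finally show ?thesis .
qed

end

subsection \<open>Averages over roots of unity\<close>

definition rootp :: "nat \<Rightarrow> nat \<Rightarrow> complex" where
  "rootp q x = cis (2 * pi * real x / real q)"

lemma norm_rootp [simp]: "cmod (rootp q x) = 1"
  by (simp add: rootp_def)

lemma root_sum:
  assumes d: "\<bar>d\<bar> < int q"
  shows "(\<Sum>x<q. rootp q x powi d) = (if d = 0 then of_nat q else 0)"
proof (cases "d = 0")
  case False
  have q: "0 < q" using d by linarith
  define w where "w = cis (2 * pi * of_int d / real q)"
  have pw: "rootp q x powi d = w ^ x" for x
    by (simp add: rootp_def w_def cis_power_int DeMoivre mult_ac)
  have wq: "w ^ q = 1"
  proof -
    have "w ^ q = cis (2 * pi * of_int d)" using q by (simp add: w_def DeMoivre)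
    then show ?thesis by (simp add: cis_multiple_2pi)
  qed
  have w1: "w \<noteq> 1"
  proof
    assume "w = 1"
    then have "cos (2 * pi * of_int d / real q) = 1" unfolding w_def by (metis cis.sel(1) one_complex.sel(1))
    then obtain k :: int where "2 * pi * of_int d / real q = of_int k * 2 * pi" using cos_one_2pi_int by blast
    then have "real_of_int d = of_int (k * int q)" using q by (simp add: field_simps)
    then have "d = k * int q" by (simp only: of_int_eq_iff)
    moreover have "k \<noteq> 0" using calculation False by auto
    then have "1 \<le> \<bar>k\<bar>" by linarith
    then have "1 * int q \<le> \<bar>k\<bar> * int q" by (intro mult_right_mono) auto
    ultimately show False using d by (simp add: abs_mult)
  qed
  show ?thesis unfolding pw using geometric_sum[OF w1, of q] wq False by simp
qed (use d in auto)

text \<open>Weights on the \<open>q\<close>-th roots of unity with density 1 + cos. For large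
  \<open>q\<close> this is a probability law with Fourier coefficient 1/2 at the frequencies 1 and
  -1 and none beyond, as recorded by \<open>cosfac\<close>.\<close>

definition coslaw :: "nat \<Rightarrow> nat \<Rightarrow> real" where
  "coslaw q x = (1 + cos (2 * pi * real x / real q)) / real q"

lemma coslaw_nonneg: "coslaw q x \<ge> 0"
proof -
  have "0 \<le> 1 + cos (2 * pi * real x / real q)" using cos_ge_minus_one[of "2 * pi * real x / real q"] by linarith
  then show ?thesis unfolding coslaw_def by (rule divide_nonneg_nonneg) simp
qed

definition cosfac :: "int \<Rightarrow> real" where
  "cosfac d = (if d = 0 then 1 else if \<bar>d\<bar> = 1 then 1 / 2 else 0)"

text \<open>The cosine shifts frequencies by one in both directions, and the shifted frequencies
  must still lie below \<open>q\<close>; hence the extra 1 in the hypothesis.\<close>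

lemma coslaw_sum:
  assumes d: "\<bar>d\<bar> + 1 < int q"
  shows "(\<Sum>x<q. complex_of_real (coslaw q x) * rootp q x powi d) = complex_of_real (cosfac d)"
proof -
  have q: "0 < q" using d by linarith
  have "complex_of_real (coslaw q x) * rootp q x powi d =
      (rootp q x powi d + rootp q x powi (d + 1) / 2 + rootp q x powi (d - 1) / 2) / of_nat q" for x
  proof -
    have nz: "rootp q x \<noteq> 0" by (metis norm_rootp norm_zero zero_neq_one)
    have "complex_of_real (cos (2 * pi * real x / real q)) = (rootp q x + cnj (rootp q x)) / 2"
      by (simp add: rootp_def complex_eq_iff)
    also have "cnj (rootp q x) = rootp q x powi (- 1)" using cnj_powi[of "rootp q x" 1] by simp
    finally have c: "complex_of_real (cos (2 * pi * real x / real q)) = (rootp q x + rootp q x powi (-1)) / 2" .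
    have "rootp q x powi (d + 1) = rootp q x powi d * rootp q x" using nz by (simp add: power_int_add)
    moreover have "rootp q x powi (d - 1) = rootp q x powi d * rootp q x powi (-1)"
      using power_int_add[of "rootp q x" d "-1"] nz by simp
    moreover have "complex_of_real (coslaw q x) = (1 + complex_of_real (cos (2 * pi * real x / real q))) / of_nat q"
      by (simp add: coslaw_def)
    ultimately show ?thesis unfolding c by (simp only:) (simp add: algebra_simps add_divide_distrib)
  qed
  then have "(\<Sum>x<q. complex_of_real (coslaw q x) * rootp q x powi d) =
      ((\<Sum>x<q. rootp q x powi d) + (\<Sum>x<q. rootp q x powi (d + 1)) / 2 + (\<Sum>x<q. rootp q x powi (d - 1)) / 2) / of_nat q"
    by (simp only: sum.distrib flip: sum_divide_distrib)
  also have "\<dots> = complex_of_real (cosfac d)"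
  proof -
    have "\<bar>d\<bar> < int q" "\<bar>d + 1\<bar> < int q" "\<bar>d - 1\<bar> < int q" using d by auto
    then show ?thesis using q by (auto simp: root_sum cosfac_def)
  qed
  finally show ?thesis .
qed

text \<open>The finite subgroup of the torus formed by the \<open>q\<close>-th roots of unity,
  encoded by exponents. It averages characters with all exponents below \<open>q\<close> in absolute
  value exactly and stands in for Haar measure.\<close>

definition grid :: "nat \<Rightarrow> nat \<Rightarrow> (nat \<Rightarrow> nat) set" where
  "grid n q = PiE {..<n} (\<lambda>_. {..<q})"

lemma grid_finite [simp]: "finite (grid n q)"
  by (simp add: grid_def finite_PiE)

definition gridt :: "nat \<Rightarrow> (nat \<Rightarrow> nat) \<Rightarrow> nat \<Rightarrow> complex" where
  "gridt q r j = rootp q (r j)"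

lemma norm_gridt [simp]: "cmod (gridt q r j) = 1"
  by (simp add: gridt_def)

definition gridw :: "nat \<Rightarrow> nat \<Rightarrow> (nat \<Rightarrow> nat) \<Rightarrow> real" where
  "gridw n q r = (\<Prod>j<n. coslaw q (r j))"

lemma gridw_nonneg: "gridw n q r \<ge> 0"
  unfolding gridw_def by (intro prod_nonneg) (simp add: coslaw_nonneg)

lemma uniform_average:
  assumes "\<And>j. j < n \<Longrightarrow> \<bar>d j\<bar> < int q"
  shows "(\<Sum>r\<in>grid n q. chi n (gridt q r) d) = (if \<forall>j<n. d j = 0 then of_nat (q ^ n) else 0)"
proof -
  have "(\<Sum>r\<in>grid n q. chi n (gridt q r) d) = (\<Prod>j<n. \<Sum>x<q. rootp q x powi d j)"
    unfolding grid_def chi_def gridt_def by (rule prod_sum_PiE[symmetric]) auto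
  also have "\<dots> = (\<Prod>j<n. if d j = 0 then of_nat q else 0)"
    using assms by (intro prod.cong refl root_sum) auto
  also have "\<dots> = (if \<forall>j<n. d j = 0 then of_nat (q ^ n) else 0)"
    by (auto intro!: prod_zero)
  finally show ?thesis .
qed

lemma coslaw_average:
  assumes "\<And>j. j < n \<Longrightarrow> \<bar>d j\<bar> + 1 < int q"
  shows "(\<Sum>r\<in>grid n q. complex_of_real (gridw n q r) * chi n (gridt q r) d) = complex_of_real (\<Prod>j<n. cosfac (d j))"
proof -
  have "(\<Sum>r\<in>grid n q. complex_of_real (gridw n q r) * chi n (gridt q r) d) =
      (\<Sum>r\<in>grid n q. \<Prod>j<n. complex_of_real (coslaw q (r j)) * rootp q (r j) powi d j)"
    by (simp add: gridw_def chi_def gridt_def prod.distrib)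
  also have "\<dots> = (\<Prod>j<n. \<Sum>x<q. complex_of_real (coslaw q x) * rootp q x powi d j)"
    unfolding grid_def by (rule prod_sum_PiE[symmetric]) auto
  also have "\<dots> = (\<Prod>j<n. complex_of_real (cosfac (d j)))"
    using assms by (intro prod.cong refl coslaw_sum) auto
  finally show ?thesis by simp
qed

text \<open>A multiplicity is a Fourier coefficient of the character sum. The grid is chosen finer
  than every difference between \<open>\<nu>\<close> and an occurring weight, so that the
  coefficient is computed exactly.\<close>

lemma count_eq_of_characters:
  assumes eq: "\<And>t. (\<And>j. j < n \<Longrightarrow> cmod (t j) = 1) \<Longrightarrow> (\<Sum>a<p. chi n t (d a)) = (\<Sum>a<p. chi n t (e a))"
  shows "card {a. a < p \<and> (\<forall>j<n. d a j = \<nu> j)} = card {a. a < (p::nat) \<and> (\<forall>j<n. e a j = \<nu> j)}"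
proof -
  define q where "q = nat (1 + (\<Sum>a<p. \<Sum>j<n. \<bar>d a j - \<nu> j\<bar> + \<bar>e a j - \<nu> j\<bar>))"
  have q: "\<bar>d a j - \<nu> j\<bar> < int q" "\<bar>e a j - \<nu> j\<bar> < int q" if "a < p" "j < n" for a j
  proof -
    have "\<bar>d a j - \<nu> j\<bar> + \<bar>e a j - \<nu> j\<bar> \<le> (\<Sum>j<n. \<bar>d a j - \<nu> j\<bar> + \<bar>e a j - \<nu> j\<bar>)"
      using that by (intro member_le_sum) auto
    also have "\<dots> \<le> (\<Sum>a<p. \<Sum>j<n. \<bar>d a j - \<nu> j\<bar> + \<bar>e a j - \<nu> j\<bar>)"
      using that by (intro member_le_sum[where f = "\<lambda>a. \<Sum>j<n. \<bar>d a j - \<nu> j\<bar> + \<bar>e a j - \<nu> j\<bar>"]) (auto intro: sum_nonneg)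
    finally show "\<bar>d a j - \<nu> j\<bar> < int q" "\<bar>e a j - \<nu> j\<bar> < int q" unfolding q_def by linarith+
  qed
  have q0: "q > 0" unfolding q_def by (simp add: sum_nonneg add_pos_nonneg)
  have *: "of_nat (card {a. a < p \<and> (\<forall>j<n. d a j = \<nu> j)} * q ^ n) =
      (\<Sum>r\<in>grid n q. cnj (chi n (gridt q r) \<nu>) * (\<Sum>a<p. chi n (gridt q r) (d a)))"
    if q: "\<And>a j. a < p \<Longrightarrow> j < n \<Longrightarrow> \<bar>d a j - \<nu> j\<bar> < int q" for d :: "nat \<Rightarrow> nat \<Rightarrow> int"
  proof -
    have "(\<Sum>r\<in>grid n q. cnj (chi n (gridt q r) \<nu>) * (\<Sum>a<p. chi n (gridt q r) (d a))) =
        (\<Sum>r\<in>grid n q. \<Sum>a<p. chi n (gridt q r) (\<lambda>j. d a j - \<nu> j))"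
      by (simp add: chi_diff sum_distrib_left mult.commute)
    also have "\<dots> = (\<Sum>a<p. \<Sum>r\<in>grid n q. chi n (gridt q r) (\<lambda>j. d a j - \<nu> j))"
      by (rule sum.swap)
    also have "\<dots> = (\<Sum>a<p. if \<forall>j<n. d a j = \<nu> j then of_nat (q ^ n) else 0)"
    proof (intro sum.cong refl)
      fix a assume "a \<in> {..<p}"
      then show "(\<Sum>r\<in>grid n q. chi n (gridt q r) (\<lambda>j. d a j - \<nu> j)) = (if \<forall>j<n. d a j = \<nu> j then of_nat (q ^ n) else 0)"
        using uniform_average[of n "\<lambda>j. d a j - \<nu> j" q] q by simp
    qed
    also have "\<dots> = of_nat (card {a. a < p \<and> (\<forall>j<n. d a j = \<nu> j)} * q ^ n)"
      by (simp add: sum.If_cases Int_def lessThan_def)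
    finally show ?thesis ..
  qed
  have "(of_nat (card {a. a < p \<and> (\<forall>j<n. d a j = \<nu> j)} * q ^ n) :: complex) =
      (\<Sum>r\<in>grid n q. cnj (chi n (gridt q r) \<nu>) * (\<Sum>a<p. chi n (gridt q r) (d a)))"
    by (rule *[OF q(1)])
  also have "\<dots> = (\<Sum>r\<in>grid n q. cnj (chi n (gridt q r) \<nu>) * (\<Sum>a<p. chi n (gridt q r) (e a)))"
    by (intro sum.cong refl arg_cong2[of _ _ _ _ "(*)"] eq) simp
  also have "\<dots> = of_nat (card {a. a < p \<and> (\<forall>j<n. e a j = \<nu> j)} * q ^ n)"
    by (rule *[OF q(2), symmetric])
  finally have "(of_nat (card {a. a < p \<and> (\<forall>j<n. d a j = \<nu> j)} * q ^ n) :: complex) =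
      of_nat (card {a. a < p \<and> (\<forall>j<n. e a j = \<nu> j)} * q ^ n)" .
  then have "card {a. a < p \<and> (\<forall>j<n. d a j = \<nu> j)} * q ^ n = card {a. a < p \<and> (\<forall>j<n. e a j = \<nu> j)} * q ^ n"
    by (simp only: of_nat_eq_iff)
  then show ?thesis using q0 by simp
qed

subsection \<open>Matrix units\<close>

definition eu :: "nat \<Rightarrow> nat \<Rightarrow> nat \<Rightarrow> complex mat" where
  "eu n j k = Matrix.mat n n (\<lambda>(a, b). if a = j \<and> b = k then 1 else 0)"

lemma eu_carrier [simp]: "eu n j k \<in> carrier_mat n n"
  and eu_dim [simp]: "dim_row (eu n j k) = n" "dim_col (eu n j k) = n"
  and eu_index [simp]: "a < n \<Longrightarrow> b < n \<Longrightarrow> eu n j k $$ (a, b) = (if a = j \<and> b = k then 1 else 0)"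
  by (simp_all add: eu_def)

lemma eu_adj: "adj (eu n j k) = eu n k j"
  by (rule eq_matI) auto

lemma eu_left: "A \<in> carrier_mat n m \<Longrightarrow> k < n \<Longrightarrow> a < n \<Longrightarrow> b < m \<Longrightarrow> (eu n j k * A) $$ (a, b) = (if a = j then A $$ (k, b) else 0)"
  by (subst mult_index[of _ n n _ m]; (subst sum_single[of k])?) auto

lemma eu_right: "A \<in> carrier_mat m n \<Longrightarrow> j < n \<Longrightarrow> a < m \<Longrightarrow> b < n \<Longrightarrow> (A * eu n j k) $$ (a, b) = (if b = k then A $$ (a, j) else 0)"
  by (subst mult_index[of _ m n _ n]; (subst sum_single[of j])?) auto

lemma eu_diag: "eu n j j = diagm n (\<lambda>i. complex_of_real (if i = j then 1 else 0))"
  by (rule eq_matI) auto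

lemma eu_torus: 
  assumes jk: "j < n" "k < n"
  shows "diagm n t * eu n j k * adj (diagm n t) = (t j * cnj (t k)) \<cdot>\<^sub>m eu n j k"
proof (rule eq_matI)
  fix a b assume "a < dim_row ((t j * cnj (t k)) \<cdot>\<^sub>m eu n j k)" "b < dim_col ((t j * cnj (t k)) \<cdot>\<^sub>m eu n j k)"
  then have ab: "a < n" "b < n" by auto
  then show "(diagm n t * eu n j k * adj (diagm n t)) $$ (a, b) = ((t j * cnj (t k)) \<cdot>\<^sub>m eu n j k) $$ (a, b)"
    unfolding diagm_adj by (subst diagm_right[of _ n]) (auto simp: diagm_left[of _ n n] simp del: index_mult_mat(1))
qed auto

lemma eu_perm:
  assumes s: "s permutes {..<n}" and jk: "j < n" "k < n"
  shows "permm n s * eu n j k * adj (permm n s) = eu n (s j) (s k)"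
proof -
  have "adj (permm n s) * eu n (s j) (s k) * permm n s = eu n j k"
  proof (rule eq_matI)
    fix a b assume "a < dim_row (eu n j k)" "b < dim_col (eu n j k)"
    then have ab: "a < n" "b < n" by auto
    show "(adj (permm n s) * eu n (s j) (s k) * permm n s) $$ (a, b) = eu n j k $$ (a, b)"
      using ab s by (subst permm_conj[OF s]) (auto simp: permutes_inj[OF s, THEN inj_eq])
  qed auto
  then have "permm n s * (adj (permm n s) * eu n (s j) (s k) * permm n s) * adj (permm n s) = permm n s * eu n j k * adj (permm n s)"
    by simp
  then show ?thesis
    using permm_U[OF s] by (simp add: assoc_mult_mat[of _ n n _ n _ n] U_left_cancel[of _ n _ n] U_right right_mult_one_mat[of _ n n])
qed

section \<open>Root operators, commutation relations and permutation symmetry of the weights\<close>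

context weight_rep
begin

definition E :: "nat \<Rightarrow> nat \<Rightarrow> complex mat" where "E j k = L (eu n j k)"

lemma E_carrier [simp]: "E j k \<in> carrier_mat p p" by (simp add: E_def)

lemma E_dim [simp]: "dim_row (E j k) = p" "dim_col (E j k) = p"
  using carrier_matD[OF E_carrier] by auto

lemma E_adj: "adj (E j k) = E k j"
  unfolding E_def using L_adj[of "eu n j k"] by (simp add: eu_adj)

lemma L_zero: "L (0\<^sub>m n n) = 0\<^sub>m p p"
proof -
  have "L (0\<^sub>m n n) = L (0 \<cdot>\<^sub>m 0\<^sub>m n n)" by simp
  also have "\<dots> = 0 \<cdot>\<^sub>m L (0\<^sub>m n n)" by (rule L_smult) simp
  also have "\<dots> = 0\<^sub>m p p" using carrier_matD[OF L_carrier[OF zero_carrier_mat[of n n]]] by (intro eq_matI) simp_all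
  finally show ?thesis .
qed

lemma L_expand:
  assumes X: "X \<in> carrier_mat n n" and ab: "a < p" "b < p"
  shows "L X $$ (a, b) = (\<Sum>j<n. \<Sum>k<n. X $$ (j, k) * E j k $$ (a, b))"
proof -
  \<comment> \<open>\<open>L\<close> is known to be additive and homogeneous, so the expansion is
    built up one matrix unit at a time over a growing set of positions.\<close>
  define R where "R J = Matrix.mat n n (\<lambda>q. if q \<in> J then X $$ q else 0)" for J
  have "L (R J) $$ (a, b) = (\<Sum>q\<in>J. X $$ q * E (fst q) (snd q) $$ (a, b))"
    if "finite J" "J \<subseteq> {..<n} \<times> {..<n}" for J
    using that
  proof (induction J rule: finite_induct)
    case empty
    have "R {} = 0\<^sub>m n n" by (rule eq_matI) (auto simp: R_def)
    then show ?case using ab by (simp add: L_zero)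
  next
    case (insert q J)
    obtain j k where q: "q = (j, k)" by (cases q)
    have "R (insert q J) = R J + X $$ q \<cdot>\<^sub>m eu n j k"
      using insert by (intro eq_matI) (auto simp: R_def q)
    then have "L (R (insert q J)) = L (R J) + X $$ q \<cdot>\<^sub>m E j k"
      by (simp add: L_add L_smult E_def R_def)
    moreover have "L (R J) \<in> carrier_mat p p" by (simp add: R_def)
    ultimately show ?case using insert ab by (simp add: q)
  qed
  from this[of "{..<n} \<times> {..<n}"]
  have "L (R ({..<n} \<times> {..<n})) $$ (a, b) = (\<Sum>j<n. \<Sum>k<n. X $$ (j, k) * E j k $$ (a, b))"
    by (simp add: sum.cartesian_product case_prod_unfold)
  moreover have "R ({..<n} \<times> {..<n}) = X" using X by (intro eq_matI) (auto simp: R_def)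
  ultimately show ?thesis by simp
qed

lemma mderiv_L:
  assumes "\<And>s. A s \<in> carrier_mat n n" "D \<in> carrier_mat n n" "mderiv n A D"
  shows "mderiv p (\<lambda>s. L (A s)) (L D)"
  unfolding mderiv_def
proof (intro allI impI)
  fix a b assume ab: "a < p" "b < p"
  show "((\<lambda>s. L (A s) $$ (a, b)) has_vector_derivative L D $$ (a, b)) (at 0)"
    unfolding L_expand[OF assms(1) ab] L_expand[OF assms(2) ab] using assms(3)
    by (intro has_vector_derivative_sum has_vector_derivative_mult_left) (auto simp: mderiv_def)
qed

text \<open>The relation \<open>L (g * Y * adj g) * \<rho> g = \<rho> g * L Y\<close> is
  differentiated at 0 along exp(\<i> s X), by the product rule on the left and directly on the
  right.\<close>

lemma L_comm_herm:
  assumes X: "X \<in> carrier_mat n n" "adj X = X" and Y: "Y \<in> carrier_mat n n"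
  shows "L X * L Y - L Y * L X = L (X * Y - Y * X)"
proof -
  obtain u a where u: "u \<in> U n" and Xu: "X = u * diagm n (\<lambda>j. complex_of_real (a j)) * adj u"
    using hermitian_spectral[OF X] by blast
  define g where "g = hexp n u a"
  have gU: "g s \<in> U n" for s using u by (simp add: g_def)
  note gc = U_carrier[OF gU]
  have g0: "g 0 = 1\<^sub>m n" using u by (simp add: g_def hexp_0)
  have dg: "mderiv n g (\<i> \<cdot>\<^sub>m X)" unfolding Xu g_def by (rule mderiv_hexp[OF u])
  have dr: "mderiv p (\<lambda>s. \<rho> (g s)) (\<i> \<cdot>\<^sub>m L X)"
    unfolding L_herm[OF X] by (rule mderiv_rho[OF X gU g0 dg])
  have adX: "adj (\<i> \<cdot>\<^sub>m X) = - \<i> \<cdot>\<^sub>m X" using X by (simp add: adj_smult)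
  define D where "D = (\<i> \<cdot>\<^sub>m X * Y) * adj (g 0) + (g 0 * Y) * (- \<i> \<cdot>\<^sub>m X)"
  have dgY: "mderiv n (\<lambda>s. g s * Y) (\<i> \<cdot>\<^sub>m X * Y)"
    using gc X Y dg by (intro mderiv_mult_right) auto
  have dga: "mderiv n (\<lambda>s. adj (g s)) (- \<i> \<cdot>\<^sub>m X)"
    unfolding adX[symmetric] using gc X dg by (intro mderiv_adj) auto
  have dconj: "mderiv n (\<lambda>s. g s * Y * adj (g s)) D"
    unfolding D_def using gc X Y by (intro mderiv_mult dgY dga) auto
  have Dc: "D \<in> carrier_mat n n" using gc[of 0] X Y by (simp add: D_def)
  have D: "D = \<i> \<cdot>\<^sub>m (X * Y - Y * X)"
    unfolding D_def g0 using X Y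
    by (intro eq_matI) (auto simp: right_mult_one_mat[of _ n n] left_mult_one_mat[of _ n n]
        mult_smult_distrib[of _ n n _ n] mult_smult_assoc_mat[of _ n n _ n] algebra_simps simp del: index_mult_mat(1))
  have "mderiv p (\<lambda>s. L (g s * Y * adj (g s)) * \<rho> (g s)) (L D * \<rho> (g 0) + L (g 0 * Y * adj (g 0)) * (\<i> \<cdot>\<^sub>m L X))"
    using gc gU X Y Dc by (intro mderiv_mult mderiv_L dconj dr) auto
  moreover have "L (g s * Y * adj (g s)) * \<rho> (g s) = \<rho> (g s) * L Y" for s
    using gU[of s] Y by (simp add: L_conj[OF gU Y] U_right_cancel[of _ p _ p])
  moreover have "L (g 0 * Y * adj (g 0)) = L Y"
    using Y by (simp add: g0 left_mult_one_mat[of _ n n] right_mult_one_mat[of _ n n])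
  ultimately have "mderiv p (\<lambda>s. \<rho> (g s) * L Y) (L D * \<rho> (g 0) + L Y * (\<i> \<cdot>\<^sub>m L X))" by simp
  moreover have "L D * \<rho> (g 0) = L D" using Dc by (simp add: g0 rone right_mult_one_mat[of _ p p])
  ultimately have 1: "mderiv p (\<lambda>s. \<rho> (g s) * L Y) (L D + L Y * (\<i> \<cdot>\<^sub>m L X))" by simp
  have 2: "mderiv p (\<lambda>s. \<rho> (g s) * L Y) (\<i> \<cdot>\<^sub>m L X * L Y)"
    using gU X Y by (intro mderiv_mult_right dr) auto
  have eq: "L D + L Y * (\<i> \<cdot>\<^sub>m L X) = \<i> \<cdot>\<^sub>m L X * L Y"
    by (rule mderiv_unique[OF 1 2]) (use X Y Dc in auto)
  have LD: "L D = \<i> \<cdot>\<^sub>m L (X * Y - Y * X)" unfolding D using X Y by (intro L_smult) auto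
  show ?thesis
  proof (rule smult_i_cancel[of _ _ p])
    note c = L_carrier[OF X(1)] L_carrier[OF Y] L_carrier[of "X * Y - Y * X"]
    have XY: "X * Y - Y * X \<in> carrier_mat n n" using X Y by auto
    have "\<i> \<cdot>\<^sub>m (L X * L Y - L Y * L X) = \<i> \<cdot>\<^sub>m L X * L Y - L Y * (\<i> \<cdot>\<^sub>m L X)"
      using c(1,2) by (intro eq_matI) (auto simp: mult_smult_distrib[of _ p p _ p] mult_smult_assoc_mat[of _ p p _ p] algebra_simps simp del: index_mult_mat(1))
    also have "\<dots> = L D"
      unfolding eq[symmetric] using c(1,2) L_carrier[OF Dc] by (intro eq_matI) (auto simp del: index_mult_mat(1))
    finally show "\<i> \<cdot>\<^sub>m (L X * L Y - L Y * L X) = \<i> \<cdot>\<^sub>m L (X * Y - Y * X)" unfolding LD .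
  qed (use X Y in auto)
qed

lemma L_comm:
  assumes X: "X \<in> carrier_mat n n" and Y: "Y \<in> carrier_mat n n"
  shows "L X * L Y - L Y * L X = L (X * Y - Y * X)"
proof -
  have *: "(A + \<i> \<cdot>\<^sub>m B) * Z - Z * (A + \<i> \<cdot>\<^sub>m B) = (A * Z - Z * A) + \<i> \<cdot>\<^sub>m (B * Z - Z * B)"
    if "A \<in> carrier_mat q q" "B \<in> carrier_mat q q" "Z \<in> carrier_mat q q" for A B Z :: "complex mat" and q
    using that
    by (simp add: mult_add_distrib_mat[of _ q q _ q] add_mult_distrib_mat[of _ q q _ _ q] 
        mult_smult_distrib[of _ q q _ q] mult_smult_assoc_mat[of _ q q _ q])
      (intro eq_matI, auto simp: algebra_simps simp del: index_mult_mat(1))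
  have c: "reP X * Y - Y * reP X \<in> carrier_mat n n" "imP X * Y - Y * imP X \<in> carrier_mat n n" using X Y by auto
  have LX: "L X = L (reP X) + \<i> \<cdot>\<^sub>m L (imP X)"
    using X by (simp add: L_herm) (simp add: L_def)
  have "L X * L Y - L Y * L X = (L (reP X) * L Y - L Y * L (reP X)) + \<i> \<cdot>\<^sub>m (L (imP X) * L Y - L Y * L (imP X))"
    unfolding LX using X Y by (intro *[of _ p]) auto
  also have "\<dots> = L (reP X * Y - Y * reP X) + \<i> \<cdot>\<^sub>m L (imP X * Y - Y * imP X)"
    using X Y by (subst L_comm_herm, simp_all, subst L_comm_herm, simp_all)
  also have "\<dots> = L ((reP X * Y - Y * reP X) + \<i> \<cdot>\<^sub>m (imP X * Y - Y * imP X))"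
    using c by (simp add: L_add L_smult)
  also have "(reP X * Y - Y * reP X) + \<i> \<cdot>\<^sub>m (imP X * Y - Y * imP X) = X * Y - Y * X"
    using X Y by (subst *[symmetric, of _ n]) (auto simp: reP_imP[OF X, symmetric])
  finally show ?thesis .
qed

lemma E_comm:
  assumes "j < n" "k < n" "l < n" "m < n" "a < p" "b < p"
  shows "(E j k * E l m) $$ (a, b) - (E l m * E j k) $$ (a, b) =
    (if k = l then E j m $$ (a, b) else 0) - (if m = j then E l k $$ (a, b) else 0)"
proof -
  have eq: "eu n j k * eu n l m - eu n l m * eu n j k = (if k = l then 1 else 0) \<cdot>\<^sub>m eu n j m + (if m = j then - 1 else 0) \<cdot>\<^sub>m eu n l k"
    using assms by (intro eq_matI) (auto simp: eu_left[of _ n n] simp del: index_mult_mat(1))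
  have "(E j k * E l m) $$ (a, b) - (E l m * E j k) $$ (a, b) = (E j k * E l m - E l m * E j k) $$ (a, b)"
    using assms by (subst index_minus_mat) auto
  also have "E j k * E l m - E l m * E j k = (if k = l then 1 else 0) \<cdot>\<^sub>m E j m + (if m = j then - 1 else 0) \<cdot>\<^sub>m E l k"
    unfolding E_def by (subst L_comm, simp, simp, subst eq, subst L_add, simp, simp, subst L_smult, simp, subst L_smult, simp, rule refl)
  finally show ?thesis using assms by (auto simp del: index_mult_mat(1))
qed

lemma E_diag: 
  assumes j: "j < n" shows "E j j = diagm p (\<lambda>a. of_int (\<mu> a j))"
proof -
  have "E j j = Lh (eu n j j)" unfolding E_def by (rule L_herm) (auto simp: eu_adj)
  also have "\<dots> = diagm p (\<lambda>b. complex_of_real (\<Sum>i<n. of_int (\<mu> b i) * (if i = j then 1 else 0)))"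
    unfolding eu_diag by (rule Lh_diag)
  also have "\<dots> = diagm p (\<lambda>a. of_int (\<mu> a j))"
    using j by (intro diagm_cong) (subst sum_single[of j], auto)
  finally show ?thesis .
qed

lemma E_torus:
  assumes jk: "j < n" "k < n" and t: "\<And>j. j < n \<Longrightarrow> cmod (t j) = 1" and ab: "a < p" "b < p"
  shows "chi n t (\<mu> a) * E j k $$ (a, b) * cnj (chi n t (\<mu> b)) = t j * cnj (t k) * E j k $$ (a, b)"
proof -
  have "\<rho> (diagm n t) * E j k * adj (\<rho> (diagm n t)) = L (diagm n t * eu n j k * adj (diagm n t))"
    unfolding E_def using t by (intro L_conj[symmetric] diagm_U) auto
  also have "\<dots> = (t j * cnj (t k)) \<cdot>\<^sub>m E j k" unfolding eu_torus[OF jk] E_def by (rule L_smult) simp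
  finally have eq: "\<rho> (diagm n t) * E j k * adj (\<rho> (diagm n t)) = (t j * cnj (t k)) \<cdot>\<^sub>m E j k" .
  have r: "\<rho> (diagm n t) = diagm p (\<lambda>a. chi n t (\<mu> a))" by (rule rdiag[OF t])
  have "(\<rho> (diagm n t) * E j k * adj (\<rho> (diagm n t))) $$ (a, b) = chi n t (\<mu> a) * E j k $$ (a, b) * cnj (chi n t (\<mu> b))"
    unfolding r diagm_adj using ab by (subst diagm_right[of _ p]) (auto simp: diagm_left[of _ p p] simp del: index_mult_mat(1))
  then show ?thesis unfolding eq using ab by (simp only: index_smult_mat E_dim)
qed

text \<open>Conjugation by the torus multiplies \<open>E j k\<close> by the root character t_j /
  t_k; a nonzero entry therefore forces the two weights to differ by this root.\<close>

lemma E_weight: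
  assumes jk: "j < n" "k < n" and ab: "a < p" "b < p" and nz: "E j k $$ (a, b) \<noteq> 0" and l: "l < n"
  shows "\<mu> a l = \<mu> b l + (if l = j then 1 else 0) - (if l = k then 1 else 0)"
proof -
  let ?d = "\<lambda>i. if i = j then 1 else 0 :: int" and ?e = "\<lambda>i. if i = k then 1 else 0 :: int"
  have "(\<lambda>l. \<mu> a l + ?e l) l = (\<lambda>l. \<mu> b l + ?d l) l"
  proof (rule chi_separates[OF _ l])
    fix t assume t: "\<And>j. j < n \<Longrightarrow> cmod (t j) = 1"
    have single: "chi n t (\<lambda>i. if i = m then 1 else 0) = t m" if m: "m < n" for m
    proof -
      have "chi n t (\<lambda>i. if i = m then 1 else 0) = (\<Prod>i\<in>{m}. t i)"
        unfolding chi_def using m by (intro prod.mono_neutral_cong_right) auto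
      then show ?thesis by simp
    qed
    have nb: "cnj (chi n t (\<mu> b)) * chi n t (\<mu> b) = 1" and nk: "cnj (t k) * t k = 1"
      using norm_chi[OF t, where d = "\<mu> b"] t[OF jk(2)] complex_norm_square[of "chi n t (\<mu> b)"] complex_norm_square[of "t k"]
      by (simp_all add: mult.commute)
    have "chi n t (\<mu> a) * cnj (chi n t (\<mu> b)) = t j * cnj (t k)"
      using E_torus[OF jk t ab] nz by (simp add: mult_ac)
    then have "chi n t (\<mu> a) * (cnj (chi n t (\<mu> b)) * chi n t (\<mu> b)) * t k = t j * (cnj (t k) * t k) * chi n t (\<mu> b)"
      by (simp add: mult_ac)
    then have "chi n t (\<mu> a) * t k = chi n t (\<mu> b) * t j" unfolding nb nk by (simp add: mult_ac)
    then show "chi n t (\<lambda>l. \<mu> a l + ?e l) = chi n t (\<lambda>l. \<mu> b l + ?d l)"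
      using single[OF jk(1)] single[OF jk(2)] by (simp add: chi_add[OF t])
  qed
  then show ?thesis by simp
qed

lemma E_perm:
  assumes s: "s permutes {..<n}" and jk: "j < n" "k < n"
  shows "\<rho> (permm n s) * E j k * adj (\<rho> (permm n s)) = E (s j) (s k)"
  unfolding E_def using L_conj[OF permm_U[OF s], of "eu n j k"] eu_perm[OF s jk] by simp

text \<open>Permutation matrices are unitary, so permuting the coordinates of \<open>t\<close>
  conjugates \<rho>(t) and leaves its trace unchanged; the multiplicities are recovered from the
  traces.\<close>

lemma weight_count_perm:
  assumes s: "s permutes {..<n}"
  shows "card {a. a < p \<and> (\<forall>j<n. \<mu> a j = \<nu> (s j))} = card {a. a < p \<and> (\<forall>j<n. \<mu> a j = \<nu> j)}"
proof -
  define r where "r = inv_into UNIV s"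
  have r: "r permutes {..<n}" unfolding r_def by (rule permutes_inv[OF s])
  have sr: "s (r x) = x" and rs: "r (s x) = x" for x
    using permutes_inverses[OF s] by (auto simp: r_def)
  have "card {a. a < p \<and> (\<forall>j<n. \<mu> a j = \<nu> j)} = card {a. a < p \<and> (\<forall>j<n. \<mu> a (r j) = \<nu> j)}"
  proof (rule count_eq_of_characters)
    fix t :: "nat \<Rightarrow> complex" assume t: "\<And>j. j < n \<Longrightarrow> cmod (t j) = 1"
    have ts: "cmod (t (s j)) = 1" if "j < n" for j using t perm_less[OF s, of j] that by simp
    note P = permm_U[OF s] and T = diagm_U[OF t]
    have "\<rho> (diagm n (\<lambda>i. t (s i))) = adj (\<rho> (permm n s)) * \<rho> (diagm n t) * \<rho> (permm n s)"
      unfolding permm_conj_diagm[OF s, symmetric] using P T by (simp add: rmult radj)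
    then have "tr (\<rho> (diagm n (\<lambda>i. t (s i)))) = tr (\<rho> (permm n s) * (adj (\<rho> (permm n s)) * \<rho> (diagm n t)))"
      using P T by (simp add: tr_comm[of "adj (\<rho> (permm n s)) * \<rho> (diagm n t)" p p "\<rho> (permm n s)"])
    also have "\<dots> = tr (\<rho> (diagm n t))" using P T by (simp add: U_left_cancel[of _ p _ p])
    finally have "(\<Sum>a<p. chi n (\<lambda>i. t (s i)) (\<mu> a)) = (\<Sum>a<p. chi n t (\<mu> a))"
      using t ts by (simp add: rdiag diagm_tr)
    moreover have "chi n (\<lambda>i. t (s i)) (\<mu> a) = chi n t (\<lambda>j. \<mu> a (r j))" for a
      unfolding chi_def using prod.permute[OF s, of "\<lambda>j. t j powi \<mu> a (r j)"] rs by (simp add: comp_def)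
    ultimately show "(\<Sum>a<p. chi n t (\<mu> a)) = (\<Sum>a<p. chi n t (\<lambda>j. \<mu> a (r j)))" by simp
  qed
  moreover have "(\<forall>j<n. \<mu> a (r j) = \<nu> j) \<longleftrightarrow> (\<forall>j<n. \<mu> a j = \<nu> (s j))" for a
    using perm_less[OF s] perm_less[OF r] sr rs by metis
  ultimately show ?thesis by simp
qed

end

subsection \<open>Averaging over monomial unitaries\<close>

text \<open>The unitary discrete Fourier matrix. All its entries have modulus 1 / sqrt p, so
  conjugating a diagonal matrix by it puts the mean of the entries into every diagonal
  position.\<close>

definition dft :: "nat \<Rightarrow> complex mat" where
  "dft p = Matrix.mat p p (\<lambda>(a, b). rootp p b powi int a / complex_of_real (sqrt (real p)))"

lemma dft_carrier [simp]: "dft p \<in> carrier_mat p p"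
  and dft_dim [simp]: "dim_row (dft p) = p" "dim_col (dft p) = p"
  by (simp_all add: dft_def)

lemma dft_U: "dft p \<in> U p"
proof -
  have "adj (adj (dft p)) * adj (dft p) = 1\<^sub>m p"
  proof (rule eq_matI)
    fix a b assume "a < dim_row (1\<^sub>m p :: complex mat)" "b < dim_col (1\<^sub>m p :: complex mat)"
    then have ab: "a < p" "b < p" by auto
    then have p: "0 < p" by auto
    have sq: "complex_of_real (sqrt (real p)) * complex_of_real (sqrt (real p)) = of_nat p"
      by (simp flip: of_real_mult)
    have "(dft p * adj (dft p)) $$ (a, b) = (\<Sum>k<p. rootp p k powi (int a - int b) / of_nat p)"
    proof (subst mult_index[of _ p p _ p], simp, simp, rule ab, rule ab, intro sum.cong refl)
      fix k assume "k \<in> {..<p}"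
      then have k: "k < p" by simp
      have nz: "rootp p k \<noteq> 0" by (metis norm_rootp norm_zero zero_neq_one)
      have "dft p $$ (a, k) * adj (dft p) $$ (k, b) = rootp p k powi int a * cnj (rootp p k powi int b) / of_nat p"
        using ab k sq by (simp add: dft_def)
      also have "cnj (rootp p k powi int b) = rootp p k powi (- int b)" by (rule cnj_powi) simp
      also have "rootp p k powi int a * rootp p k powi (- int b) = rootp p k powi (int a - int b)"
        using power_int_add[of "rootp p k" "int a" "- int b"] nz by simp
      finally show "dft p $$ (a, k) * adj (dft p) $$ (k, b) = rootp p k powi (int a - int b) / of_nat p" .
    qed
    also have "\<dots> = (if a = b then 1 else 0)"
      using root_sum[of "int a - int b" p] ab p by (simp flip: sum_divide_distrib)
    finally show "(adj (adj (dft p)) * adj (dft p)) $$ (a, b) = 1\<^sub>m p $$ (a, b)" using ab by simp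
  qed auto
  then have "adj (dft p) \<in> U p" by (intro U_intro) auto
  from U_adj[OF this] show ?thesis by simp
qed

lemma dft_zero_diagonal:
  assumes "(\<Sum>k<p. x k) = 0" "a < p"
  shows "(dft p * diagm p x * adj (dft p)) $$ (a, a) = 0"
proof -
  have "(dft p * diagm p x * adj (dft p)) $$ (a, a) = (\<Sum>k<p. (dft p * diagm p x) $$ (a, k) * adj (dft p) $$ (k, a))"
    using assms by (intro mult_index[of _ p p _ p]) auto
  also have "\<dots> = (\<Sum>k<p. x k / of_nat p)"
  proof (intro sum.cong refl)
    fix k assume "k \<in> {..<p}"
    then have k: "k < p" by simp
    have "rootp p k powi int a * cnj (rootp p k powi int a) = 1"
      unfolding complex_norm_square[symmetric] by (simp add: norm_power_int norm_power)
    moreover have "complex_of_real (sqrt (real p)) * complex_of_real (sqrt (real p)) = of_nat p"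
      by (simp flip: of_real_mult)
    moreover have "(dft p * diagm p x) $$ (a, k) * adj (dft p) $$ (k, a) =
        x k * (rootp p k powi int a * cnj (rootp p k powi int a)) / (complex_of_real (sqrt (real p)) * complex_of_real (sqrt (real p)))"
      using assms k by (subst diagm_right[of _ p]) (simp_all add: dft_def mult_ac)
    ultimately show "(dft p * diagm p x) $$ (a, k) * adj (dft p) $$ (k, a) = x k / of_nat p" by simp
  qed
  also have "\<dots> = 0" using assms by (simp flip: sum_divide_distrib)
  finally show ?thesis .
qed

lemma exists_permutation_pair:
  assumes "a \<noteq> b" "a' \<noteq> b'" "a < p" "b < p" "a' < p" "b' < (p :: nat)"
  shows "\<exists>s. s permutes {..<p} \<and> s a = a' \<and> s b = b'"
proof -
  let ?t = "Transposition.transpose a a'"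
  let ?s = "Transposition.transpose (?t b) b' \<circ> ?t"
  have t: "?t permutes {..<p}" using assms by (intro permutes_swap_id) auto
  have "?t b < p" using t assms perm_less by simp
  then have "Transposition.transpose (?t b) b' permutes {..<p}" using assms by (intro permutes_swap_id) auto
  then have "?s permutes {..<p}" using t by (intro permutes_compose)
  moreover have "?t b \<noteq> a'" using assms(1) by (metis transpose_apply_first transpose_eq_iff)
  then have "?s a = a'" using assms(2) by (simp add: Transposition.transpose_def)
  moreover have "?s b = b'" by simp
  ultimately show ?thesis by blast
qed

text \<open>The symmetric group is transitive on ordered pairs of distinct points, so the sum does
  not depend on the pair.\<close>

lemma sum_permutations_pair:
  fixes f :: "nat \<Rightarrow> nat \<Rightarrow> real"
  assumes "a \<noteq> b" "a' \<noteq> b'" "a < p" "b < p" "a' < p" "b' < p"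
  shows "(\<Sum>r | r permutes {..<p}. f (r a) (r b)) = (\<Sum>r | r permutes {..<p}. f (r a') (r b'))"
proof -
  obtain s where s: "s permutes {..<p}" "s a = a'" "s b = b'"
    using exists_permutation_pair[OF assms] by blast
  have "(\<Sum>r | r permutes {..<p}. f (r a') (r b')) = (\<Sum>r | r permutes {..<p}. f ((r \<circ> s) a) ((r \<circ> s) b))"
    using s by simp
  also have "\<dots> = (\<Sum>r | r permutes {..<p}. f (r a) (r b))"
    using sum_permutations_compose_right[OF s(1), of "\<lambda>r. f (r a) (r b)"] by (simp add: o_def)
  finally show ?thesis ..
qed

text \<open>Expanded in entries so that phases attached to the four indices can be averaged.\<close>

lemma tr_quartic:
  assumes y: "y \<in> carrier_mat p p" and l: "l \<in> carrier_mat p p"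
  shows "tr (adj (l * y) * (y * l)) = (\<Sum>a<p. \<Sum>b<p. \<Sum>c<p. \<Sum>d<p. cnj (y $$ (b, a)) * cnj (l $$ (c, b)) * y $$ (c, d) * l $$ (d, a))"
proof -
  have "tr (adj (l * y) * (y * l)) = (\<Sum>a<p. \<Sum>c<p. adj (l * y) $$ (a, c) * (y * l) $$ (c, a))"
    using y l by (intro tr_mult[of _ p p]) auto
  also have "\<dots> = (\<Sum>a<p. \<Sum>c<p. cnj (\<Sum>b<p. l $$ (c, b) * y $$ (b, a)) * (\<Sum>d<p. y $$ (c, d) * l $$ (d, a)))"
  proof (intro sum.cong refl)
    fix a c assume "a \<in> {..<p}" "c \<in> {..<p}"
    then have ac: "a < p" "c < p" by auto
    have "adj (l * y) $$ (a, c) = cnj ((l * y) $$ (c, a))"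
      using ac y l by (intro adj_index) auto
    then show "adj (l * y) $$ (a, c) * (y * l) $$ (c, a) = cnj (\<Sum>b<p. l $$ (c, b) * y $$ (b, a)) * (\<Sum>d<p. y $$ (c, d) * l $$ (d, a))"
      unfolding mult_index[OF l y ac(2,1)] mult_index[OF y l ac(2,1)] by simp
  qed
  also have "\<dots> = (\<Sum>a<p. \<Sum>c<p. \<Sum>b<p. \<Sum>d<p. cnj (y $$ (b, a)) * cnj (l $$ (c, b)) * y $$ (c, d) * l $$ (d, a))"
    by (simp only: cnj_sum sum_product) (intro sum.cong refl, simp add: mult_ac)
  also have "\<dots> = (\<Sum>a<p. \<Sum>b<p. \<Sum>c<p. \<Sum>d<p. cnj (y $$ (b, a)) * cnj (l $$ (c, b)) * y $$ (c, d) * l $$ (d, a))"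
    by (intro sum.cong refl sum.swap)
  finally show ?thesis .
qed

text \<open>A permutation combined with diagonal phases. Fourth roots of unity suffice, since the
  phase average meets only exponents of absolute value at most 2.\<close>

definition monomial_mat :: "nat \<Rightarrow> (nat \<Rightarrow> nat) \<Rightarrow> (nat \<Rightarrow> nat) \<Rightarrow> complex mat" where
  "monomial_mat p D r = diagm p (gridt 4 D) * adj (permm p r)"

lemma monomial_mat_U: "r permutes {..<p} \<Longrightarrow> monomial_mat p D r \<in> U p"
  unfolding monomial_mat_def by (intro U_mult diagm_U U_adj permm_U) auto

lemma monomial_mat_conj:
  assumes r: "r permutes {..<p}" and M: "M \<in> carrier_mat p p" and ab: "a < p" "b < p"
  shows "(monomial_mat p D r * M * adj (monomial_mat p D r)) $$ (a, b) = gridt 4 D a * M $$ (r a, r b) * cnj (gridt 4 D b)"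
proof -
  have "adj (monomial_mat p D r) = permm p r * adj (diagm p (gridt 4 D))"
    by (simp add: monomial_mat_def mat_adjoint_mult[of _ p p _ p])
  then have "monomial_mat p D r * M * adj (monomial_mat p D r) = diagm p (gridt 4 D) * (adj (permm p r) * M * permm p r) * diagm p (\<lambda>i. cnj (gridt 4 D i))"
    using M by (simp add: monomial_mat_def assoc_mult_mat[of _ p p _ p _ p] diagm_adj)
  then show ?thesis
    using M ab by (simp only:) (subst diagm_right[of _ p], simp_all add: diagm_left[of _ p p] permm_conj[OF r] del: index_mult_mat(1))
qed

text \<open>The exponent vector vanishes only if the indices \<open>a\<close>, \<open>c\<close>
  match the conjugated ones \<open>b\<close>, \<open>d\<close>. The pairing \<open>a = b\<close>,
  \<open>c = d\<close> is excluded by assumption, which leaves the crossed one.\<close>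

lemma phase_average:
  assumes "a \<noteq> b" "c \<noteq> d" "a < p" "b < p" "c < p" "d < p"
  shows "(\<Sum>D\<in>grid p 4. cnj (gridt 4 D b) * gridt 4 D a * gridt 4 D c * cnj (gridt 4 D d)) =
    (if c = b \<and> d = a then of_nat (4 ^ p) else 0)"
proof -
  let ?e = "\<lambda>m i. if i = m then 1 else 0 :: int"
  have single: "chi p t (?e m) = t m" if "m < p" for t m
  proof -
    have "chi p t (?e m) = (\<Prod>i\<in>{m}. t i)"
      unfolding chi_def using that by (intro prod.mono_neutral_cong_right) auto
    then show ?thesis by simp
  qed
  define e where "e i = (?e a i + ?e c i) - (?e b i + ?e d i)" for i
  have "cnj (gridt 4 D b) * gridt 4 D a * gridt 4 D c * cnj (gridt 4 D d) = chi p (gridt 4 D) e" for D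
  proof -
    have "chi p (gridt 4 D) e = chi p (gridt 4 D) (\<lambda>i. ?e a i + ?e c i) * cnj (chi p (gridt 4 D) (\<lambda>i. ?e b i + ?e d i))"
      unfolding e_def by (rule chi_diff) simp
    also have "\<dots> = (gridt 4 D a * gridt 4 D c) * cnj (gridt 4 D b * gridt 4 D d)"
      using assms by (subst chi_add, simp, subst chi_add, simp) (simp add: single)
    finally show ?thesis by (simp add: mult_ac)
  qed
  then have "(\<Sum>D\<in>grid p 4. cnj (gridt 4 D b) * gridt 4 D a * gridt 4 D c * cnj (gridt 4 D d)) = (\<Sum>D\<in>grid p 4. chi p (gridt 4 D) e)"
    by simp
  also have "\<dots> = (if \<forall>i<p. e i = 0 then of_nat (4 ^ p) else 0)"
    by (rule uniform_average) (auto simp: e_def)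
  also have "(\<forall>i<p. e i = 0) \<longleftrightarrow> c = b \<and> d = a"
  proof
    assume "\<forall>i<p. e i = 0"
    then have "e a = 0" "e b = 0" using assms by auto
    then show "c = b \<and> d = a" using assms by (auto simp: e_def split: if_splits)
  qed (auto simp: e_def)
  finally show ?thesis .
qed

text \<open>Because the diagonal of \<open>M\<close> vanishes, only terms with distinct indices in
  both factors survive, and of these the phase average keeps the crossed pairing. What remains
  involves only the diagonal of \<open>l\<close>.\<close>

lemma monomial_average_one:
  assumes M: "M \<in> carrier_mat p p" and M0: "\<And>a. a < p \<Longrightarrow> M $$ (a, a) = 0" and l: "l \<in> carrier_mat p p" and r: "r permutes {..<p}"
  shows "(\<Sum>D\<in>grid p 4. tr (adj (l * (monomial_mat p D r * M * adj (monomial_mat p D r))) * ((monomial_mat p D r * M * adj (monomial_mat p D r)) * l))) =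
    of_nat (4 ^ p) * (\<Sum>a<p. \<Sum>b<p. if a = b then 0 else complex_of_real ((cmod (M $$ (r b, r a)))\<^sup>2) * (cnj (l $$ (b, b)) * l $$ (a, a)))"
proof -
  let ?y = "\<lambda>D. monomial_mat p D r * M * adj (monomial_mat p D r)"
  let ?g = "\<lambda>D a. gridt 4 D a"
  have yc: "?y D \<in> carrier_mat p p" for D using monomial_mat_U[OF r, of D] M by simp
  define X where "X a b c d = cnj (M $$ (r b, r a)) * cnj (l $$ (c, b)) * M $$ (r c, r d) * l $$ (d, a)" for a b c d
  have "(\<Sum>D\<in>grid p 4. tr (adj (l * ?y D) * (?y D * l))) =
      (\<Sum>D\<in>grid p 4. \<Sum>a<p. \<Sum>b<p. \<Sum>c<p. \<Sum>d<p. X a b c d * (cnj (?g D b) * ?g D a * ?g D c * cnj (?g D d)))"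
    unfolding tr_quartic[OF yc l]
    by (intro sum.cong refl) (auto simp: monomial_mat_conj[OF r M] X_def mult_ac simp del: index_mult_mat(1))
  also have "\<dots> = (\<Sum>a<p. \<Sum>b<p. \<Sum>c<p. \<Sum>d<p. X a b c d * (\<Sum>D\<in>grid p 4. cnj (?g D b) * ?g D a * ?g D c * cnj (?g D d)))"
    by (simp only: sum_distrib_left sum.swap[of _ _ "grid p 4"])
  also have "\<dots> = (\<Sum>a<p. \<Sum>b<p. if a = b then 0 else of_nat (4 ^ p) * (complex_of_real ((cmod (M $$ (r b, r a)))\<^sup>2) * (cnj (l $$ (b, b)) * l $$ (a, a))))"
  proof (intro sum.cong refl)
    fix a b assume "a \<in> {..<p}" "b \<in> {..<p}"
    then have ab: "a < p" "b < p" by auto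
    have z: "X a b c d * (\<Sum>D\<in>grid p 4. cnj (?g D b) * ?g D a * ?g D c * cnj (?g D d)) =
        (if a \<noteq> b \<and> c = b \<and> d = a then of_nat (4 ^ p) * X a b b a else 0)" if cd: "c < p" "d < p" for c d
    proof (cases "a = b \<or> c = d")
      case True
      then have "X a b c d = 0" using M0[of "r a"] M0[of "r c"] r ab cd by (auto simp: X_def)
      then show ?thesis using True by auto
    next
      case False
      then show ?thesis using phase_average[of a b c d p] ab cd by auto
    qed
    have "(\<Sum>c<p. \<Sum>d<p. X a b c d * (\<Sum>D\<in>grid p 4. cnj (?g D b) * ?g D a * ?g D c * cnj (?g D d))) =
        (\<Sum>c<p. \<Sum>d<p. if a \<noteq> b \<and> c = b \<and> d = a then of_nat (4 ^ p) * X a b b a else 0)"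
      using z by (intro sum.cong refl) auto
    also have "\<dots> = (if a = b then 0 else of_nat (4 ^ p) * X a b b a)"
      using ab by (subst sum_single[of b], simp, simp, subst sum_single[of a]) auto
    also have "X a b b a = complex_of_real ((cmod (M $$ (r b, r a)))\<^sup>2) * (cnj (l $$ (b, b)) * l $$ (a, a))"
      by (simp add: X_def complex_norm_square mult_ac del: of_real_power)
    finally show "(\<Sum>c<p. \<Sum>d<p. X a b c d * (\<Sum>D\<in>grid p 4. cnj (?g D b) * ?g D a * ?g D c * cnj (?g D d))) =
        (if a = b then 0 else of_nat (4 ^ p) * (complex_of_real ((cmod (M $$ (r b, r a)))\<^sup>2) * (cnj (l $$ (b, b)) * l $$ (a, a))))" .
  qed
  also have "\<dots> = of_nat (4 ^ p) * (\<Sum>a<p. \<Sum>b<p. if a = b then 0 else complex_of_real ((cmod (M $$ (r b, r a)))\<^sup>2) * (cnj (l $$ (b, b)) * l $$ (a, a)))"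
    unfolding sum_distrib_left by (intro sum.cong refl) auto
  finally show ?thesis .
qed

text \<open>Averaged over phases and permutations, the terms become nonnegative multiples of
  \<open>\<bar>tr l\<bar>\<^sup>2 - \<Sum>\<^sub>a \<bar>l\<^sub>a\<^sub>a\<bar>\<^sup>2\<close>.\<close>

lemma monomial_average:
  assumes M: "M \<in> carrier_mat p p" and M0: "\<And>a. a < p \<Longrightarrow> M $$ (a, a) = 0"
    and l: "l \<in> carrier_mat p p" and trl: "tr l = 0"
  shows "(\<Sum>r | r permutes {..<p}. \<Sum>D\<in>grid p 4.
    Re (tr (adj (l * (monomial_mat p D r * M * adj (monomial_mat p D r))) * ((monomial_mat p D r * M * adj (monomial_mat p D r)) * l)))) \<le> 0"
proof -
  let ?f = "\<lambda>r a b. (cmod (M $$ (r b, r a)))\<^sup>2"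
  have "(\<Sum>r | r permutes {..<p}. \<Sum>D\<in>grid p 4.
      Re (tr (adj (l * (monomial_mat p D r * M * adj (monomial_mat p D r))) * ((monomial_mat p D r * M * adj (monomial_mat p D r)) * l)))) =
      Re (\<Sum>r | r permutes {..<p}. of_nat (4 ^ p) * (\<Sum>a<p. \<Sum>b<p. if a = b then 0 else complex_of_real (?f r a b) * (cnj (l $$ (b, b)) * l $$ (a, a))))"
    unfolding Re_sum[symmetric] by (intro arg_cong[of _ _ Re] sum.cong refl monomial_average_one[OF M M0 l]) auto
  also have "(\<Sum>r | r permutes {..<p}. of_nat (4 ^ p) * (\<Sum>a<p. \<Sum>b<p. if a = b then 0 else complex_of_real (?f r a b) * (cnj (l $$ (b, b)) * l $$ (a, a)))) =
      of_nat (4 ^ p) * (\<Sum>a<p. \<Sum>b<p. if a = b then 0 else complex_of_real (\<Sum>r | r permutes {..<p}. ?f r a b) * (cnj (l $$ (b, b)) * l $$ (a, a)))"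
    unfolding sum_distrib_left[symmetric]
    by (subst sum.swap, intro arg_cong2[of _ _ _ _ "(*)"] refl sum.cong, subst sum.swap, intro sum.cong refl)
      (auto simp: sum_distrib_right)
  finally have 1: "(\<Sum>r | r permutes {..<p}. \<Sum>D\<in>grid p 4.
      Re (tr (adj (l * (monomial_mat p D r * M * adj (monomial_mat p D r))) * ((monomial_mat p D r * M * adj (monomial_mat p D r)) * l)))) =
      Re (of_nat (4 ^ p) * (\<Sum>a<p. \<Sum>b<p. if a = b then 0 else complex_of_real (\<Sum>r | r permutes {..<p}. ?f r a b) * (cnj (l $$ (b, b)) * l $$ (a, a))))" .
  \<comment> \<open>By double transitivity this one sum serves for every off-diagonal position; for
    \<open>p\<close> below 2 there are none.\<close>
  define \<kappa> where "\<kappa> = (\<Sum>r | r permutes {..<p}. ?f r 0 1)"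
  have k0: "\<kappa> \<ge> 0" unfolding \<kappa>_def by (intro sum_nonneg) auto
  have k: "(\<Sum>r | r permutes {..<p}. ?f r a b) = \<kappa>" if "a \<noteq> b" "a < p" "b < p" for a b
  proof -
    have "0 < p \<and> 1 < p" using that by auto
    then show ?thesis unfolding \<kappa>_def using that
      by (intro sum_permutations_pair[where f = "\<lambda>x y. (cmod (M $$ (y, x)))\<^sup>2"]) auto
  qed
  have "(\<Sum>a<p. \<Sum>b<p. if a = b then 0 else complex_of_real (\<Sum>r | r permutes {..<p}. ?f r a b) * (cnj (l $$ (b, b)) * l $$ (a, a))) =
      (\<Sum>a<p. \<Sum>b<p. complex_of_real \<kappa> * (cnj (l $$ (b, b)) * l $$ (a, a) - (if a = b then cnj (l $$ (b, b)) * l $$ (a, a) else 0)))"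
    using k by (intro sum.cong refl) auto
  also have "\<dots> = complex_of_real \<kappa> * ((\<Sum>a<p. \<Sum>b<p. cnj (l $$ (b, b)) * l $$ (a, a)) - (\<Sum>a<p. \<Sum>b<p. if a = b then cnj (l $$ (b, b)) * l $$ (a, a) else 0))"
    by (simp only: sum_subtractf flip: sum_distrib_left)
  also have "(\<Sum>a<p. \<Sum>b<p. cnj (l $$ (b, b)) * l $$ (a, a)) = cnj (tr l) * tr l"
    using l by (simp add: mat_trace_def sum_product) (rule sum.swap)
  also have "(\<Sum>a<p. \<Sum>b<p. if a = b then cnj (l $$ (b, b)) * l $$ (a, a) else 0) = (\<Sum>a<p. complex_of_real ((cmod (l $$ (a, a)))\<^sup>2))"
    by (intro sum.cong refl) (simp add: complex_norm_square mult.commute del: of_real_power)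
  finally have 2: "(\<Sum>a<p. \<Sum>b<p. if a = b then 0 else complex_of_real (\<Sum>r | r permutes {..<p}. ?f r a b) * (cnj (l $$ (b, b)) * l $$ (a, a))) =
      - complex_of_real (\<kappa> * (\<Sum>a<p. (cmod (l $$ (a, a)))\<^sup>2))"
    using trl by simp
  have "of_nat (4 ^ p) * - complex_of_real (\<kappa> * (\<Sum>a<p. (cmod (l $$ (a, a)))\<^sup>2)) = complex_of_real (- (4 ^ p * (\<kappa> * (\<Sum>a<p. (cmod (l $$ (a, a)))\<^sup>2))))"
    by simp
  then show ?thesis unfolding 1 2 using k0 by (simp only: Re_complex_of_real) (simp add: sum_nonneg)
qed

text \<open>If all members were positive, so would be the sum over the monomial matrices. One
  unitary serves for the sum over \<open>i\<close> as a whole, not for each term separately.\<close>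

lemma exists_decorrelating_unitary:
  assumes M: "M \<in> carrier_mat p p" and M0: "\<And>a. a < p \<Longrightarrow> M $$ (a, a) = 0" and I: "finite I"
    and l: "\<And>i. i \<in> I \<Longrightarrow> l i \<in> carrier_mat p p" and trl: "\<And>i. i \<in> I \<Longrightarrow> tr (l i) = 0"
  shows "\<exists>W\<in>U p. (\<Sum>i\<in>I. Re (tr (adj (l i * (W * M * adj W)) * ((W * M * adj W) * l i)))) \<le> 0"
proof (rule ccontr)
  assume "\<not> ?thesis"
  then have pos: "(\<Sum>i\<in>I. Re (tr (adj (l i * (W * M * adj W)) * ((W * M * adj W) * l i)))) > 0" if "W \<in> U p" for W
    using that by (meson not_le)
  let ?F = "\<lambda>r D i. Re (tr (adj (l i * (monomial_mat p D r * M * adj (monomial_mat p D r))) * ((monomial_mat p D r * M * adj (monomial_mat p D r)) * l i)))"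
  have "0 < (\<Sum>r | r permutes {..<p}. \<Sum>D\<in>grid p 4. \<Sum>i\<in>I. ?F r D i)"
  proof (rule sum_pos, goal_cases)
    case 1
    show ?case by (simp add: finite_permutations)
  next
    case 2
    show ?case using permutes_id by blast
  next
    case (3 r)
    have "grid p 4 \<noteq> {}" by (simp add: grid_def PiE_eq_empty_iff lessThan_empty_iff)
    with 3 show ?case by (intro sum_pos[of "grid p 4"] pos monomial_mat_U) auto
  qed
  also have "\<dots> = (\<Sum>i\<in>I. \<Sum>r | r permutes {..<p}. \<Sum>D\<in>grid p 4. ?F r D i)"
    by (simp only: sum.swap[of _ _ I])
  also have "\<dots> \<le> 0" by (intro sum_nonpos monomial_average M M0 l trl)
  finally show False by simp
qed

subsection \<open>The Casimir inequality\<close>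

text \<open>The coefficient matrices are conjugated by the entrywise conjugate of \<open>g\<close>,
  which preserves the trace inner product. This makes sums over all \<open>l j k\<close> independent
  of the basis of matrix units.\<close>

lemma sesquilinear_basis_change:
  assumes g: "g \<in> U n"
  shows "(\<Sum>j<n. \<Sum>k<n. cnj (\<Sum>c<n. \<Sum>d<n. cnj (g $$ (j, c)) * g $$ (k, d) * x c d) *
      (\<Sum>c<n. \<Sum>d<n. cnj (g $$ (j, c)) * g $$ (k, d) * y c d)) = (\<Sum>c<n. \<Sum>d<n. cnj (x c d) * y c d)"
proof -
  define v where "v = Matrix.mat n n (\<lambda>(j, c). cnj (g $$ (j, c)))"
  have vc [simp]: "v \<in> carrier_mat n n" by (simp add: v_def)
  note vd = carrier_matD[OF vc]
  have vU: "v \<in> U n"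
  proof (rule U_intro)
    have "adj v = Matrix.mat n n (\<lambda>(i, j). g $$ (j, i))" by (rule eq_matI) (auto simp: v_def)
    show "adj v * v = 1\<^sub>m n"
    proof (rule eq_matI)
      fix a b assume "a < dim_row (1\<^sub>m n :: complex mat)" "b < dim_col (1\<^sub>m n :: complex mat)"
      then have ab: "a < n" "b < n" by auto
      have "(adj v * v) $$ (a, b) = (\<Sum>k<n. g $$ (k, a) * cnj (g $$ (k, b)))"
        using ab vd by (subst mult_index[of _ n n _ n]) (simp_all add: v_def)
      also have "\<dots> = (adj g * g) $$ (b, a)"
        using ab U_carrier[OF g] by (subst mult_index[of _ n n _ n]) (auto simp: mult.commute)
      finally show "(adj v * v) $$ (a, b) = 1\<^sub>m n $$ (a, b)" using ab by (auto simp: U_left[OF g])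
    qed (use vd in auto)
  qed simp
  define X where "X = Matrix.mat n n (\<lambda>(c, d). x c d)"
  define Y where "Y = Matrix.mat n n (\<lambda>(c, d). y c d)"
  have XY [simp]: "X \<in> carrier_mat n n" "Y \<in> carrier_mat n n" by (simp_all add: X_def Y_def)
  have e: "(v * Z * adj v) $$ (j, k) = (\<Sum>c<n. \<Sum>d<n. cnj (g $$ (j, c)) * g $$ (k, d) * z c d)"
    if jk: "j < n" "k < n" and Z: "Z = Matrix.mat n n (\<lambda>(c, d). z c d)" for Z z j k
  proof -
    have "(v * Z * adj v) $$ (j, k) = (\<Sum>c<n. \<Sum>d<n. v $$ (j, c) * Z $$ (c, d) * adj v $$ (d, k))"
      using jk Z by (intro mult_index3[of _ n n _ n _ n]) auto
    then show ?thesis using jk by (auto simp: Z v_def mult_ac intro!: sum.cong)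
  qed
  have t: "tr (adj A * B) = (\<Sum>j<n. \<Sum>k<n. cnj (A $$ (j, k)) * B $$ (j, k))"
    if "A \<in> carrier_mat n n" "B \<in> carrier_mat n n" for A B
    using that by (subst tr_mult[of _ n n], simp, simp, subst sum.swap) (auto intro!: sum.cong)
  have "(\<Sum>j<n. \<Sum>k<n. cnj (\<Sum>c<n. \<Sum>d<n. cnj (g $$ (j, c)) * g $$ (k, d) * x c d) *
      (\<Sum>c<n. \<Sum>d<n. cnj (g $$ (j, c)) * g $$ (k, d) * y c d)) =
      (\<Sum>j<n. \<Sum>k<n. cnj ((v * X * adj v) $$ (j, k)) * (v * Y * adj v) $$ (j, k))"
    by (intro sum.cong refl) (simp only: lessThan_iff e[OF _ _ X_def] e[OF _ _ Y_def])
  also have "\<dots> = tr (adj (v * X * adj v) * (v * Y * adj v))" by (rule t[symmetric]) auto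
  also have "adj (v * X * adj v) * (v * Y * adj v) = v * (adj X * Y * adj v)"
    using vU by (simp add: mat_adjoint_mult[of _ n n _ n] assoc_mult_mat[of _ n n _ n _ n] U_left_cancel[of v n _ n])
  also have "tr \<dots> = tr (adj X * Y * adj v * v)" by (rule tr_comm[of _ n n]) auto
  also have "adj X * Y * adj v * v = adj X * Y" using vU by (subst U_right_cancel[of v n _ n]) auto
  also have "tr (adj X * Y) = (\<Sum>c<n. \<Sum>d<n. cnj (x c d) * y c d)"
    by (subst t) (auto simp: X_def Y_def intro!: sum.cong)
  finally show ?thesis .
qed

lemma sum_norm_basis_change:
  assumes "g \<in> U n"
  shows "(\<Sum>j<n. \<Sum>k<n. (cmod (\<Sum>c<n. \<Sum>d<n. cnj (g $$ (j, c)) * g $$ (k, d) * x c d))\<^sup>2) = (\<Sum>c<n. \<Sum>d<n. (cmod (x c d))\<^sup>2)"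
proof -
  have *: "cnj z * z = complex_of_real ((cmod z)\<^sup>2)" for z
    unfolding complex_norm_square by (rule mult.commute)
  have "complex_of_real (\<Sum>j<n. \<Sum>k<n. (cmod (\<Sum>c<n. \<Sum>d<n. cnj (g $$ (j, c)) * g $$ (k, d) * x c d))\<^sup>2) =
      complex_of_real (\<Sum>c<n. \<Sum>d<n. (cmod (x c d))\<^sup>2)"
    using sesquilinear_basis_change[OF assms, of x x] unfolding * of_real_sum .
  then show ?thesis by (simp only: of_real_eq_iff)
qed

lemma sum_square_differences:
  fixes v :: "nat \<Rightarrow> real"
  shows "(\<Sum>j<n. \<Sum>k<n. (v j - v k)\<^sup>2) = 2 * real n * (\<Sum>j<n. (v j)\<^sup>2) - 2 * (\<Sum>j<n. v j)\<^sup>2"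
proof -
  have "(\<Sum>j<n. \<Sum>k<n. (v j - v k)\<^sup>2) = (\<Sum>j<n. \<Sum>k<n. (v j)\<^sup>2 + (v k)\<^sup>2 - 2 * (v j * v k))"
    by (simp add: power2_diff mult.assoc)
  also have "\<dots> = real n * (\<Sum>j<n. (v j)\<^sup>2) + real n * (\<Sum>j<n. (v j)\<^sup>2) - 2 * ((\<Sum>j<n. v j) * (\<Sum>j<n. v j))"
    by (simp add: sum.distrib sum_subtractf sum_product flip: sum_distrib_left)
  finally show ?thesis by (simp add: power2_eq_square)
qed

text \<open>Dimension one is kept apart: there \<rho> is a power of the determinant, and the
  trace-free parts on which the Casimir argument works all vanish.\<close>

locale irr_weight_rep = weight_rep +
  assumes irr: "irreducible_rep n p \<rho>" and p2: "2 \<le> p"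
begin

lemma commutant_scalar:
  assumes A: "A \<in> carrier_mat p p" "adj A = A" and inv: "\<And>g. g \<in> U n \<Longrightarrow> adj (\<rho> g) * A * \<rho> g = A"
  shows "\<exists>c. A = c \<cdot>\<^sub>m 1\<^sub>m p"
proof -
  have "A * \<rho> g = \<rho> g * A" if g: "g \<in> U n" for g
  proof -
    have "\<rho> g * (adj (\<rho> g) * (A * \<rho> g)) = \<rho> g * (adj (\<rho> g) * A * \<rho> g)"
      using A(1) g by (simp add: assoc_mult_mat[of _ p p _ p _ p])
    then show ?thesis unfolding inv[OF g] using A(1) g by (simp add: U_left_cancel[of _ p _ p])
  qed
  then show ?thesis using irr A unfolding irreducible_rep_def by blast
qed

text \<open>The identity matrix is central, so \<open>L\<close> of it commutes with \<rho> and is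
  scalar; its diagonal entries are the coordinate sums of the weights.\<close>

lemma weight_sum: "a < p \<Longrightarrow> (\<Sum>j<n. \<mu> a j) = (\<Sum>j<n. \<mu> 0 j)"
proof -
  assume a: "a < p"
  have "1\<^sub>m n = diagm n (\<lambda>j. complex_of_real 1)" by (simp add: diagm_one)
  moreover have "L (1\<^sub>m n) = Lh (1\<^sub>m n)" by (rule L_herm) auto
  ultimately have L1: "L (1\<^sub>m n) = diagm p (\<lambda>a. complex_of_real (\<Sum>j<n. of_int (\<mu> a j) * 1))"
    by (simp only: Lh_diag[of "\<lambda>_. 1"])
  have "\<exists>c. L (1\<^sub>m n) = c \<cdot>\<^sub>m 1\<^sub>m p"
  proof (rule commutant_scalar)
    show "adj (L (1\<^sub>m n)) = L (1\<^sub>m n)" using L_adj[of "1\<^sub>m n"] by simp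
    fix g assume g: "g \<in> U n"
    have "\<rho> (adj g) * L (1\<^sub>m n) * adj (\<rho> (adj g)) = L (adj g * 1\<^sub>m n * adj (adj g))"
      using g by (intro L_conj[symmetric]) auto
    then show "adj (\<rho> g) * L (1\<^sub>m n) * \<rho> g = L (1\<^sub>m n)"
      using g by (simp add: radj right_mult_one_mat[of _ n n] U_left)
  qed simp
  then obtain c where c: "L (1\<^sub>m n) = c \<cdot>\<^sub>m 1\<^sub>m p" by blast
  have "complex_of_real (\<Sum>j<n. of_int (\<mu> b j) * 1) = c" if "b < p" for b
    using arg_cong[OF c, of "\<lambda>M. M $$ (b, b)"] that unfolding L1 by simp
  from this[OF a] this[of 0] a have "complex_of_real (\<Sum>j<n. of_int (\<mu> a j)) = complex_of_real (\<Sum>j<n. of_int (\<mu> 0 j))" by simp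
  then have "real_of_int (\<Sum>j<n. \<mu> a j) = real_of_int (\<Sum>j<n. \<mu> 0 j)" by (simp only: of_real_eq_iff of_int_sum)
  then show ?thesis by (simp only: of_int_eq_iff)
qed

text \<open>If all weights agreed, every torus element and hence every unitary would act by a
  scalar, and any nonscalar diagonal matrix would contradict irreducibility.\<close>

lemma weights_differ: "\<exists>a<p. \<exists>j<n. \<mu> a j \<noteq> \<mu> 0 j"
proof (rule ccontr)
  assume "\<not> ?thesis"
  then have same: "\<mu> a j = \<mu> 0 j" if "a < p" "j < n" for a j using that by blast
  have sc: "\<exists>c. \<rho> g = c \<cdot>\<^sub>m 1\<^sub>m p" if g: "g \<in> U n" for g
  proof -
    obtain u t where u: "u \<in> U n" and t: "\<And>j. j < n \<Longrightarrow> cmod (t j) = 1" and gt: "g = u * diagm n t * adj u"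
      using unitary_spectral[OF g] by blast
    have "chi n t (\<mu> a) = chi n t (\<mu> 0)" if "a < p" for a
      unfolding chi_def using same[OF that] by (intro prod.cong arg_cong2[where f = power_int]) auto
    then have "diagm p (\<lambda>a. chi n t (\<mu> a)) = diagm p (\<lambda>_. chi n t (\<mu> 0))"
      by (intro diagm_cong)
    then have "\<rho> g = \<rho> u * (chi n t (\<mu> 0) \<cdot>\<^sub>m 1\<^sub>m p) * adj (\<rho> u)"
      unfolding gt using rconj[OF u t] by (simp add: diagm_const)
    also have "\<dots> = chi n t (\<mu> 0) \<cdot>\<^sub>m 1\<^sub>m p"
      using u by (simp add: smult_mult_mult[of _ p] right_mult_one_mat[of _ p p] U_right[OF rU[OF u]])
    finally show ?thesis by blast
  qed
  define A where "A = diagm p (\<lambda>i. complex_of_real (if i = 0 then 1 else 0))"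
  have "\<exists>c. A = c \<cdot>\<^sub>m 1\<^sub>m p"
  proof (rule commutant_scalar)
    show "A \<in> carrier_mat p p" by (simp add: A_def)
    show "adj A = A" by (simp add: A_def diagm_adj)
    fix g assume g: "g \<in> U n"
    obtain c where c: "\<rho> g = c \<cdot>\<^sub>m 1\<^sub>m p" using sc[OF g] by blast
    have "A * \<rho> g = \<rho> g * A" unfolding c A_def
      by (simp add: mult_smult_distrib[of _ p p _ p] mult_smult_assoc_mat[of _ p p _ p] right_mult_one_mat[of _ p p] left_mult_one_mat[of _ p p])
    then show "adj (\<rho> g) * A * \<rho> g = A"
      using g by (simp add: A_def assoc_mult_mat[of _ p p _ p _ p] U_left_cancel[of _ p _ p])
  qed
  then obtain c where c: "A = c \<cdot>\<^sub>m 1\<^sub>m p" by blast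
  have "A $$ (0, 0) = c" "A $$ (1, 1) = c" unfolding c using p2 by auto
  then show False using p2 by (simp add: A_def)
qed

text \<open>Since the coordinate sum is fixed, all weights with equal coordinates coincide, so not
  every weight can be of that kind.\<close>

lemma coordinates_differ: "\<exists>a<p. \<exists>j<n. \<exists>k<n. \<mu> a j \<noteq> \<mu> a k"
proof (rule ccontr)
  assume "\<not> ?thesis"
  then have c: "\<mu> a j = \<mu> a k" if "a < p" "j < n" "k < n" for a j k using that by blast
  obtain a j where aj: "a < p" "j < n" "\<mu> a j \<noteq> \<mu> 0 j" using weights_differ by blast
  have s: "(\<Sum>k<n. \<mu> b k) = int n * \<mu> b j" if "b < p" for b
  proof -
    have "(\<Sum>k<n. \<mu> b k) = (\<Sum>k<n. \<mu> b j)" using c[OF that _ aj(2)] by (intro sum.cong) auto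
    then show ?thesis by simp
  qed
  have "int n * \<mu> a j = int n * \<mu> 0 j" using s[OF aj(1)] s[of 0] weight_sum[OF aj(1)] p2 by linarith
  then show False using aj by simp
qed

lemma n2: "2 \<le> n"
proof -
  obtain a j k where "j < n" "k < n" "\<mu> a j \<noteq> \<mu> a k" using coordinates_differ by blast
  then have "j \<noteq> k" by auto
  with \<open>j < n\<close> \<open>k < n\<close> show ?thesis by linarith
qed

text \<open>Diagonal entries of \<open>E j k * E k j - E k j * E j k = E j j - E k k\<close>, where
  \<open>E k j\<close> is the adjoint of \<open>E j k\<close>.\<close>

lemma E_commutator_diag:
  assumes jk: "j < n" "k < n" "j \<noteq> k" and a: "a < p"
  shows "(\<Sum>b<p. (cmod (E j k $$ (a, b)))\<^sup>2) - (\<Sum>b<p. (cmod (E j k $$ (b, a)))\<^sup>2) = of_int (\<mu> a j - \<mu> a k)"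
proof -
  have kj: "E k j $$ (b, c) = cnj (E j k $$ (c, b))" if "b < p" "c < p" for b c
    using that by (subst E_adj[symmetric]) simp
  have 1: "(E j k * E k j) $$ (a, a) = complex_of_real (\<Sum>b<p. (cmod (E j k $$ (a, b)))\<^sup>2)"
    unfolding mult_index[OF E_carrier E_carrier a a] of_real_sum
    by (intro sum.cong refl) (use a in \<open>simp add: kj complex_norm_square del: of_real_power\<close>)
  have 2: "(E k j * E j k) $$ (a, a) = complex_of_real (\<Sum>b<p. (cmod (E j k $$ (b, a)))\<^sup>2)"
    unfolding mult_index[OF E_carrier E_carrier a a] of_real_sum
    by (intro sum.cong refl) (use a in \<open>simp add: kj complex_norm_square mult.commute del: of_real_power\<close>)
  have "(E j k * E k j) $$ (a, a) - (E k j * E j k) $$ (a, a) = complex_of_int (\<mu> a j - \<mu> a k)"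
    using E_comm[of j k k j a a] jk a by (simp add: E_diag)
  then have "complex_of_real ((\<Sum>b<p. (cmod (E j k $$ (a, b)))\<^sup>2) - (\<Sum>b<p. (cmod (E j k $$ (b, a)))\<^sup>2)) = complex_of_real (of_int (\<mu> a j - \<mu> a k))"
    unfolding 1 2 by simp
  then show ?thesis by (simp only: of_real_eq_iff)
qed

text \<open>The diagonal relation is multiplied by \<open>\<mu> a j - \<mu> a k\<close> and summed
  by parts; this difference jumps by 2 along every nonzero entry of \<open>E j k\<close>.\<close>

lemma fr2_E_formula:
  assumes jk: "j < n" "k < n" "j \<noteq> k"
  shows "2 * fr2 (E j k) = (\<Sum>a<p. (of_int (\<mu> a j - \<mu> a k))\<^sup>2)"
proof -
  let ?e = "\<lambda>a b. (cmod (E j k $$ (a, b)))\<^sup>2" and ?h = "\<lambda>a. real_of_int (\<mu> a j - \<mu> a k)"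
  have "(\<Sum>a<p. (?h a)\<^sup>2) = (\<Sum>a<p. ?h a * ((\<Sum>b<p. ?e a b) - (\<Sum>b<p. ?e b a)))"
    using E_commutator_diag[OF jk] by (intro sum.cong) (auto simp: power2_eq_square)
  also have "\<dots> = (\<Sum>a<p. \<Sum>b<p. ?h a * ?e a b) - (\<Sum>a<p. \<Sum>b<p. ?h a * ?e b a)"
    by (simp add: right_diff_distrib sum_subtractf sum_distrib_left)
  also have "(\<Sum>a<p. \<Sum>b<p. ?h a * ?e b a) = (\<Sum>a<p. \<Sum>b<p. ?h b * ?e a b)"
    by (rule sum.swap)
  also have "(\<Sum>a<p. \<Sum>b<p. ?h a * ?e a b) - (\<Sum>a<p. \<Sum>b<p. ?h b * ?e a b) = (\<Sum>a<p. \<Sum>b<p. (?h a - ?h b) * ?e a b)"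
    by (simp add: left_diff_distrib sum_subtractf)
  also have "\<dots> = (\<Sum>a<p. \<Sum>b<p. 2 * ?e a b)"
  proof (intro sum.cong refl)
    fix a b assume "a \<in> {..<p}" "b \<in> {..<p}"
    then have ab: "a < p" "b < p" by auto
    show "(?h a - ?h b) * ?e a b = 2 * ?e a b"
    proof (cases "E j k $$ (a, b) = 0")
      case False
      have "\<mu> a j = \<mu> b j + 1" "\<mu> a k = \<mu> b k - 1"
        using E_weight[OF jk(1,2) ab False jk(1)] E_weight[OF jk(1,2) ab False jk(2)] jk(3) by auto
      then have "?h a - ?h b = 2" by simp
      then show ?thesis by simp
    qed simp
  qed
  also have "\<dots> = 2 * fr2 (E j k)" by (simp add: fr2_def sum_distrib_left)
  finally show ?thesis ..
qed

text \<open>The difference of the two sums is the trace of a commutator.\<close>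

lemma weight_trace:
  assumes jk: "j < n" "k < n"
  shows "(\<Sum>a<p. \<mu> a j) = (\<Sum>a<p. \<mu> a k)"
proof (cases "j = k")
  case False
  let ?e = "\<lambda>a b. (cmod (E j k $$ (a, b)))\<^sup>2"
  have "(\<Sum>a<p. real_of_int (\<mu> a j - \<mu> a k)) = (\<Sum>a<p. (\<Sum>b<p. ?e a b) - (\<Sum>b<p. ?e b a))"
    using E_commutator_diag[OF jk False] by (intro sum.cong) auto
  also have "\<dots> = (\<Sum>a<p. \<Sum>b<p. ?e a b) - (\<Sum>a<p. \<Sum>b<p. ?e b a)" by (rule sum_subtractf)
  also have "(\<Sum>a<p. \<Sum>b<p. ?e b a) = (\<Sum>a<p. \<Sum>b<p. ?e a b)" by (rule sum.swap)
  finally have "real_of_int ((\<Sum>a<p. \<mu> a j) - (\<Sum>a<p. \<mu> a k)) = 0"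
    by (simp add: sum_subtractf)
  then show ?thesis by linarith
qed simp

text \<open>The common squared size of the root operators. Permutation matrices carry one root
  operator into another, so the pair \<open>0\<close>, \<open>1\<close> is representative.\<close>

definition B :: real where "B = fr2 (E 0 1)"

lemma fr2_E:
  assumes "j < n" "k < n" "j \<noteq> k" shows "fr2 (E j k) = B"
proof -
  obtain s where s: "s permutes {..<n}" "s 0 = j" "s 1 = k"
    using exists_permutation_pair[of 0 1 j k n] assms n2 by auto
  have "E j k = \<rho> (permm n s) * E 0 1 * adj (\<rho> (permm n s))"
    using E_perm[OF s(1), of 0 1] n2 s by simp
  then show ?thesis using permm_U[OF s(1)] by (simp add: B_def fr2_U_right[of _ p _ p] fr2_U_left[of _ p _ p])
qed

lemma B_pos: "B > 0"
proof -
  obtain a j k where a: "a < p" "j < n" "k < n" "\<mu> a j \<noteq> \<mu> a k" using coordinates_differ by blast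
  have "0 < (real_of_int (\<mu> a j - \<mu> a k))\<^sup>2" using a by simp
  also have "\<dots> \<le> (\<Sum>a<p. (of_int (\<mu> a j - \<mu> a k))\<^sup>2)" using a by (intro member_le_sum) auto
  also have "\<dots> = 2 * B" using fr2_E_formula[of j k] fr2_E[of j k] a by force
  finally show ?thesis by simp
qed

definition wmean :: real where "wmean = of_int (\<Sum>j<n. \<mu> 0 j) / real n"

text \<open>The trace-free part of \<open>E j k\<close>. One constant serves for all
  \<open>j\<close>: the weights have a common coordinate sum, and by \<open>weight_trace\<close> the
  traces of the \<open>E j j\<close> agree.\<close>

definition l :: "nat \<Rightarrow> nat \<Rightarrow> complex mat" where
  "l j k = E j k - (if j = k then complex_of_real wmean else 0) \<cdot>\<^sub>m 1\<^sub>m p"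

lemma l_carrier [simp]: "l j k \<in> carrier_mat p p"
  by (simp add: l_def)

lemma l_dim [simp]: "dim_row (l j k) = p" "dim_col (l j k) = p"
  by (simp_all add: l_def)

lemma l_index: "a < p \<Longrightarrow> b < p \<Longrightarrow> l j k $$ (a, b) = E j k $$ (a, b) - (if j = k \<and> a = b then complex_of_real wmean else 0)"
  by (simp add: l_def)

lemma l_adj: "adj (l j k) = l k j"
proof -
  have "adj (l j k) = adj (E j k) - adj ((if j = k then complex_of_real wmean else 0) \<cdot>\<^sub>m 1\<^sub>m p)"
    unfolding l_def by (rule adj_minus[of _ p p]) auto
  then show ?thesis by (auto simp: E_adj adj_smult l_def)
qed

lemma wmean_sum: "a < p \<Longrightarrow> (\<Sum>j<n. of_int (\<mu> a j) - wmean) = 0"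
proof -
  assume a: "a < p"
  have "(\<Sum>j<n. of_int (\<mu> a j) - wmean) = of_int (\<Sum>j<n. \<mu> a j) - real n * wmean"
    by (simp add: sum_subtractf)
  then show ?thesis unfolding weight_sum[OF a] using n2 by (simp add: wmean_def)
qed

lemma tr_l: assumes jk: "j < n" "k < n" shows "tr (l j k) = 0"
proof (cases "j = k")
  case False
  have "E j k $$ (a, a) = 0" if a: "a < p" for a
    using E_weight[OF jk a a, of j] jk False by fastforce
  then show ?thesis using False by (simp add: mat_trace_def l_index)
next
  case True
  have "real n * (\<Sum>a<p. of_int (\<mu> a j) - wmean) = (\<Sum>i<n. \<Sum>a<p. of_int (\<mu> a i) - wmean)"
  proof -
    have "(\<Sum>a<p. of_int (\<mu> a i) - wmean) = (\<Sum>a<p. of_int (\<mu> a j) - wmean)" if "i < n" for i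
    proof -
      have "real_of_int (\<Sum>a<p. \<mu> a i) = real_of_int (\<Sum>a<p. \<mu> a j)" using weight_trace[OF that jk(1)] by simp
      then show ?thesis by (simp add: sum_subtractf)
    qed
    then show ?thesis by simp
  qed
  also have "\<dots> = (\<Sum>a<p. \<Sum>i<n. of_int (\<mu> a i) - wmean)" by (rule sum.swap)
  also have "\<dots> = 0" by (simp add: wmean_sum)
  finally have z: "(\<Sum>a<p. of_int (\<mu> a j) - wmean) = 0" using n2 by simp
  have "tr (l j k) = (\<Sum>a<p. complex_of_real (of_int (\<mu> a j) - wmean))"
    using True jk by (simp add: mat_trace_def l_index E_diag)
  also have "\<dots> = complex_of_real (\<Sum>a<p. of_int (\<mu> a j) - wmean)" by simp
  finally show ?thesis unfolding z by simp
qed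

text \<open>The n (n - 1) off-diagonal terms contribute \<open>B\<close> each. The diagonal ones
  contribute (n - 1) \<open>B\<close> altogether, by comparing the squared differences of the
  centred weight coordinates with their squares.\<close>

lemma fr2_l_sum: "(\<Sum>j<n. \<Sum>k<n. fr2 (l j k)) = B * ((real n)\<^sup>2 - 1)"
proof -
  let ?v = "\<lambda>a j. real_of_int (\<mu> a j) - wmean"
  define S where "S = (\<Sum>j<n. \<Sum>a<p. (?v a j)\<^sup>2)"
  have off: "fr2 (l j k) = B" if "j < n" "k < n" "j \<noteq> k" for j k
  proof -
    have "l j k = E j k" using that by (intro eq_matI) (auto simp: l_index)
    then show ?thesis using fr2_E[OF that] by simp
  qed
  have dg: "fr2 (l j j) = (\<Sum>a<p. (?v a j)\<^sup>2)" if "j < n" for j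
  proof -
    have "l j j = diagm p (\<lambda>a. complex_of_real (?v a j))" using that by (intro eq_matI) (auto simp: l_index E_diag)
    then show ?thesis by (simp only: fr2_diagm norm_of_real power2_abs)
  qed
  have cnt: "(\<Sum>k<n. if j = k then x else y) = x + (real n - 1) * y" if "j < n" for j :: nat and x y :: real
  proof -
    have "(\<Sum>k<n. if j = k then x else y) = (\<Sum>k<n. (if j = k then x - y else 0) + y)" by (intro sum.cong) auto
    also have "\<dots> = (x - y) + real n * y" using that by (simp add: sum.distrib)
    finally show ?thesis by (simp add: algebra_simps)
  qed
  have tot: "(\<Sum>j<n. \<Sum>k<n. fr2 (l j k)) = S + real n * ((real n - 1) * B)"
  proof -
    have "(\<Sum>j<n. \<Sum>k<n. fr2 (l j k)) = (\<Sum>j<n. \<Sum>k<n. if j = k then (\<Sum>a<p. (?v a j)\<^sup>2) else B)"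
      using off dg by (intro sum.cong refl) auto
    also have "\<dots> = (\<Sum>j<n. (\<Sum>a<p. (?v a j)\<^sup>2) + (real n - 1) * B)"
      by (intro sum.cong refl cnt) auto
    finally show ?thesis by (simp add: sum.distrib S_def)
  qed
  have "(\<Sum>j<n. \<Sum>k<n. \<Sum>a<p. (?v a j - ?v a k)\<^sup>2) = (\<Sum>j<n. \<Sum>k<n. if j = k then 0 else 2 * B)"
  proof (intro sum.cong refl)
    fix j k assume "j \<in> {..<n}" "k \<in> {..<n}"
    then show "(\<Sum>a<p. (?v a j - ?v a k)\<^sup>2) = (if j = k then 0 else 2 * B)"
      using fr2_E_formula[of j k] fr2_E[of j k] by auto
  qed
  also have "\<dots> = real n * ((real n - 1) * (2 * B))"
    using cnt[of _ 0 "2 * B"] by simp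
  finally have 1: "(\<Sum>j<n. \<Sum>k<n. \<Sum>a<p. (?v a j - ?v a k)\<^sup>2) = real n * ((real n - 1) * (2 * B))" .
  have "(\<Sum>j<n. \<Sum>k<n. \<Sum>a<p. (?v a j - ?v a k)\<^sup>2) = (\<Sum>a<p. \<Sum>j<n. \<Sum>k<n. (?v a j - ?v a k)\<^sup>2)"
    by (simp only: sum.swap[of _ "{..<p}"])
  also have "\<dots> = (\<Sum>a<p. 2 * real n * (\<Sum>j<n. (?v a j)\<^sup>2))"
  proof (intro sum.cong refl)
    fix a assume "a \<in> {..<p}"
    then have z: "(\<Sum>j<n. ?v a j) = 0" using wmean_sum by simp
    show "(\<Sum>j<n. \<Sum>k<n. (?v a j - ?v a k)\<^sup>2) = 2 * real n * (\<Sum>j<n. (?v a j)\<^sup>2)"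
      unfolding sum_square_differences z by simp
  qed
  also have "\<dots> = 2 * real n * (\<Sum>a<p. \<Sum>j<n. (?v a j)\<^sup>2)" by (simp only: sum_distrib_left)
  also have "(\<Sum>a<p. \<Sum>j<n. (?v a j)\<^sup>2) = S" unfolding S_def by (rule sum.swap)
  finally have "2 * real n * S = 2 * real n * ((real n - 1) * B)" unfolding 1 by auto
  then have "(real n - 1) * B = S" using n2 by auto
  then show ?thesis unfolding tot by (auto simp: algebra_simps power2_eq_square)
qed

text \<open>Under \<rho>(g) the \<open>l j k\<close> transform as matrix units do under
  \<open>g\<close>; the scalar correction is compatible with this because the rows of
  \<open>g\<close> are orthonormal.\<close>

lemma l_rotate:
  assumes g: "g \<in> U n" and jk: "j < n" "k < n" and ab: "a < p" "b < p"
  shows "(adj (\<rho> g) * l j k * \<rho> g) $$ (a, b) = (\<Sum>c<n. \<Sum>d<n. cnj (g $$ (j, c)) * g $$ (k, d) * l c d $$ (a, b))"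
proof -
  note gc = U_carrier[OF g]
  define X where "X = adj g * eu n j k * g"
  have Xc: "X \<in> carrier_mat n n" using gc by (simp add: X_def)
  have LX: "L X = adj (\<rho> g) * E j k * \<rho> g"
    using L_conj[of "adj g" "eu n j k"] g by (simp add: X_def radj E_def)
  have Xi: "X $$ (c, d) = cnj (g $$ (j, c)) * g $$ (k, d)" if cd: "c < n" "d < n" for c d
  proof -
    have "X $$ (c, d) = (\<Sum>i<n. (adj g * eu n j k) $$ (c, i) * g $$ (i, d))"
      unfolding X_def using gc cd by (intro mult_index[of _ n n _ n]) auto
    also have "\<dots> = (adj g * eu n j k) $$ (c, k) * g $$ (k, d)"
      using gc cd jk by (subst sum_single[of k]) (auto simp: eu_right[of _ n n] simp del: index_mult_mat(1))
    also have "(adj g * eu n j k) $$ (c, k) = cnj (g $$ (j, c))"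
      using gc cd jk by (subst eu_right[of _ n n]) auto
    finally show ?thesis .
  qed
  have row: "(\<Sum>c<n. cnj (g $$ (j, c)) * g $$ (k, c)) = (if j = k then 1 else 0)"
  proof -
    have "(\<Sum>c<n. cnj (g $$ (j, c)) * g $$ (k, c)) = (g * adj g) $$ (k, j)"
      using gc jk by (subst mult_index[of _ n n _ n]) (auto simp: mult.commute)
    then show ?thesis using jk by (auto simp: U_right[OF g])
  qed
  have "adj (\<rho> g) * l j k * \<rho> g = adj (\<rho> g) * E j k * \<rho> g - (if j = k then complex_of_real wmean else 0) \<cdot>\<^sub>m 1\<^sub>m p"
    unfolding l_def using g
    by (simp add: mult_minus_right[of _ p p _ p] mult_minus_left[of _ p p _ _ p] smult_mult_mult[of _ p]
        right_mult_one_mat[of _ p p] U_left[OF rU[OF g]])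
  then have "(adj (\<rho> g) * l j k * \<rho> g) $$ (a, b) = L X $$ (a, b) - (if j = k \<and> a = b then complex_of_real wmean else 0)"
    unfolding LX using g ab by (simp del: index_mult_mat(1))
  also have "L X $$ (a, b) = (\<Sum>c<n. \<Sum>d<n. cnj (g $$ (j, c)) * g $$ (k, d) * E c d $$ (a, b))"
    unfolding L_expand[OF Xc ab] using Xi by (intro sum.cong refl) auto
  also have "(if j = k \<and> a = b then complex_of_real wmean else 0) =
      (\<Sum>c<n. \<Sum>d<n. cnj (g $$ (j, c)) * g $$ (k, d) * (if c = d \<and> a = b then complex_of_real wmean else 0))"
  proof -
    have "(\<Sum>d<n. cnj (g $$ (j, c)) * g $$ (k, d) * (if c = d \<and> a = b then complex_of_real wmean else 0)) =
        cnj (g $$ (j, c)) * g $$ (k, c) * (if a = b then complex_of_real wmean else 0)" if "c < n" for c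
      using that by (subst sum_single[of c]) auto
    then have "(\<Sum>c<n. \<Sum>d<n. cnj (g $$ (j, c)) * g $$ (k, d) * (if c = d \<and> a = b then complex_of_real wmean else 0)) =
        (\<Sum>c<n. cnj (g $$ (j, c)) * g $$ (k, c)) * (if a = b then complex_of_real wmean else 0)"
      unfolding sum_distrib_right by (intro sum.cong refl) auto
    then show ?thesis unfolding row by auto
  qed
  finally show ?thesis using ab by (simp add: l_index right_diff_distrib sum_subtractf)
qed

text \<open>The scalar by which the Casimir element acts, read off from its trace.\<close>

definition cas :: real where "cas = B * ((real n)\<^sup>2 - 1) / real p"

lemma cas_pos: "cas > 0"
proof -
  have "1 < (real n)\<^sup>2" using n2 by (intro one_less_power) auto
  then show ?thesis unfolding cas_def using B_pos p2 by auto
qed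

text \<open>Independence of the basis of matrix units makes the Casimir element commute with \<rho>,
  and irreducibility then makes it scalar.\<close>

lemma casimir_scalar:
  assumes ab: "a < p" "b < p"
  shows "(\<Sum>j<n. \<Sum>k<n. (adj (l j k) * l j k) $$ (a, b)) = (if a = b then complex_of_real cas else 0)"
proof -
  define C where "C = Matrix.mat p p (\<lambda>(a, b). \<Sum>j<n. \<Sum>k<n. (adj (l j k) * l j k) $$ (a, b))"
  have Cc: "C \<in> carrier_mat p p" by (simp add: C_def)
  have entry: "(adj A * A) $$ (a, b) = (\<Sum>e<p. cnj (A $$ (e, a)) * A $$ (e, b))"
    if "A \<in> carrier_mat p p" "a < p" "b < p" for A a b
    using that by (subst mult_index[of _ p p _ p]) auto
  have "\<exists>c. C = c \<cdot>\<^sub>m 1\<^sub>m p"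
  proof (rule commutant_scalar[OF Cc])
    have h: "cnj ((adj (l j k) * l j k) $$ (b, a)) = (adj (l j k) * l j k) $$ (a, b)" if "a < p" "b < p" for a b j k
      unfolding entry[OF l_carrier that] entry[OF l_carrier that(2,1)] cnj_sum
      by (rule sum.cong[OF refl]) (simp only: complex_cnj_mult complex_cnj_cnj mult.commute)
    show "adj C = C"
    proof (rule eq_matI)
      fix a b assume "a < dim_row C" "b < dim_col C"
      then have ab: "a < p" "b < p" using Cc by auto
      then have "adj C $$ (a, b) = cnj (C $$ (b, a))" using Cc by simp
      also have "\<dots> = (\<Sum>j<n. \<Sum>k<n. cnj ((adj (l j k) * l j k) $$ (b, a)))"
        using ab by (simp add: C_def del: index_mult_mat(1))
      also have "\<dots> = C $$ (a, b)" unfolding h[OF ab] using ab by (simp add: C_def del: index_mult_mat(1))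
      finally show "adj C $$ (a, b) = C $$ (a, b)" .
    qed (use Cc in auto)
    fix g assume g: "g \<in> U n"
    show "adj (\<rho> g) * C * \<rho> g = C"
    proof (rule eq_matI)
      fix a b assume "a < dim_row C" "b < dim_col C"
      then have ab: "a < p" "b < p" using Cc by auto
      let ?l = "\<lambda>j k. adj (\<rho> g) * l j k * \<rho> g"
      have conj: "adj (?l j k) * ?l j k = adj (\<rho> g) * (adj (l j k) * l j k) * \<rho> g" for j k
        using g by (simp add: mat_adjoint_mult[of _ p p _ p] assoc_mult_mat[of _ p p _ p _ p] U_left_cancel[of _ p _ p])
      have "(adj (\<rho> g) * C * \<rho> g) $$ (a, b) = (\<Sum>c<p. \<Sum>d<p. adj (\<rho> g) $$ (a, c) * C $$ (c, d) * \<rho> g $$ (d, b))"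
        using g ab Cc by (intro mult_index3[of _ p p _ p _ p]) auto
      also have "\<dots> = (\<Sum>c<p. \<Sum>d<p. \<Sum>j<n. \<Sum>k<n. adj (\<rho> g) $$ (a, c) * (adj (l j k) * l j k) $$ (c, d) * \<rho> g $$ (d, b))"
        by (intro sum.cong refl) (auto simp: C_def sum_distrib_left sum_distrib_right simp del: index_mult_mat(1))
      also have "\<dots> = (\<Sum>j<n. \<Sum>k<n. \<Sum>c<p. \<Sum>d<p. adj (\<rho> g) $$ (a, c) * (adj (l j k) * l j k) $$ (c, d) * \<rho> g $$ (d, b))"
        by (simp only: sum.swap[of _ "{..<n}" "{..<p}"])
      also have "\<dots> = (\<Sum>j<n. \<Sum>k<n. (adj (?l j k) * ?l j k) $$ (a, b))"
        unfolding conj using g ab by (intro sum.cong refl mult_index3[of _ p p _ p _ p, symmetric]) auto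
      also have "\<dots> = (\<Sum>j<n. \<Sum>k<n. \<Sum>e<p. cnj (?l j k $$ (e, a)) * ?l j k $$ (e, b))"
        using g ab by (intro sum.cong refl entry) auto
      also have "\<dots> = (\<Sum>e<p. \<Sum>j<n. \<Sum>k<n. cnj (?l j k $$ (e, a)) * ?l j k $$ (e, b))"
        by (simp only: sum.swap[of _ "{..<p}"])
      also have "\<dots> = (\<Sum>e<p. \<Sum>c<n. \<Sum>d<n. cnj (l c d $$ (e, a)) * l c d $$ (e, b))"
      proof (rule sum.cong[OF refl])
        fix e assume "e \<in> {..<p}"
        then have e: "e < p" by simp
        have "(\<Sum>j<n. \<Sum>k<n. cnj (?l j k $$ (e, a)) * ?l j k $$ (e, b)) =
            (\<Sum>j<n. \<Sum>k<n. cnj (\<Sum>c<n. \<Sum>d<n. cnj (g $$ (j, c)) * g $$ (k, d) * l c d $$ (e, a)) *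
              (\<Sum>c<n. \<Sum>d<n. cnj (g $$ (j, c)) * g $$ (k, d) * l c d $$ (e, b)))"
          by (intro sum.cong refl) (simp only: lessThan_iff l_rotate[OF g _ _ e ab(1)] l_rotate[OF g _ _ e ab(2)])
        then show "(\<Sum>j<n. \<Sum>k<n. cnj (?l j k $$ (e, a)) * ?l j k $$ (e, b)) = (\<Sum>c<n. \<Sum>d<n. cnj (l c d $$ (e, a)) * l c d $$ (e, b))"
          unfolding sesquilinear_basis_change[OF g] .
      qed
      also have "\<dots> = (\<Sum>c<n. \<Sum>d<n. (adj (l c d) * l c d) $$ (a, b))"
        using ab by (simp only: sum.swap[of _ "{..<p}"] entry[OF l_carrier ab])
      also have "\<dots> = C $$ (a, b)" using ab by (simp add: C_def del: index_mult_mat(1))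
      finally show "(adj (\<rho> g) * C * \<rho> g) $$ (a, b) = C $$ (a, b)" .
    qed (use carrier_matD[OF rc[OF g]] Cc in auto)
  qed
  then obtain c where c: "C = c \<cdot>\<^sub>m 1\<^sub>m p" by blast
  have Ce: "(\<Sum>j<n. \<Sum>k<n. (adj (l j k) * l j k) $$ (a, b)) = (if a = b then c else 0)" if "a < p" "b < p" for a b
    using arg_cong[OF c, of "\<lambda>M. M $$ (a, b)"] that by (simp add: C_def del: index_mult_mat(1))
  have "of_nat p * c = (\<Sum>a<p. \<Sum>j<n. \<Sum>k<n. (adj (l j k) * l j k) $$ (a, a))"
    using Ce by simp
  also have "\<dots> = (\<Sum>j<n. \<Sum>k<n. \<Sum>a<p. (adj (l j k) * l j k) $$ (a, a))"
    by (simp only: sum.swap[of _ "{..<n}" "{..<p}"])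
  also have "\<dots> = (\<Sum>j<n. \<Sum>k<n. tr (adj (l j k) * l j k))"
    by (simp add: mat_trace_def)
  also have "\<dots> = complex_of_real (\<Sum>j<n. \<Sum>k<n. fr2 (l j k))"
    by (simp add: fr2_tr(1)[OF l_carrier])
  finally have "of_nat p * c = complex_of_real (real p * cas)" using p2 by (simp add: fr2_l_sum cas_def)
  then have "c = complex_of_real cas" using p2 by simp
  then show ?thesis using Ce[OF ab] by simp
qed

end

section \<open>The Casimir form and the trace estimate\<close>

lemma fr2_minus:
  assumes "A \<in> carrier_mat n m" "B \<in> carrier_mat n m"
  shows "fr2 (A - B) = fr2 A + fr2 B - 2 * Re (tr (adj A * B))"
proof -
  have "tr (adj A * B) = (\<Sum>i<n. \<Sum>j<m. cnj (A $$ (i, j)) * B $$ (i, j))"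
    using assms carrier_matD[OF assms(1)] carrier_matD[OF assms(2)]
    by (subst tr_mult[of _ m n], simp, simp, subst sum.swap) (auto intro!: sum.cong)
  then have t: "Re (tr (adj A * B)) = (\<Sum>i<n. \<Sum>j<m. Re (cnj (A $$ (i, j)) * B $$ (i, j)))" by simp
  have e: "(cmod (x - y))\<^sup>2 = (cmod x)\<^sup>2 + (cmod y)\<^sup>2 - 2 * Re (cnj x * y)" for x y
    unfolding cmod_power2 by (simp add: power2_eq_square algebra_simps)
  have "fr2 (A - B) = (\<Sum>i<n. \<Sum>j<m. (cmod (A $$ (i, j) - B $$ (i, j)))\<^sup>2)"
    using assms carrier_matD[OF assms(1)] carrier_matD[OF assms(2)] by (simp add: fr2_carrier[of _ n m])
  then show ?thesis unfolding e t fr2_carrier[OF assms(1)] fr2_carrier[OF assms(2)]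
    by (simp only: sum.distrib sum_subtractf sum_distrib_left)
qed

lemma fr2_minus_le:
  assumes "A \<in> carrier_mat n m" "B \<in> carrier_mat n m"
  shows "fr2 (A - B) \<le> 2 * fr2 A + 2 * fr2 B"
proof -
  have "fr (A - B) \<le> fr A + fr B"
  proof -
    have "C - 0\<^sub>m n m = C" if "C \<in> carrier_mat n m" for C :: "complex mat"
      using that by (intro eq_matI) auto
    then show ?thesis using fr_triangle3[OF assms(1) zero_carrier_mat assms(2)] assms
      by (simp add: fr_minus_commute[of "0\<^sub>m n m" n m])
  qed
  then have "(fr (A - B))\<^sup>2 \<le> (fr A + fr B)\<^sup>2" by (intro power_mono) auto
  also have "\<dots> \<le> 2 * (fr A)\<^sup>2 + 2 * (fr B)\<^sup>2" using sum_squares_ge_zero[of "fr A - fr B" 0]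
    by (simp add: power2_eq_square algebra_simps)
  finally show ?thesis by simp
qed

context irr_weight_rep
begin

text \<open>The Casimir operator of the conjugation action on matrices, written as a quadratic form;
  it vanishes on scalars.\<close>

definition Q :: "complex mat \<Rightarrow> real" where
  "Q x = (\<Sum>j<n. \<Sum>k<n. fr2 (l j k * x - x * l j k))"

lemma Q_nonneg: "Q x \<ge> 0"
  unfolding Q_def by (intro sum_nonneg) simp

lemma casimir_trace:
  assumes Y: "Y \<in> carrier_mat p p"
  shows "(\<Sum>j<n. \<Sum>k<n. tr (adj (l j k) * l j k * Y)) = complex_of_real cas * tr Y"
proof -
  have "(\<Sum>j<n. \<Sum>k<n. tr (adj (l j k) * l j k * Y)) =
      (\<Sum>j<n. \<Sum>k<n. \<Sum>a<p. \<Sum>b<p. (adj (l j k) * l j k) $$ (a, b) * Y $$ (b, a))"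
    using Y by (intro sum.cong refl tr_mult) auto
  also have "\<dots> = (\<Sum>a<p. \<Sum>b<p. \<Sum>j<n. \<Sum>k<n. (adj (l j k) * l j k) $$ (a, b) * Y $$ (b, a))"
    by (simp only: sum.swap[of _ "{..<p}" "{..<n}"])
  also have "\<dots> = (\<Sum>a<p. \<Sum>b<p. (\<Sum>j<n. \<Sum>k<n. (adj (l j k) * l j k) $$ (a, b)) * Y $$ (b, a))"
    by (simp only: sum_distrib_right)
  also have "\<dots> = (\<Sum>a<p. \<Sum>b<p. (if a = b then complex_of_real cas else 0) * Y $$ (b, a))"
    by (intro sum.cong refl) (simp only: lessThan_iff casimir_scalar)
  also have "\<dots> = (\<Sum>a<p. complex_of_real cas * Y $$ (a, a))"
  proof (rule sum.cong[OF refl])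
    fix a assume "a \<in> {..<p}"
    then show "(\<Sum>b<p. (if a = b then complex_of_real cas else 0) * Y $$ (b, a)) = complex_of_real cas * Y $$ (a, a)"
      by (subst sum_single[of a]) auto
  qed
  also have "\<dots> = complex_of_real cas * tr Y" using Y by (simp add: mat_trace_def sum_distrib_left)
  finally show ?thesis .
qed

lemma fr2_l_left:
  assumes x: "x \<in> carrier_mat p p"
  shows "(\<Sum>j<n. \<Sum>k<n. fr2 (l j k * x)) = cas * fr2 x"
proof -
  have "complex_of_real (fr2 (l j k * x)) = tr (adj (l j k) * l j k * (x * adj x))" for j k
  proof -
    have "complex_of_real (fr2 (l j k * x)) = tr (adj (l j k * x) * (l j k * x))"
      using x by (intro fr2_tr(1)[symmetric, of _ p p]) auto
    also have "adj (l j k * x) * (l j k * x) = adj x * (adj (l j k) * l j k * x)"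
      using x by (simp add: mat_adjoint_mult[of _ p p _ p] assoc_mult_mat[of _ p p _ p _ p])
    also have "tr \<dots> = tr (adj (l j k) * l j k * x * adj x)" using x by (intro tr_comm[of _ p p]) auto
    finally show ?thesis using x by (simp add: assoc_mult_mat[of _ p p _ p _ p])
  qed
  then have "complex_of_real (\<Sum>j<n. \<Sum>k<n. fr2 (l j k * x)) = (\<Sum>j<n. \<Sum>k<n. tr (adj (l j k) * l j k * (x * adj x)))"
    by (simp only: of_real_sum)
  also have "\<dots> = complex_of_real (cas * fr2 x)"
    using x by (subst casimir_trace) (auto simp: fr2_tr(2)[of x p p])
  finally show ?thesis by (simp only: of_real_eq_iff)
qed

lemma fr2_l_right:
  assumes x: "x \<in> carrier_mat p p"
  shows "(\<Sum>j<n. \<Sum>k<n. fr2 (x * l j k)) = cas * fr2 x"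
proof -
  have "fr2 (x * l j k) = fr2 (l k j * adj x)" for j k
  proof -
    have "fr2 (x * l j k) = fr2 (adj (x * l j k))" by simp
    also have "adj (x * l j k) = l k j * adj x" using x by (simp add: mat_adjoint_mult[of _ p p _ p] l_adj)
    finally show ?thesis .
  qed
  then have "(\<Sum>j<n. \<Sum>k<n. fr2 (x * l j k)) = (\<Sum>j<n. \<Sum>k<n. fr2 (l k j * adj x))" by simp
  also have "\<dots> = (\<Sum>k<n. \<Sum>j<n. fr2 (l k j * adj x))" by (rule sum.swap)
  also have "\<dots> = cas * fr2 x" using x by (subst fr2_l_left) auto
  finally show ?thesis .
qed

text \<open>The two square terms are Casimir traces. Only the mixed term depends on the position of
  \<open>x\<close> relative to the representation, and it is the one made nonpositive by
  averaging.\<close>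

lemma Q_expand:
  assumes x: "x \<in> carrier_mat p p"
  shows "Q x = 2 * cas * fr2 x - 2 * (\<Sum>j<n. \<Sum>k<n. Re (tr (adj (l j k * x) * (x * l j k))))"
proof -
  have "Q x = (\<Sum>j<n. \<Sum>k<n. fr2 (l j k * x) + fr2 (x * l j k) - 2 * Re (tr (adj (l j k * x) * (x * l j k))))"
    unfolding Q_def using x by (intro sum.cong refl fr2_minus[of _ p p]) auto
  also have "\<dots> = (\<Sum>j<n. \<Sum>k<n. fr2 (l j k * x)) + (\<Sum>j<n. \<Sum>k<n. fr2 (x * l j k))
      - 2 * (\<Sum>j<n. \<Sum>k<n. Re (tr (adj (l j k * x) * (x * l j k))))"
    by (simp only: sum.distrib sum_subtractf sum_distrib_left)
  finally show ?thesis unfolding fr2_l_left[OF x] fr2_l_right[OF x] by simp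
qed

lemma Q_le:
  assumes x: "x \<in> carrier_mat p p"
  shows "Q x \<le> 4 * cas * fr2 x"
proof -
  have "Q x \<le> (\<Sum>j<n. \<Sum>k<n. 2 * fr2 (l j k * x) + 2 * fr2 (x * l j k))"
    unfolding Q_def using x by (intro sum_mono fr2_minus_le[of _ p p]) auto
  also have "\<dots> = 2 * (\<Sum>j<n. \<Sum>k<n. fr2 (l j k * x)) + 2 * (\<Sum>j<n. \<Sum>k<n. fr2 (x * l j k))"
    by (simp only: sum.distrib sum_distrib_left)
  finally show ?thesis unfolding fr2_l_left[OF x] fr2_l_right[OF x] by (simp add: mult_ac)
qed

lemma sqrt_Q: "sqrt (Q x) = L2_set (\<lambda>(j, k). fr (l j k * x - x * l j k)) ({..<n} \<times> {..<n})"
  unfolding L2_set_def Q_def by (simp add: sum.cartesian_product case_prod_beta)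

lemma Q_triangle:
  assumes x: "x \<in> carrier_mat p p" and y: "y \<in> carrier_mat p p"
  shows "sqrt (Q x) \<le> sqrt (Q y) + sqrt (Q (x - y))"
proof -
  let ?c = "\<lambda>x j k. l j k * x - x * l j k"
  have "fr (?c x j k) \<le> fr (?c y j k) + fr (?c (x - y) j k)" for j k
  proof -
    have "?c x j k = ?c y j k + ?c (x - y) j k"
      unfolding mult_minus_right[OF l_carrier x y] mult_minus_left[OF x y l_carrier]
      using x y carrier_matD[OF x] carrier_matD[OF y] by (intro eq_matI) (auto simp del: index_mult_mat(1))
    then show ?thesis using fr_triangle[of "?c y j k" p p "?c (x - y) j k"] x y by simp
  qed
  then have "sqrt (Q x) \<le> L2_set (\<lambda>q. (case q of (j, k) \<Rightarrow> fr (?c y j k)) + (case q of (j, k) \<Rightarrow> fr (?c (x - y) j k))) ({..<n} \<times> {..<n})"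
    unfolding sqrt_Q by (intro L2_set_mono) auto
  also have "\<dots> \<le> sqrt (Q y) + sqrt (Q (x - y))"
    unfolding sqrt_Q by (rule L2_set_triangle_ineq)
  finally show ?thesis .
qed

text \<open>Conjugating \<open>x\<close> by \<rho>(g) amounts to conjugating every
  \<open>l j k\<close> by the inverse, and that is a unitary change of the basis of matrix
  units.\<close>

lemma Q_conj:
  assumes g: "g \<in> U n" and x: "x \<in> carrier_mat p p"
  shows "Q (\<rho> g * x * adj (\<rho> g)) = Q x"
proof -
  let ?l = "\<lambda>j k. adj (\<rho> g) * l j k * \<rho> g"
  note rg = rU[OF g] rc[OF g]
  have e: "(?l j k * x - x * ?l j k) $$ (a, b) =
      (\<Sum>c<n. \<Sum>d<n. cnj (g $$ (j, c)) * g $$ (k, d) * (l c d * x - x * l c d) $$ (a, b))"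
    if jk: "j < n" "k < n" and ab: "a < p" "b < p" for j k a b
  proof -
    have "(?l j k * x) $$ (a, b) = (\<Sum>i<p. ?l j k $$ (a, i) * x $$ (i, b))"
      using rg x ab by (intro mult_index[of _ p p _ p]) auto
    also have "\<dots> = (\<Sum>i<p. (\<Sum>c<n. \<Sum>d<n. cnj (g $$ (j, c)) * g $$ (k, d) * l c d $$ (a, i)) * x $$ (i, b))"
      by (rule sum.cong[OF refl]) (simp only: lessThan_iff l_rotate[OF g jk ab(1)])
    also have "\<dots> = (\<Sum>c<n. \<Sum>d<n. \<Sum>i<p. cnj (g $$ (j, c)) * g $$ (k, d) * (l c d $$ (a, i) * x $$ (i, b)))"
      by (simp only: sum_distrib_right sum.swap[of _ "{..<n}" "{..<p}"] mult.assoc)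
    also have "\<dots> = (\<Sum>c<n. \<Sum>d<n. cnj (g $$ (j, c)) * g $$ (k, d) * (l c d * x) $$ (a, b))"
      using ab by (simp only: mult_index[OF l_carrier x ab] sum_distrib_left)
    finally have 1: "(?l j k * x) $$ (a, b) = (\<Sum>c<n. \<Sum>d<n. cnj (g $$ (j, c)) * g $$ (k, d) * (l c d * x) $$ (a, b))" .
    have "(x * ?l j k) $$ (a, b) = (\<Sum>i<p. x $$ (a, i) * ?l j k $$ (i, b))"
      using rg x ab by (intro mult_index[of _ p p _ p]) auto
    also have "\<dots> = (\<Sum>i<p. x $$ (a, i) * (\<Sum>c<n. \<Sum>d<n. cnj (g $$ (j, c)) * g $$ (k, d) * l c d $$ (i, b)))"
      by (rule sum.cong[OF refl]) (simp only: lessThan_iff l_rotate[OF g jk _ ab(2)])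
    also have "\<dots> = (\<Sum>c<n. \<Sum>d<n. \<Sum>i<p. cnj (g $$ (j, c)) * g $$ (k, d) * (x $$ (a, i) * l c d $$ (i, b)))"
      by (simp only: sum_distrib_left sum.swap[of _ "{..<n}" "{..<p}"] mult.assoc mult.left_commute[of "x $$ q" for q])
    also have "\<dots> = (\<Sum>c<n. \<Sum>d<n. cnj (g $$ (j, c)) * g $$ (k, d) * (x * l c d) $$ (a, b))"
      using ab by (simp only: mult_index[OF x l_carrier ab] sum_distrib_left)
    finally have 2: "(x * ?l j k) $$ (a, b) = (\<Sum>c<n. \<Sum>d<n. cnj (g $$ (j, c)) * g $$ (k, d) * (x * l c d) $$ (a, b))" .
    have 3: "(A - B) $$ (a, b) = A $$ (a, b) - B $$ (a, b)" if "B \<in> carrier_mat p p" for A B :: "complex mat"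
      using that ab by simp
    have 4: "(?l j k * x - x * ?l j k) $$ (a, b) = (?l j k * x) $$ (a, b) - (x * ?l j k) $$ (a, b)"
      using rg x by (intro 3) simp
    have 5: "(l c d * x - x * l c d) $$ (a, b) = (l c d * x) $$ (a, b) - (x * l c d) $$ (a, b)" for c d
      using x by (intro 3) simp
    show ?thesis unfolding 4 5 1 2 by (simp only: right_diff_distrib sum_subtractf)
  qed
  have c: "fr2 (l j k * (\<rho> g * x * adj (\<rho> g)) - \<rho> g * x * adj (\<rho> g) * l j k) = fr2 (?l j k * x - x * ?l j k)" for j k
  proof -
    have "\<rho> g * (?l j k * x - x * ?l j k) * adj (\<rho> g) = l j k * (\<rho> g * x * adj (\<rho> g)) - \<rho> g * x * adj (\<rho> g) * l j k"
      using rg x by (simp add: mult_minus_right[of _ p p _ p] mult_minus_left[of _ p p _ _ p]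
          assoc_mult_mat[of _ p p _ p _ p] U_left_cancel[of _ p _ p] U_right U_right_cancel[of _ p _ p])
    moreover have "fr2 (\<rho> g * (?l j k * x - x * ?l j k) * adj (\<rho> g)) = fr2 (?l j k * x - x * ?l j k)"
      using rg x by (simp add: fr2_U_right[of _ p _ p] fr2_U_left[of _ p _ p])
    ultimately show ?thesis by simp
  qed
  have f: "fr2 A = (\<Sum>a<p. \<Sum>b<p. (cmod (A $$ (a, b)))\<^sup>2)" if "A \<in> carrier_mat p p" for A
    by (rule fr2_carrier[OF that])
  have "Q (\<rho> g * x * adj (\<rho> g)) = (\<Sum>j<n. \<Sum>k<n. \<Sum>a<p. \<Sum>b<p. (cmod ((?l j k * x - x * ?l j k) $$ (a, b)))\<^sup>2)"
    unfolding Q_def c using rg x by (intro sum.cong refl f) simp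
  also have "\<dots> = (\<Sum>a<p. \<Sum>b<p. \<Sum>j<n. \<Sum>k<n. (cmod ((?l j k * x - x * ?l j k) $$ (a, b)))\<^sup>2)"
    by (simp only: sum.swap[of _ "{..<p}" "{..<n}"])
  also have "\<dots> = (\<Sum>a<p. \<Sum>b<p. \<Sum>c<n. \<Sum>d<n. (cmod ((l c d * x - x * l c d) $$ (a, b)))\<^sup>2)"
  proof (rule sum.cong[OF refl], rule sum.cong[OF refl])
    fix a b assume "a \<in> {..<p}" "b \<in> {..<p}"
    then have ab: "a < p" "b < p" by auto
    have "(\<Sum>j<n. \<Sum>k<n. (cmod ((?l j k * x - x * ?l j k) $$ (a, b)))\<^sup>2) =
      (\<Sum>j<n. \<Sum>k<n. (cmod (\<Sum>c<n. \<Sum>d<n. cnj (g $$ (j, c)) * g $$ (k, d) * (l c d * x - x * l c d) $$ (a, b)))\<^sup>2)"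
      by (rule sum.cong[OF refl], rule sum.cong[OF refl]) (simp only: lessThan_iff e[OF _ _ ab])
    then show "(\<Sum>j<n. \<Sum>k<n. (cmod ((?l j k * x - x * ?l j k) $$ (a, b)))\<^sup>2) =
       (\<Sum>c<n. \<Sum>d<n. (cmod ((l c d * x - x * l c d) $$ (a, b)))\<^sup>2)"
      unfolding sum_norm_basis_change[OF g] .
  qed
  also have "\<dots> = (\<Sum>c<n. \<Sum>d<n. \<Sum>a<p. \<Sum>b<p. (cmod ((l c d * x - x * l c d) $$ (a, b)))\<^sup>2)"
    by (simp only: sum.swap[of _ "{..<p}" "{..<n}"])
  also have "\<dots> = Q x"
    unfolding Q_def using x by (intro sum.cong refl f[symmetric]) simp
  finally show ?thesis .
qed

text \<open>Subtracting the scalar \<open>f\<close> does not affect commutators. As \<rho>(t)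
  conjugates \<open>E j k\<close> into its multiple by t_j / t_k, the commutator has squared norm B
  |t_j - t_k|^2, and the diagonal \<open>l j j\<close> commute with \<rho>(t).\<close>

lemma Q_torus:
  assumes t: "\<And>j. j < n \<Longrightarrow> cmod (t j) = 1"
  shows "Q (diagm p (\<lambda>a. chi n t (\<mu> a) - f)) = B * (2 * (real n)\<^sup>2 - 2 * (cmod (\<Sum>j<n. t j))\<^sup>2)"
proof -
  let ?x = "diagm p (\<lambda>a. chi n t (\<mu> a) - f)"
  have commutator: "fr2 (l j k * ?x - ?x * l j k) = B * (cmod (t j - t k))\<^sup>2" if jk: "j < n" "k < n" for j k
  proof -
    have ent: "(l j k * ?x - ?x * l j k) $$ (a, b) = l j k $$ (a, b) * (chi n t (\<mu> b) - chi n t (\<mu> a))"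
      if ab: "a < p" "b < p" for a b
      using ab by (simp add: diagm_right[of _ p] diagm_left[of _ p p] algebra_simps del: index_mult_mat(1))
    show ?thesis
    proof (cases "j = k")
      case True
      have "l j k $$ (a, b) * (chi n t (\<mu> b) - chi n t (\<mu> a)) = 0" if ab: "a < p" "b < p" for a b
        using True jk ab by (auto simp: l_index E_diag)
      then have "fr2 (l j k * ?x - ?x * l j k) = (\<Sum>a<p. \<Sum>b<p. 0)"
        by (subst fr2_carrier[of _ p p], simp, intro sum.cong refl) (simp only: lessThan_iff ent, simp)
      then show ?thesis using True by simp
    next
      case False
      have nt: "cmod (chi n t (\<mu> b)) = 1" for b by (rule norm_chi) (rule t)
      have "(cmod (l j k $$ (a, b) * (chi n t (\<mu> b) - chi n t (\<mu> a))))\<^sup>2 = (cmod (t j - t k))\<^sup>2 * (cmod (E j k $$ (a, b)))\<^sup>2"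
        if ab: "a < p" "b < p" for a b
      proof -
        have c1: "z * cnj z = 1" "cnj z * z = 1" if "cmod z = 1" for z
          using that complex_norm_square[of z] by (simp_all add: mult.commute)
        have "chi n t (\<mu> a) * E j k $$ (a, b) * cnj (chi n t (\<mu> b)) * chi n t (\<mu> b) = chi n t (\<mu> a) * E j k $$ (a, b)"
          by (simp only: mult.assoc c1[OF nt] mult_1_right)
        then have "E j k $$ (a, b) * (chi n t (\<mu> b) - chi n t (\<mu> a)) =
            (E j k $$ (a, b) - chi n t (\<mu> a) * E j k $$ (a, b) * cnj (chi n t (\<mu> b))) * chi n t (\<mu> b)"
          by (simp add: left_diff_distrib right_diff_distrib mult.commute)
        also have "\<dots> = E j k $$ (a, b) * (t k - t j) * (cnj (t k) * chi n t (\<mu> b))"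
        proof -
          have "(t k - t j) * cnj (t k) = 1 - t j * cnj (t k)" using c1[OF t[OF jk(2)]] by (simp add: left_diff_distrib)
          then have "E j k $$ (a, b) * (t k - t j) * (cnj (t k) * chi n t (\<mu> b)) = E j k $$ (a, b) * (1 - t j * cnj (t k)) * chi n t (\<mu> b)"
            by (metis mult.assoc)
          moreover have tor: "chi n t (\<mu> a) * E j k $$ (a, b) * cnj (chi n t (\<mu> b)) = t j * cnj (t k) * E j k $$ (a, b)"
            by (rule E_torus[OF jk t ab])
          ultimately show ?thesis unfolding tor by (simp only: left_diff_distrib right_diff_distrib mult_1_right mult_1_left mult_ac)
        qed
        finally have "cmod (E j k $$ (a, b) * (chi n t (\<mu> b) - chi n t (\<mu> a))) = cmod (E j k $$ (a, b)) * cmod (t k - t j)"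
          by (simp only: norm_mult nt t[OF jk(2)] complex_mod_cnj mult_1_right)
        then show ?thesis using False ab by (simp add: l_index power_mult_distrib norm_minus_commute mult.commute)
      qed
      then have "fr2 (l j k * ?x - ?x * l j k) = (\<Sum>a<p. \<Sum>b<p. (cmod (t j - t k))\<^sup>2 * (cmod (E j k $$ (a, b)))\<^sup>2)"
        by (subst fr2_carrier[of _ p p], simp, intro sum.cong refl) (simp only: lessThan_iff ent)
      also have "\<dots> = (cmod (t j - t k))\<^sup>2 * fr2 (E j k)"
        unfolding fr2_carrier[OF E_carrier] by (simp only: sum_distrib_left)
      finally show ?thesis using fr2_E[OF jk False] by simp
    qed
  qed
  have e: "(cmod (x - y))\<^sup>2 = (cmod x)\<^sup>2 + (cmod y)\<^sup>2 - 2 * Re (x * cnj y)" for x y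
    unfolding cmod_power2 by (simp add: power2_eq_square algebra_simps)
  have "(\<Sum>j<n. \<Sum>k<n. (cmod (t j - t k))\<^sup>2) = (\<Sum>j<n. \<Sum>k<n. 2 - 2 * Re (t j * cnj (t k)))"
    unfolding e using t by (intro sum.cong refl) auto
  also have "\<dots> = 2 * (real n)\<^sup>2 - 2 * Re (\<Sum>j<n. \<Sum>k<n. t j * cnj (t k))"
    by (simp add: sum_subtractf sum_distrib_left power2_eq_square)
  also have "(\<Sum>j<n. \<Sum>k<n. t j * cnj (t k)) = (\<Sum>j<n. t j) * cnj (\<Sum>j<n. t j)"
    by (simp add: sum_product)
  also have "Re \<dots> = (cmod (\<Sum>j<n. t j))\<^sup>2" by (simp add: complex_mult_cnj cmod_power2 del: cnj_sum)
  finally have s: "(\<Sum>j<n. \<Sum>k<n. (cmod (t j - t k))\<^sup>2) = 2 * (real n)\<^sup>2 - 2 * (cmod (\<Sum>j<n. t j))\<^sup>2" .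
  have "Q ?x = (\<Sum>j<n. \<Sum>k<n. B * (cmod (t j - t k))\<^sup>2)"
    unfolding Q_def using commutator by (intro sum.cong refl) auto
  also have "\<dots> = B * (\<Sum>j<n. \<Sum>k<n. (cmod (t j - t k))\<^sup>2)" by (simp only: sum_distrib_left)
  finally show ?thesis unfolding s .
qed

text \<open>\<open>Q\<close> is evaluated at two nearby conjugates of \<open>x\<close>. At a
  decorrelated conjugate \<open>y\<close> it is at least 2 \<open>cas\<close> times the squared
  norm; at the conjugate \<open>y'\<close> by a nearby \<rho>(g) it equals \<open>Q x\<close>, which
  the torus formula gives. The seminorm \<open>sqrt Q\<close> passes from one to the other.\<close>

lemma casimir_inequality:
  assumes dense: "dense_within n p \<rho> c" and c: "0 \<le> c" "c \<le> sqrt (real p) / 10"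
    and t: "\<And>j. j < n \<Longrightarrow> cmod (t j) = 1"
  shows "1 - (cmod (\<Sum>a<p. chi n t (\<mu> a)))\<^sup>2 / (real p)\<^sup>2 \<le>
    ((real n)\<^sup>2 - (cmod (\<Sum>j<n. t j))\<^sup>2) / ((real n)\<^sup>2 - 1) + 10 * (c / sqrt (real p))"
proof -
  let ?c = "\<lambda>a. chi n t (\<mu> a)"
  define f where "f = (\<Sum>a<p. ?c a) / of_nat p"
  define x where "x = diagm p (\<lambda>a. ?c a - f)"
  have xc [simp]: "x \<in> carrier_mat p p" by (simp add: x_def)
  have nt: "cmod (?c b) = 1" for b by (rule norm_chi) (rule t)
  define T where "T = diagm p ?c"
  have TU: "T \<in> U p" unfolding T_def by (rule diagm_U) (rule nt)
  have xT: "x = T - f \<cdot>\<^sub>m 1\<^sub>m p" by (simp add: x_def T_def diagm_minus flip: diagm_const)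
  have x0: "(\<Sum>a<p. ?c a - f) = 0" using p2 by (simp add: f_def sum_subtractf)
  define F where "F = 1 - (cmod f)\<^sup>2"
  have fx: "fr2 x = real p * F"
  proof -
    have e: "(cmod (y - f))\<^sup>2 = (cmod y)\<^sup>2 + (cmod f)\<^sup>2 - 2 * Re (cnj f * y)" for y
      unfolding cmod_power2 by (simp add: power2_eq_square algebra_simps)
    have "fr2 x = (\<Sum>a<p. 1 + (cmod f)\<^sup>2 - 2 * Re (cnj f * ?c a))"
      unfolding x_def fr2_diagm e nt by simp
    also have "\<dots> = real p * (1 + (cmod f)\<^sup>2) - 2 * Re (cnj f * (\<Sum>a<p. ?c a))"
      by (simp only: sum_subtractf sum_constant card_lessThan sum_distrib_left Re_sum)
    also have "(\<Sum>a<p. ?c a) = of_nat p * f" using p2 by (simp add: f_def)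
    also have "Re (cnj f * (of_nat p * f)) = real p * (cmod f)\<^sup>2"
      unfolding cmod_power2 by (simp add: power2_eq_square algebra_simps)
    finally show ?thesis by (simp add: F_def algebra_simps)
  qed
  have F0: "F \<ge> 0"
  proof (rule ccontr)
    assume "\<not> F \<ge> 0"
    then have "real p * F < 0" using p2 by (simp add: mult_pos_neg)
    then show False using fx fr2_nonneg[of x] by simp
  qed
  \<comment> \<open>The averaging over monomial matrices needs zero diagonal, which the Fourier
    matrix provides for the traceless \<open>x\<close>.\<close>
  define M where "M = dft p * x * adj (dft p)"
  have Mc: "M \<in> carrier_mat p p" by (simp add: M_def)
  have M0: "M $$ (a, a) = 0" if "a < p" for a
    unfolding M_def x_def by (rule dft_zero_diagonal[OF x0 that])
  obtain W where W: "W \<in> U p" and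
    W0: "(\<Sum>i\<in>{..<n} \<times> {..<n}. Re (tr (adj (case_prod l i * (W * M * adj W)) * ((W * M * adj W) * case_prod l i)))) \<le> 0"
    using exists_decorrelating_unitary[OF Mc M0, of "{..<n} \<times> {..<n}" "case_prod l"] tr_l by auto
  define z where "z = W * dft p"
  have z: "z \<in> U p" using W dft_U by (simp add: z_def)
  define y where "y = z * x * adj z"
  have yc [simp]: "y \<in> carrier_mat p p" using z by (simp add: y_def)
  have yM: "y = W * M * adj W"
    using W unfolding y_def z_def M_def
    by (simp add: mat_adjoint_mult[of _ p p _ p] assoc_mult_mat[of _ p p _ p _ p])
  have fy: "fr2 y = fr2 x" using z by (simp add: y_def fr2_U_right[of _ p _ p] fr2_U_left[of _ p _ p])
  have W1: "(\<Sum>j<n. \<Sum>k<n. Re (tr (adj (l j k * y) * (y * l j k)))) \<le> 0"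
    using W0 unfolding yM[symmetric] by (simp add: sum.cartesian_product case_prod_beta)
  have Qy: "2 * cas * (real p * F) \<le> Q y" using Q_expand[OF yc] W1 unfolding fy fx by linarith
  obtain g where g: "g \<in> U n" "fr (\<rho> g - z) \<le> c" using dense z unfolding dense_within_def by blast
  define y' where "y' = \<rho> g * x * adj (\<rho> g)"
  have y'c [simp]: "y' \<in> carrier_mat p p" using g by (simp add: y'_def)
  \<comment> \<open>The scalar part of \<open>x\<close> is fixed by conjugation, so the two
    conjugates differ as those of the unitary \<open>T\<close> do.\<close>
  have conjx: "h * x * adj h = h * T * adj h - f \<cdot>\<^sub>m 1\<^sub>m p" if h: "h \<in> U p" for h
    unfolding xT using h TU U_carrier[OF h]
    by (simp add: mult_minus_right[of _ p p _ p] mult_minus_left[of _ p p _ _ p] smult_mult_mult[of _ p]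
        right_mult_one_mat[of _ p p] U_right[OF h])
  have "y - y' = z * T * adj z - \<rho> g * T * adj (\<rho> g)"
    unfolding y_def y'_def conjx[OF z] conjx[OF rU[OF g(1)]]
    using carrier_matD[OF U_carrier[OF z]] carrier_matD[OF rc[OF g(1)]]
    by (intro eq_matI) (auto simp del: index_mult_mat(1))
  then have "fr (y - y') \<le> 2 * fr (z - \<rho> g)" using fr_conj_diff[OF z rU[OF g(1)] TU] by simp
  also have "\<dots> \<le> 2 * c" using g z by (simp add: fr_minus_commute[of z p p])
  finally have d: "fr (y - y') \<le> 2 * c" .
  have "sqrt (Q (y - y')) \<le> sqrt (4 * cas * fr2 (y - y'))" by (intro real_sqrt_le_mono Q_le) simp
  also have "\<dots> = 2 * sqrt cas * fr (y - y')" by (simp add: real_sqrt_mult fr_def)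
  also have "\<dots> \<le> 2 * sqrt cas * (2 * c)" using d cas_pos by (intro mult_left_mono) auto
  finally have q1: "sqrt (Q (y - y')) \<le> 4 * sqrt cas * c" by simp
  have Qy': "Q y' = B * (2 * (real n)\<^sup>2 - 2 * (cmod (\<Sum>j<n. t j))\<^sup>2)"
  proof -
    have "Q y' = Q x" unfolding y'_def by (rule Q_conj[OF g(1) xc])
    also have "\<dots> = B * (2 * (real n)\<^sup>2 - 2 * (cmod (\<Sum>j<n. t j))\<^sup>2)"
      unfolding x_def by (rule Q_torus) (rule t)
    finally show ?thesis .
  qed
  define A where "A = ((real n)\<^sup>2 - (cmod (\<Sum>j<n. t j))\<^sup>2) / ((real n)\<^sup>2 - 1)"
  have n1: "(real n)\<^sup>2 \<ge> 4" using power_mono[of 2 "real n" 2] n2 by simp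
  have p0: "real p > 0" using p2 by simp
  have QA: "Q y' = 2 * cas * real p * A"
    unfolding Qy' A_def cas_def using n1 p0 by (simp add: field_simps)
  have "sqrt (2 * cas * (real p * F)) \<le> sqrt (Q y)" using Qy by simp
  also have "\<dots> \<le> sqrt (Q y') + sqrt (Q (y - y'))" by (rule Q_triangle) simp_all
  also have "\<dots> \<le> sqrt (2 * cas * real p * A) + 4 * sqrt cas * c" using q1 QA by simp
  finally have chain: "sqrt (2 * cas * (real p * F)) \<le> sqrt (2 * cas * real p * A) + 4 * sqrt cas * c" .
  then have "sqrt (2 * cas * p) * sqrt F \<le> sqrt (2 * cas * p) * (sqrt A + 2 * sqrt 2 * (c / sqrt p))"
  proof -
    have "sqrt (2 * cas * p) * (2 * sqrt 2 * (c / sqrt p)) = 2 * (sqrt 2 * sqrt 2) * sqrt cas * c * (sqrt p / sqrt p)"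
      by (simp only: real_sqrt_mult times_divide_eq_right times_divide_eq_left mult_ac)
    also have "\<dots> = 4 * sqrt cas * c" using p0 by simp
    finally show ?thesis using chain
      by (simp add: distrib_left real_sqrt_mult mult.assoc)
  qed
  then have m: "sqrt F \<le> sqrt A + 2 * sqrt 2 * (c / sqrt p)"
    using cas_pos p0 by (simp add: mult_le_cancel_left_pos)
  define e where "e = c / sqrt (real p)"
  have e: "0 \<le> e" "e \<le> 1 / 10" using c p0 by (auto simp: e_def field_simps)
  have A0: "A \<ge> 0"
  proof -
    have "0 \<le> 2 * cas * real p * A" using Q_nonneg[of y'] QA by simp
    moreover have "0 < 2 * cas * real p" using cas_pos p0 by simp
    ultimately show ?thesis by (simp only: zero_le_mult_iff) linarith
  qed
  have A1: "A \<le> 4 / 3"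
  proof -
    have "A \<le> (real n)\<^sup>2 / ((real n)\<^sup>2 - 1)" unfolding A_def using n1 by (intro divide_right_mono) auto
    also have "\<dots> \<le> 4 / 3" using n1 by (simp add: field_simps)
    finally show ?thesis .
  qed
  have s2: "sqrt 2 \<le> 3 / 2" by (rule real_le_lsqrt) (auto simp: power2_eq_square)
  have sA: "sqrt A \<le> 6 / 5"
    using A1 by (intro real_le_lsqrt) (auto simp: power2_eq_square)
  have "F = (sqrt F)\<^sup>2" using F0 by simp
  also have "\<dots> \<le> (sqrt A + 2 * sqrt 2 * e)\<^sup>2" using m F0 unfolding e_def by (intro power_mono) auto
  also have "\<dots> = A + 4 * (sqrt 2 * sqrt A) * e + 8 * (e * e)"
    using A0 by (simp add: power2_eq_square algebra_simps)
  \<comment> \<open>The error terms add up to 8 \<open>e\<close>, rounded up to 10 \<open>e\<close>;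
    the bound 6/5 for \<open>sqrt A\<close> comes from \<open>A \<le> 4 / 3\<close>, valid as
    \<open>n\<close> is at least 2.\<close>
  also have "\<dots> \<le> A + 4 * ((3 / 2) * (6 / 5)) * e + 8 * ((1 / 10) * e)"
    using s2 sA e A0 by (intro add_mono mult_mono order_refl mult_left_mono mult_right_mono) auto
  also have "\<dots> \<le> A + 10 * e" using e by simp
  finally have "F \<le> A + 10 * e" .
  then show ?thesis unfolding F_def A_def e_def f_def by (simp add: norm_divide power_divide)
qed

end

subsection \<open>Averaging over the torus\<close>

lemma average_square:
  fixes e :: "nat \<Rightarrow> nat \<Rightarrow> int"
  assumes q: "\<And>a b j. a < m \<Longrightarrow> b < m \<Longrightarrow> j < n \<Longrightarrow> \<bar>e a j - e b j\<bar> + 1 < int q"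
  shows "(\<Sum>r\<in>grid n q. gridw n q r * (cmod (\<Sum>a<m. chi n (gridt q r) (e a)))\<^sup>2) =
    (\<Sum>a<m. \<Sum>b<m. \<Prod>j<n. cosfac (e a j - e b j))"
proof -
  have s: "complex_of_real ((cmod (\<Sum>a<m. chi n (gridt q r) (e a)))\<^sup>2) = (\<Sum>a<m. \<Sum>b<m. chi n (gridt q r) (\<lambda>j. e a j - e b j))" for r
  proof -
    have "complex_of_real ((cmod (\<Sum>a<m. chi n (gridt q r) (e a)))\<^sup>2) =
        (\<Sum>a<m. \<Sum>b<m. chi n (gridt q r) (e a) * cnj (chi n (gridt q r) (e b)))"
      unfolding complex_norm_square cnj_sum by (rule sum_product)
    then show ?thesis by (simp add: chi_diff)
  qed
  have "complex_of_real (\<Sum>r\<in>grid n q. gridw n q r * (cmod (\<Sum>a<m. chi n (gridt q r) (e a)))\<^sup>2) =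
      (\<Sum>r\<in>grid n q. \<Sum>a<m. \<Sum>b<m. complex_of_real (gridw n q r) * chi n (gridt q r) (\<lambda>j. e a j - e b j))"
    by (simp only: of_real_sum of_real_mult s sum_distrib_left)
  also have "\<dots> = (\<Sum>a<m. \<Sum>b<m. \<Sum>r\<in>grid n q. complex_of_real (gridw n q r) * chi n (gridt q r) (\<lambda>j. e a j - e b j))"
    by (simp only: sum.swap[of _ "{..<m}" "grid n q"])
  also have "\<dots> = (\<Sum>a<m. \<Sum>b<m. complex_of_real (\<Prod>j<n. cosfac (e a j - e b j)))"
    by (rule sum.cong[OF refl], rule sum.cong[OF refl], rule coslaw_average) (use q in auto)
  finally show ?thesis by (simp only: of_real_eq_iff flip: of_real_sum)
qed

definition weq :: "nat \<Rightarrow> (nat \<Rightarrow> int) \<Rightarrow> (nat \<Rightarrow> int) \<Rightarrow> bool" where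
  "weq n c d \<longleftrightarrow> (\<forall>j<n. c j = d j)"

definition root_apart :: "nat \<Rightarrow> (nat \<Rightarrow> int) \<Rightarrow> (nat \<Rightarrow> int) \<Rightarrow> bool" where
  "root_apart n c d \<longleftrightarrow> (\<exists>i<n. \<exists>k<n. i \<noteq> k \<and>
     (\<forall>j<n. c j = d j + (if j = i then 1 else 0) - (if j = k then 1 else 0)))"

text \<open>Bounds for the cosine-weighted mean of one character times the conjugate of another:
  each coordinate in which they differ contributes a factor of at most 1/2, so two such coordinates
  give 1/4 and four give 1/16.\<close>

definition pair_bound :: "nat \<Rightarrow> (nat \<Rightarrow> int) \<Rightarrow> (nat \<Rightarrow> int) \<Rightarrow> real" where
  "pair_bound n c d = (if weq n c d then 1 else if root_apart n c d then 1 / 4 else 1 / 16)"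

lemma prod_cosfac_le:
  assumes "finite Z" shows "(\<Prod>j\<in>Z. cosfac (d j)) \<le> (1 / 2) ^ card {j\<in>Z. d j \<noteq> 0}"
proof -
  have "(\<Prod>j\<in>Z. cosfac (d j)) = (\<Prod>j | j \<in> Z \<and> d j \<noteq> 0. cosfac (d j))"
    using assms by (intro prod.mono_neutral_right) (auto simp: cosfac_def)
  also have "\<dots> \<le> (\<Prod>j | j \<in> Z \<and> d j \<noteq> 0. 1 / 2)"
    by (intro prod_mono) (auto simp: cosfac_def)
  finally show ?thesis by simp
qed

text \<open>A nonzero vector with entries in \<open>{-1, 0, 1}\<close> and sum zero is a root or has at least four
  nonzero entries.\<close>

lemma prod_cosfac_pair_bound:
  assumes sum: "(\<Sum>j<n. c j) = (\<Sum>j<n. d j)"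
  shows "(\<Prod>j<n. cosfac (c j - d j)) \<le> pair_bound n c d"
proof -
  define x where "x j = c j - d j" for j
  define Z where "Z = {j\<in>{..<n}. x j \<noteq> 0}"
  have Z: "finite Z" "Z \<subseteq> {..<n}" by (auto simp: Z_def)
  have le: "(\<Prod>j<n. cosfac (x j)) \<le> (1 / 2) ^ card Z" unfolding Z_def by (rule prod_cosfac_le) simp
  have big: "(\<Prod>j<n. cosfac (x j)) = 0" if "i < n" "\<bar>x i\<bar> \<noteq> 0" "\<bar>x i\<bar> \<noteq> 1" for i
    using that by (intro prod_zero) (auto simp: cosfac_def intro!: bexI[of _ i])
  have xs: "(\<Sum>j\<in>Z. x j) = 0"
  proof -
    have "(\<Sum>j\<in>Z. x j) = (\<Sum>j<n. x j)" unfolding Z_def by (intro sum.mono_neutral_left) auto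
    then show ?thesis using sum by (simp add: x_def sum_subtractf)
  qed
  have x0: "x j = 0" if "j < n" "j \<notin> Z" for j using that by (auto simp: Z_def)
  have pb: "pair_bound n c d \<ge> 1 / 16" by (simp add: pair_bound_def)
  have "(\<Prod>j<n. cosfac (x j)) \<le> pair_bound n c d"
  proof (cases "\<exists>i<n. \<bar>x i\<bar> \<noteq> 0 \<and> \<bar>x i\<bar> \<noteq> 1")
    case True
    then obtain i where "i < n" "\<bar>x i\<bar> \<noteq> 0" "\<bar>x i\<bar> \<noteq> 1" by blast
    then have "(\<Prod>j<n. cosfac (x j)) = 0" by (rule big)
    then show ?thesis using pb by linarith
  next
    case False
    then have one: "\<bar>x j\<bar> = 1" if "j \<in> Z" for j using that unfolding Z_def by auto
    consider "card Z = 0" | "card Z = 1" | "card Z = 2" | "card Z = 3" | "card Z \<ge> 4" by linarith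
    then show ?thesis
    proof cases
      case 1
      then have "weq n c d" using Z x0 by (auto simp: weq_def x_def)
      then show ?thesis using le 1 by (simp add: pair_bound_def)
    next
      case 2
      then obtain i where "Z = {i}" using card_1_singletonE by blast
      then show ?thesis using xs one[of i] by simp
    next
      case 3
      then obtain i k where ik: "Z = {i, k}" "i \<noteq> k" by (auto simp: card_2_iff)
      have "x i + x k = 0" using xs ik by simp
      moreover have "\<bar>x i\<bar> = 1" "\<bar>x k\<bar> = 1" using one ik by auto
      ultimately have "x i = 1 \<and> x k = -1 \<or> x k = 1 \<and> x i = -1" by linarith
      then obtain i' k' where ik': "Z = {i', k'}" "i' \<noteq> k'" "x i' = 1" "x k' = -1" using ik by blast
      have "c j = d j + (if j = i' then 1 else 0) - (if j = k' then 1 else 0)" if "j < n" for j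
        using ik' x0[OF that] by (auto simp: x_def)
      then have "root_apart n c d" unfolding root_apart_def using ik' Z by blast
      then show ?thesis using le 3 by (simp add: pair_bound_def power2_eq_square)
    next
      case 4
      then obtain i k l where ikl: "Z = {i, k, l}" "i \<noteq> k" "i \<noteq> l" "k \<noteq> l" by (auto simp: card_3_iff)
      have "x i + x k + x l = 0" using xs ikl by simp
      moreover have "\<bar>x i\<bar> = 1" "\<bar>x k\<bar> = 1" "\<bar>x l\<bar> = 1" using one ikl by auto
      ultimately show ?thesis by linarith
    next
      case 5
      have "(1 / 2 :: real) ^ card Z \<le> (1 / 2) ^ 4" using 5 by (intro power_decreasing) auto
      also have "\<dots> \<le> pair_bound n c d" using pb by (simp add: power4_eq_xxxx)
      finally show ?thesis using le by linarith
    qed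
  qed
  then show ?thesis by (simp only: x_def)
qed

lemma prod_cosfac_units:
  assumes "j < n" "k < (n :: nat)"
  shows "(\<Prod>i<n. cosfac ((if i = j then 1 else 0) - (if i = k then 1 else 0))) = (if j = k then 1 else 1 / 4)"
proof (cases "j = k")
  case True
  then show ?thesis by (auto simp: cosfac_def intro!: prod.neutral)
next
  case False
  have "(\<Prod>i<n. cosfac ((if i = j then 1 else 0) - (if i = k then 1 else 0))) = (\<Prod>i\<in>{j, k}. cosfac ((if i = j then 1 else 0) - (if i = k then 1 else 0)))"
    using assms by (intro prod.mono_neutral_right) (auto simp: cosfac_def)
  then show ?thesis using False by (simp add: cosfac_def)
qed

lemma chi_unit: "j < n \<Longrightarrow> chi n t (\<lambda>i. if i = j then 1 else 0) = t j"
proof -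
  assume j: "j < n"
  have "chi n t (\<lambda>i. if i = j then 1 else 0) = (\<Prod>i<n. if i = j then t i else 1)"
    unfolding chi_def by (intro prod.cong) auto
  then show ?thesis using j by simp
qed

context irr_weight_rep
begin

text \<open>The Casimir inequality averaged over the grid. Both squared moduli become sums over
  pairs; for the standard character the mean is n + n (n - 1) / 4, since two distinct unit vectors
  always differ by a root.\<close>

lemma pair_inequality:
  assumes dense: "dense_within n p \<rho> c" and c: "0 \<le> c" "c \<le> sqrt (real p) / 10"
  shows "(real p)\<^sup>2 * (1 / 4 + 3 / (4 * (real n + 1)) - 10 * (c / sqrt (real p))) \<le>
    (\<Sum>a<p. \<Sum>b<p. pair_bound n (\<mu> a) (\<mu> b))"
proof -
  \<comment> \<open>Exceeds every difference of weights by at least 3, which leaves room for the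
    shift caused by the cosine and also covers differences of unit vectors.\<close>
  define q where "q = nat (3 + (\<Sum>a<p. \<Sum>b<p. \<Sum>j<n. \<bar>\<mu> a j - \<mu> b j\<bar>))"
  have q: "\<bar>\<mu> a j - \<mu> b j\<bar> + 1 < int q" if "a < p" "b < p" "j < n" for a b j
  proof -
    have "\<bar>\<mu> a j - \<mu> b j\<bar> \<le> (\<Sum>j<n. \<bar>\<mu> a j - \<mu> b j\<bar>)" using that by (intro member_le_sum) auto
    also have "\<dots> \<le> (\<Sum>b<p. \<Sum>j<n. \<bar>\<mu> a j - \<mu> b j\<bar>)" using that by (intro member_le_sum sum_nonneg) auto
    also have "\<dots> \<le> (\<Sum>a<p. \<Sum>b<p. \<Sum>j<n. \<bar>\<mu> a j - \<mu> b j\<bar>)" using that by (intro member_le_sum sum_nonneg) auto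
    finally show ?thesis by (simp add: q_def)
  qed
  have q2: "2 < int q"
  proof -
    have "0 \<le> (\<Sum>a<p. \<Sum>b<p. \<Sum>j<n. \<bar>\<mu> a j - \<mu> b j\<bar>)" by (intro sum_nonneg) auto
    then show ?thesis by (simp add: q_def)
  qed
  let ?w = "gridw n q" and ?t = "gridt q"
  define d' where "d' = c / sqrt (real p)"
  have p0: "real p > 0" using p2 by simp
  have n1: "real n \<ge> 2" using n2 by simp
  have n1': "(real n)\<^sup>2 - 1 > 0" using power_mono[of 2 "real n" 2] n1 by simp
  have tot: "(\<Sum>r\<in>grid n q. ?w r) = 1"
  proof -
    have "(\<Sum>r\<in>grid n q. complex_of_real (?w r) * chi n (?t r) (\<lambda>_. 0)) = complex_of_real (\<Prod>j<n. cosfac 0)"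
      using q2 by (intro coslaw_average) auto
    then have "complex_of_real (\<Sum>r\<in>grid n q. ?w r) = complex_of_real 1" by (simp add: chi_def cosfac_def)
    then show ?thesis by (simp only: of_real_eq_iff)
  qed
  have av1: "(\<Sum>r\<in>grid n q. ?w r * (cmod (\<Sum>a<p. chi n (?t r) (\<mu> a)))\<^sup>2) = (\<Sum>a<p. \<Sum>b<p. \<Prod>j<n. cosfac (\<mu> a j - \<mu> b j))"
    by (rule average_square[OF q])
  have av2: "(\<Sum>r\<in>grid n q. ?w r * (cmod (\<Sum>j<n. ?t r j))\<^sup>2) = real n * (1 + (real n - 1) / 4)"
  proof -
    have "(\<Sum>r\<in>grid n q. ?w r * (cmod (\<Sum>j<n. ?t r j))\<^sup>2) =
        (\<Sum>r\<in>grid n q. ?w r * (cmod (\<Sum>j<n. chi n (?t r) (\<lambda>i. if i = j then 1 else 0)))\<^sup>2)"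
      by (simp add: chi_unit)
    also have "\<dots> = (\<Sum>j<n. \<Sum>k<n. \<Prod>i<n. cosfac ((if i = j then 1 else 0) - (if i = k then 1 else 0)))"
      using q2 by (intro average_square) auto
    also have "\<dots> = (\<Sum>j<n. \<Sum>k<n. if j = k then 1 else 1 / 4)"
      by (rule sum.cong[OF refl], rule sum.cong[OF refl]) (simp only: lessThan_iff prod_cosfac_units)
    also have "\<dots> = (\<Sum>j<n. 1 + (real n - 1) / 4)"
    proof (rule sum.cong[OF refl])
      fix j assume "j \<in> {..<n}"
      then have "(\<Sum>k<n. if j = k then 1 else 1 / 4 :: real) = (\<Sum>k<n. (if j = k then 3 / 4 else 0) + 1 / 4)"
        by (intro sum.cong) auto
      also have "\<dots> = 3 / 4 + real n / 4" using \<open>j \<in> {..<n}\<close> by (simp add: sum.distrib)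
      finally show "(\<Sum>k<n. if j = k then 1 else 1 / 4) = 1 + (real n - 1) / 4" by (simp add: field_simps)
    qed
    finally show ?thesis by simp
  qed
  have pt: "?w r * (1 - 10 * d') - ?w r * (cmod (\<Sum>a<p. chi n (?t r) (\<mu> a)))\<^sup>2 / (real p)\<^sup>2 \<le>
      (?w r * (real n)\<^sup>2 - ?w r * (cmod (\<Sum>j<n. ?t r j))\<^sup>2) / ((real n)\<^sup>2 - 1)" for r
  proof -
    have "1 - (cmod (\<Sum>a<p. chi n (?t r) (\<mu> a)))\<^sup>2 / (real p)\<^sup>2 \<le>
      ((real n)\<^sup>2 - (cmod (\<Sum>j<n. ?t r j))\<^sup>2) / ((real n)\<^sup>2 - 1) + 10 * d'"
      unfolding d'_def by (rule casimir_inequality[OF dense c]) simp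
    then have "1 - 10 * d' - (cmod (\<Sum>a<p. chi n (?t r) (\<mu> a)))\<^sup>2 / (real p)\<^sup>2 \<le>
      ((real n)\<^sup>2 - (cmod (\<Sum>j<n. ?t r j))\<^sup>2) / ((real n)\<^sup>2 - 1)" by linarith
    from mult_left_mono[OF this gridw_nonneg[of n q r]] show ?thesis
      by (simp add: algebra_simps diff_divide_distrib)
  qed
  have "(\<Sum>r\<in>grid n q. ?w r * (1 - 10 * d') - ?w r * (cmod (\<Sum>a<p. chi n (?t r) (\<mu> a)))\<^sup>2 / (real p)\<^sup>2) \<le>
      (\<Sum>r\<in>grid n q. (?w r * (real n)\<^sup>2 - ?w r * (cmod (\<Sum>j<n. ?t r j))\<^sup>2) / ((real n)\<^sup>2 - 1))"
    by (rule sum_mono) (rule pt)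
  then have "(\<Sum>r\<in>grid n q. ?w r) * (1 - 10 * d') - (\<Sum>r\<in>grid n q. ?w r * (cmod (\<Sum>a<p. chi n (?t r) (\<mu> a)))\<^sup>2) / (real p)\<^sup>2 \<le>
      ((\<Sum>r\<in>grid n q. ?w r) * (real n)\<^sup>2 - (\<Sum>r\<in>grid n q. ?w r * (cmod (\<Sum>j<n. ?t r j))\<^sup>2)) / ((real n)\<^sup>2 - 1)"
    by (simp only: sum_subtractf sum_distrib_right[symmetric] sum_divide_distrib[symmetric])
  then have main: "1 - 10 * d' - (\<Sum>a<p. \<Sum>b<p. \<Prod>j<n. cosfac (\<mu> a j - \<mu> b j)) / (real p)\<^sup>2 \<le>
      ((real n)\<^sup>2 - real n * (1 + (real n - 1) / 4)) / ((real n)\<^sup>2 - 1)"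
    unfolding tot av1 av2 by simp
  have "((real n)\<^sup>2 - real n * (1 + (real n - 1) / 4)) / ((real n)\<^sup>2 - 1) = 3 / 4 - 3 / (4 * (real n + 1))"
  proof -
    have f: "(real n)\<^sup>2 - 1 = (real n - 1) * (real n + 1)" by (simp add: power2_eq_square algebra_simps)
    have g: "(real n)\<^sup>2 - real n * (1 + (real n - 1) / 4) = (real n - 1) * (3 / 4 * real n)"
      by (simp add: power2_eq_square field_simps)
    have "((real n)\<^sup>2 - real n * (1 + (real n - 1) / 4)) / ((real n)\<^sup>2 - 1) = (3 / 4 * real n) / (real n + 1)"
      unfolding f g using n1 by (intro mult_divide_mult_cancel_left) simp
    also have "\<dots> = 3 / 4 - 3 / (4 * (real n + 1))" using n1 by (simp add: field_simps)
    finally show ?thesis .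
  qed
  then have "1 / 4 + 3 / (4 * (real n + 1)) - 10 * d' \<le> (\<Sum>a<p. \<Sum>b<p. \<Prod>j<n. cosfac (\<mu> a j - \<mu> b j)) / (real p)\<^sup>2"
    using main by linarith
  then have "(real p)\<^sup>2 * (1 / 4 + 3 / (4 * (real n + 1)) - 10 * d') \<le> (\<Sum>a<p. \<Sum>b<p. \<Prod>j<n. cosfac (\<mu> a j - \<mu> b j))"
    using p0 by (simp add: le_divide_eq mult.commute)
  also have "\<dots> \<le> (\<Sum>a<p. \<Sum>b<p. pair_bound n (\<mu> a) (\<mu> b))"
  proof (intro sum_mono prod_cosfac_pair_bound)
    fix a b assume "a \<in> {..<p}" "b \<in> {..<p}"
    then show "(\<Sum>j<n. \<mu> a j) = (\<Sum>j<n. \<mu> b j)" using weight_sum[of a] weight_sum[of b] by simp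
  qed
  finally show ?thesis unfolding d'_def .
qed

end

subsection \<open>Multiplicities of weights\<close>

text \<open>A minimum over finitely many pairs. The separation has to be uniform over all orders up
  to \<open>N\<close>, because the final \<delta> may not depend on the dimension.\<close>

lemma roots_separated:
  "\<exists>r>0. \<forall>K\<le>N. \<forall>i<K. \<forall>j<K. i \<noteq> j \<longrightarrow> 2 * r \<le> cmod (rootp K i - rootp K j)"
proof -
  define S where "S = (\<lambda>(K, i, j). cmod (rootp K i - rootp K j)) ` {(K, i, j). K \<le> N \<and> i < K \<and> j < K \<and> i \<noteq> j}"
  have "{(K, i, j). K \<le> N \<and> i < K \<and> j < K \<and> i \<noteq> j} \<subseteq> {..N} \<times> {..N} \<times> {..N}" by auto
  then have fin: "finite S" unfolding S_def by (intro finite_imageI) (rule finite_subset, auto)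
  have pos: "s > 0" if "s \<in> S" for s
  proof -
    obtain K i j where s: "s = cmod (rootp K i - rootp K j)" and ij: "i < K" "j < K" "i \<noteq> j"
    proof -
      have "\<exists>K i j. s = cmod (rootp K i - rootp K j) \<and> i < K \<and> j < K \<and> i \<noteq> j"
        using \<open>s \<in> S\<close> unfolding S_def by auto
      then show ?thesis using that by blast
    qed
    have "inj_on (\<lambda>k. cis (2 * pi * real k / real K)) {..<K}"
      using bij_betw_roots_unity[of K] ij by (simp add: bij_betw_def)
    then have "rootp K i \<noteq> rootp K j" using ij unfolding rootp_def by (auto dest: inj_onD)
    then show ?thesis by (simp add: s)
  qed
  define r where "r = Min (insert 1 S) / 2"
  have "r > 0" unfolding r_def using fin pos by auto
  moreover have "2 * r \<le> cmod (rootp K i - rootp K j)" if "K \<le> N" "i < K" "j < K" "i \<noteq> j" for K i j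
  proof -
    have "cmod (rootp K i - rootp K j) \<in> S" unfolding S_def using that by (intro image_eqI[of _ _ "(K, i, j)"]) auto
    then show ?thesis unfolding r_def using fin by simp
  qed
  ultimately show ?thesis by blast
qed

lemma card_residue_class:
  assumes "1 \<le> p" "1 \<le> K"
  shows "card {b. b < p \<and> b mod K = (k :: nat)} \<le> (p - 1) div K + 1"
proof -
  have "inj_on (\<lambda>b. b div K) {b. b < p \<and> b mod K = k}"
    by (rule inj_onI) (metis (mono_tags, lifting) div_mult_mod_eq mem_Collect_eq)
  moreover have "(\<lambda>b. b div K) ` {b. b < p \<and> b mod K = k} \<subseteq> {..(p - 1) div K}"
    by (auto intro!: div_le_mono)
  ultimately have "card {b. b < p \<and> b mod K = k} \<le> card {..(p - 1) div K}"
    by (intro card_inj_on_le) auto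
  then show ?thesis by simp
qed

context weight_rep
begin

text \<open>An operator close to \<open>y\<close> has few eigenvalues near a given point if \<open>y\<close> has, so no weight of
  \<open>g\<close> with \<open>\<rho> g\<close> close to \<open>y\<close> can have a large multiplicity.\<close>

lemma multiplicity_bound:
  assumes dense: "dense_within n p \<rho> c" and c: "0 \<le> c" and p: "1 \<le> p" and K: "1 \<le> K" and r: "0 < r"
    and sep: "\<And>i j. i < K \<Longrightarrow> j < K \<Longrightarrow> i \<noteq> j \<Longrightarrow> 2 * r \<le> cmod (rootp K i - rootp K j)"
  shows "real (card {a. a < p \<and> weq n (\<mu> a) \<nu>}) \<le> real ((p - 1) div K) + 1 + c\<^sup>2 / r\<^sup>2"
proof -
  \<comment> \<open>A diagonal unitary whose eigenvalues are \<open>K\<close>-th roots of unity,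
    repeated periodically, so each is taken about p / K times.\<close>
  define y where "y b = rootp K (b mod K)" for b
  have yU: "diagm p y \<in> U p" by (rule diagm_U) (simp add: y_def)
  obtain g where g: "g \<in> U n" and gy: "fr (\<rho> g - diagm p y) \<le> c"
    using dense yU unfolding dense_within_def by blast
  obtain u t where u: "u \<in> U n" and t: "\<And>j. j < n \<Longrightarrow> cmod (t j) = 1" and gt: "g = u * diagm n t * adj u"
    using unitary_spectral[OF g] by blast
  let ?x = "\<lambda>a. chi n t (\<mu> a)"
  define R where "R = \<rho> u"
  have R: "R \<in> U p" unfolding R_def using rU[OF u] .
  note Rc = U_carrier[OF R]
  have rg: "\<rho> g * R = R * diagm p ?x"
  proof -
    have "\<rho> g = R * diagm p ?x * adj R" unfolding gt R_def by (rule rconj[OF u t])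
    then show ?thesis using R by (simp add: assoc_mult_mat[of _ p p _ p _ p] U_left right_mult_one_mat[of _ p p])
  qed
  \<comment> \<open>In eigenbases of both operators the squared distance is a sum over pairs of
    eigenvalues, weighted by the squared entries of the unitary \<open>R\<close>, whose rows and
    columns have sum 1.\<close>
  let ?e = "\<lambda>b a. (cmod (y b - ?x a))\<^sup>2 * (cmod (R $$ (b, a)))\<^sup>2"
  have "(\<Sum>b<p. \<Sum>a<p. ?e b a) = fr2 (diagm p y * R - R * diagm p ?x)"
  proof -
    have "(diagm p y * R - R * diagm p ?x) $$ (b, a) = (y b - ?x a) * R $$ (b, a)" if "b < p" "a < p" for a b
      using that Rc by (simp add: diagm_left[of _ p p] diagm_right[of _ p p] algebra_simps del: index_mult_mat(1))
    then show ?thesis using Rc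
      by (subst fr2_carrier[of _ p p]) (auto simp: norm_mult power_mult_distrib simp del: index_minus_mat(1) intro!: sum.cong)
  qed
  also have "diagm p y * R - R * diagm p ?x = (diagm p y - \<rho> g) * R"
    unfolding rg[symmetric] using Rc g by (simp add: mult_minus_left[of _ p p _ _ p])
  also have "fr2 \<dots> = fr2 (diagm p y - \<rho> g)" using R g by (intro fr2_U_right[of _ p _ p]) auto
  also have "\<dots> = (fr (\<rho> g - diagm p y))\<^sup>2" using g by (simp add: fr_minus_commute[of _ p p] flip: fr_sq)
  also have "\<dots> \<le> c\<^sup>2" using gy by (intro power_mono) (auto simp: fr_nonneg)
  finally have small: "(\<Sum>b<p. \<Sum>a<p. ?e b a) \<le> c\<^sup>2" .
  define A where "A = {a. a < p \<and> weq n (\<mu> a) \<nu>}"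
  define la where "la = chi n t \<nu>"
  have la: "?x a = la" if "a \<in> A" for a
    using that unfolding la_def A_def chi_def weq_def by (intro prod.cong) auto
  \<comment> \<open>Indices at which \<open>y\<close> comes within \<open>r\<close> of the
    eigenvalue \<open>la\<close>; the separation by \<open>2 * r\<close> confines them to a single
    residue class modulo \<open>K\<close>.\<close>
  define B0 where "B0 = {b. b < p \<and> cmod (y b - la) < r}"
  have A: "finite A" "A \<subseteq> {..<p}" and B0: "finite B0" "B0 \<subseteq> {..<p}" by (auto simp: A_def B0_def)
  let ?R = "\<lambda>b a. (cmod (R $$ (b, a)))\<^sup>2"
  have far: "r\<^sup>2 * (\<Sum>b\<in>{..<p} - B0. \<Sum>a\<in>A. ?R b a) \<le> c\<^sup>2"
  proof -
    have "r\<^sup>2 * (\<Sum>b\<in>{..<p} - B0. \<Sum>a\<in>A. ?R b a) = (\<Sum>b\<in>{..<p} - B0. \<Sum>a\<in>A. r\<^sup>2 * ?R b a)"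
      by (simp only: sum_distrib_left)
    also have "\<dots> \<le> (\<Sum>b\<in>{..<p} - B0. \<Sum>a\<in>A. ?e b a)"
    proof (intro sum_mono mult_right_mono power_mono)
      fix b a assume "b \<in> {..<p} - B0" "a \<in> A"
      then show "r \<le> cmod (y b - ?x a)" using la by (auto simp: B0_def)
    qed (use r in auto)
    also have "\<dots> \<le> (\<Sum>b\<in>{..<p} - B0. \<Sum>a<p. ?e b a)"
      using A by (intro sum_mono sum_mono2) auto
    also have "\<dots> \<le> (\<Sum>b<p. \<Sum>a<p. ?e b a)"
      by (intro sum_mono2 sum_nonneg) auto
    finally show ?thesis using small by linarith
  qed
  have near: "(\<Sum>b\<in>B0. \<Sum>a\<in>A. ?R b a) \<le> real (card B0)"
  proof -
    have "(\<Sum>b\<in>B0. \<Sum>a\<in>A. ?R b a) \<le> (\<Sum>b\<in>B0. \<Sum>a<p. ?R b a)"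
      using A by (intro sum_mono sum_mono2) auto
    also have "\<dots> = (\<Sum>b\<in>B0. 1)" using B0 U_row_sum[OF R] by (intro sum.cong) auto
    finally show ?thesis by simp
  qed
  have cB: "card B0 \<le> (p - 1) div K + 1"
  proof (cases "B0 = {}")
    case False
    then obtain b0 where b0: "b0 \<in> B0" by blast
    have "B0 \<subseteq> {b. b < p \<and> b mod K = b0 mod K}"
    proof
      fix b assume b: "b \<in> B0"
      have "b mod K = b0 mod K"
      proof (rule ccontr)
        assume "b mod K \<noteq> b0 mod K"
        then have "2 * r \<le> cmod (y b - y b0)" unfolding y_def using K by (intro sep) auto
        also have "\<dots> \<le> cmod (y b - la) + cmod (y b0 - la)" using norm_triangle_ineq4[of "y b - la" "y b0 - la"] by simp
        also have "\<dots> < 2 * r" using b b0 by (auto simp: B0_def)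
        finally show False by simp
      qed
      then show "b \<in> {b. b < p \<and> b mod K = b0 mod K}" using b by (auto simp: B0_def)
    qed
    then have "card B0 \<le> card {b. b < p \<and> b mod K = b0 mod K}" by (intro card_mono) auto
    also have "\<dots> \<le> (p - 1) div K + 1" using p K by (rule card_residue_class)
    finally show ?thesis .
  qed simp
  have "real (card A) = (\<Sum>a\<in>A. \<Sum>b<p. ?R b a)" using A U_col_sum[OF R] by (simp add: subset_eq)
  also have "\<dots> = (\<Sum>b<p. \<Sum>a\<in>A. ?R b a)" by (rule sum.swap)
  also have "\<dots> = (\<Sum>b\<in>{..<p} - B0. \<Sum>a\<in>A. ?R b a) + (\<Sum>b\<in>B0. \<Sum>a\<in>A. ?R b a)"
    using B0 by (intro sum.subset_diff) auto
  also have "\<dots> \<le> c\<^sup>2 / r\<^sup>2 + real ((p - 1) div K + 1)"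
    using far near cB r by (intro add_mono) (auto simp: field_simps)
  finally show ?thesis by (simp add: A_def)
qed

end

subsection \<open>Configurations of weights\<close>

lemma root_apart_sum:
  assumes "root_apart n c d" shows "(\<Sum>j<n. c j) = (\<Sum>j<n. d j)"
proof -
  obtain i k where ik: "i < n" "k < n" and e: "\<And>j. j < n \<Longrightarrow> c j = d j + (if j = i then 1 else 0) - (if j = k then 1 else 0)"
    using assms unfolding root_apart_def by blast
  have "(\<Sum>j<n. c j) = (\<Sum>j<n. d j + (if j = i then 1 else 0) - (if j = k then 1 else 0))"
    using e by (intro sum.cong) auto
  then show ?thesis using ik by (simp add: sum.distrib sum_subtractf)
qed

lemma root_apart_dist:
  assumes "root_apart n c d" shows "(\<Sum>j<n. \<bar>c j - d j\<bar>) = 2"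
proof -
  obtain i k where ik: "i < n" "k < n" "i \<noteq> k" and e: "\<And>j. j < n \<Longrightarrow> c j = d j + (if j = i then 1 else 0) - (if j = k then 1 else 0)"
    using assms unfolding root_apart_def by blast
  have "(\<Sum>j<n. \<bar>c j - d j\<bar>) = (\<Sum>j<n. (if j = i then 1 else 0) + (if j = k then 1 else 0))"
    using e ik by (intro sum.cong) auto
  then show ?thesis using ik by (simp add: sum.distrib)
qed

lemma root_apart_cong: "weq n c c' \<Longrightarrow> weq n d d' \<Longrightarrow> root_apart n c d \<longleftrightarrow> root_apart n c' d'"
  unfolding root_apart_def weq_def by (intro ex_cong1 conj_cong refl) auto

lemma root_apart_perm:
  assumes s: "s permutes {..<n}" and ra: "root_apart n c d" shows "root_apart n (\<lambda>j. c (s j)) (\<lambda>j. d (s j))"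
proof -
  obtain i k where ik: "i < n" "k < n" "i \<noteq> k" and e: "\<And>j. j < n \<Longrightarrow> c j = d j + (if j = i then 1 else 0) - (if j = k then 1 else 0)"
    using ra unfolding root_apart_def by blast
  define r where "r = inv_into UNIV s"
  have r: "r permutes {..<n}" "\<And>j. s j = i \<longleftrightarrow> j = r i" "\<And>j. s j = k \<longleftrightarrow> j = r k"
    unfolding r_def using permutes_inv[OF s] permutes_inverses[OF s] by auto
  have "r i \<noteq> r k" using r(2)[of "r i"] r(3)[of "r i"] ik by auto
  moreover have "r i < n" "r k < n" using perm_less[OF r(1)] ik by auto
  moreover have "\<forall>j<n. c (s j) = d (s j) + (if j = r i then 1 else 0) - (if j = r k then 1 else 0)"
    using e perm_less[OF s] r by simp
  ultimately show ?thesis unfolding root_apart_def by blast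
qed

text \<open>Such a count is a finite sum of multiplicities; \<open>R\<close> cuts a weight down to
  its first \<open>n\<close> coordinates and so provides canonical representatives.\<close>

lemma card_pred_of_counts:
  assumes eq: "\<And>\<nu>. card {a. a < (p::nat) \<and> weq n (d a) \<nu>} = card {a. a < p \<and> weq n (e a) \<nu>}"
    and P: "\<And>c c'. weq n c c' \<Longrightarrow> P c = P c'"
  shows "card {a. a < p \<and> P (d a)} = card {a. a < p \<and> P (e a)}"
proof -
  define R :: "(nat \<Rightarrow> int) \<Rightarrow> nat \<Rightarrow> int" where "R f = (\<lambda>j. if j < n then f j else 0)" for f
  define F where "F = {f \<in> R ` d ` {..<p} \<union> R ` e ` {..<p}. P f}"
  have F: "finite F" by (simp add: F_def)
  have Rw: "weq n f (R f)" for f by (simp add: weq_def R_def)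
  have RP: "P (R f) = P f" for f using P[OF Rw[of f]] by simp
  have RR: "R g = R f \<longleftrightarrow> weq n g f" for f g
    unfolding R_def weq_def by (auto simp: fun_eq_iff)
  have RRR: "R (R f) = R f" for f by (auto simp: R_def)
  have part: "card {a. a < p \<and> P (h a)} = (\<Sum>f\<in>F. card {a. a < p \<and> weq n (h a) f})"
    if h: "R ` h ` {..<p} \<subseteq> R ` d ` {..<p} \<union> R ` e ` {..<p}" for h
  proof -
    have "(\<Sum>f\<in>F. card {a. a < p \<and> weq n (h a) f}) = card (\<Union>f\<in>F. {a. a < p \<and> weq n (h a) f})"
    proof (rule card_UN_disjoint[symmetric])
      show "\<forall>f\<in>F. \<forall>g\<in>F. f \<noteq> g \<longrightarrow> {a. a < p \<and> weq n (h a) f} \<inter> {a. a < p \<and> weq n (h a) g} = {}"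
      proof (intro ballI impI equals0I)
        fix f g a assume fg: "f \<in> F" "g \<in> F" "f \<noteq> g" "a \<in> {a. a < p \<and> weq n (h a) f} \<inter> {a. a < p \<and> weq n (h a) g}"
        then have "R f = R g" using RR[of "h a" f] RR[of "h a" g] by auto
        moreover have "R f = f" "R g = g" using fg unfolding F_def by (auto simp: RRR)
        ultimately show False using fg by simp
      qed
    qed (use F in auto)
    also have "(\<Union>f\<in>F. {a. a < p \<and> weq n (h a) f}) = {a. a < p \<and> P (h a)}"
    proof (intro equalityI subsetI)
      fix a assume "a \<in> (\<Union>f\<in>F. {a. a < p \<and> weq n (h a) f})"
      then show "a \<in> {a. a < p \<and> P (h a)}" using P unfolding F_def by blast
    next
      fix a assume a: "a \<in> {a. a < p \<and> P (h a)}"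
      then have "R (h a) \<in> F" unfolding F_def using h RP by auto
      then show "a \<in> (\<Union>f\<in>F. {a. a < p \<and> weq n (h a) f})" using a Rw by blast
    qed
    finally show ?thesis ..
  qed
  show ?thesis using part[of d] part[of e] eq by simp
qed

text \<open>At each coordinate at most one of the four vectors is nonzero. The other three are at
  distance |y j| there and the fourth at distance at least |x q j| - |y j|; summation over the
  coordinates gives the inequality.\<close>

lemma four_points:
  fixes x :: "nat \<Rightarrow> nat \<Rightarrow> int"
  assumes disj: "\<And>q q' j. q < 4 \<Longrightarrow> q' < 4 \<Longrightarrow> q \<noteq> q' \<Longrightarrow> j < n \<Longrightarrow> x q j = 0 \<or> x q' j = 0"
    and X: "\<And>q. q < 4 \<Longrightarrow> (\<Sum>j<n. \<bar>x q j\<bar>) = X" and y: "\<And>q. q < 4 \<Longrightarrow> (\<Sum>j<n. \<bar>x q j - y j\<bar>) = 2"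
  shows "4 * X + 2 * (\<Sum>j<n. \<bar>y j\<bar>) \<le> 8"
proof -
  have four: "(\<Sum>q<4. f q) = f 0 + f 1 + f 2 + f 3" for f :: "nat \<Rightarrow> int"
    by (simp add: eval_nat_numeral)
  have pt: "(\<Sum>q<4. \<bar>x q j\<bar>) + 2 * \<bar>y j\<bar> \<le> (\<Sum>q<4. \<bar>x q j - y j\<bar>)" if "j < n" for j
    unfolding four using disj[of 0 1 j] disj[of 0 2 j] disj[of 0 3 j] disj[of 1 2 j] disj[of 1 3 j] disj[of 2 3 j] that
    by auto
  have "4 * X + 2 * (\<Sum>j<n. \<bar>y j\<bar>) = (\<Sum>q<4. \<Sum>j<n. \<bar>x q j\<bar>) + 2 * (\<Sum>j<n. \<bar>y j\<bar>)"
    using X by simp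
  also have "\<dots> = (\<Sum>j<n. (\<Sum>q<4. \<bar>x q j\<bar>) + 2 * \<bar>y j\<bar>)"
    by (simp only: sum.distrib sum_distrib_left sum.swap[of _ "{..<4}"])
  also have "\<dots> \<le> (\<Sum>j<n. \<Sum>q<4. \<bar>x q j - y j\<bar>)" using pt by (intro sum_mono) auto
  also have "\<dots> = (\<Sum>q<4. \<Sum>j<n. \<bar>x q j - y j\<bar>)" by (rule sum.swap)
  also have "\<dots> = (\<Sum>q<(4::nat). 2)" using y by (intro sum.cong) auto
  finally show ?thesis by simp
qed

lemma abs_sum_one:
  fixes z :: "nat \<Rightarrow> int"
  assumes "(\<Sum>j<n. \<bar>z j\<bar>) = 1"
  shows "\<exists>i<n. (z i = 1 \<or> z i = -1) \<and> (\<forall>j<n. j \<noteq> i \<longrightarrow> z j = 0) \<and> (\<Sum>j<n. z j) = z i"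
proof -
  have "\<exists>i<n. z i \<noteq> 0"
  proof (rule ccontr)
    assume "\<not> ?thesis"
    then have "(\<Sum>j<n. \<bar>z j\<bar>) = 0" by (intro sum.neutral) auto
    then show False using assms by simp
  qed
  then obtain i where i: "i < n" "z i \<noteq> 0" by blast
  have s: "(\<Sum>j<n. \<bar>z j\<bar>) = \<bar>z i\<bar> + (\<Sum>j\<in>{..<n} - {i}. \<bar>z j\<bar>)" using i by (intro sum.remove) auto
  moreover have "(\<Sum>j\<in>{..<n} - {i}. \<bar>z j\<bar>) \<ge> 0" by (intro sum_nonneg) auto
  ultimately have r: "(\<Sum>j\<in>{..<n} - {i}. \<bar>z j\<bar>) = 0" "\<bar>z i\<bar> = 1" using assms i by linarith+
  then have z: "z j = 0" if "j < n" "j \<noteq> i" for j using that by (simp add: sum_nonneg_eq_0_iff)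
  then have "(\<Sum>j<n. z j) = z i" using i by (intro sum_single) auto
  moreover have "z i = 1 \<or> z i = -1" using r(2) by linarith
  ultimately show ?thesis using z i by blast
qed

text \<open>An integer and its absolute value have the same parity.\<close>

lemma abs_sum_parity:
  fixes z :: "nat \<Rightarrow> int"
  shows "even ((\<Sum>j<n. \<bar>z j\<bar>) - (\<Sum>j<n. z j))"
proof -
  have "even (\<bar>z j\<bar> - z j)" for j by (cases "z j \<ge> 0") auto
  then show ?thesis by (simp add: dvd_sum flip: sum_subtractf)
qed

definition constant_weight :: "nat \<Rightarrow> (nat \<Rightarrow> int) \<Rightarrow> bool" where
  "constant_weight n c \<longleftrightarrow> (\<exists>v. \<forall>j<n. c j = v)"

lemma nonconstant_abs_sum: "\<not> constant_weight n c \<Longrightarrow> 1 \<le> (\<Sum>j<n. \<bar>c j - v\<bar>)"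
proof -
  assume "\<not> constant_weight n c"
  then obtain j where j: "j < n" "c j \<noteq> v" unfolding constant_weight_def by blast
  have "\<bar>c j - v\<bar> \<le> (\<Sum>j<n. \<bar>c j - v\<bar>)" using j by (intro member_le_sum) auto
  then show ?thesis using j by linarith
qed

text \<open>Otherwise three disjoint pairs of coordinates with different values could be chosen one
  after the other, and exchanging within each pair would change six entries by at least 1.\<close>

lemma nearly_constant:
  fixes c :: "nat \<Rightarrow> int"
  assumes close: "\<And>s. s permutes {..<n} \<Longrightarrow> (\<Sum>j<n. \<bar>c j - c (s j)\<bar>) \<le> 4"
  shows "\<exists>v S. S \<subseteq> {..<n} \<and> card S \<le> 4 \<and> (\<forall>j<n. j \<notin> S \<longrightarrow> c j = v)"
proof (rule ccontr)
  assume no: "\<not> ?thesis"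
  have ex: "\<exists>i<n. \<exists>k<n. i \<notin> S \<and> k \<notin> S \<and> c i \<noteq> c k" if "S \<subseteq> {..<n}" "card S \<le> 4" for S
    using no that by metis
  obtain i1 k1 where 1: "i1 < n" "k1 < n" "c i1 \<noteq> c k1" using ex[of "{}"] by auto
  have "card {i1, k1} \<le> 4" by (simp add: card_insert_if)
  then obtain i2 k2 where 2: "i2 < n" "k2 < n" "i2 \<notin> {i1, k1}" "k2 \<notin> {i1, k1}" "c i2 \<noteq> c k2"
    using ex[of "{i1, k1}"] 1 by auto
  have "card {i1, k1, i2, k2} \<le> 4" by (simp add: card_insert_if)
  then obtain i3 k3 where 3: "i3 < n" "k3 < n" "i3 \<notin> {i1, k1, i2, k2}" "k3 \<notin> {i1, k1, i2, k2}" "c i3 \<noteq> c k3"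
    using ex[of "{i1, k1, i2, k2}"] 1 2 by auto
  define s where "s = Transposition.transpose i1 k1 \<circ> Transposition.transpose i2 k2 \<circ> Transposition.transpose i3 k3"
  have s: "s permutes {..<n}"
    unfolding s_def using 1 2 3 by (intro permutes_compose permutes_swap_id) auto
  have ne: "i1 \<noteq> k1" "i2 \<noteq> k2" "i3 \<noteq> k3" using 1 2 3 by auto
  let ?T = "{i1, k1, i2, k2, i3, k3}"
  have "card ?T = 6" using 1 2 3 ne by auto
  then have "6 = (\<Sum>j\<in>?T. 1 :: int)" by simp
  also have "\<dots> \<le> (\<Sum>j\<in>?T. \<bar>c j - c (s j)\<bar>)"
  proof (rule sum_mono)
    fix j assume "j \<in> ?T"
    then have "c j \<noteq> c (s j)" using 1 2 3 ne by (auto simp: s_def Transposition.transpose_def)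
    then show "1 \<le> \<bar>c j - c (s j)\<bar>" by linarith
  qed
  also have "\<dots> \<le> (\<Sum>j<n. \<bar>c j - c (s j)\<bar>)" using 1 2 3 by (intro sum_mono2) auto
  finally show False using close[OF s] by simp
qed

lemma exists_exchange:
  assumes S: "S \<subseteq> {..<n::nat}" and T: "T \<subseteq> {..<n}" and d: "S \<inter> T = {}" and card: "card S = card T"
  shows "\<exists>s. s permutes {..<n} \<and> (\<forall>j. s (s j) = j) \<and> s ` S = T"
proof -
  have fin: "finite S" "finite T" using S T by (auto intro: finite_subset)
  obtain h where h: "bij_betw h S T" using finite_same_card_bij[OF fin card] by blast
  define s where "s j = (if j \<in> S then h j else if j \<in> T then inv_into S h j else j)" for j
  have hT: "h j \<in> T" if "j \<in> S" for j using h that by (auto simp: bij_betw_def)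
  have hS: "inv_into S h j \<in> S" "h (inv_into S h j) = j" if "j \<in> T" for j
    using h that by (auto simp: bij_betw_def inv_into_into f_inv_into_f)
  have hh: "inv_into S h (h j) = j" if "j \<in> S" for j using h that by (simp add: bij_betw_def)
  have ss: "s (s j) = j" for j using hT[of j] hS[of j] hh[of j] d by (auto simp: s_def)
  have "s permutes {..<n}"
    by (rule inverse_permutes[of s s]) (use ss S T in \<open>auto simp: s_def\<close>)
  moreover have "s ` S = T" using h by (auto simp: s_def bij_betw_def image_iff)
  ultimately show ?thesis using ss by blast
qed

text \<open>With at most four exceptional coordinates, 16 coordinates have room for four disjoint
  copies of the exceptional set.\<close>

lemma exists_disjoint_copies:
  assumes S: "S \<subseteq> {..<n::nat}" "card S \<le> 4" and n: "16 \<le> n"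
  shows "\<exists>s. (\<forall>q<4. s q permutes {..<n} \<and> (\<forall>j. s q (s q j) = j)) \<and>
    (\<forall>q<4::nat. \<forall>q'<4. q \<noteq> q' \<longrightarrow> s q ` S \<inter> s q' ` S = {})"
proof -
  have fin: "finite S" using S by (auto intro: finite_subset)
  obtain T1 where T1: "T1 \<subseteq> {..<n} - S" "card T1 = card S" "finite T1"
  proof (rule obtain_subset_with_card_n)
    show "card S \<le> card ({..<n} - S)" using S n fin by (simp add: card_Diff_subset)
  qed
  obtain T2 where T2: "T2 \<subseteq> {..<n} - (S \<union> T1)" "card T2 = card S" "finite T2"
  proof (rule obtain_subset_with_card_n)
    have "card (S \<union> T1) \<le> 8" using card_Un_le[of S T1] T1 S by simp
    then show "card S \<le> card ({..<n} - (S \<union> T1))"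
      using S n fin T1 by (subst card_Diff_subset) auto
  qed
  obtain T3 where T3: "T3 \<subseteq> {..<n} - (S \<union> T1 \<union> T2)" "card T3 = card S" "finite T3"
  proof (rule obtain_subset_with_card_n)
    have "card (S \<union> T1 \<union> T2) \<le> 12" using card_Un_le[of S T1] card_Un_le[of "S \<union> T1" T2] T1 T2 S by simp
    then show "card S \<le> card ({..<n} - (S \<union> T1 \<union> T2))"
      using S n fin T1 T2 by (subst card_Diff_subset) auto
  qed
  obtain s1 where s1: "s1 permutes {..<n}" "\<And>j. s1 (s1 j) = j" "s1 ` S = T1"
    using exists_exchange[of S n T1] S T1 by auto
  obtain s2 where s2: "s2 permutes {..<n}" "\<And>j. s2 (s2 j) = j" "s2 ` S = T2"
    using exists_exchange[of S n T2] S T2 by auto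
  obtain s3 where s3: "s3 permutes {..<n}" "\<And>j. s3 (s3 j) = j" "s3 ` S = T3"
    using exists_exchange[of S n T3] S T3 by auto
  define s where "s q = (if q = 0 then id else if q = (1::nat) then s1 else if q = 2 then s2 else s3)" for q
  have im: "s q ` S = (if q = 0 then S else if q = 1 then T1 else if q = 2 then T2 else T3)" for q
    by (simp add: s_def s1 s2 s3)
  have "\<forall>q<4. s q permutes {..<n} \<and> (\<forall>j. s q (s q j) = j)"
    using s1 s2 s3 by (simp add: s_def permutes_id)
  moreover have "\<forall>q<4::nat. \<forall>q'<4. q \<noteq> q' \<longrightarrow> s q ` S \<inter> s q' ` S = {}"
    unfolding im using T1 T2 T3 by auto
  ultimately show ?thesis by blast
qed

text \<open>Let \<open>y\<close> differ by a root from four permuted copies of \<open>c\<close>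
  whose deviations from \<open>v\<close> sit at disjoint places. Then \<open>four_points\<close>
  applies; as \<open>c\<close> and \<open>y\<close> are not constant, it leaves total deviation 1
  for \<open>c\<close> and 1 or 2 for \<open>y\<close>, and parity excludes 2. The permutations
  belong to the conclusion because the weights not adjacent to all four copies still have to be
  discarded.\<close>

lemma standard_configuration:
  fixes c :: "nat \<Rightarrow> int"
  assumes n: "16 \<le> n" and close: "\<And>s. s permutes {..<n} \<Longrightarrow> (\<Sum>j<n. \<bar>c j - c (s j)\<bar>) \<le> 4"
    and nc: "\<not> constant_weight n c"
  shows "\<exists>v s \<sigma>. (\<forall>q<4. \<sigma> q permutes {..<n}) \<and>
    (\<forall>y. \<not> constant_weight n y \<and> (\<forall>q<4::nat. root_apart n (\<lambda>j. c (\<sigma> q j)) y) \<longrightarrow>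
      (s = 1 \<or> s = -1) \<and> (\<exists>i<n. weq n y (\<lambda>j. v + (if j = i then s else 0))))"
proof -
  have "\<exists>v S. S \<subseteq> {..<n} \<and> card S \<le> 4 \<and> (\<forall>j<n. j \<notin> S \<longrightarrow> c j = v)"
    by (rule nearly_constant) (rule close)
  then obtain v S where S: "S \<subseteq> {..<n}" "card S \<le> 4" and v: "\<And>j. j < n \<Longrightarrow> j \<notin> S \<Longrightarrow> c j = v"
    by blast
  obtain \<sigma> where sg': "\<forall>q<4. \<sigma> q permutes {..<n} \<and> (\<forall>j. \<sigma> q (\<sigma> q j) = j)"
    and disj': "\<forall>q<4::nat. \<forall>q'<4. q \<noteq> q' \<longrightarrow> \<sigma> q ` S \<inter> \<sigma> q' ` S = {}"
    using exists_disjoint_copies[OF S n] by (elim exE conjE)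
  have sg: "\<sigma> q permutes {..<n}" "\<sigma> q (\<sigma> q j) = j" if "q < 4" for q j
    using sg' that by simp_all
  have disj: "\<sigma> q ` S \<inter> \<sigma> q' ` S = {}" if "q < 4" "q' < 4" "q \<noteq> q'" for q q'
    using disj' that by simp
  define x where "x q j = c (\<sigma> q j) - v" for q j
  define X where "X = (\<Sum>j<n. \<bar>c j - v\<bar>)"
  define s where "s = (\<Sum>j<n. c j - v)"
  have X1: "X \<ge> 1" unfolding X_def by (rule nonconstant_abs_sum[OF nc])
  have supp: "j \<in> \<sigma> q ` S" if "q < 4" "j < n" "x q j \<noteq> 0" for q j
  proof -
    have "\<sigma> q j \<in> S" using v[of "\<sigma> q j"] perm_less[OF sg(1)[OF that(1)]] that by (auto simp: x_def)
    then show ?thesis using sg(2)[OF that(1), of j] by (metis image_eqI)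
  qed
  have perm: "(\<Sum>j<n. f (c (\<sigma> q j))) = (\<Sum>j<n. f (c j))" if "q < 4" for q and f :: "int \<Rightarrow> int"
    using sum.permute[OF sg(1)[OF that], of "\<lambda>j. f (c j)"] by (simp add: o_def)
  have main: "(s = 1 \<or> s = -1) \<and> (\<exists>i<n. weq n y (\<lambda>j. v + (if j = i then s else 0)))"
    if ny: "\<not> constant_weight n y" and ra: "\<And>q. q < 4 \<Longrightarrow> root_apart n (\<lambda>j. c (\<sigma> q j)) y" for y
  proof -
    define z where "z j = y j - v" for j
    have "4 * X + 2 * (\<Sum>j<n. \<bar>z j\<bar>) \<le> 8"
    proof (rule four_points[where n = n and x = x])
      fix q q' j assume "q < 4" "q' < (4::nat)" "q \<noteq> q'" "j < n"
      then show "x q j = 0 \<or> x q' j = 0" using supp[of q j] supp[of q' j] disj[of q q'] by blast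
    next
      fix q :: nat assume q: "q < 4"
      show "(\<Sum>j<n. \<bar>x q j\<bar>) = X" unfolding x_def X_def by (rule perm[OF q])
      show "(\<Sum>j<n. \<bar>x q j - z j\<bar>) = 2" using root_apart_dist[OF ra[OF q]] by (simp add: x_def z_def)
    qed
    moreover have "(\<Sum>j<n. \<bar>z j\<bar>) \<ge> 1" unfolding z_def by (rule nonconstant_abs_sum[OF ny])
    ultimately have Xone: "X = 1" and z2: "(\<Sum>j<n. \<bar>z j\<bar>) \<le> 2" "(\<Sum>j<n. \<bar>z j\<bar>) \<ge> 1" using X1 by linarith+
    have s1: "s = 1 \<or> s = -1" using abs_sum_one[where n = n and z = "\<lambda>j. c j - v"] Xone unfolding X_def s_def by auto
    have "(\<Sum>j<n. z j) = s"
      using root_apart_sum[OF ra[of 0]] perm[of 0 "\<lambda>x. x"] by (simp add: z_def s_def sum_subtractf)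
    then have "(\<Sum>j<n. \<bar>z j\<bar>) \<noteq> 2" using abs_sum_parity[where z = z and n = n] s1 by auto
    then have "(\<Sum>j<n. \<bar>z j\<bar>) = 1" using z2 by linarith
    from abs_sum_one[OF this] obtain i where i: "i < n" "\<And>j. j < n \<Longrightarrow> j \<noteq> i \<Longrightarrow> z j = 0" "z i = s"
      using \<open>(\<Sum>j<n. z j) = s\<close> by auto
    then have "weq n y (\<lambda>j. v + (if j = i then s else 0))" by (auto simp: weq_def z_def algebra_simps)
    then show ?thesis using s1 i by blast
  qed
  show ?thesis
    by (rule exI[of _ v], rule exI[of _ s], rule exI[of _ \<sigma>]) (use sg main in blast)
qed

definition standard_weight :: "nat \<Rightarrow> int \<Rightarrow> int \<Rightarrow> (nat \<Rightarrow> int) \<Rightarrow> bool" where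
  "standard_weight n v s c \<longleftrightarrow> (\<exists>i<n. weq n c (\<lambda>j. v + (if j = i then s else 0)))"

lemma weq_sym: "weq n c d \<longleftrightarrow> weq n d c"
  by (auto simp: weq_def)

lemma weq_trans: "weq n c d \<Longrightarrow> weq n d e \<Longrightarrow> weq n c e"
  by (simp add: weq_def)

lemma weq_perm: "s permutes {..<n} \<Longrightarrow> weq n c d \<Longrightarrow> weq n (\<lambda>j. c (s j)) (\<lambda>j. d (s j))"
  by (simp add: weq_def)

lemma standard_weight_perm:
  assumes s: "s permutes {..<n}" and w: "standard_weight n v e c"
  shows "standard_weight n v e (\<lambda>j. c (s j))"
proof -
  obtain i where i: "i < n" "weq n c (\<lambda>j. v + (if j = i then e else 0))" using w unfolding standard_weight_def by blast
  define r where "r = inv_into UNIV s"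
  have r: "r permutes {..<n}" "\<And>j. s j = i \<longleftrightarrow> j = r i"
    unfolding r_def using permutes_inv[OF s] permutes_inverses[OF s] by auto
  have "weq n (\<lambda>j. c (s j)) (\<lambda>j. v + (if j = r i then e else 0))"
    using weq_perm[OF s i(2)] by (simp add: r(2))
  then show ?thesis unfolding standard_weight_def using perm_less[OF r(1), of i] i by blast
qed

text \<open>Two permutations of a vector with two distinct values, each taken twice, can be at distance
  four.\<close>

lemma close_permutations_standard:
  fixes c :: "nat \<Rightarrow> int"
  assumes close: "\<And>s. s permutes {..<n} \<Longrightarrow> (\<Sum>j<n. \<bar>c j - c (s j)\<bar>) \<le> 2"
    and nc: "\<not> constant_weight n c"
  shows "\<exists>v s. (s = 1 \<or> s = -1) \<and> standard_weight n v s c"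
proof -
  have two: "(\<Sum>j\<in>T. \<bar>c j - c (s j)\<bar>) \<le> 2" if "s permutes {..<n}" "T \<subseteq> {..<n}" for s T
  proof -
    have "(\<Sum>j\<in>T. \<bar>c j - c (s j)\<bar>) \<le> (\<Sum>j<n. \<bar>c j - c (s j)\<bar>)" using that by (intro sum_mono2) auto
    then show ?thesis using close[OF that(1)] by linarith
  qed
  have one: "\<bar>c i - c k\<bar> = 1" if "i < n" "k < n" "c i \<noteq> c k" for i k
  proof -
    have "i \<noteq> k" using that by auto
    then have "(\<Sum>j\<in>{i, k}. \<bar>c j - c (Transposition.transpose i k j)\<bar>) = 2 * \<bar>c i - c k\<bar>" by simp
    then have "2 * \<bar>c i - c k\<bar> \<le> 2"
      using two[of "Transposition.transpose i k" "{i, k}"] that by (simp add: permutes_swap_id)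
    then show ?thesis using that(3) by arith
  qed
  obtain i0 where i0: "i0 < n" "c i0 \<noteq> c 0" using nc unfolding constant_weight_def by blast
  then have n0: "0 < n" by simp
  have vals: "c j = c i0 \<or> c j = c 0" if j: "j < n" for j
    using one[OF i0(1) n0 i0(2)] one[OF j i0(1)] one[OF j n0] by linarith
  show ?thesis
  proof (cases "\<forall>j<n. j \<noteq> i0 \<longrightarrow> c j = c 0")
    case True
    then have "weq n c (\<lambda>j. c 0 + (if j = i0 then c i0 - c 0 else 0))" by (auto simp: weq_def)
    moreover have "c i0 - c 0 = 1 \<or> c i0 - c 0 = -1" using one[OF i0(1) n0 i0(2)] by linarith
    ultimately show ?thesis unfolding standard_weight_def using i0 by blast
  next
    case False
    then obtain i1 where i1: "i1 < n" "i1 \<noteq> i0" "c i1 = c i0" using vals by blast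
    have "c j = c i0" if j: "j < n" "j \<noteq> 0" for j
    proof (rule ccontr)
      assume "c j \<noteq> c i0"
      then have cj: "c j = c 0" using vals j by blast
      let ?s = "Transposition.transpose i0 0 \<circ> Transposition.transpose i1 j"
      have ne: "i0 \<noteq> 0" "i1 \<noteq> j" "i1 \<noteq> 0" "j \<noteq> i0" using i0(2) i1(3) cj \<open>c j \<noteq> c i0\<close> by metis+
      have "?s permutes {..<n}" using i0 i1 j n0 by (intro permutes_compose permutes_swap_id) auto
      from two[OF this, of "{i0, 0, i1, j}"] have "(\<Sum>j\<in>{i0, 0, i1, j}. \<bar>c j - c (?s j)\<bar>) \<le> 2"
        using i0 i1 j n0 by auto
      moreover have "(\<Sum>j\<in>{i0, 0, i1, j}. \<bar>c j - c (?s j)\<bar>) = 4 * \<bar>c i0 - c 0\<bar>"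
        using ne i1 j cj by (simp add: Transposition.transpose_def abs_minus_commute)
      ultimately show False using one[OF i0(1) n0 i0(2)] by simp
    qed
    then have "weq n c (\<lambda>j. c i0 + (if j = 0 then c 0 - c i0 else 0))" by (auto simp: weq_def)
    moreover have "c 0 - c i0 = 1 \<or> c 0 - c i0 = -1" using one[OF i0(1) n0 i0(2)] by linarith
    ultimately show ?thesis unfolding standard_weight_def using n0 by blast
  qed
qed

context irr_weight_rep
begin

lemma card_weights_perm:
  assumes s: "s permutes {..<n}" and P: "\<And>c c'. weq n c c' \<Longrightarrow> P c = P c'"
  shows "card {b. b < p \<and> P (\<lambda>j. \<mu> b (s j))} = card {b. b < p \<and> P (\<mu> b)}"
proof (rule card_pred_of_counts[where d = "\<lambda>b j. \<mu> b (s j)" and e = \<mu> and n = n])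
  fix \<nu>
  define r where "r = inv_into UNIV s"
  have r: "r permutes {..<n}" "\<And>j. s (r j) = j" "\<And>j. r (s j) = j"
    unfolding r_def using permutes_inv[OF s] permutes_inverses[OF s] by auto
  have "weq n (\<lambda>j. \<mu> a (s j)) \<nu> \<longleftrightarrow> (\<forall>j<n. \<mu> a j = \<nu> (r j))" for a
    unfolding weq_def by (metis perm_less[OF r(1)] perm_less[OF s] r(2,3))
  then show "card {a. a < p \<and> weq n (\<lambda>j. \<mu> a (s j)) \<nu>} = card {a. a < p \<and> weq n (\<mu> a) \<nu>}"
    using weight_count_perm[OF r(1), of \<nu>] by (simp add: weq_def)
qed (use P in blast)

lemma root_apart_count_perm:
  assumes s: "s permutes {..<n}"
  shows "card {b. b < p \<and> root_apart n (\<lambda>j. c (s j)) (\<mu> b)} = card {b. b < p \<and> root_apart n c (\<mu> b)}"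
proof -
  define r where "r = inv_into UNIV s"
  have r: "r permutes {..<n}" "\<And>j. s (r j) = j" "\<And>j. r (s j) = j"
    unfolding r_def using permutes_inv[OF s] permutes_inverses[OF s] by auto
  have "root_apart n (\<lambda>j. c (s j)) (\<mu> b) \<longleftrightarrow> root_apart n c (\<lambda>j. \<mu> b (r j))" for b
    using root_apart_perm[OF r(1), of "\<lambda>j. c (s j)" "\<mu> b"] root_apart_perm[OF s, of c "\<lambda>j. \<mu> b (r j)"] r by auto
  then have "card {b. b < p \<and> root_apart n (\<lambda>j. c (s j)) (\<mu> b)} = card {b. b < p \<and> root_apart n c (\<lambda>j. \<mu> b (r j))}" by simp
  also have "\<dots> = card {b. b < p \<and> root_apart n c (\<mu> b)}"
    by (rule card_weights_perm[OF r(1)], rule root_apart_cong) (simp_all add: weq_def)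
  finally show ?thesis .
qed

text \<open>The coordinate sums agree. Hence all constant weights together are controlled by the
  bound for a single multiplicity.\<close>

lemma constant_weights_equal:
  assumes "a < p" "b < p" "constant_weight n (\<mu> a)" "constant_weight n (\<mu> b)"
  shows "weq n (\<mu> a) (\<mu> b)"
proof -
  obtain v w where v: "\<And>j. j < n \<Longrightarrow> \<mu> a j = v" and w: "\<And>j. j < n \<Longrightarrow> \<mu> b j = w"
    using assms unfolding constant_weight_def by blast
  have "(\<Sum>j<n. \<mu> a j) = (\<Sum>j<n. \<mu> b j)" using weight_sum[OF assms(1)] weight_sum[OF assms(2)] by simp
  then have "v = w" using v w n2 by simp
  then show ?thesis using v w by (simp add: weq_def)
qed

definition near :: "nat \<Rightarrow> nat" where "near a = card {b. b < p \<and> root_apart n (\<mu> a) (\<mu> b)}"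

lemma near_le: "near a \<le> p"
proof -
  have "near a \<le> card {..<p}" unfolding near_def by (intro card_mono) auto
  then show ?thesis by simp
qed

text \<open>The pair inequality makes some nonconstant weight adjacent to 94 percent of all weights,
  and by permutation symmetry the same holds for each of its permutations. Any two such
  neighbourhoods meet, which puts the permutations at distance at most four; four neighbourhoods
  together still share more than two thirds of the nonconstant weights, and to these
  \<open>standard_configuration\<close> applies.\<close>

lemma large_configuration:
  assumes dense: "dense_within n p \<rho> c" and c: "0 \<le> c" "c / sqrt (real p) \<le> 1 / 10000"
    and mult: "\<And>\<nu>. real (card {a. a < p \<and> weq n (\<mu> a) \<nu>}) \<le> real p / 150"
  shows "\<exists>v s. (s = 1 \<or> s = -1) \<and> 3 * card {b. b < p \<and> \<not> standard_weight n v s (\<mu> b)} < p"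
proof -
  have p0: "real p > 0" using p2 by simp
  have c1: "c \<le> sqrt (real p) / 10" using c p0 by (simp add: divide_le_eq)
  have row: "(\<Sum>b<p. pair_bound n (\<mu> a) (\<mu> b)) \<le> real p / 16 + real p / 150 + 3 / 16 * real (near a)" for a
  proof -
    have "(\<Sum>b<p. pair_bound n (\<mu> a) (\<mu> b)) \<le>
        (\<Sum>b<p. 1 / 16 + (if weq n (\<mu> b) (\<mu> a) then 1 else 0) + 3 / 16 * (if root_apart n (\<mu> a) (\<mu> b) then 1 else 0))"
      by (intro sum_mono) (auto simp: pair_bound_def weq_sym)
    also have "\<dots> = real p / 16 + real (card {b. b < p \<and> weq n (\<mu> b) (\<mu> a)}) + 3 / 16 * real (near a)"
      unfolding sum.distrib sum_distrib_left[symmetric] near_def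
      by (simp add: sum.If_cases Int_def lessThan_def conj_commute)
    finally show ?thesis using mult[of "\<mu> a"] by linarith
  qed
  \<comment> \<open>Equal to (16/3) (1/150 + 1/1000): the allowances for equal weights and for the
    density error, divided by the coefficient 3/16 of \<open>near\<close>.\<close>
  define \<eta> :: real where "\<eta> = 46 / 1125"
  have tot: "(1 + 4 / (real n + 1) - \<eta>) * (real p)\<^sup>2 \<le> (\<Sum>a<p. real (near a))"
  proof -
    have "(real p)\<^sup>2 * (1 / 4 + 3 / (4 * (real n + 1)) - 10 * (1 / 10000)) \<le>
        (real p)\<^sup>2 * (1 / 4 + 3 / (4 * (real n + 1)) - 10 * (c / sqrt (real p)))"
    proof (rule mult_left_mono)
      show "1 / 4 + 3 / (4 * (real n + 1)) - 10 * (1 / 10000) \<le> 1 / 4 + 3 / (4 * (real n + 1)) - 10 * (c / sqrt (real p))"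
        using c(2) by linarith
    qed simp
    also have "\<dots> \<le> (\<Sum>a<p. \<Sum>b<p. pair_bound n (\<mu> a) (\<mu> b))" by (rule pair_inequality[OF dense c(1) c1])
    also have "\<dots> \<le> (\<Sum>a<p. real p / 16 + real p / 150 + 3 / 16 * real (near a))" by (intro sum_mono row)
    also have "\<dots> = (real p)\<^sup>2 * (1 / 16 + 1 / 150) + 3 / 16 * (\<Sum>a<p. real (near a))"
      by (simp add: sum.distrib sum_distrib_left power2_eq_square algebra_simps)
    finally have a: "(real p)\<^sup>2 * (1 / 4 + 3 / (4 * (real n + 1)) - 10 * (1 / 10000)) \<le>
        (real p)\<^sup>2 * (1 / 16 + 1 / 150) + 3 / 16 * (\<Sum>a<p. real (near a))" .
    define x where "x = 1 / (real n + 1)"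
    have x: "3 / (4 * (real n + 1)) = 3 / 4 * x" "4 / (real n + 1) = 4 * x" by (simp_all add: x_def)
    show ?thesis using a unfolding x \<eta>_def by (simp add: algebra_simps)
  qed
  have up: "(\<Sum>a<p. real (near a)) \<le> (real p)\<^sup>2"
  proof -
    have "(\<Sum>a<p. real (near a)) \<le> (\<Sum>a<p. real p)" by (intro sum_mono) (use near_le in simp)
    then show ?thesis by (simp add: power2_eq_square)
  qed
  \<comment> \<open>There cannot be more root pairs than pairs, so the surplus 4 / (n + 1) is at
    most \<open>\<eta>\<close>, which forces \<open>n\<close> to be large.\<close>
  have n16: "16 \<le> n"
  proof -
    have "(1 + 4 / (real n + 1) - \<eta>) * (real p)\<^sup>2 \<le> 1 * (real p)\<^sup>2" using tot up by linarith
    then have "1 + 4 / (real n + 1) - \<eta> \<le> 1" using p0 by (subst (asm) mult_le_cancel_right_pos) auto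
    then have "4 / (real n + 1) \<le> 46 / 1125" by (simp add: \<eta>_def)
    then have "16 \<le> real n" by (simp add: field_simps)
    then show ?thesis by simp
  qed
  have ge: "(1 - \<eta>) * (real p)\<^sup>2 \<le> (\<Sum>a<p. real (near a))"
  proof -
    have "(1 - \<eta>) * (real p)\<^sup>2 \<le> (1 + 4 / (real n + 1) - \<eta>) * (real p)\<^sup>2" by (intro mult_right_mono) auto
    then show ?thesis using tot by linarith
  qed
  define C where "C = {a. a < p \<and> constant_weight n (\<mu> a)}"
  have C: "finite C" "C \<subseteq> {..<p}" by (auto simp: C_def)
  have cC: "real (card C) \<le> real p / 150"
  proof (cases "C = {}")
    case False
    then obtain a where "a \<in> C" by blast
    then have "C \<subseteq> {b. b < p \<and> weq n (\<mu> b) (\<mu> a)}" using constant_weights_equal by (auto simp: C_def)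
    then have "card C \<le> card {b. b < p \<and> weq n (\<mu> b) (\<mu> a)}" by (intro card_mono) auto
    then show ?thesis using mult[of "\<mu> a"] by linarith
  qed simp
  have "\<exists>a\<in>{..<p} - C. 94 / 100 * real p \<le> real (near a)"
  proof (rule ccontr)
    assume "\<not> ?thesis"
    then have "\<forall>a\<in>{..<p} - C. real (near a) \<le> 94 / 100 * real p" by (meson linorder_le_cases)
    then have "(\<Sum>a\<in>{..<p} - C. real (near a)) \<le> (\<Sum>a\<in>{..<p} - C. 94 / 100 * real p)" by (intro sum_mono) blast
    also have "\<dots> \<le> (\<Sum>a<p. 94 / 100 * real p)" by (intro sum_mono2) auto
    finally have 1: "(\<Sum>a\<in>{..<p} - C. real (near a)) \<le> 94 / 100 * (real p)\<^sup>2" by (simp add: power2_eq_square)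
    have "(\<Sum>a\<in>C. real (near a)) \<le> (\<Sum>a\<in>C. real p)" by (intro sum_mono) (use near_le in simp)
    also have "\<dots> \<le> real p / 150 * real p" using cC p0 by simp
    finally have 2: "(\<Sum>a\<in>C. real (near a)) \<le> (real p)\<^sup>2 / 150" by (simp add: power2_eq_square)
    have "(\<Sum>a<p. real (near a)) = (\<Sum>a\<in>{..<p} - C. real (near a)) + (\<Sum>a\<in>C. real (near a))"
      using C by (intro sum.subset_diff) auto
    then have "(1 - \<eta>) * (real p)\<^sup>2 \<le> (94 / 100 + 1 / 150) * (real p)\<^sup>2" using ge 1 2 by (simp add: algebra_simps)
    then show False using p0 by (simp add: \<eta>_def)
  qed
  then obtain a0 where a0: "a0 < p" "\<not> constant_weight n (\<mu> a0)" "94 / 100 * real p \<le> real (near a0)"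
    by (auto simp: C_def)
  define G where "G s = {b. b < p \<and> root_apart n (\<lambda>j. \<mu> a0 (s j)) (\<mu> b)}" for s
  have G: "finite (G s)" "G s \<subseteq> {..<p}" for s by (auto simp: G_def)
  have cG: "94 / 100 * real p \<le> real (card (G s))" if "s permutes {..<n}" for s
    using root_apart_count_perm[OF that, of "\<mu> a0"] a0(3) by (simp add: G_def near_def)
  have close: "(\<Sum>j<n. \<bar>\<mu> a0 j - \<mu> a0 (s j)\<bar>) \<le> 4" if s: "s permutes {..<n}" for s
  proof -
    have "G id \<inter> G s \<noteq> {}"
    proof
      assume "G id \<inter> G s = {}"
      then have "card (G id) + card (G s) = card (G id \<union> G s)" using G by (simp add: card_Un_disjoint)
      also have "\<dots> \<le> card {..<p}" using G by (intro card_mono) auto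
      finally show False using cG[OF s] cG[OF permutes_id] p0 by simp
    qed
    then obtain b where b: "root_apart n (\<mu> a0) (\<mu> b)" "root_apart n (\<lambda>j. \<mu> a0 (s j)) (\<mu> b)" by (auto simp: G_def)
    have "(\<Sum>j<n. \<bar>\<mu> a0 j - \<mu> a0 (s j)\<bar>) \<le> (\<Sum>j<n. \<bar>\<mu> a0 j - \<mu> b j\<bar> + \<bar>\<mu> a0 (s j) - \<mu> b j\<bar>)"
      by (intro sum_mono) auto
    then show ?thesis using root_apart_dist[OF b(1)] root_apart_dist[OF b(2)] by (simp add: sum.distrib)
  qed
  have "\<exists>v s \<sigma>. (\<forall>q<4. \<sigma> q permutes {..<n}) \<and>
    (\<forall>y. \<not> constant_weight n y \<and> (\<forall>q<4::nat. root_apart n (\<lambda>j. \<mu> a0 (\<sigma> q j)) y) \<longrightarrow>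
      (s = 1 \<or> s = -1) \<and> (\<exists>i<n. weq n y (\<lambda>j. v + (if j = i then s else 0))))"
    by (rule standard_configuration[OF n16 _ a0(2)]) (rule close)
  then obtain v s \<sigma> where sg: "\<forall>q<4. \<sigma> q permutes {..<n}"
    and st: "\<forall>y. \<not> constant_weight n y \<and> (\<forall>q<4::nat. root_apart n (\<lambda>j. \<mu> a0 (\<sigma> q j)) y) \<longrightarrow>
      (s = 1 \<or> s = -1) \<and> (\<exists>i<n. weq n y (\<lambda>j. v + (if j = i then s else 0)))"
    by (elim exE conjE)
  \<comment> \<open>The discarded weights make up a share of at most 1/150 + 4 (6/100), which is
    below 1/3.\<close>
  define D where "D = C \<union> (\<Union>q<4. {..<p} - G (\<sigma> q))"
  have cD: "real (card D) < real p / 3"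
  proof -
    have "card D \<le> card C + (\<Sum>q<4. card ({..<p} - G (\<sigma> q)))"
      unfolding D_def using card_Un_le[of C] card_UN_le[of "{..<4}" "\<lambda>q. {..<p} - G (\<sigma> q)"] by (meson add_left_mono finite_lessThan le_trans)
    then have "real (card D) \<le> real (card C) + (\<Sum>q<4. real (card ({..<p} - G (\<sigma> q))))"
      by (metis of_nat_add of_nat_le_iff of_nat_sum)
    also have "(\<Sum>q<4. real (card ({..<p} - G (\<sigma> q)))) \<le> (\<Sum>q<(4::nat). 6 / 100 * real p)"
    proof (rule sum_mono)
      fix q :: nat assume "q \<in> {..<4}"
      then have "94 / 100 * real p \<le> real (card (G (\<sigma> q)))" using sg cG by simp
      moreover have "card ({..<p} - G (\<sigma> q)) = p - card (G (\<sigma> q))" using G by (simp add: card_Diff_subset)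
      moreover have "card (G (\<sigma> q)) \<le> p" using card_mono[OF _ G(2)] by fastforce
      ultimately show "real (card ({..<p} - G (\<sigma> q))) \<le> 6 / 100 * real p" by (simp add: of_nat_diff)
    qed
    finally show ?thesis using cC p0 by simp
  qed
  have std: "(s = 1 \<or> s = -1) \<and> standard_weight n v s (\<mu> b)" if b: "b < p" "b \<notin> D" for b
  proof -
    have "\<not> constant_weight n (\<mu> b)" using b by (auto simp: D_def C_def)
    moreover have "\<forall>q<4. root_apart n (\<lambda>j. \<mu> a0 (\<sigma> q j)) (\<mu> b)" using b by (auto simp: D_def G_def)
    ultimately show ?thesis using st unfolding standard_weight_def by blast
  qed
  have finD: "finite D" unfolding D_def using C by auto
  have "card {b. b < p \<and> \<not> standard_weight n v s (\<mu> b)} \<le> card D"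
    using std finD by (intro card_mono) auto
  then have "3 * card {b. b < p \<and> \<not> standard_weight n v s (\<mu> b)} < p" using cD by linarith
  moreover have "s = 1 \<or> s = -1"
  proof -
    have "\<not> {..<p} \<subseteq> D" 
    proof
      assume "{..<p} \<subseteq> D"
      then have "p \<le> card D" using card_mono[OF finD, of "{..<p}"] by simp
      then show False using cD p0 by linarith
    qed
    then show ?thesis using std by blast
  qed
  ultimately show ?thesis by blast
qed

end

section \<open>Weights in bounded dimension: the exact count\<close>

context irr_weight_rep
begin

lemma E_root_apart:
  assumes jk: "j < n" "k < n" "j \<noteq> k" and ab: "a < p" "b < p" and nz: "E j k $$ (a, b) \<noteq> 0"
  shows "root_apart n (\<mu> a) (\<mu> b)"
  unfolding root_apart_def using E_weight[OF jk(1,2) ab nz] jk by blast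

text \<open>Every root operator is nonzero, so every root occurs as a difference of two weights, and
  distinct roots give distinct pairs.\<close>

lemma root_pairs_many: "n * (n - 1) \<le> card {(a, b). a < p \<and> b < p \<and> root_apart n (\<mu> a) (\<mu> b)}"
proof -
  let ?R = "{(a, b). a < p \<and> b < p \<and> root_apart n (\<mu> a) (\<mu> b)}"
  define T where "T = Sigma {..<n} (\<lambda>j. {..<n} - {j})"
  have cT: "card T = n * (n - 1)"
  proof -
    have "card T = (\<Sum>j<n. card ({..<n} - {j}))" unfolding T_def by (rule card_SigmaI) auto
    also have "\<dots> = (\<Sum>j<n. n - 1)" by (intro sum.cong) auto
    finally show ?thesis by simp
  qed
  have ex: "\<exists>q. fst q < p \<and> snd q < p \<and> E j k $$ q \<noteq> 0" if "(j, k) \<in> T" for j k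
  proof (rule ccontr)
    assume no: "\<not> ?thesis"
    have jk: "j < n" "k < n" "j \<noteq> k" using that by (auto simp: T_def)
    have "E j k $$ (a, b) = 0" if "a < p" "b < p" for a b using no that by auto
    then have "fr2 (E j k) = 0" by (simp add: fr2_carrier[OF E_carrier])
    then show False using fr2_E[OF jk] B_pos by simp
  qed
  define h where "h = (\<lambda>(j, k). SOME q. fst q < p \<and> snd q < p \<and> E j k $$ q \<noteq> 0)"
  have h: "fst (h (j, k)) < p" "snd (h (j, k)) < p" "E j k $$ (fst (h (j, k)), snd (h (j, k))) \<noteq> 0" if "(j, k) \<in> T" for j k
    using someI_ex[OF ex[OF that]] by (auto simp: h_def)
  have inj: "inj_on h T"
  proof (rule inj_onI, clarify)
    fix j k j' k' assume T: "(j, k) \<in> T" "(j', k') \<in> T" and eq: "h (j, k) = h (j', k')"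
    have jk: "j < n" "k < n" "j \<noteq> k" "j' < n" "k' < n" "j' \<noteq> k'" using T by (auto simp: T_def)
    have 1: "\<mu> (fst (h (j, k))) i = \<mu> (snd (h (j, k))) i + (if i = j then 1 else 0) - (if i = k then 1 else 0)" if "i < n" for i
      using E_weight[OF jk(1,2) h(1,2,3)[OF T(1)] that] .
    have 2: "\<mu> (fst (h (j, k))) i = \<mu> (snd (h (j, k))) i + (if i = j' then 1 else 0) - (if i = k' then 1 else 0)" if "i < n" for i
      using E_weight[OF jk(4,5) h(1,2,3)[OF T(2)] that] unfolding eq .
    show "j = j' \<and> k = k'"
      using 1[OF jk(1)] 2[OF jk(1)] 1[OF jk(2)] 2[OF jk(2)] jk by (auto split: if_splits)
  qed
  have sub: "h ` T \<subseteq> ?R"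
  proof clarify
    fix a b j k assume jk: "(j, k) \<in> T" and ab: "(a, b) = h (j, k)"
    have "fst (h (j, k)) = a" "snd (h (j, k)) = b" by (simp_all flip: ab)
    then show "a < p \<and> b < p \<and> root_apart n (\<mu> a) (\<mu> b)"
      using h[OF jk] E_root_apart[of j k a b] jk by (auto simp: T_def)
  qed
  have "finite ?R" by (rule finite_subset[of _ "{..<p} \<times> {..<p}"]) auto
  then show ?thesis using card_inj_on_le[OF inj sub] cT by simp
qed

text \<open>All weights are distinct and the total error stays below one pair, so the inequality
  determines the count: any two weights differ by a root, and \<open>p\<close> is \<open>n\<close>
  or \<open>n + 1\<close>. A nonconstant weight is then at distance at most two from its
  permutations, hence standard, and its orbit has \<open>n\<close> elements. A further weight would
  have to be constant, which the coordinate sum forbids.\<close>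

lemma small_configuration:
  assumes dense: "dense_within n p \<rho> c" and c: "0 \<le> c" "c / sqrt (real p) \<le> 1 / 10000000" and p400: "p < 400"
    and mult: "\<And>\<nu>. card {a. a < p \<and> weq n (\<mu> a) \<nu>} \<le> 1"
  shows "\<exists>v s. (s = 1 \<or> s = -1) \<and> 3 * card {b. b < p \<and> \<not> standard_weight n v s (\<mu> b)} < p"
proof -
  have p0: "real p > 0" using p2 by simp
  have c1: "c \<le> sqrt (real p) / 10" using c p0 by (simp add: divide_le_eq)
  have same: "a = b" if "a < p" "b < p" "weq n (\<mu> a) (\<mu> b)" for a b
  proof (rule ccontr)
    assume ne: "a \<noteq> b"
    have "card {a, b} \<le> card {x. x < p \<and> weq n (\<mu> x) (\<mu> b)}"
      using that by (intro card_mono) (auto simp: weq_def)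
    then show False using mult[of "\<mu> b"] ne by simp
  qed
  define R where "R = {(a, b). a < p \<and> b < p \<and> root_apart n (\<mu> a) (\<mu> b)}"
  define D where "D = {(a, b). a < p \<and> b < p \<and> a \<noteq> b}"
  have ne: "a \<noteq> b" if "root_apart n (\<mu> a) (\<mu> b)" for a b using root_apart_dist[OF that] by auto
  have RD: "R \<subseteq> D" using ne by (auto simp: R_def D_def)
  have finD: "finite D" unfolding D_def by (rule finite_subset[of _ "{..<p} \<times> {..<p}"]) auto
  have cD: "card D = p * (p - 1)"
  proof -
    have "D = Sigma {..<p} (\<lambda>a. {..<p} - {a})" by (auto simp: D_def)
    then have "card D = (\<Sum>a<p. card ({..<p} - {a}))" by (simp add: card_SigmaI)
    also have "\<dots> = (\<Sum>a<p. p - 1)" by (intro sum.cong) auto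
    finally show ?thesis by simp
  qed
  have cRD: "card R \<le> card D" by (rule card_mono[OF finD RD])
  have nR: "n * (n - 1) \<le> card R" using root_pairs_many by (simp add: R_def)
  have np: "n \<le> p"
  proof (rule ccontr)
    assume "\<not> n \<le> p"
    then have "p * (p - 1) < n * (n - 1)" using p2 by (intro mult_less_le_imp_less) auto
    then show False using nR cRD cD by simp
  qed
  define rest where "rest = real p * (real p - 1) - real (card R)"
  have rD: "real (card D) = real p * (real p - 1)" using p2 by (simp add: cD of_nat_diff)
  have pb: "(\<Sum>a<p. \<Sum>b<p. pair_bound n (\<mu> a) (\<mu> b)) = real p + real (card R) / 4 + rest / 16"
  proof -
    have "(\<Sum>a<p. \<Sum>b<p. pair_bound n (\<mu> a) (\<mu> b)) = (\<Sum>q\<in>{..<p} \<times> {..<p}. pair_bound n (\<mu> (fst q)) (\<mu> (snd q)))"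
      by (simp add: sum.cartesian_product case_prod_beta)
    also have "\<dots> = (\<Sum>q\<in>{..<p} \<times> {..<p}. (if q \<in> {..<p} \<times> {..<p} - D then 15 / 16 else 0) + (if q \<in> R then 3 / 16 else 0) + 1 / 16)"
    proof (rule sum.cong[OF refl])
      fix q assume q: "q \<in> {..<p} \<times> {..<p}"
      obtain a b where qab: "q = (a, b)" "a < p" "b < p" using q by auto
      show "pair_bound n (\<mu> (fst q)) (\<mu> (snd q)) = (if q \<in> {..<p} \<times> {..<p} - D then 15 / 16 else 0) + (if q \<in> R then 3 / 16 else 0) + 1 / 16"
        using qab same[of a b] ne[of a b] by (auto simp: pair_bound_def D_def R_def weq_def)
    qed
    also have "\<dots> = 15 / 16 * real (card ({..<p} \<times> {..<p} - D)) + 3 / 16 * real (card R) + real p * real p / 16"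
    proof -
      have "({..<p} \<times> {..<p}) \<inter> R = R" by (auto simp: R_def)
      moreover have "({..<p} \<times> {..<p}) \<inter> ({..<p} \<times> {..<p} - D) = {..<p} \<times> {..<p} - D" by blast
      ultimately show ?thesis by (simp only: sum.distrib sum.inter_restrict[symmetric] finite_cartesian_product finite_lessThan sum_constant card_cartesian_product card_lessThan of_nat_mult)
    qed
    also have "card ({..<p} \<times> {..<p} - D) = p * p - p * (p - 1)"
    proof -
      have "D \<subseteq> {..<p} \<times> {..<p}" by (auto simp: D_def)
      then show ?thesis using finD by (simp add: card_Diff_subset cD)
    qed
    also have "p * p - p * (p - 1) = p" using p2 by (cases p) auto
    finally show ?thesis by (simp add: rest_def field_simps)
  qed
  have "rest \<ge> 0" using cRD rD by (simp add: rest_def)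
  have pp: "(real p)\<^sup>2 \<le> 160000" using power_mono[of "real p" 400 2] p400 by simp
  define y where "y = (real p)\<^sup>2 / (real n + 1)"
  \<comment> \<open>The constant 16/100 is 10 times 400^2 / 10^7, the density error in the worst
    case.\<close>
  have ineq: "3 / 16 * rest + 3 / 4 * y \<le> 3 / 4 * real p + 16 / 100"
  proof -
    define z where "z = (real p)\<^sup>2 * (c / sqrt (real p))"
    have "(real p)\<^sup>2 * (1 / 4 + 3 / (4 * (real n + 1)) - 10 * (c / sqrt (real p))) = (real p)\<^sup>2 / 4 + 3 / 4 * y - 10 * z"
      by (simp add: y_def z_def algebra_simps)
    then have "(real p)\<^sup>2 / 4 + 3 / 4 * y - 10 * z \<le> real p + real (card R) / 4 + rest / 16"
      using pair_inequality[OF dense c(1) c1] unfolding pb by simp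
    moreover have "z \<le> 160000 * (1 / 10000000)"
      unfolding z_def using pp c p0 by (intro mult_mono) auto
    moreover have "real (card R) = (real p)\<^sup>2 - real p - rest" by (simp add: rest_def power2_eq_square algebra_simps)
    ultimately show ?thesis by linarith
  qed
  \<comment> \<open>If \<open>p\<close> were at least n + 2, then \<open>y\<close> would be at least
    p + 1, and the excess 3/4 is more than the allowance 16/100.\<close>
  have pn: "p \<le> n + 1"
  proof (rule ccontr)
    assume "\<not> p \<le> n + 1"
    then have a: "real p \<ge> real n + 2" by simp
    then have "(real p + 1) * (real n + 1) \<le> real p * real p"
    proof -
      have "real p * (real n + 2) \<le> real p * real p" using a p0 by (intro mult_left_mono) auto
      then show ?thesis using a by (simp add: algebra_simps)
    qed
    then have "real p + 1 \<le> y" by (simp add: y_def pos_le_divide_eq power2_eq_square)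
    then show False using ineq \<open>rest \<ge> 0\<close> by linarith
  qed
  \<comment> \<open>For \<open>p = n\<close> the roots alone supply all p (p - 1) pairs. For
    \<open>p = n + 1\<close> one has \<open>y = p\<close>, and \<open>rest\<close>, an integer in
    value, is below 1.\<close>
  have RDeq: "R = D"
  proof -
    have "card D \<le> card R"
    proof (cases "p = n")
      case True
      then show ?thesis using nR cD by simp
    next
      case False
      then have "real n + 1 = real p" using pn np by simp
      then have "y = real p" using p0 by (simp add: y_def power2_eq_square)
      then have "rest < 1" using ineq by simp
      then have "real (card D) < real (card R) + 1" using rD by (simp add: rest_def)
      then show ?thesis by linarith
    qed
    then have "card R = card D" using cRD by linarith
    then show ?thesis by (rule card_subset_eq[OF finD RD])
  qed
  have ra: "root_apart n (\<mu> a) (\<mu> b)" if "a < p" "b < p" "a \<noteq> b" for a b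
  proof -
    have "(a, b) \<in> D" using that by (simp add: D_def)
    then show ?thesis unfolding RDeq[symmetric] by (simp add: R_def)
  qed
  have orbit: "\<exists>b<p. weq n (\<mu> b) (\<lambda>j. \<mu> a (s j))" if "s permutes {..<n}" "a < p" for a s
  proof -
    have "card {b. b < p \<and> weq n (\<mu> b) (\<lambda>j. \<mu> a (s j))} = card {b. b < p \<and> weq n (\<mu> b) (\<mu> a)}"
      using weight_count_perm[OF that(1), of "\<mu> a"] by (simp add: weq_def)
    moreover have "card {b. b < p \<and> weq n (\<mu> b) (\<mu> a)} > 0"
      using that(2) by (subst card_gt_0_iff) (auto simp: weq_def)
    ultimately show ?thesis by (metis (mono_tags, lifting) card_gt_0_iff empty_Collect_eq)
  qed
  obtain a0 j0 k0 where a0: "a0 < p" "j0 < n" "k0 < n" "\<mu> a0 j0 \<noteq> \<mu> a0 k0" using coordinates_differ by blast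
  have nc: "\<not> constant_weight n (\<mu> a0)" using a0 by (auto simp: constant_weight_def)
  have close: "(\<Sum>j<n. \<bar>\<mu> a0 j - \<mu> a0 (s j)\<bar>) \<le> 2" if s: "s permutes {..<n}" for s
  proof -
    obtain b where b: "b < p" "weq n (\<mu> b) (\<lambda>j. \<mu> a0 (s j))" using orbit[OF s a0(1)] by blast
    have e: "(\<Sum>j<n. \<bar>\<mu> a0 j - \<mu> a0 (s j)\<bar>) = (\<Sum>j<n. \<bar>\<mu> a0 j - \<mu> b j\<bar>)"
      using b(2) by (intro sum.cong) (auto simp: weq_def)
    show ?thesis
    proof (cases "b = a0")
      case True
      then show ?thesis unfolding e by simp
    next
      case False
      then show ?thesis unfolding e using root_apart_dist[OF ra[OF a0(1) b(1)]] by simp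
    qed
  qed
  have "\<exists>v s. (s = 1 \<or> s = -1) \<and> standard_weight n v s (\<mu> a0)"
    by (rule close_permutations_standard[OF _ nc]) (rule close)
  then obtain v s where s: "s = 1 \<or> s = -1" and st: "standard_weight n v s (\<mu> a0)" by blast
  obtain i0 where i0: "i0 < n" "weq n (\<mu> a0) (\<lambda>j. v + (if j = i0 then s else 0))"
    using st unfolding standard_weight_def by blast
  have "\<exists>a<p. weq n (\<mu> a) (\<lambda>j. v + (if j = l then s else 0))" if l: "l < n" for l
  proof -
    have tp: "Transposition.transpose i0 l permutes {..<n}" using i0 l by (intro permutes_swap_id) auto
    obtain a where a: "a < p" "weq n (\<mu> a) (\<lambda>j. \<mu> a0 (Transposition.transpose i0 l j))" using orbit[OF tp a0(1)] by blast
    have "weq n (\<lambda>j. \<mu> a0 (Transposition.transpose i0 l j)) (\<lambda>j. v + (if Transposition.transpose i0 l j = i0 then s else 0))"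
      by (rule weq_perm[OF tp i0(2)])
    moreover have "Transposition.transpose i0 l j = i0 \<longleftrightarrow> j = l" for j
      by (metis transpose_apply_second transpose_involutory)
    ultimately show ?thesis using weq_trans[OF a(2)] a(1) by auto
  qed
  then obtain f where f: "f l < p" "weq n (\<mu> (f l)) (\<lambda>j. v + (if j = l then s else 0))" if "l < n" for l by metis
  have finj: "inj_on f {..<n}"
  proof (rule inj_onI)
    fix l k assume lk: "l \<in> {..<n}" "k \<in> {..<n}" "f l = f k"
    then have "v + (if l = l then s else 0) = v + (if l = k then s else 0)"
      using f(2)[of l] f(2)[of k] by (auto simp: weq_def)
    then show "l = k" using s by (auto split: if_splits)
  qed
  have all: "standard_weight n v s (\<mu> b)" if b: "b < p" for b
  proof (rule ccontr)
    assume nb: "\<not> standard_weight n v s (\<mu> b)"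
    then have nf: "b \<notin> f ` {..<n}" using f unfolding standard_weight_def by blast
    have "card (insert b (f ` {..<n})) = n + 1" using nf finj by (simp add: card_image)
    moreover have "insert b (f ` {..<n}) \<subseteq> {..<p}" using b f by auto
    moreover have "card {..<p} \<le> n + 1" using pn by simp
    ultimately have eq: "insert b (f ` {..<n}) = {..<p}" by (intro card_seteq) auto
    \<comment> \<open>A transposition that changes the weight of \<open>b\<close> would turn it into
      one of the standard weights, and applying it again would make the weight of \<open>b\<close>
      standard.\<close>
    have const: "\<mu> b j = \<mu> b k" if jk: "j < n" "k < n" for j k
    proof (rule ccontr)
      assume d: "\<mu> b j \<noteq> \<mu> b k"
      let ?t = "Transposition.transpose j k"
      have tp: "?t permutes {..<n}" using jk by (intro permutes_swap_id) auto
      obtain b' where b': "b' < p" "weq n (\<mu> b') (\<lambda>i. \<mu> b (?t i))" using orbit[OF tp b] by blast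
      have "\<mu> b' j = \<mu> b k" using b'(2) jk by (simp add: weq_def)
      then have "b' \<noteq> b" using d by auto
      then have "b' \<in> f ` {..<n}" using eq b'(1) by blast
      then have "standard_weight n v s (\<mu> b')" using f unfolding standard_weight_def by blast
      then have "standard_weight n v s (\<lambda>i. \<mu> b' (?t i))" by (rule standard_weight_perm[OF tp])
      moreover have "weq n (\<lambda>i. \<mu> b' (?t i)) (\<mu> b)" using weq_perm[OF tp b'(2)] by simp
      ultimately show False using nb weq_trans weq_sym unfolding standard_weight_def by meson
    qed
    have "(\<Sum>j<n. \<mu> b j) = (\<Sum>j<n. \<mu> b 0)" by (rule sum.cong[OF refl], rule const) (use n2 in auto)
    then have 1: "(\<Sum>j<n. \<mu> b j) = int n * \<mu> b 0" by simp
    have "(\<Sum>j<n. \<mu> a0 j) = (\<Sum>j<n. v + (if j = i0 then s else 0))" using i0 by (intro sum.cong) (auto simp: weq_def)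
    also have "\<dots> = int n * v + s" using i0 by (simp add: sum.distrib)
    finally have "int n * \<mu> b 0 = int n * v + s" using 1 weight_sum[OF b] weight_sum[OF a0(1)] by simp
    then have "int n * (\<mu> b 0 - v) = s" by (simp add: algebra_simps)
    then have "int n dvd s" by (metis dvd_triv_left)
    then show False using s n2 by auto
  qed
  have none: "{b. b < p \<and> \<not> standard_weight n v s (\<mu> b)} = {}" using all by blast
  have "3 * card {b. b < p \<and> \<not> standard_weight n v s (\<mu> b)} < p" unfolding none using p2 by simp
  then show ?thesis using s by blast
qed

end

text \<open>Below dimension 400 the roots of order \<open>p\<close> bound all multiplicities by one;
  from 400 on, roots of order 400 bound them by p / 150. One separation constant for all orders up
  to 400 makes \<open>d0\<close> absolute.\<close>

lemma mostly_standard: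
  "\<exists>d0>0. \<forall>n p \<rho> \<mu> c. irr_weight_rep n p \<rho> \<mu> \<longrightarrow> dense_within n p \<rho> c \<longrightarrow> 0 \<le> c \<longrightarrow> c / sqrt (real p) \<le> d0 \<longrightarrow>
    (\<exists>v s. (s = 1 \<or> s = -1) \<and> 3 * card {b. b < p \<and> \<not> standard_weight n v s (\<mu> b)} < p)"
proof -
  obtain r where r: "r > 0" and sep: "\<And>K i j. K \<le> 400 \<Longrightarrow> i < K \<Longrightarrow> j < K \<Longrightarrow> i \<noteq> j \<Longrightarrow> 2 * r \<le> cmod (rootp K i - rootp K j)"
    using roots_separated[of 400] by blast
  \<comment> \<open>The part r / 100 makes c^2 / r^2 at most p / 10000 in the multiplicity bound; 1
    / 10000000 is what the exact count requires.\<close>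
  define d0 where "d0 = min (1 / 10000000) (r / 100)"
  have d0: "d0 > 0" using r by (simp add: d0_def)
  have "\<exists>v s. (s = 1 \<or> s = -1) \<and> 3 * card {b. b < p \<and> \<not> standard_weight n v s (\<mu> b)} < p"
    if iw: "irr_weight_rep n p \<rho> \<mu>" and dense: "dense_within n p \<rho> c" and c: "0 \<le> c" "c / sqrt (real p) \<le> d0" for n p \<rho> \<mu> c
  proof -
    interpret irr_weight_rep n p \<rho> \<mu> by (rule iw)
    have p0: "real p > 0" using p2 by simp
    have cr: "c\<^sup>2 / r\<^sup>2 \<le> real p / 10000"
    proof -
      have "c \<le> r / 100 * sqrt (real p)" using c p0 by (simp add: d0_def divide_le_eq)
      then have "c\<^sup>2 \<le> (r / 100 * sqrt (real p))\<^sup>2" using c by (intro power_mono) auto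
      also have "\<dots> = r\<^sup>2 * (real p / 10000)" by (simp add: power_mult_distrib power_divide)
      finally show ?thesis using r by (simp add: divide_le_eq mult.commute)
    qed
    show ?thesis
    proof (cases "p < 400")
      case True
      have "card {a. a < p \<and> weq n (\<mu> a) \<nu>} \<le> 1" for \<nu>
      proof -
        have "real (card {a. a < p \<and> weq n (\<mu> a) \<nu>}) \<le> real ((p - 1) div p) + 1 + c\<^sup>2 / r\<^sup>2"
          using p2 True by (intro multiplicity_bound[OF dense c(1) _ _ r sep]) auto
        moreover have "(p - 1) div p = 0" using p2 by simp
        moreover have "c\<^sup>2 / r\<^sup>2 < 1" using cr True by linarith
        ultimately show ?thesis by linarith
      qed
      then show ?thesis using c True by (intro small_configuration[OF dense]) (auto simp: d0_def)
    next
      case False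
      have "real (card {a. a < p \<and> weq n (\<mu> a) \<nu>}) \<le> real p / 150" for \<nu>
      proof -
        have "real (card {a. a < p \<and> weq n (\<mu> a) \<nu>}) \<le> real ((p - 1) div 400) + 1 + c\<^sup>2 / r\<^sup>2"
          using p2 by (intro multiplicity_bound[OF dense c(1) _ _ r sep]) auto
        moreover have "real ((p - 1) div 400) \<le> real p / 400"
        proof -
          have "real ((p - 1) div 400) \<le> real (p - 1) / 400" using of_nat_div_le_of_nat[of "p - 1" 400, where 'a = real] by simp
          then show ?thesis by linarith
        qed
        ultimately show ?thesis using cr False by linarith
      qed
      moreover have "c / sqrt (real p) \<le> 1 / 10000"
      proof -
        have "d0 \<le> 1 / 10000000" by (simp add: d0_def)
        then show ?thesis using c(2) by linarith
      qed
      ultimately show ?thesis by (intro large_configuration[OF dense c(1)])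
    qed
  qed
  then show ?thesis using d0 by blast
qed

subsection \<open>A highest weight vector\<close>

text \<open>Gaussian elimination, one equation at a time: a variable with nonzero coefficient is
  eliminated, and its value is restored by back substitution.\<close>

lemma underdetermined_system:
  fixes f :: "'b \<Rightarrow> 'a \<Rightarrow> complex"
  assumes "finite B" "finite A" "card B < card A"
  shows "\<exists>x. (\<exists>a\<in>A. x a \<noteq> 0) \<and> (\<forall>b\<in>B. (\<Sum>a\<in>A. f b a * x a) = 0)"
  using assms
proof (induction B arbitrary: A f rule: finite_induct)
  case empty
  then have "A \<noteq> {}" by auto
  then show ?case by (intro exI[of _ "\<lambda>_. 1"]) auto
next
  case (insert b B)
  show ?case
  proof (cases "\<forall>a\<in>A. f b a = 0")
    case True
    have "\<exists>x. (\<exists>a\<in>A. x a \<noteq> 0) \<and> (\<forall>c\<in>B. (\<Sum>a\<in>A. f c a * x a) = 0)"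
      using insert.prems insert.hyps by (intro insert.IH) auto
    then show ?thesis using True by auto
  next
    case False
    then obtain a0 where a0: "a0 \<in> A" "f b a0 \<noteq> 0" by blast
    define h where "h c a = f c a - f c a0 * f b a / f b a0" for c a
    have "card B < card (A - {a0})" using insert.prems insert.hyps a0 by simp
    then have "\<exists>x. (\<exists>a\<in>A - {a0}. x a \<noteq> 0) \<and> (\<forall>c\<in>B. (\<Sum>a\<in>A - {a0}. h c a * x a) = 0)"
      using insert.prems insert.hyps by (intro insert.IH) auto
    then obtain x where x: "\<exists>a\<in>A - {a0}. x a \<noteq> 0" and hx: "\<And>c. c \<in> B \<Longrightarrow> (\<Sum>a\<in>A - {a0}. h c a * x a) = 0" by blast
    define S where "S = (\<Sum>a\<in>A - {a0}. f b a * x a)"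
    define y where "y = x(a0 := - S / f b a0)"
    have split: "(\<Sum>a\<in>A. f c a * y a) = f c a0 * (- S / f b a0) + (\<Sum>a\<in>A - {a0}. f c a * x a)" for c
      using insert.prems a0 by (subst sum.remove[of _ a0]) (auto simp: y_def intro!: sum.cong)
    have "(\<Sum>a\<in>A. f c a * y a) = (\<Sum>a\<in>A - {a0}. h c a * x a)" for c
      unfolding split h_def S_def
      by (simp add: left_diff_distrib right_diff_distrib sum_subtractf sum_divide_distrib sum_distrib_left mult_ac)
    then have "\<forall>c\<in>B. (\<Sum>a\<in>A. f c a * y a) = 0" using hx by simp
    moreover have "(\<Sum>a\<in>A. f b a * y a) = 0" unfolding split using a0 by (simp add: S_def)
    moreover have "\<exists>a\<in>A. y a \<noteq> 0" using x by (auto simp: y_def)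
    ultimately show ?thesis by blast
  qed
qed

context irr_weight_rep
begin

text \<open>The vectors \<open>E j k x\<close> with \<open>x\<close> of weight \<open>v + e\<^sub>i\<close> lie in nonstandard weight spaces, and every
  such weight space arises from at most two values of \<open>i\<close>.\<close>

lemma exists_extremal_vector:
  assumes bad: "3 * card {b. b < p \<and> \<not> standard_weight n v 1 (\<mu> b)} < p"
  shows "\<exists>i<n. \<exists>x\<in>carrier_mat p 1. x \<noteq> 0\<^sub>m p 1 \<and>
    (\<forall>a<p. x $$ (a, 0) \<noteq> 0 \<longrightarrow> weq n (\<mu> a) (\<lambda>j. v + (if j = i then 1 else 0))) \<and>
    (\<forall>j<n. \<forall>k<n. k \<noteq> i \<longrightarrow> j \<noteq> k \<longrightarrow> E j k * x = 0\<^sub>m p 1)"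
proof -
  define A where "A i = {a. a < p \<and> weq n (\<mu> a) (\<lambda>j. v + (if j = i then 1 else 0))}" for i
  define hit where "hit i b j k \<longleftrightarrow> j < n \<and> k < n \<and> k \<noteq> i \<and> j \<noteq> k \<and>
    (\<forall>l<n. \<mu> b l = v + (if l = i then 1 else 0) + (if l = j then 1 else 0) - (if l = k then 1 else 0))" for i b j k
  define B' where "B' i = {b. b < p \<and> (\<exists>j k. hit i b j k)}" for i
  define D where "D = {b. b < p \<and> \<not> standard_weight n v 1 (\<mu> b)}"
  have fin: "finite (A i)" "finite (B' i)" "finite D" for i by (auto simp: A_def B'_def D_def)
  have BD: "B' i \<subseteq> D" for i
  proof
    fix b assume "b \<in> B' i"
    then obtain j k where b: "b < p" and h: "hit i b j k" by (auto simp: B'_def)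
    have "\<mu> b k < v" using h unfolding hit_def by auto
    then have "\<not> standard_weight n v 1 (\<mu> b)"
      using h unfolding standard_weight_def weq_def hit_def by (metis add.commute add_increasing zero_le_one leD order_refl)
    then show "b \<in> D" using b by (simp add: D_def)
  qed
  have two: "card {i. i < n \<and> b \<in> B' i} \<le> 2" for b
  proof (cases "\<exists>i. i < n \<and> b \<in> B' i")
    case True
    then obtain i j k where i: "i < n" and h: "hit i b j k" by (auto simp: B'_def)
    have "{i. i < n \<and> b \<in> B' i} \<subseteq> {i, j}"
    proof
      fix i' assume "i' \<in> {i. i < n \<and> b \<in> B' i}"
      then have i': "i' < n" "b \<in> B' i'" by auto
      then obtain j' k' where h': "hit i' b j' k'" by (auto simp: B'_def)
      have "\<mu> b i' > v" using h' i'(1) unfolding hit_def by auto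
      then show "i' \<in> {i, j}" using h i' unfolding hit_def by (auto split: if_splits)
    qed
    then have "card {i. i < n \<and> b \<in> B' i} \<le> card {i, j}" by (intro card_mono) auto
    also have "\<dots> \<le> 2" by (simp add: card_insert_if)
    finally show ?thesis .
  next
    case False
    then have "{i. i < n \<and> b \<in> B' i} = {}" by blast
    then show ?thesis by (simp only: card.empty)
  qed
  have sumB: "(\<Sum>i<n. card (B' i)) \<le> 2 * card D"
  proof -
    have "(\<Sum>i<n. card (B' i)) = (\<Sum>i<n. \<Sum>b\<in>D. if b \<in> B' i then 1 else 0)"
      using fin BD by (intro sum.cong refl) (simp add: sum.If_cases Int_absorb1)
    also have "\<dots> = (\<Sum>b\<in>D. \<Sum>i<n. if b \<in> B' i then 1 else 0)" by (rule sum.swap)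
    also have "\<dots> = (\<Sum>b\<in>D. card {i. i < n \<and> b \<in> B' i})"
      by (intro sum.cong refl) (simp add: sum.If_cases Int_def lessThan_def)
    also have "\<dots> \<le> (\<Sum>b\<in>D. 2)" using two by (intro sum_mono)
    finally show ?thesis by simp
  qed
  have sumA: "(\<Sum>i<n. card (A i)) = p - card D"
  proof -
    have "(\<Sum>i<n. card (A i)) = card (\<Union>i<n. A i)"
    proof (rule card_UN_disjoint[symmetric])
      show "\<forall>i\<in>{..<n}. \<forall>j\<in>{..<n}. i \<noteq> j \<longrightarrow> A i \<inter> A j = {}"
      proof (intro ballI impI equals0I)
        fix i j a assume ij: "i \<in> {..<n}" "j \<in> {..<n}" "i \<noteq> j" "a \<in> A i \<inter> A j"
        then have "v + (if i = i then 1 else 0) = v + (if i = j then 1 else 0)"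
          by (auto simp: A_def weq_def)
        then show False using ij by simp
      qed
    qed (use fin in auto)
    also have "(\<Union>i<n. A i) = {..<p} - D" by (auto simp: A_def D_def standard_weight_def)
    also have "card ({..<p} - D) = p - card D" using fin by (subst card_Diff_subset) (auto simp: D_def)
    finally show ?thesis .
  qed
  \<comment> \<open>The sizes of the \<open>A i\<close> sum to p - |D|, those of the
    \<open>B' i\<close> to at most 2 |D|; this is where the bound of one third enters.\<close>
  have "\<exists>i<n. card (B' i) < card (A i)"
  proof (rule ccontr)
    assume "\<not> ?thesis"
    then have "(\<Sum>i<n. card (A i)) \<le> (\<Sum>i<n. card (B' i))" by (intro sum_mono) (metis lessThan_iff not_less)
    then show False using sumA sumB bad by (simp add: D_def)
  qed
  then obtain i where i: "i < n" "card (B' i) < card (A i)" by blast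
  \<comment> \<open>For given \<open>i\<close> and \<open>b\<close> the root leading from v + e_i to
    the weight of \<open>b\<close> is unique, so a single linear equation per \<open>b\<close>
    covers all pairs \<open>j\<close>, \<open>k\<close>.\<close>
  define g where "g b = (SOME q. hit i b (fst q) (snd q))" for b
  have g: "hit i b (fst (g b)) (snd (g b))" if "b \<in> B' i" for b
  proof -
    have "\<exists>q. hit i b (fst q) (snd q)" using that by (auto simp: B'_def)
    then show ?thesis unfolding g_def by (rule someI_ex)
  qed
  obtain y where y: "\<exists>a\<in>A i. y a \<noteq> 0" and yB: "\<And>b. b \<in> B' i \<Longrightarrow> (\<Sum>a\<in>A i. E (fst (g b)) (snd (g b)) $$ (b, a) * y a) = 0"
    using underdetermined_system[OF fin(2) fin(1) i(2), of "\<lambda>b a. E (fst (g b)) (snd (g b)) $$ (b, a)"] by blast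
  define x where "x = Matrix.mat p 1 (\<lambda>(a, _). if a \<in> A i then y a else 0)"
  have xc: "x \<in> carrier_mat p 1" by (simp add: x_def)
  have "x \<noteq> 0\<^sub>m p 1"
  proof
    assume x0: "x = 0\<^sub>m p 1"
    obtain a where a: "a \<in> A i" "y a \<noteq> 0" using y by blast
    have "x $$ (a, 0) = y a" using a by (simp add: x_def A_def)
    then show False using x0 a by (simp add: A_def)
  qed
  moreover have "\<forall>a<p. x $$ (a, 0) \<noteq> 0 \<longrightarrow> weq n (\<mu> a) (\<lambda>j. v + (if j = i then 1 else 0))"
    by (auto simp: x_def A_def)
  moreover have "E j k * x = 0\<^sub>m p 1" if jk: "j < n" "k < n" "k \<noteq> i" "j \<noteq> k" for j k
  proof (rule eq_matI)
    fix b c assume "b < dim_row (0\<^sub>m p 1 :: complex mat)" "c < dim_col (0\<^sub>m p 1 :: complex mat)"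
    then have b: "b < p" and c: "c = 0" by auto
    have "(E j k * x) $$ (b, 0) = (\<Sum>a<p. E j k $$ (b, a) * x $$ (a, 0))"
      using b xc by (intro mult_index[of _ p p _ 1]) auto
    also have "\<dots> = (\<Sum>a\<in>A i. E j k $$ (b, a) * x $$ (a, 0))"
      by (intro sum.mono_neutral_right) (auto simp: x_def A_def)
    also have "\<dots> = (\<Sum>a\<in>A i. E j k $$ (b, a) * y a)"
      by (intro sum.cong) (auto simp: x_def A_def)
    also have "\<dots> = 0"
    proof (cases "\<exists>a\<in>A i. E j k $$ (b, a) \<noteq> 0")
      case True
      then obtain a where a: "a \<in> A i" "E j k $$ (b, a) \<noteq> 0" by blast
      have h: "hit i b j k"
        unfolding hit_def using jk E_weight[OF jk(1,2) b _ a(2)] a(1) by (auto simp: A_def weq_def)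
      then have bB: "b \<in> B' i" using b by (auto simp: B'_def)
      have "fst (g b) = j \<and> snd (g b) = k"
      proof -
        obtain j' k' where gb: "g b = (j', k')" by fastforce
        have h': "hit i b j' k'" using g[OF bB] by (simp add: gb)
        have e: "(if l = j then 1 else 0) - (if l = k then 1 else 0) = (if l = j' then 1 else 0 :: int) - (if l = k' then 1 else 0)"
          if "l < n" for l
        proof -
          have "\<mu> b l = v + (if l = i then 1 else 0) + (if l = j then 1 else 0) - (if l = k then 1 else 0)"
            using h that unfolding hit_def by blast
          moreover have "\<mu> b l = v + (if l = i then 1 else 0) + (if l = j' then 1 else 0) - (if l = k' then 1 else 0)"
            using h' that unfolding hit_def by blast
          ultimately show ?thesis by linarith
        qed
        have "j' = j \<and> k' = k" using e[OF jk(1)] e[OF jk(2)] jk(4) h' unfolding hit_def by (auto split: if_splits)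
        then show ?thesis by (simp add: gb)
      qed
      then show ?thesis using yB[OF bB] by simp
    qed auto
    finally show "(E j k * x) $$ (b, c) = 0\<^sub>m p 1 $$ (b, c)" using b c by simp
  qed (use xc in auto)
  ultimately show ?thesis using i(1) xc by blast
qed

end

subsection \<open>Intertwiners with the standard representation\<close>

text \<open>In an eigenbasis of \<open>C\<close>, commutation with transpositions transported to
  that basis makes all eigenvalues equal.\<close>

lemma unitary_commutant_scalar:
  assumes C: "C \<in> carrier_mat n n" "adj C = C" and comm: "\<And>g. g \<in> U n \<Longrightarrow> C * g = g * C"
  shows "\<exists>c. C = complex_of_real c \<cdot>\<^sub>m 1\<^sub>m n"
proof -
  obtain u d where u: "u \<in> U n" and Cu: "C = u * diagm n (\<lambda>i. complex_of_real (d i)) * adj u"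
    using hermitian_spectral[OF C] by blast
  let ?D = "diagm n (\<lambda>i. complex_of_real (d i))"
  have Du: "?D = adj u * C * u"
    unfolding Cu using u by (simp add: assoc_mult_mat[of _ n n _ n _ n] U_left U_left_cancel[of _ n _ n] right_mult_one_mat[of _ n n])
  have d0: "d i = d 0" if i: "i < n" for i
  proof -
    let ?s = "Transposition.transpose 0 i"
    have s: "?s permutes {..<n}" using i by (intro permutes_swap_id) auto
    let ?P = "permm n ?s"
    have P: "?P \<in> U n" by (rule permm_U[OF s])
    have "diagm n (\<lambda>i. complex_of_real (d (?s i))) = adj ?P * ?D * ?P"
      using permm_conj_diagm[OF s, of "\<lambda>i. complex_of_real (d i)"] by (simp add: o_def)
    also have "\<dots> = adj ?P * adj u * (C * (u * ?P))"
      unfolding Du using u P C by (simp add: assoc_mult_mat[of _ n n _ n _ n])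
    also have "C * (u * ?P) = C * (u * ?P * adj u * u)"
      using u P by (simp add: assoc_mult_mat[of _ n n _ n _ n] U_left right_mult_one_mat[of _ n n])
    also have "\<dots> = C * (u * ?P * adj u) * u"
      using u P C by (simp add: assoc_mult_mat[of _ n n _ n _ n])
    also have "C * (u * ?P * adj u) = u * ?P * adj u * C" using u P by (intro comm) auto
    also have "adj ?P * adj u * (u * ?P * adj u * C * u) = adj u * C * u"
      using u P C by (simp add: assoc_mult_mat[of _ n n _ n _ n] U_left_cancel[of _ n _ n])
    finally have "diagm n (\<lambda>i. complex_of_real (d (?s i))) = ?D" unfolding Du .
    from arg_cong[OF this, of "\<lambda>M. M $$ (i, i)"] i show ?thesis by simp
  qed
  have "?D = complex_of_real (d 0) \<cdot>\<^sub>m 1\<^sub>m n"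
    unfolding diagm_const[symmetric] by (rule diagm_cong) (rule arg_cong[OF d0])
  then have "C = complex_of_real (d 0) \<cdot>\<^sub>m 1\<^sub>m n"
    unfolding Cu using u by (simp add: smult_mult_mult[of _ n] right_mult_one_mat[of _ n n] U_right[OF u])
  then show ?thesis by blast
qed

context irr_weight_rep
begin

lemma E_comm_apply:
  assumes jk: "j < n" "k < n" "h < n" "m < n" and x: "x \<in> carrier_mat p 1"
  shows "E j k * (E h m * x) = E h m * (E j k * x) + (if k = h then E j m * x else 0\<^sub>m p 1) - (if m = j then E h k * x else 0\<^sub>m p 1)"
proof (rule eq_matI)
  fix a b assume "a < dim_row (E h m * (E j k * x) + (if k = h then E j m * x else 0\<^sub>m p 1) - (if m = j then E h k * x else 0\<^sub>m p 1))"
    "b < dim_col (E h m * (E j k * x) + (if k = h then E j m * x else 0\<^sub>m p 1) - (if m = j then E h k * x else 0\<^sub>m p 1))"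
  then have ab: "a < p" "b < 1" using x by (auto split: if_splits)
  have X: "(M * x) $$ (a, b) = (\<Sum>c<p. M $$ (a, c) * x $$ (c, b))" if "M \<in> carrier_mat p p" for M
    using that x ab by (intro mult_index[of _ p p _ 1]) auto
  have "(E j k * (E h m * x)) $$ (a, b) - (E h m * (E j k * x)) $$ (a, b) =
      (\<Sum>c<p. ((E j k * E h m) $$ (a, c) - (E h m * E j k) $$ (a, c)) * x $$ (c, b))"
    using x by (simp add: X left_diff_distrib sum_subtractf del: index_mult_mat(1) flip: assoc_mult_mat[of _ p p _ p _ 1])
  also have "\<dots> = (\<Sum>c<p. ((if k = h then E j m $$ (a, c) else 0) - (if m = j then E h k $$ (a, c) else 0)) * x $$ (c, b))"
    by (rule sum.cong[OF refl]) (simp only: lessThan_iff E_comm[OF jk ab(1)])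
  also have "\<dots> = (if k = h then (E j m * x) $$ (a, b) else 0) - (if m = j then (E h k * x) $$ (a, b) else 0)"
    by (simp add: X left_diff_distrib sum_subtractf del: index_mult_mat(1))
  finally show "(E j k * (E h m * x)) $$ (a, b) = (E h m * (E j k * x) + (if k = h then E j m * x else 0\<^sub>m p 1) - (if m = j then E h k * x else 0\<^sub>m p 1)) $$ (a, b)"
    using ab x by (auto simp: algebra_simps simp del: index_mult_mat(1) split: if_splits)
qed (use x in \<open>auto split: if_splits\<close>)

text \<open>For \<open>j, h \<noteq> i\<close> the relation \<open>E j i (E h i x) = 0\<close> does not come from reordering: it holds because
  the norm of that vector vanishes, \<open>E i j\<close> being the adjoint of \<open>E j i\<close>.\<close>

lemma extremal_orbit:
  assumes i: "i < n" and x: "x \<in> carrier_mat p 1"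
    and wt: "\<And>a. a < p \<Longrightarrow> x $$ (a, 0) \<noteq> 0 \<Longrightarrow> weq n (\<mu> a) (\<lambda>j. v + (if j = i then 1 else 0))"
    and ann: "\<And>j k. j < n \<Longrightarrow> k < n \<Longrightarrow> k \<noteq> i \<Longrightarrow> j \<noteq> k \<Longrightarrow> E j k * x = 0\<^sub>m p 1"
    and y_def: "\<And>h. y h = (if h = i then x else E h i * x)"
    and jkl: "j < n" "k < n" "h < n"
  shows "E j k * y h = (if k = h then y j else 0\<^sub>m p 1) + (if j = k then of_int v else 0) \<cdot>\<^sub>m y h"
proof -
  have yc: "y h \<in> carrier_mat p 1" for h using x by (simp add: y_def)
  note yd = carrier_matD[OF yc]
  note xd = carrier_matD[OF x]
  have diag: "E j j * x = (of_int v + (if j = i then 1 else 0)) \<cdot>\<^sub>m x" if j: "j < n" for j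
  proof (rule eq_matI)
    fix a b assume "a < dim_row ((of_int v + (if j = i then 1 else 0)) \<cdot>\<^sub>m x)" "b < dim_col ((of_int v + (if j = i then 1 else 0)) \<cdot>\<^sub>m x)"
    then have ab: "a < p" "b = 0" using x by auto
    have "(E j j * x) $$ (a, b) = of_int (\<mu> a j) * x $$ (a, 0)"
      unfolding E_diag[OF j] using x ab by (simp add: diagm_left[of _ p 1] del: index_mult_mat(1))
    also have "\<dots> = (of_int v + (if j = i then 1 else 0)) * x $$ (a, 0)"
      using wt[OF ab(1)] j by (cases "x $$ (a, 0) = 0") (auto simp: weq_def)
    finally show "(E j j * x) $$ (a, b) = ((of_int v + (if j = i then 1 else 0)) \<cdot>\<^sub>m x) $$ (a, b)" using ab x by simp
  qed (use x in auto)
  have first: "E j k * x = (if k = i then y j else 0\<^sub>m p 1) + (if j = k then of_int v else 0) \<cdot>\<^sub>m x" if jk: "j < n" "k < n" for j k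
  proof (cases "j = k")
    case True
    then show ?thesis using diag[OF jk(1)] x by (auto simp: y_def add_smult_distrib_right_mat[of _ p 1] comm_add_mat[of _ p 1])
  next
    case False
    then show ?thesis using ann[OF jk] x by (auto simp: y_def)
  qed
  have comm: "E j k * (E h m * x) = E h m * (E j k * x) + (if k = h then E j m * x else 0\<^sub>m p 1) - (if m = j then E h k * x else 0\<^sub>m p 1)"
    if "j < n" "k < n" "h < n" "m < n" for j k h m using E_comm_apply[OF that x] .
  \<comment> \<open>For \<open>k \<noteq> i\<close> the commutation relation moves
    \<open>E j k\<close> past \<open>E h i\<close> onto \<open>x\<close>, where its action is
    known.\<close>
  have gen: "E j k * y h = (if k = h then y j else 0\<^sub>m p 1) + (if j = k then of_int v else 0) \<cdot>\<^sub>m y h"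
    if jk: "j < n" "k < n" "k \<noteq> i" and h: "h < n" for j k h
  proof (cases "h = i")
    case True
    then show ?thesis using first[OF jk(1,2)] jk by (auto simp: y_def)
  next
    case False
    have m1: "E h i * (E j k * x) = (if j = k then of_int v else 0) \<cdot>\<^sub>m y h"
      using first[OF jk(1,2)] jk False x by (auto simp: y_def mult_smult_distrib[of _ p p _ 1])
    have m2: "(if k = h then E j i * x else 0\<^sub>m p 1) - (if i = j then E h k * x else 0\<^sub>m p 1) = (if k = h then y j else 0\<^sub>m p 1)"
      using first[OF h jk(2)] first[OF i i] jk False x
      by (intro eq_matI) (auto simp: y_def simp del: index_mult_mat(1) split: if_splits)
    have "A + B - C = (B - C) + A" if "A \<in> carrier_mat p 1" "B \<in> carrier_mat p 1" "C \<in> carrier_mat p 1" for A B C :: "complex mat"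
      using that by (intro eq_matI) auto
    then have m3: "E h i * (E j k * x) + (if k = h then E j i * x else 0\<^sub>m p 1) - (if i = j then E h k * x else 0\<^sub>m p 1) =
        ((if k = h then E j i * x else 0\<^sub>m p 1) - (if i = j then E h k * x else 0\<^sub>m p 1)) + E h i * (E j k * x)"
      using mult_cl(1)[OF E_carrier mult_cl(1)[OF E_carrier x]] mult_cl(1)[OF E_carrier x] by simp
    have "E j k * y h = E j k * (E h i * x)" using False by (simp add: y_def)
    also have "\<dots> = E h i * (E j k * x) + (if k = h then E j i * x else 0\<^sub>m p 1) - (if i = j then E h k * x else 0\<^sub>m p 1)"
      by (rule comm[OF jk(1,2) h i])
    finally have m4: "E j k * y h = \<dots>" .
    show ?thesis using trans[OF m4 m3] unfolding m2 m1 .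
  qed
  show ?thesis
  proof (cases "k = i")
    case False
    then show ?thesis using gen jkl by simp
  next
    case ki: True
    show ?thesis
    proof (cases "h = i")
      case True
      then show ?thesis using first[of j k] jkl ki by (auto simp: y_def)
    next
      case li: False
      show ?thesis
      proof (cases "j = i")
        case True
        have "E i i * (E h i * x) = E h i * (E i i * x) - E h i * x"
          using comm[OF i i jkl(3) i] li x by (auto intro!: eq_matI simp del: index_mult_mat(1))
        also have "\<dots> = of_int v \<cdot>\<^sub>m (E h i * x)"
          using diag[OF i] x by (intro eq_matI) (auto simp: mult_smult_distrib[of _ p p _ 1] algebra_simps simp del: index_mult_mat(1))
        finally show ?thesis using True ki li x by (auto simp: y_def)
      next
        case ji: False
        define w where "w = E j i * y h"
        have wc: "w \<in> carrier_mat p 1" unfolding w_def by (rule mult_cl(1)[OF E_carrier yc])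
        have "E i j * w = 0\<^sub>m p 1"
        proof -
          have "E i j * (E j i * y h) = E j i * (E i j * y h) + E i i * y h - E j j * y h"
            using E_comm_apply[OF i jkl(1) jkl(1) i yc[of h]] by simp
          also have "E i j * y h = (if j = h then x else 0\<^sub>m p 1)"
          proof -
            have "y i = x" by (simp add: y_def)
            moreover have "(0 :: complex) \<cdot>\<^sub>m y h = 0\<^sub>m p 1" using yd by (intro eq_matI) auto
            moreover have "(if i = j then of_int v else 0) = (0 :: complex)" using ji by simp
            moreover have "(if j = h then x else 0\<^sub>m p 1) + 0\<^sub>m p 1 = (if j = h then x else 0\<^sub>m p 1)"
              using x by (simp add: right_add_zero_mat[of _ p 1])
            ultimately show ?thesis unfolding gen[OF i jkl(1) ji jkl(3)] by metis
          qed
          also have "E j j * y h = (if j = h then y j else 0\<^sub>m p 1) + of_int v \<cdot>\<^sub>m y h"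
            using gen[OF jkl(1) jkl(1) ji jkl(3)] by simp
          also have "E i i * y h = of_int v \<cdot>\<^sub>m y h"
          proof -
            have "E i i * (E h i * x) = E h i * (E i i * x) - E h i * x"
              using comm[OF i i jkl(3) i] li x by (auto intro!: eq_matI simp del: index_mult_mat(1))
            also have "\<dots> = of_int v \<cdot>\<^sub>m (E h i * x)"
              using diag[OF i] x by (intro eq_matI) (auto simp: mult_smult_distrib[of _ p p _ 1] algebra_simps simp del: index_mult_mat(1))
            finally show ?thesis using li by (simp add: y_def)
          qed
          also have "E j i * (if j = h then x else 0\<^sub>m p 1) = (if j = h then y j else 0\<^sub>m p 1)"
            using ji by (simp add: y_def right_mult_zero_mat[of _ p p])
          finally show ?thesis unfolding w_def
            using yc[of h] yc[of j] by (simp add: minus_r_inv_mat[of _ p 1])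
        qed
        then have "adj w * w = 0\<^sub>m 1 1"
          unfolding w_def using yc[of h]
          by (simp add: mat_adjoint_mult[of _ p p _ 1] E_adj assoc_mult_mat[of _ 1 p _ p _ 1])
        then have "fr2 w = 0" using fr2_tr(1)[OF wc] by (simp add: mat_trace_def)
        then have "w = 0\<^sub>m p 1" using fr2_eq_0[OF wc] by simp
        then show ?thesis using ki li ji yc[of h] yd unfolding w_def by auto
      qed
    qed
  qed
qed

text \<open>The columns of \<open>S\<close> are the extremal vector \<open>x\<close> in place
  \<open>i\<close> and its images \<open>E h i * x\<close> elsewhere; they transform like the
  standard basis, up to \<open>v\<close> times the trace.\<close>

lemma exists_intertwiner:
  assumes bad: "3 * card {b. b < p \<and> \<not> standard_weight n v 1 (\<mu> b)} < p"
  shows "\<exists>S\<in>carrier_mat p n. S \<noteq> 0\<^sub>m p n \<and>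
    (\<forall>X\<in>carrier_mat n n. L X * S = S * X + (of_int v * tr X) \<cdot>\<^sub>m S)"
proof -
  obtain i x where i: "i < n" and x: "x \<in> carrier_mat p 1" "x \<noteq> 0\<^sub>m p 1"
    and wt: "\<And>a. a < p \<Longrightarrow> x $$ (a, 0) \<noteq> 0 \<Longrightarrow> weq n (\<mu> a) (\<lambda>j. v + (if j = i then 1 else 0))"
    and ann: "\<And>j k. j < n \<Longrightarrow> k < n \<Longrightarrow> k \<noteq> i \<Longrightarrow> j \<noteq> k \<Longrightarrow> E j k * x = 0\<^sub>m p 1"
    using exists_extremal_vector[OF bad] by blast
  define y where "y h = (if h = i then x else E h i * x)" for h
  have yc: "y h \<in> carrier_mat p 1" for h using x by (simp add: y_def)
  have orb: "E j k * y h = (if k = h then y j else 0\<^sub>m p 1) + (if j = k then of_int v else 0) \<cdot>\<^sub>m y h"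
    if "j < n" "k < n" "h < n" for j k h
    by (rule extremal_orbit[OF i x(1) wt ann y_def that])
  define S where "S = Matrix.mat p n (\<lambda>(a, h). y h $$ (a, 0))"
  have Sc: "S \<in> carrier_mat p n" by (simp add: S_def)
  have "S \<noteq> 0\<^sub>m p n"
  proof
    assume S0: "S = 0\<^sub>m p n"
    have "x = 0\<^sub>m p 1"
    proof (rule eq_matI)
      fix a b assume "a < dim_row (0\<^sub>m p 1 :: complex mat)" "b < dim_col (0\<^sub>m p 1 :: complex mat)"
      then have ab: "a < p" "b = 0" by auto
      have "x $$ (a, 0) = S $$ (a, i)" using ab i by (simp add: S_def y_def)
      then show "x $$ (a, b) = 0\<^sub>m p 1 $$ (a, b)" using S0 ab i by simp
    qed (use x in auto)
    then show False using x by simp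
  qed
  moreover have "L X * S = S * X + (of_int v * tr X) \<cdot>\<^sub>m S" if X: "X \<in> carrier_mat n n" for X
  proof (rule eq_matI)
    fix a h assume "a < dim_row (S * X + (of_int v * tr X) \<cdot>\<^sub>m S)" "h < dim_col (S * X + (of_int v * tr X) \<cdot>\<^sub>m S)"
    then have al: "a < p" "h < n" using Sc X by auto
    have ent: "(\<Sum>c<p. E j k $$ (a, c) * S $$ (c, h)) = (if k = h then S $$ (a, j) else 0) + (if j = k then of_int v else 0) * S $$ (a, h)"
      if jk: "j < n" "k < n" for j k
    proof -
      have "(\<Sum>c<p. E j k $$ (a, c) * S $$ (c, h)) = (E j k * y h) $$ (a, 0)"
        using al by (subst mult_index[OF E_carrier yc]) (auto simp: S_def)
      then show ?thesis unfolding orb[OF jk al(2)] using al jk carrier_matD[OF yc] by (auto simp: S_def)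
    qed
    have "(L X * S) $$ (a, h) = (\<Sum>c<p. L X $$ (a, c) * S $$ (c, h))"
      using al X Sc by (intro mult_index[of _ p p _ n]) (auto simp: L_carrier)
    also have "\<dots> = (\<Sum>c<p. (\<Sum>j<n. \<Sum>k<n. X $$ (j, k) * E j k $$ (a, c)) * S $$ (c, h))"
      by (rule sum.cong[OF refl]) (simp only: lessThan_iff L_expand[OF X al(1)])
    also have "\<dots> = (\<Sum>j<n. \<Sum>k<n. \<Sum>c<p. X $$ (j, k) * (E j k $$ (a, c) * S $$ (c, h)))"
      by (simp only: sum_distrib_right sum.swap[of _ "{..<n}" "{..<p}"] mult.assoc)
    also have "\<dots> = (\<Sum>j<n. \<Sum>k<n. X $$ (j, k) * ((if k = h then S $$ (a, j) else 0) + (if j = k then of_int v else 0) * S $$ (a, h)))"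
      unfolding sum_distrib_left[symmetric] by (rule sum.cong[OF refl], rule sum.cong[OF refl]) (simp only: lessThan_iff ent)
    also have "\<dots> = (\<Sum>j<n. X $$ (j, h) * S $$ (a, j) + of_int v * X $$ (j, j) * S $$ (a, h))"
    proof (rule sum.cong[OF refl])
      fix j assume j: "j \<in> {..<n}"
      have "(\<Sum>k<n. X $$ (j, k) * ((if k = h then S $$ (a, j) else 0) + (if j = k then of_int v else 0) * S $$ (a, h))) =
          (\<Sum>k<n. (if k = h then X $$ (j, k) * S $$ (a, j) else 0) + (if k = j then X $$ (j, k) * of_int v * S $$ (a, h) else 0))"
        by (rule sum.cong[OF refl]) (auto simp: algebra_simps)
      also have "\<dots> = X $$ (j, h) * S $$ (a, j) + of_int v * X $$ (j, j) * S $$ (a, h)"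
        using j al by (simp add: sum.distrib mult.commute)
      finally show "(\<Sum>k<n. X $$ (j, k) * ((if k = h then S $$ (a, j) else 0) + (if j = k then of_int v else 0) * S $$ (a, h))) =
          X $$ (j, h) * S $$ (a, j) + of_int v * X $$ (j, j) * S $$ (a, h)" .
    qed
    also have "\<dots> = (S * X) $$ (a, h) + of_int v * tr X * S $$ (a, h)"
      using X al by (subst mult_index[OF Sc X]) (auto simp: sum.distrib mat_trace_def sum_distrib_left sum_distrib_right mult_ac)
    finally show "(L X * S) $$ (a, h) = (S * X + (of_int v * tr X) \<cdot>\<^sub>m S) $$ (a, h)"
      using al Sc X by (simp del: index_mult_mat(1))
  qed (use Sc X carrier_matD[OF L_carrier[OF X]] in auto)
  ultimately show ?thesis using Sc by blast
qed

end

section \<open>Determinants of unitary matrices and passage from the infinitesimal to the group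
  action\<close>

lemma one_smult: "(1 :: complex) \<cdot>\<^sub>m A = A"
  by (rule eq_matI) auto

lemma det_diagm: "det (diagm n t) = (\<Prod>j<n. t j)"
proof -
  have "det (diagm n t) = prod_list (diag_mat (diagm n t))"
    by (rule det_upper_triangular[of _ n]) (auto simp: upper_triangular_def)
  also have "diag_mat (diagm n t) = map t [0..<n]" unfolding diag_mat_def by (auto intro!: map_cong)
  also have "prod_list (map t [0..<n]) = (\<Prod>j<n. t j)"
    by (simp add: prod.distinct_set_conv_list[symmetric] atLeast0LessThan)
  finally show ?thesis .
qed

lemma det_conj:
  assumes u: "u \<in> U n" and A: "A \<in> carrier_mat n n" shows "det (u * A * adj u) = det A"
proof -
  have "det u * det (adj u) = det (u * adj u)" using u by (intro det_mult[of _ n, symmetric]) auto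
  then have "det u * det (adj u) = 1" using u by (simp add: U_right)
  moreover have "det (u * A * adj u) = det u * det A * det (adj u)"
    using u A by (simp add: det_mult[of _ n])
  ultimately show ?thesis by (simp add: mult_ac)
qed

lemma det_adj:
  assumes g: "g \<in> U n" shows "det (adj g) = cnj (det g)"
proof -
  obtain u t where u: "u \<in> U n" and gt: "g = u * diagm n t * adj u" using unitary_spectral[OF g] by blast
  have "adj g = u * diagm n (\<lambda>i. cnj (t i)) * adj u"
    unfolding gt using u by (simp add: mat_adjoint_mult[of _ n n _ n] assoc_mult_mat[of _ n n _ n _ n] diagm_adj)
  then show ?thesis unfolding gt using u by (simp only: det_conj[OF u diagm_carrier] det_diagm cnj_prod)
qed

lemma norm_det_U:
  assumes g: "g \<in> U n" shows "cmod (det g) = 1"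
proof -
  have "det g * det (adj g) = det (g * adj g)" using g by (intro det_mult[of _ n, symmetric]) auto
  then have "det g * cnj (det g) = 1" using g by (simp add: U_right det_adj)
  then have "complex_of_real ((cmod (det g))\<^sup>2) = 1" by (simp only: complex_norm_square)
  then have "(cmod (det g))\<^sup>2 = 1" using of_real_eq_1_iff by blast
  then show ?thesis using norm_ge_zero[of "det g"] unfolding power2_eq_1_iff by linarith
qed

context irr_weight_rep
begin

text \<open>After conjugation \<open>g\<close> is diagonal, and the relation for the diagonal matrix
  units says that column \<open>h\<close> of the transformed \<open>S\<close> is supported at the
  weight v + e_h. There the torus acts by t_h times the \<open>v\<close>-th power of the
  determinant, so no differential equation has to be integrated.\<close>

lemma intertwiner_group:
  assumes S: "S \<in> carrier_mat p n" and LS: "\<And>X. X \<in> carrier_mat n n \<Longrightarrow> L X * S = S * X + (of_int v * tr X) \<cdot>\<^sub>m S"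
    and g: "g \<in> U n"
  shows "\<rho> g * S = det g powi v \<cdot>\<^sub>m (S * g)"
proof -
  obtain u t where u: "u \<in> U n" and t: "\<And>j. j < n \<Longrightarrow> cmod (t j) = 1" and gt: "g = u * diagm n t * adj u"
    using unitary_spectral[OF g] by blast
  define R where "R = \<rho> u"
  have R: "R \<in> U p" unfolding R_def by (rule rU[OF u])
  note uc = U_carrier[OF u] and Rc = U_carrier[OF R]
  define S' where "S' = adj R * S * u"
  have S': "S' \<in> carrier_mat p n" using S uc Rc by (simp add: S'_def)
  have SS': "S = R * S' * adj u"
    unfolding S'_def using S R u by (simp add: assoc_mult_mat[of _ p p _ n _ n] assoc_mult_mat[of _ p n _ n _ n]
        assoc_mult_mat[of _ p p _ p _ n] U_left_cancel[of _ p _ n] U_right_cancel[of _ n _ p] U_right right_mult_one_mat[of _ p n])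
  have ent: "of_int (\<mu> a j) * S' $$ (a, h) = (if h = j then S' $$ (a, h) else 0) + of_int v * S' $$ (a, h)"
    if j: "j < n" and ah: "a < p" "h < n" for a h j
  proof -
    let ?X = "u * eu n j j * adj u"
    have Xc: "?X \<in> carrier_mat n n" using uc by simp
    have trX: "tr ?X = 1"
    proof -
      have "tr ?X = tr (adj u * (u * eu n j j))" using uc by (intro tr_comm[of _ n n]) auto
      also have "\<dots> = tr (eu n j j)" using u by (simp add: U_left_cancel[of _ n _ n])
      also have "\<dots> = 1" using j unfolding eu_diag diagm_tr by (subst sum_single[of j]) auto
      finally show ?thesis .
    qed
    have "L ?X = R * E j j * adj R" unfolding R_def E_def using u by (intro L_conj) auto
    then have "R * E j j * adj R * S = S * ?X + of_int v \<cdot>\<^sub>m S" using LS[OF Xc] trX by simp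
    then have "adj R * (R * E j j * adj R * S) * u = adj R * (S * ?X + of_int v \<cdot>\<^sub>m S) * u" by simp
    moreover have "adj R * (R * E j j * adj R * S) * u = E j j * S'"
      unfolding S'_def using S R u by (simp add: assoc_mult_mat[of _ p p _ p _ n] assoc_mult_mat[of _ p p _ n _ n] assoc_mult_mat[of _ p p _ p _ p] U_left_cancel[of _ p _ n])
    moreover have "adj R * (S * ?X + of_int v \<cdot>\<^sub>m S) * u = S' * eu n j j + of_int v \<cdot>\<^sub>m S'"
    proof -
      have "adj R * (S * ?X + of_int v \<cdot>\<^sub>m S) * u = adj R * (S * ?X) * u + adj R * (of_int v \<cdot>\<^sub>m S) * u"
        using S Rc uc Xc by (subst mult_add_distrib_mat[of _ p p _ n], simp, simp, simp) (subst add_mult_distrib_mat[of _ p n], auto)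
      also have "adj R * (of_int v \<cdot>\<^sub>m S) * u = of_int v \<cdot>\<^sub>m S'"
        unfolding S'_def using S Rc uc by (simp add: mult_smult_distrib[of _ p p _ n] mult_smult_assoc_mat[of _ p n _ n])
      also have "adj R * (S * ?X) * u = S' * eu n j j"
        unfolding S'_def using S R u by (simp add: assoc_mult_mat[of _ p p _ n _ n] assoc_mult_mat[of _ p n _ n _ n]
          assoc_mult_mat[of _ n n _ n _ n] U_left right_mult_one_mat[of _ n n])
      finally show ?thesis .
    qed
    ultimately have "(E j j * S') $$ (a, h) = (S' * eu n j j + of_int v \<cdot>\<^sub>m S') $$ (a, h)" by simp
    moreover have "(E j j * S') $$ (a, h) = of_int (\<mu> a j) * S' $$ (a, h)"
      unfolding E_diag[OF j] by (rule diagm_left[OF S' ah])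
    moreover have "(S' * eu n j j) $$ (a, h) = (if h = j then S' $$ (a, h) else 0)"
      using eu_right[OF S' j ah] by auto
    ultimately show ?thesis using ah S' by (simp del: index_mult_mat(1))
  qed
  define c where "c = chi n t (\<lambda>_. v)"
  have key: "diagm p (\<lambda>a. chi n t (\<mu> a)) * S' = c \<cdot>\<^sub>m (S' * diagm n t)"
  proof (rule eq_matI)
    fix a h assume "a < dim_row (c \<cdot>\<^sub>m (S' * diagm n t))" "h < dim_col (c \<cdot>\<^sub>m (S' * diagm n t))"
    then have ah: "a < p" "h < n" using S' by auto
    have "chi n t (\<mu> a) * S' $$ (a, h) = c * (S' $$ (a, h) * t h)"
    proof (cases "S' $$ (a, h) = 0")
      case False
      have wt: "\<mu> a j = v + (if j = h then 1 else 0)" if "j < n" for j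
      proof -
        have "of_int (\<mu> a j) * S' $$ (a, h) = of_int (v + (if j = h then 1 else 0)) * S' $$ (a, h)"
          using ent[OF that ah] by (auto simp: algebra_simps)
        then show ?thesis using False of_int_eq_iff by (metis mult_right_cancel)
      qed
      have "chi n t (\<mu> a) = chi n t (\<lambda>j. v + (if j = h then 1 else 0))"
        unfolding chi_def using wt by (intro prod.cong) auto
      also have "\<dots> = c * t h" unfolding c_def using t by (simp add: chi_add chi_unit[OF ah(2)])
      finally show ?thesis by simp
    qed simp
    then show "(diagm p (\<lambda>a. chi n t (\<mu> a)) * S') $$ (a, h) = (c \<cdot>\<^sub>m (S' * diagm n t)) $$ (a, h)"
      using ah S' by (simp add: diagm_left[OF S' ah] diagm_right[OF S' ah] del: index_mult_mat(1))
  qed (use S' in auto)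
  have cd: "c = det g powi v"
  proof -
    have "det g = (\<Prod>j<n. t j)" unfolding gt det_conj[OF u diagm_carrier] det_diagm ..
    moreover have "c = (\<Prod>j<n. t j) powi v"
      unfolding c_def chi_def by (induction n) (simp_all add: power_int_mult_distrib)
    ultimately show ?thesis by simp
  qed
  have rg: "\<rho> g = R * diagm p (\<lambda>a. chi n t (\<mu> a)) * adj R" unfolding gt R_def by (rule rconj[OF u t])
  have "\<rho> g * S = R * (diagm p (\<lambda>a. chi n t (\<mu> a)) * S') * adj u"
    unfolding rg by (subst SS') (use S' R u in \<open>simp add: assoc_mult_mat[of _ p p _ p _ n] assoc_mult_mat[of _ p p _ n _ n] assoc_mult_mat[of _ p p _ p _ p] U_left_cancel[of _ p _ n]\<close>)
  also have "\<dots> = c \<cdot>\<^sub>m (R * (S' * diagm n t) * adj u)"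
    unfolding key using S' Rc uc by (simp add: mult_smult_distrib[of _ p p _ n] mult_smult_assoc_mat[of _ p n _ n])
  also have "R * (S' * diagm n t) * adj u = R * S' * adj u * (u * diagm n t * adj u)"
    using S' R u by (simp add: assoc_mult_mat[of _ p p _ n _ n] assoc_mult_mat[of _ p n _ n _ n] assoc_mult_mat[of _ n n _ n _ n] U_left_cancel[of _ n _ n])
  also have "\<dots> = S * g" using SS' gt by simp
  finally show ?thesis unfolding cd .
qed

text \<open>Schur's lemma on both sides: \<open>adj S * S\<close> commutes with \<open>U n\<close>
  and \<open>S * adj S\<close> with \<rho>, so both are scalar, and with the same scalar since
  \<open>S\<close> is nonzero. Comparing traces gives \<open>p = n\<close>, and rescaling makes
  \<open>S\<close> unitary.\<close>

lemma standard_representation: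
  assumes bad: "3 * card {b. b < p \<and> \<not> standard_weight n v 1 (\<mu> b)} < p"
  shows "p = n \<and> (\<exists>W\<in>U n. \<forall>g\<in>U n. \<rho> g = det g powi v \<cdot>\<^sub>m (W * g * adj W))"
proof -
  obtain S where S: "S \<in> carrier_mat p n" "S \<noteq> 0\<^sub>m p n"
    and LS: "\<And>X. X \<in> carrier_mat n n \<Longrightarrow> L X * S = S * X + (of_int v * tr X) \<cdot>\<^sub>m S"
    using exists_intertwiner[OF bad] by blast
  have gS: "\<rho> g * S = det g powi v \<cdot>\<^sub>m (S * g)" if "g \<in> U n" for g
    by (rule intertwiner_group[OF S(1) LS that])
  have nd: "cnj (det g powi v) * det g powi v = 1" if "g \<in> U n" for g
  proof -
    have "cmod (det g powi v) = 1" using norm_det_U[OF that] by (simp add: norm_power_int)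
    then show ?thesis using complex_norm_square[of "det g powi v"] by (simp add: mult.commute)
  qed
  have Sg: "adj S * \<rho> g = det g powi v \<cdot>\<^sub>m (g * adj S)" if g: "g \<in> U n" for g
  proof -
    have "adj S * \<rho> g = adj (\<rho> (adj g) * S)"
      using g S(1) by (simp add: mat_adjoint_mult[of _ p p _ n] radj)
    also have "\<dots> = cnj (det (adj g) powi v) \<cdot>\<^sub>m (g * adj S)"
      unfolding gS[OF U_adj[OF g]] using g S(1) by (simp add: adj_smult mat_adjoint_mult[of _ p n _ n])
    also have "cnj (det (adj g) powi v) = det g powi v" using g by (simp add: det_adj flip: complex_cnj_power_int)
    finally show ?thesis .
  qed
  define A where "A = adj S * S"
  have Ac: "A \<in> carrier_mat n n" using S(1) unfolding A_def by (intro mult_carrier_mat[of _ n p]) auto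
  have "\<exists>c. A = complex_of_real c \<cdot>\<^sub>m 1\<^sub>m n"
  proof (rule unitary_commutant_scalar[OF Ac])
    show "adj A = A" unfolding A_def using S(1) by (simp add: mat_adjoint_mult[of _ n p _ n])
    fix g assume g: "g \<in> U n"
    have "det g powi v \<cdot>\<^sub>m (A * g) = adj S * (det g powi v \<cdot>\<^sub>m (S * g))"
      using S(1) g by (simp add: A_def mult_smult_distrib[of _ n p _ n] assoc_mult_mat[of _ n p _ n _ n])
    also have "\<dots> = adj S * \<rho> g * S"
      unfolding gS[OF g, symmetric] using S(1) g by (simp add: assoc_mult_mat[of _ n p _ p _ n])
    also have "\<dots> = det g powi v \<cdot>\<^sub>m (g * A)"
      unfolding Sg[OF g] using S(1) g by (simp add: A_def mult_smult_assoc_mat[of _ n p _ n] assoc_mult_mat[of _ n n _ p _ n])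
    finally have "det g powi v \<cdot>\<^sub>m (A * g) = det g powi v \<cdot>\<^sub>m (g * A)" .
    then have "cnj (det g powi v) \<cdot>\<^sub>m (det g powi v \<cdot>\<^sub>m (A * g)) = cnj (det g powi v) \<cdot>\<^sub>m (det g powi v \<cdot>\<^sub>m (g * A))" by simp
    then show "A * g = g * A" unfolding smult_smult nd[OF g] one_smult .
  qed
  then obtain c1 where c1: "A = complex_of_real c1 \<cdot>\<^sub>m 1\<^sub>m n" by blast
  define T where "T = S * adj S"
  have Tc: "T \<in> carrier_mat p p" using S(1) unfolding T_def by (intro mult_carrier_mat[of _ p n]) auto
  have "\<exists>c. T = c \<cdot>\<^sub>m 1\<^sub>m p"
  proof -
    have "adj T = T" unfolding T_def using S(1) by (simp add: mat_adjoint_mult[of _ p n _ p])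
    moreover have "T * \<rho> g = \<rho> g * T" if g: "g \<in> U n" for g
    proof -
      have "T * \<rho> g = S * (adj S * \<rho> g)" using S(1) g by (simp add: T_def assoc_mult_mat[of _ p n _ p _ p])
      also have "\<dots> = det g powi v \<cdot>\<^sub>m (S * g * adj S)"
        unfolding Sg[OF g] using S(1) g by (simp add: mult_smult_distrib[of _ p n _ p] assoc_mult_mat[of _ p n _ n _ p])
      also have "\<dots> = \<rho> g * S * adj S"
        unfolding gS[OF g] using S(1) g by (simp add: mult_smult_assoc_mat[of _ p n _ p])
      also have "\<dots> = \<rho> g * T" using S(1) g by (simp add: T_def assoc_mult_mat[of _ p p _ n _ p])
      finally show ?thesis .
    qed
    ultimately show ?thesis using irr Tc unfolding irreducible_rep_def by blast
  qed
  then obtain c2 where c2: "T = c2 \<cdot>\<^sub>m 1\<^sub>m p" by blast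
  have "complex_of_real c1 \<cdot>\<^sub>m S = S * A"
    unfolding c1 using S(1) by (simp add: mult_smult_distrib[of _ p n _ n] right_mult_one_mat[of _ p n])
  also have "\<dots> = T * S" using S(1) by (simp add: A_def T_def assoc_mult_mat[of _ p n _ p _ n])
  also have "\<dots> = c2 \<cdot>\<^sub>m S" unfolding c2 using S(1) by (simp add: mult_smult_assoc_mat[of _ p p _ n] left_mult_one_mat[of _ p n])
  finally have cS: "complex_of_real c1 \<cdot>\<^sub>m S = c2 \<cdot>\<^sub>m S" .
  have fS: "fr2 S > 0" using S fr2_eq_0[OF S(1)] fr2_nonneg[of S] by linarith
  obtain a h where ah: "a < p" "h < n" "S $$ (a, h) \<noteq> 0"
  proof -
    have "\<exists>a<p. \<exists>h<n. S $$ (a, h) \<noteq> 0"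
    proof (rule ccontr)
      assume "\<not> ?thesis"
      then have "S = 0\<^sub>m p n" using S(1) by (intro eq_matI) auto
      then show False using S(2) by simp
    qed
    then show ?thesis using that by blast
  qed
  have c12: "c2 = complex_of_real c1"
    using arg_cong[OF cS, of "\<lambda>M. M $$ (a, h)"] ah S(1) by simp
  have "complex_of_real (fr2 S) = of_nat n * complex_of_real c1"
    unfolding fr2_tr(1)[OF S(1), symmetric] A_def[symmetric] c1 by (simp add: mat_trace_def)
  then have "complex_of_real (fr2 S) = complex_of_real (real n * c1)" by simp
  then have n1: "fr2 S = real n * c1" by (simp only: of_real_eq_iff)
  have "complex_of_real (fr2 S) = of_nat p * c2"
    unfolding fr2_tr(2)[OF S(1), symmetric] T_def[symmetric] c2 by (simp add: mat_trace_def)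
  then have "complex_of_real (fr2 S) = complex_of_real (real p * c1)" by (simp add: c12)
  then have p1: "fr2 S = real p * c1" by (simp only: of_real_eq_iff)
  have c10: "c1 > 0" using fS n1 by (simp add: zero_less_mult_iff)
  have pn: "p = n" using n1 p1 c10 by simp
  define r where "r = complex_of_real (1 / sqrt c1)"
  define W where "W = r \<cdot>\<^sub>m S"
  have Wc: "W \<in> carrier_mat n n" using S(1) pn by (simp add: W_def)
  have "adj W * W = (cnj r * r) \<cdot>\<^sub>m A"
    unfolding W_def adj_smult A_def using S(1)
    by (simp add: mult_smult_distrib[of _ n p _ n] mult_smult_assoc_mat[of _ n p _ n] smult_smult mult.commute)
  also have "\<dots> = (cnj r * r * complex_of_real c1) \<cdot>\<^sub>m 1\<^sub>m n" unfolding c1 by (simp add: smult_smult)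
  also have "cnj r * r * complex_of_real c1 = 1"
  proof -
    have "1 / sqrt c1 * (1 / sqrt c1) * c1 = 1" using c10 by simp
    then have "complex_of_real (1 / sqrt c1 * (1 / sqrt c1) * c1) = 1" by (simp only: of_real_1)
    then show ?thesis unfolding r_def complex_cnj_complex_of_real of_real_mult .
  qed
  finally have "W \<in> U n" using Wc by (intro U_intro) (simp_all only: one_smult)
  moreover have "\<rho> g = det g powi v \<cdot>\<^sub>m (W * g * adj W)" if g: "g \<in> U n" for g
  proof -
    have rgc: "\<rho> g \<in> carrier_mat n n" using rc[OF g] pn by simp
    have "\<rho> g * W = det g powi v \<cdot>\<^sub>m (W * g)"
      unfolding W_def using gS[OF g] S(1) g pn rgc
      by (simp add: mult_smult_distrib[of _ n n _ n] mult_smult_assoc_mat[of _ n n _ n] smult_smult mult.commute)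
    then have "\<rho> g * W * adj W = det g powi v \<cdot>\<^sub>m (W * g * adj W)"
      using Wc g by (simp add: mult_smult_assoc_mat[of _ n n _ n])
    then show ?thesis using \<open>W \<in> U n\<close> rgc by (simp add: U_right_cancel[of _ n _ n])
  qed
  ultimately show ?thesis using pn by blast
qed

end

subsection \<open>Nearly dense irreducible representations\<close>

abbreviation conj_mat :: "complex mat \<Rightarrow> complex mat" where "conj_mat \<equiv> map_mat cnj"

lemma conj_mat_mult:
  assumes "A \<in> carrier_mat n m" "B \<in> carrier_mat m q"
  shows "conj_mat (A * B) = conj_mat A * conj_mat B"
proof (rule eq_matI)
  fix i j assume "i < dim_row (conj_mat A * conj_mat B)" "j < dim_col (conj_mat A * conj_mat B)"
  then have ij: "i < n" "j < q" using assms by auto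
  have "conj_mat (A * B) $$ (i, j) = cnj ((A * B) $$ (i, j))" using ij assms by (simp del: index_mult_mat(1))
  also have "\<dots> = (\<Sum>k<m. conj_mat A $$ (i, k) * conj_mat B $$ (k, j))"
    unfolding mult_index[OF assms ij] using ij assms by simp
  also have "\<dots> = (conj_mat A * conj_mat B) $$ (i, j)"
    using ij assms by (subst mult_index[of _ n m _ q]) auto
  finally show "conj_mat (A * B) $$ (i, j) = (conj_mat A * conj_mat B) $$ (i, j)" .
qed (use assms in auto)

lemma conj_mat_conj [simp]: "conj_mat (conj_mat A) = A"
  by (rule eq_matI) auto

lemma adj_conj_mat: "adj (conj_mat A) = conj_mat (adj A)"
  by (rule eq_matI) auto

lemma conj_mat_diagm: "conj_mat (diagm n t) = diagm n (\<lambda>i. cnj (t i))"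
  by (rule eq_matI) auto

lemma conj_mat_U [simp]: "g \<in> U n \<Longrightarrow> conj_mat g \<in> U n"
proof -
  assume g: "g \<in> U n"
  have "adj (conj_mat g) * conj_mat g = conj_mat (adj g * g)"
    unfolding adj_conj_mat using g by (intro conj_mat_mult[of _ n n _ n, symmetric]) auto
  also have "\<dots> = 1\<^sub>m n" unfolding U_left[OF g] by (rule eq_matI) auto
  finally show ?thesis using U_carrier[OF g] by (intro U_intro) auto
qed

lemma det_conj_mat:
  assumes g: "g \<in> U n" shows "det (conj_mat g) = cnj (det g)"
proof -
  obtain u t where u: "u \<in> U n" and gt: "g = u * diagm n t * adj u" using unitary_spectral[OF g] by blast
  have "conj_mat g = conj_mat u * diagm n (\<lambda>i. cnj (t i)) * adj (conj_mat u)"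
    unfolding gt adj_conj_mat conj_mat_diagm[symmetric] using u by (simp add: conj_mat_mult[of _ n n _ n])
  then show ?thesis unfolding gt using u
    by (simp only: det_conj[OF u diagm_carrier] det_conj[OF conj_mat_U[OF u] diagm_carrier] det_diagm cnj_prod)
qed

lemma cnj_det_powi: "g \<in> U n \<Longrightarrow> cnj (det g) powi (- v) = det g powi v"
  using cnj_powi[OF norm_det_U, of g n "- v"] by simp

lemma dense_within_conj:
  assumes dense: "dense_within n p \<rho> c" and w: "w \<in> U p" and rU: "\<And>g. g \<in> U n \<Longrightarrow> \<rho> g \<in> U p"
  shows "dense_within n p (\<lambda>g. adj w * \<rho> g * w) c"
  unfolding dense_within_def
proof
  fix z assume z: "z \<in> U p"
  then have "w * z * adj w \<in> U p" using w by simp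
  then obtain g where g: "g \<in> U n" "fr (\<rho> g - w * z * adj w) \<le> c" using dense unfolding dense_within_def by blast
  have rg: "\<rho> g \<in> carrier_mat p p" using rU[OF g(1)] by simp
  have "adj w * \<rho> g * w - z = adj w * (\<rho> g - w * z * adj w) * w"
    using w z rg by (simp add: mult_minus_right[of _ p p _ p] mult_minus_left[of _ p p _ _ p]
        assoc_mult_mat[of _ p p _ p _ p] U_left U_left_cancel[of _ p _ p] right_mult_one_mat[of _ p p])
  then have "fr (adj w * \<rho> g * w - z) = fr (\<rho> g - w * z * adj w)"
    using w z rg by (simp add: fr_U_right[of _ p _ p] fr_U_left[of _ p _ p])
  then have "fr (adj w * \<rho> g * w - z) \<le> c" using g by linarith
  then show "\<exists>g\<in>U n. fr (adj w * \<rho> g * w - z) \<le> c" using g(1) by (rule rev_bexI[rotated])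
qed

lemma irreducible_conj:
  assumes irr: "irreducible_rep n p \<rho>" and w: "w \<in> U p" and rU: "\<And>g. g \<in> U n \<Longrightarrow> \<rho> g \<in> U p"
  shows "irreducible_rep n p (\<lambda>g. adj w * \<rho> g * w)"
  unfolding irreducible_rep_def
proof (intro ballI impI)
  fix A assume A: "A \<in> carrier_mat p p" "adj A = A" and comm: "\<forall>g\<in>U n. A * (adj w * \<rho> g * w) = adj w * \<rho> g * w * A"
  note wc = U_carrier[OF w]
  let ?A = "w * A * adj w"
  have Aw: "A = adj w * ?A * w"
    using w A by (simp add: assoc_mult_mat[of _ p p _ p _ p] U_left U_left_cancel[of _ p _ p] right_mult_one_mat[of _ p p])
  have 1: "?A \<in> carrier_mat p p" using wc A by simp
  have 2: "adj ?A = ?A" using wc A by (simp add: mat_adjoint_mult[of _ p p _ p] assoc_mult_mat[of _ p p _ p _ p])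
  have 3: "?A * \<rho> g = \<rho> g * ?A" if g: "g \<in> U n" for g
  proof -
    have rg: "\<rho> g \<in> carrier_mat p p" using rU[OF g] by simp
    have "w * (A * (adj w * \<rho> g * w)) * adj w = w * (adj w * \<rho> g * w * A) * adj w" using comm g by simp
    moreover have "w * (A * (adj w * \<rho> g * w)) * adj w = ?A * \<rho> g"
      using w A rg by (simp add: assoc_mult_mat[of _ p p _ p _ p] U_right right_mult_one_mat[of _ p p])
    moreover have "w * (adj w * \<rho> g * w * A) * adj w = \<rho> g * ?A"
      using w A rg by (simp add: assoc_mult_mat[of _ p p _ p _ p] U_left_cancel[of _ p _ p])
    ultimately show ?thesis by simp
  qed
  obtain c where c: "?A = c \<cdot>\<^sub>m 1\<^sub>m p" using irr 1 2 3 unfolding irreducible_rep_def by blast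
  have "A = adj w * (c \<cdot>\<^sub>m 1\<^sub>m p) * w" using Aw unfolding c .
  also have "\<dots> = c \<cdot>\<^sub>m 1\<^sub>m p" using w by (simp add: smult_mult_mult[of _ p] right_mult_one_mat[of _ p p] U_left)
  finally have "A = c \<cdot>\<^sub>m 1\<^sub>m p" .
  then show "\<exists>c. A = c \<cdot>\<^sub>m 1\<^sub>m p" by (rule exI)
qed

lemma exists_weight_rep:
  assumes rep: "unitary_rep n p \<rho>"
  shows "\<exists>w\<in>U p. \<exists>\<mu>. weight_rep n p (\<lambda>g. adj w * \<rho> g * w) \<mu>"
proof -
  obtain w \<mu> where w: "w \<in> U p" and
    d: "\<And>t. (\<forall>j<n. cmod (t j) = 1) \<Longrightarrow> adj w * \<rho> (diagm n t) * w = diagm p (\<lambda>a. \<Prod>j<n. t j powi \<mu> a j)"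
    using exists_weights[OF rep] by blast
  have rU: "\<rho> g \<in> U p" if "g \<in> U n" for g using rep that by (simp add: unitary_rep_def)
  have "weight_rep n p (\<lambda>g. adj w * \<rho> g * w) \<mu>"
  proof
    fix g h assume g: "g \<in> U n" and h: "h \<in> U n"
    show "adj w * \<rho> g * w \<in> U p" using w rU[OF g] by simp
    have "\<rho> (g * h) = \<rho> g * \<rho> h" using rep g h by (simp add: unitary_rep_def)
    then show "adj w * \<rho> (g * h) * w = adj w * \<rho> g * w * (adj w * \<rho> h * w)"
      using w rU[OF g] rU[OF h] by (simp add: assoc_mult_mat[of _ p p _ p _ p] U_left_cancel[of _ p _ p])
  next
    fix t :: "nat \<Rightarrow> complex" assume "\<And>j. j < n \<Longrightarrow> cmod (t j) = 1"
    then show "adj w * \<rho> (diagm n t) * w = diagm p (\<lambda>a. chi n t (\<mu> a))"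
      unfolding chi_def by (intro d) auto
  qed
  then show ?thesis using w by blast
qed

text \<open>The only weight is fixed by all permutations, hence constant, and a torus element acts
  by a power of its determinant; conjugation extends this to all unitaries.\<close>

lemma one_dimensional_rep:
  assumes rep: "unitary_rep n 1 \<rho>"
  shows "\<exists>k::int. \<forall>g\<in>U n. \<rho> g = det g powi k \<cdot>\<^sub>m 1\<^sub>m 1"
proof -
  obtain w \<mu> where w: "w \<in> U 1" and "weight_rep n 1 (\<lambda>g. adj w * \<rho> g * w) \<mu>"
    using exists_weight_rep[OF rep] by blast
  then interpret weight_rep n 1 "\<lambda>g. adj w * \<rho> g * w" \<mu> by simp
  have const: "\<mu> 0 j = \<mu> 0 0" if j: "j < n" for j
  proof -
    let ?s = "Transposition.transpose 0 j"
    have s: "?s permutes {..<n}" using j by (intro permutes_swap_id) auto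
    have "{a. a < 1 \<and> (\<forall>i<n. \<mu> a i = \<mu> 0 i)} = {0}" by auto
    then have "card {a. a < 1 \<and> (\<forall>i<n. \<mu> a i = \<mu> 0 (?s i))} = 1"
      using weight_count_perm[OF s, of "\<mu> 0"] by simp
    then obtain a where "{a. a < 1 \<and> (\<forall>i<n. \<mu> a i = \<mu> 0 (?s i))} = {a}" by (rule card_1_singletonE)
    then have a: "a < 1" "\<forall>i<n. \<mu> a i = \<mu> 0 (?s i)" by blast+
    have "\<mu> a j = \<mu> 0 (?s j)" using a(2) j by blast
    then show ?thesis using a(1) by simp
  qed
  have "\<rho> g = det g powi \<mu> 0 0 \<cdot>\<^sub>m 1\<^sub>m 1" if g: "g \<in> U n" for g
  proof -
    have rg: "\<rho> g \<in> carrier_mat 1 1" using rep g unfolding unitary_rep_def by (intro U_carrier) blast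
    obtain u t where u: "u \<in> U n" and t: "\<And>j. j < n \<Longrightarrow> cmod (t j) = 1" and gt: "g = u * diagm n t * adj u"
      using unitary_spectral[OF g] by blast
    have "det g = (\<Prod>j<n. t j)" unfolding gt det_conj[OF u diagm_carrier] det_diagm ..
    moreover have "(\<Prod>j<n. t j) powi k = (\<Prod>j<n. t j powi k)" for k by (induction n) (simp_all add: power_int_mult_distrib)
    moreover have "chi n t (\<mu> 0) = (\<Prod>j<n. t j powi \<mu> 0 0)" unfolding chi_def by (rule prod.cong[OF refl], rule arg_cong2[where f = power_int], rule refl, rule const) simp
    ultimately have "chi n t (\<mu> 0) = det g powi \<mu> 0 0" by simp
    then have dc: "diagm 1 (\<lambda>a. chi n t (\<mu> a)) = det g powi \<mu> 0 0 \<cdot>\<^sub>m 1\<^sub>m 1"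
      unfolding diagm_const[symmetric] by (intro diagm_cong) simp
    let ?\<rho> = "\<lambda>g. adj w * \<rho> g * w"
    have "?\<rho> g = ?\<rho> u * diagm 1 (\<lambda>a. chi n t (\<mu> a)) * adj (?\<rho> u)" unfolding gt by (rule rconj[OF u t])
    also have "\<dots> = det g powi \<mu> 0 0 \<cdot>\<^sub>m 1\<^sub>m 1"
      unfolding dc smult_mult_mult[OF rc[OF u] one_carrier_mat adj_carrier[OF rc[OF u]]]
      by (simp only: right_mult_one_mat[OF rc[OF u]] U_right[OF rU[OF u]])
    finally have 1: "?\<rho> g = det g powi \<mu> 0 0 \<cdot>\<^sub>m 1\<^sub>m 1" .
    have "\<rho> g = w * ?\<rho> g * adj w"
      using w rg by (simp add: assoc_mult_mat[of _ 1 1 _ 1 _ 1] U_right U_left_cancel[of _ 1 _ 1] right_mult_one_mat[of _ 1 1])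
    also have "\<dots> = det g powi \<mu> 0 0 \<cdot>\<^sub>m 1\<^sub>m 1"
      unfolding 1 smult_mult_mult[OF U_carrier[OF w] one_carrier_mat adj_carrier[OF U_carrier[OF w]]]
      by (simp only: right_mult_one_mat[OF U_carrier[OF w]] U_right[OF w])
    finally show ?thesis .
  qed
  then show ?thesis by blast
qed

context irr_weight_rep
begin

text \<open>Entrywise conjugation is an automorphism of \<open>U n\<close>. Composing with it
  negates the weights and keeps irreducibility, so it exchanges the two signs of standard
  weights.\<close>

lemma conj_irr_weight_rep: "irr_weight_rep n p (\<lambda>g. \<rho> (conj_mat g)) (\<lambda>a j. - \<mu> a j)"
proof
  fix g h assume g: "g \<in> U n" and h: "h \<in> U n"
  show "\<rho> (conj_mat g) \<in> U p" using g by simp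
  show "\<rho> (conj_mat (g * h)) = \<rho> (conj_mat g) * \<rho> (conj_mat h)"
    using g h by (simp add: conj_mat_mult[of _ n n _ n] rmult)
next
  fix t :: "nat \<Rightarrow> complex" assume t: "\<And>j. j < n \<Longrightarrow> cmod (t j) = 1"
  have "\<rho> (conj_mat (diagm n t)) = diagm p (\<lambda>a. chi n (\<lambda>j. cnj (t j)) (\<mu> a))"
    unfolding conj_mat_diagm using t by (intro rdiag) simp
  moreover have "chi n (\<lambda>j. cnj (t j)) (\<mu> a) = chi n t (\<lambda>j. - \<mu> a j)" for a
    unfolding chi_def using t by (intro prod.cong) (simp_all add: cnj_powi flip: complex_cnj_power_int)
  ultimately show "\<rho> (conj_mat (diagm n t)) = diagm p (\<lambda>a. chi n t (\<lambda>j. - \<mu> a j))" by simp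
next
  show "irreducible_rep n p (\<lambda>g. \<rho> (conj_mat g))"
    unfolding irreducible_rep_def
  proof (intro ballI impI)
    fix A assume A: "A \<in> carrier_mat p p" "adj A = A" "\<forall>g\<in>U n. A * \<rho> (conj_mat g) = \<rho> (conj_mat g) * A"
    have "A * \<rho> g = \<rho> g * A" if "g \<in> U n" for g using A(3) conj_mat_U[OF that] conj_mat_conj[of g] by metis
    then show "\<exists>c. A = c \<cdot>\<^sub>m 1\<^sub>m p" using irr A unfolding irreducible_rep_def by blast
  qed
qed (rule p2)

lemma standard_representation_sign:
  assumes s: "s = 1 \<or> s = -1" and bad: "3 * card {b. b < p \<and> \<not> standard_weight n v s (\<mu> b)} < p"
  shows "p = n \<and> (\<exists>W\<in>U n. (\<forall>g\<in>U n. \<rho> g = det g powi v \<cdot>\<^sub>m (W * g * adj W)) \<or>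
    (\<forall>g\<in>U n. \<rho> g = det g powi v \<cdot>\<^sub>m (W * conj_mat g * adj W)))"
proof (cases "s = 1")
  case True
  then show ?thesis using standard_representation[of v] bad by blast
next
  case False
  then have s1: "s = -1" using s by simp
  interpret c: irr_weight_rep n p "\<lambda>g. \<rho> (conj_mat g)" "\<lambda>a j. - \<mu> a j" by (rule conj_irr_weight_rep)
  have "standard_weight n (- v) 1 (\<lambda>j. - \<mu> b j) \<longleftrightarrow> standard_weight n v s (\<mu> b)" for b
  proof -
    have "weq n (\<lambda>j. - \<mu> b j) (\<lambda>j. - v + (if j = i then 1 else 0)) \<longleftrightarrow> weq n (\<mu> b) (\<lambda>j. v + (if j = i then s else 0))" for i
      unfolding weq_def s1 by (intro all_cong1 imp_cong refl) auto
    then show ?thesis by (simp add: standard_weight_def)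
  qed
  then have "3 * card {b. b < p \<and> \<not> standard_weight n (- v) 1 (\<lambda>j. - \<mu> b j)} < p" using bad by simp
  from c.standard_representation[OF this] obtain W where pn: "p = n" and W: "W \<in> U n"
    and rep: "\<And>g. g \<in> U n \<Longrightarrow> \<rho> (conj_mat g) = det g powi (- v) \<cdot>\<^sub>m (W * g * adj W)" by blast
  have "\<rho> g = det g powi v \<cdot>\<^sub>m (W * conj_mat g * adj W)" if g: "g \<in> U n" for g
    using rep[OF conj_mat_U[OF g]] cnj_det_powi[OF g] by (simp add: det_conj_mat[OF g])
  then show ?thesis using pn W by blast
qed

end

text \<open>Here \<open>c / sqrt (real p)\<close> is the radius in the normalized norm. The equality
  of \<open>p\<close> and \<open>n\<close> is part of the conclusion, and the description of \<rho>
  carries no error term.\<close>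

lemma nearly_onto_irreducible:
  "\<exists>d0>0. \<forall>n p \<rho> c. unitary_rep n p \<rho> \<longrightarrow> irreducible_rep n p \<rho> \<longrightarrow> 2 \<le> p \<longrightarrow> dense_within n p \<rho> c \<longrightarrow>
    0 \<le> c \<longrightarrow> c / sqrt (real p) \<le> d0 \<longrightarrow>
    p = n \<and> (\<exists>k::int. \<exists>W\<in>U n. (\<forall>g\<in>U n. \<rho> g = det g powi k \<cdot>\<^sub>m (W * g * adj W)) \<or>
      (\<forall>g\<in>U n. \<rho> g = det g powi k \<cdot>\<^sub>m (W * conj_mat g * adj W)))"
proof -
  obtain d0 where d0: "d0 > 0" and ms: "\<forall>n p \<rho> \<mu> c. irr_weight_rep n p \<rho> \<mu> \<longrightarrow> dense_within n p \<rho> c \<longrightarrow> 0 \<le> c \<longrightarrow> c / sqrt (real p) \<le> d0 \<longrightarrow>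
    (\<exists>v s. (s = 1 \<or> s = -1) \<and> 3 * card {b. b < p \<and> \<not> standard_weight n v s (\<mu> b)} < p)"
    using mostly_standard by (elim exE conjE)
  have "p = n \<and> (\<exists>k::int. \<exists>W\<in>U n. (\<forall>g\<in>U n. \<rho> g = det g powi k \<cdot>\<^sub>m (W * g * adj W)) \<or>
      (\<forall>g\<in>U n. \<rho> g = det g powi k \<cdot>\<^sub>m (W * conj_mat g * adj W)))"
    if rep: "unitary_rep n p \<rho>" and irr: "irreducible_rep n p \<rho>" and p2: "2 \<le> p" and dense: "dense_within n p \<rho> c"
      and c: "0 \<le> c" "c / sqrt (real p) \<le> d0" for n p \<rho> c
  proof -
    have \<rho>U: "\<rho> g \<in> U p" if "g \<in> U n" for g using rep that by (simp add: unitary_rep_def)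
    obtain w \<mu> where w: "w \<in> U p" and wr: "weight_rep n p (\<lambda>g. adj w * \<rho> g * w) \<mu>"
      using exists_weight_rep[OF rep] by blast
    let ?\<rho> = "\<lambda>g. adj w * \<rho> g * w"
    have iw: "irr_weight_rep n p ?\<rho> \<mu>"
      by (intro irr_weight_rep.intro irr_weight_rep_axioms.intro wr p2 irreducible_conj[OF irr w \<rho>U])
    interpret irr_weight_rep n p ?\<rho> \<mu> by (rule iw)
    have "dense_within n p ?\<rho> c" by (rule dense_within_conj[OF dense w \<rho>U])
    then obtain v s where s: "s = 1 \<or> s = -1" and bad: "3 * card {b. b < p \<and> \<not> standard_weight n v s (\<mu> b)} < p"
      using ms iw c by blast
    from standard_representation_sign[OF s bad] obtain W where pn: "p = n" and W: "W \<in> U n"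
      and cs: "(\<forall>g\<in>U n. ?\<rho> g = det g powi v \<cdot>\<^sub>m (W * g * adj W)) \<or> (\<forall>g\<in>U n. ?\<rho> g = det g powi v \<cdot>\<^sub>m (W * conj_mat g * adj W))"
      by blast
    have tr: "\<rho> g = det g powi v \<cdot>\<^sub>m (w * W * h * adj (w * W))"
      if g: "g \<in> U n" and h: "h \<in> carrier_mat n n" and e: "?\<rho> g = det g powi v \<cdot>\<^sub>m (W * h * adj W)" for g h
    proof -
      have "\<rho> g = w * ?\<rho> g * adj w"
        using w \<rho>U[OF g] by (simp add: assoc_mult_mat[of _ p p _ p _ p] U_right U_left_cancel[of _ p _ p] right_mult_one_mat[of _ p p])
      also have "\<dots> = det g powi v \<cdot>\<^sub>m (w * (W * h * adj W) * adj w)"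
        unfolding e using w W h pn by (intro smult_mult_mult[of _ n]) auto
      also have "w * (W * h * adj W) * adj w = w * W * h * adj (w * W)"
        using w W h unfolding pn by (simp add: mat_adjoint_mult[of _ n n _ n] assoc_mult_mat[of _ n n _ n _ n])
      finally show ?thesis .
    qed
    have wW: "w * W \<in> U n" using w W pn by simp
    show ?thesis using cs
    proof
      assume a: "\<forall>g\<in>U n. ?\<rho> g = det g powi v \<cdot>\<^sub>m (W * g * adj W)"
      have "\<forall>g\<in>U n. \<rho> g = det g powi v \<cdot>\<^sub>m (w * W * g * adj (w * W))"
      proof
        fix g assume g: "g \<in> U n"
        show "\<rho> g = det g powi v \<cdot>\<^sub>m (w * W * g * adj (w * W))" using a g by (intro tr) auto
      qed
      then show ?thesis using pn wW by blast
    next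
      assume a: "\<forall>g\<in>U n. ?\<rho> g = det g powi v \<cdot>\<^sub>m (W * conj_mat g * adj W)"
      have "\<forall>g\<in>U n. \<rho> g = det g powi v \<cdot>\<^sub>m (w * W * conj_mat g * adj (w * W))"
      proof
        fix g assume g: "g \<in> U n"
        show "\<rho> g = det g powi v \<cdot>\<^sub>m (w * W * conj_mat g * adj (w * W))" using a g by (intro tr) auto
      qed
      then show ?thesis using pn wW by blast
    qed
  qed
  then show ?thesis using d0 by blast
qed

subsection \<open>Nearly surjective homomorphisms\<close>

lemma ad_adj: "u \<in> U m \<Longrightarrow> ad m u x = u * x * adj u"
  by (simp add: ad_def inv_unitary_group)

lemma fr2_U: "A \<in> U q \<Longrightarrow> fr2 A = real q"
proof -
  assume A: "A \<in> U q"
  have "fr2 A = (\<Sum>i<q. \<Sum>j<q. (cmod (A $$ (i, j)))\<^sup>2)" by (rule fr2_carrier) (rule U_carrier[OF A])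
  also have "\<dots> = (\<Sum>i<q. 1)" by (rule sum.cong[OF refl]) (simp add: U_row_sum[OF A])
  finally show ?thesis by simp
qed

lemma smult_U: "cmod z = 1 \<Longrightarrow> z \<cdot>\<^sub>m 1\<^sub>m q \<in> U q"
  unfolding diagm_const[symmetric] by (rule diagm_U)

text \<open>The two matrices agree on the block of size \<open>n\<close>. On the complement two
  unitaries of size \<open>m - n\<close> are compared; their squared distance is at most 4 (m - n),
  which the assumption bounds by 2 \<delta>^2 m.\<close>

lemma block_distance:
  assumes u: "u \<in> U m" and W: "W \<in> U n" and h: "h \<in> U n" and nm: "n \<le> m" and d: "cmod d = 1" and R: "R \<in> U (m - n)"
    and \<phi>: "adj u * F * u = bsum (d \<cdot>\<^sub>m (W * h * adj W)) R" and F: "F \<in> U m" and m: "0 < m"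
    and sm: "2 * real (m - n) \<le> \<delta>\<^sup>2 * real m" "0 \<le> \<delta>"
  shows "hs_dist m F (d \<cdot>\<^sub>m ad m (u * bsum W (1\<^sub>m (m - n))) (pad m h)) \<le> 2 * \<delta>"
proof -
  let ?q = "m - n" and ?W = "bsum W (1\<^sub>m (m - n))"
  have qm: "n + ?q = m" using nm by simp
  have WU: "?W \<in> U m" using bsum_U[OF W U_one[of ?q]] qm by simp
  have uc: "u \<in> carrier_mat m m" and Wc: "?W \<in> carrier_mat m m" and Fc: "F \<in> carrier_mat m m"
    using u WU F by auto
  have hc: "h \<in> carrier_mat n n" and W'c: "W \<in> carrier_mat n n" and Rc: "R \<in> carrier_mat ?q ?q" using h W R by auto
  have padh: "pad m h = bsum h (1\<^sub>m ?q)" using hc by (simp add: pad_bsum)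
  have hq: "bsum h (1\<^sub>m ?q) \<in> carrier_mat m m" using bsum_carrier[OF hc one_carrier_mat[of ?q]] qm by simp
  let ?G = "d \<cdot>\<^sub>m ad m (u * ?W) (pad m h)"
  have WhW: "?W * bsum h (1\<^sub>m ?q) * adj ?W = bsum (W * h * adj W) (1\<^sub>m ?q)"
    using W'c hc by (simp add: bsum_adj bsum_mult[of _ n n _ ?q ?q _ n _ ?q])
  have G: "?G = u * (d \<cdot>\<^sub>m bsum (W * h * adj W) (1\<^sub>m ?q)) * adj u"
  proof -
    have "ad m (u * ?W) (pad m h) = u * (?W * bsum h (1\<^sub>m ?q) * adj ?W) * adj u"
      unfolding padh ad_adj[OF U_mult[OF u WU]] using uc Wc hq
      by (simp add: mat_adjoint_mult[of _ m m _ m] assoc_mult_mat[of _ m m _ m _ m])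
    moreover have "bsum (W * h * adj W) (1\<^sub>m ?q) \<in> carrier_mat m m"
      using bsum_carrier[of "W * h * adj W" n n "1\<^sub>m ?q" ?q ?q] W'c hc qm by simp
    ultimately show ?thesis unfolding WhW using uc by (simp add: smult_mult_mult[of _ m])
  qed
  have Fu: "F = u * bsum (d \<cdot>\<^sub>m (W * h * adj W)) R * adj u"
    unfolding \<phi>[symmetric] using u Fc by (simp add: assoc_mult_mat[of _ m m _ m _ m] U_right U_left_cancel[of _ m _ m] right_mult_one_mat[of _ m m])
  let ?b1 = "bsum (d \<cdot>\<^sub>m (W * h * adj W)) R" and ?b2 = "bsum (d \<cdot>\<^sub>m (W * h * adj W)) (d \<cdot>\<^sub>m 1\<^sub>m ?q)"
  have b: "?b1 \<in> carrier_mat m m" "?b2 \<in> carrier_mat m m"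
    using bsum_carrier[of "d \<cdot>\<^sub>m (W * h * adj W)" n n R ?q ?q] bsum_carrier[of "d \<cdot>\<^sub>m (W * h * adj W)" n n "d \<cdot>\<^sub>m 1\<^sub>m ?q" ?q ?q] W'c hc Rc qm by simp_all
  have G': "?G = u * ?b2 * adj u" unfolding G bsum_smult ..
  have Gc: "?G \<in> carrier_mat m m" unfolding G' using uc b by simp
  have "F - ?G = u * (?b1 - ?b2) * adj u"
    unfolding G' by (subst Fu) (use uc b in \<open>simp add: mult_minus_right[of _ m m _ m] mult_minus_left[of _ m m _ _ m]\<close>)
  then have "fr2 (F - ?G) = fr2 (?b1 - ?b2)" using u b by (simp add: fr2_U_right[of _ m _ m] fr2_U_left[of _ m _ m])
  also have "?b1 - ?b2 = bsum (0\<^sub>m n n) (R - d \<cdot>\<^sub>m 1\<^sub>m ?q)"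
    using W'c hc Rc by (intro eq_matI) (auto simp: bsum_def simp del: index_mult_mat(1))
  also have "fr2 \<dots> = fr2 (R - d \<cdot>\<^sub>m 1\<^sub>m ?q)"
    using Rc by (subst fr2_bsum[of _ n n _ ?q ?q]) (auto simp: fr2_carrier[of "0\<^sub>m n n" n n])
  also have "\<dots> \<le> 2 * fr2 R + 2 * fr2 (d \<cdot>\<^sub>m 1\<^sub>m ?q)"
    using Rc by (intro fr2_minus_le[of _ ?q ?q]) auto
  also have "\<dots> = 4 * real ?q" using fr2_U[OF R] fr2_U[OF smult_U[OF d, of ?q]] by simp
  also have "\<dots> \<le> (2 * \<delta>)\<^sup>2 * real m" using sm by (simp add: power_mult_distrib)
  finally have "fr (F - ?G) \<le> sqrt ((2 * \<delta>)\<^sup>2 * real m)" unfolding fr_def by (rule real_sqrt_le_mono)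
  also have "\<dots> = 2 * \<delta> * sqrt (real m)" using sm(2) by (simp add: real_sqrt_mult)
  finally show ?thesis using m by (simp add: hs_dist_fr[OF Fc Gc] divide_le_eq)
qed

lemma near_standard_mono: "near_standard \<epsilon> n m \<phi> k u \<Longrightarrow> \<epsilon> \<le> \<epsilon>' \<Longrightarrow> near_standard \<epsilon>' n m \<phi> k u"
  unfolding near_standard_def by (meson order_trans)

lemma dense_within_of_delta_surjective:
  assumes "delta_surjective (U n) (U m) (hs_dist m) \<delta> \<phi>" and \<phi>: "\<And>g. g \<in> U n \<Longrightarrow> \<phi> g \<in> U m" and m: "0 < m"
  shows "dense_within n m \<phi> (\<delta> * sqrt (real m))"
  unfolding dense_within_def
proof
  fix z assume z: "z \<in> U m"
  then obtain g where g: "g \<in> U n" "hs_dist m (\<phi> g) z \<le> \<delta>" using assms(1) unfolding delta_surjective_def by blast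
  have "hs_dist m (\<phi> g) z = fr (\<phi> g - z) / sqrt (real m)" using \<phi>[OF g(1)] z by (intro hs_dist_fr) auto
  then have "fr (\<phi> g - z) \<le> \<delta> * sqrt (real m)" using g m by (simp add: divide_le_eq)
  then show "\<exists>g\<in>U n. fr (\<phi> g - z) \<le> \<delta> * sqrt (real m)" using g(1) by blast
qed

lemma nearly_onto_structure:
  assumes \<epsilon>: "0 < \<epsilon>"
  shows "\<exists>\<delta>>0. \<forall>n m \<phi>. 1 \<le> n \<longrightarrow> 1 \<le> m \<longrightarrow> \<phi> \<in> hom (unitary_group n) (unitary_group m) \<longrightarrow>
    continuous_map (unitary_topology n) (unitary_topology m) \<phi> \<longrightarrow> delta_surjective (U n) (U m) (hs_dist m) \<delta> \<phi> \<longrightarrow>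
    (m = 1 \<and> (\<exists>k::int. \<forall>v\<in>U n. \<phi> v = (det v powi k) \<cdot>\<^sub>m 1\<^sub>m 1)) \<or>
    (n \<le> m \<and> real m \<le> (1 + \<epsilon>) * real n \<and> (\<exists>k::int. \<exists>u\<in>U m. near_standard \<epsilon> n m \<phi> k u))"
proof -
  obtain d0 where d0: "d0 > 0" and irr: "\<forall>n p \<rho> c. unitary_rep n p \<rho> \<longrightarrow> irreducible_rep n p \<rho> \<longrightarrow> 2 \<le> p \<longrightarrow> dense_within n p \<rho> c \<longrightarrow>
    0 \<le> c \<longrightarrow> c / sqrt (real p) \<le> d0 \<longrightarrow>
    p = n \<and> (\<exists>k::int. \<exists>W\<in>U n. (\<forall>g\<in>U n. \<rho> g = det g powi k \<cdot>\<^sub>m (W * g * adj W)) \<or>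
      (\<forall>g\<in>U n. \<rho> g = det g powi k \<cdot>\<^sub>m (W * conj_mat g * adj W)))"
    using nearly_onto_irreducible by (elim exE conjE)
  \<comment> \<open>Half of \<open>d0\<close> pays for passing from \<open>m\<close> to
    \<open>p > m / 2\<close>, half of \<epsilon> for the block distance 2 \<delta>; the bound 1/2
    secures the hypothesis 2 c^2 \<le> m of the irreducible block.\<close>
  define \<delta> where "\<delta> = min (d0 / 2) (min (\<epsilon> / 2) (1 / 2))"
  have \<delta>: "\<delta> > 0" "2 * \<delta> \<le> d0" "2 * \<delta> \<le> \<epsilon>" "\<delta> \<le> 1 / 2" using d0 \<epsilon> by (auto simp: \<delta>_def min_def)
  have "(m = 1 \<and> (\<exists>k::int. \<forall>v\<in>U n. \<phi> v = (det v powi k) \<cdot>\<^sub>m 1\<^sub>m 1)) \<or>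
    (n \<le> m \<and> real m \<le> (1 + \<epsilon>) * real n \<and> (\<exists>k::int. \<exists>u\<in>U m. near_standard \<epsilon> n m \<phi> k u))"
    if n: "1 \<le> n" and m: "1 \<le> m" and hom: "\<phi> \<in> hom (unitary_group n) (unitary_group m)"
      and cont: "continuous_map (unitary_topology n) (unitary_topology m) \<phi>"
      and surj: "delta_surjective (U n) (U m) (hs_dist m) \<delta> \<phi>" for n m \<phi>
  proof -
    have rep: "unitary_rep n m \<phi>" by (rule rep_of_continuous_hom[OF hom cont m n])
    have \<phi>U: "\<phi> g \<in> U m" if "g \<in> U n" for g using rep that by (simp add: unitary_rep_def)
    show ?thesis
    proof (cases "m = 1")
      case True
      then show ?thesis using one_dimensional_rep rep by simp
    next
      case False
      define c where "c = \<delta> * sqrt (real m)"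
      have c0: "0 \<le> c" using \<delta> by (simp add: c_def)
      have c2: "c\<^sup>2 = \<delta>\<^sup>2 * real m" by (simp add: c_def power_mult_distrib)
      have d2: "\<delta>\<^sup>2 \<le> \<delta> / 2" using \<delta> mult_left_mono[of \<delta> "1 / 2" \<delta>] by (simp add: power2_eq_square)
      have cm: "2 * c\<^sup>2 \<le> real m"
      proof -
        have "2 * \<delta>\<^sup>2 \<le> 1" using d2 \<delta> by linarith
        then have "2 * \<delta>\<^sup>2 * real m \<le> 1 * real m" by (rule mult_right_mono) simp
        then show ?thesis unfolding c2 by simp
      qed
      have dense: "dense_within n m \<phi> c"
        unfolding c_def using m by (intro dense_within_of_delta_surjective[OF surj \<phi>U]) auto
      obtain p \<rho> \<rho>' u where pm: "p \<le> m" "m < 2 * p" "2 * real (m - p) \<le> c\<^sup>2" and u: "u \<in> U m"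
        and blk: "\<forall>g\<in>U n. adj u * \<phi> g * u = bsum (\<rho> g) (\<rho>' g)" and \<rho>': "\<forall>g\<in>U n. \<rho>' g \<in> U (m - p)"
        and r: "unitary_rep n p \<rho>" "irreducible_rep n p \<rho>" "dense_within n p \<rho> c"
        using exists_irreducible_block[OF rep dense c0 cm m] by (elim exE conjE)
      have p2: "2 \<le> p" using pm False m by linarith
      have "c / sqrt (real p) \<le> d0"
      proof -
        have "sqrt (real m) \<le> sqrt (2\<^sup>2 * real p)" using pm by simp
        also have "\<dots> = 2 * sqrt (real p)" by (simp only: real_sqrt_mult real_sqrt_abs)
        finally have "c \<le> \<delta> * (2 * sqrt (real p))" unfolding c_def using \<delta> by (intro mult_left_mono) auto
        also have "\<dots> \<le> d0 * sqrt (real p)" using \<delta> mult_right_mono[of "2 * \<delta>" d0 "sqrt (real p)"] by simp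
        finally show ?thesis using p2 by (simp add: divide_le_eq)
      qed
      then have pn: "p = n" and kW: "\<exists>k::int. \<exists>W\<in>U n. (\<forall>g\<in>U n. \<rho> g = det g powi k \<cdot>\<^sub>m (W * g * adj W)) \<or>
          (\<forall>g\<in>U n. \<rho> g = det g powi k \<cdot>\<^sub>m (W * conj_mat g * adj W))"
        using irr r p2 c0 by blast+
      obtain k W where W: "W \<in> U n" and alt: "(\<forall>g\<in>U n. \<rho> g = det g powi k \<cdot>\<^sub>m (W * g * adj W)) \<or>
          (\<forall>g\<in>U n. \<rho> g = det g powi k \<cdot>\<^sub>m (W * conj_mat g * adj W))"
        using kW by blast
      have sm: "2 * real (m - n) \<le> \<delta>\<^sup>2 * real m" using pm pn c2 by simp
      have "real m \<le> (1 + \<epsilon>) * real n"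
      proof -
        have "\<delta>\<^sup>2 * real m \<le> \<delta>\<^sup>2 * (2 * real n)" using pm pn by (intro mult_left_mono) auto
        then have "real m - real n \<le> \<delta>\<^sup>2 * real n" using sm pm pn by (simp add: of_nat_diff)
        also have "\<dots> \<le> \<epsilon> * real n" using d2 \<delta> by (intro mult_right_mono) auto
        finally show ?thesis by (simp add: algebra_simps)
      qed
      moreover have "near_standard \<epsilon> n m \<phi> k (u * bsum W (1\<^sub>m (m - n)))"
      proof -
        have close: "hs_dist m (\<phi> g) (det g powi k \<cdot>\<^sub>m ad m (u * bsum W (1\<^sub>m (m - n))) (pad m h)) \<le> \<epsilon>"
          if g: "g \<in> U n" and h: "h \<in> U n" and e: "\<rho> g = det g powi k \<cdot>\<^sub>m (W * h * adj W)" for g h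
        proof -
          have "cmod (det g powi k) = 1" using norm_det_U[OF g] by (simp add: norm_power_int)
          moreover have "adj u * \<phi> g * u = bsum (det g powi k \<cdot>\<^sub>m (W * h * adj W)) (\<rho>' g)" using blk g e by simp
          ultimately have "hs_dist m (\<phi> g) (det g powi k \<cdot>\<^sub>m ad m (u * bsum W (1\<^sub>m (m - n))) (pad m h)) \<le> 2 * \<delta>"
            using \<rho>' g pn pm m \<delta> by (intro block_distance[OF u W h _ _ _ _ \<phi>U[OF g] _ sm]) auto
          then show ?thesis using \<delta> by linarith
        qed
        show ?thesis unfolding near_standard_def using alt
        proof
          assume "\<forall>g\<in>U n. \<rho> g = det g powi k \<cdot>\<^sub>m (W * g * adj W)"
          then show "(\<forall>v\<in>U n. hs_dist m (\<phi> v) (det v powi k \<cdot>\<^sub>m ad m (u * bsum W (1\<^sub>m (m - n))) (pad m v)) \<le> \<epsilon>) \<or>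
            (\<forall>v\<in>U n. hs_dist m (\<phi> v) (det v powi k \<cdot>\<^sub>m ad m (u * bsum W (1\<^sub>m (m - n))) (pad m (conj_mat v))) \<le> \<epsilon>)"
            using close by blast
        next
          assume "\<forall>g\<in>U n. \<rho> g = det g powi k \<cdot>\<^sub>m (W * conj_mat g * adj W)"
          then show "(\<forall>v\<in>U n. hs_dist m (\<phi> v) (det v powi k \<cdot>\<^sub>m ad m (u * bsum W (1\<^sub>m (m - n))) (pad m v)) \<le> \<epsilon>) \<or>
            (\<forall>v\<in>U n. hs_dist m (\<phi> v) (det v powi k \<cdot>\<^sub>m ad m (u * bsum W (1\<^sub>m (m - n))) (pad m (conj_mat v))) \<le> \<epsilon>)"
            using close conj_mat_U by blast
        qed
      qed
      moreover have "u * bsum W (1\<^sub>m (m - n)) \<in> U m"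
      proof -
        have "bsum W (1\<^sub>m (m - n)) \<in> U m" using bsum_U[OF W U_one[of "m - n"]] pm pn by simp
        then show ?thesis using u by simp
      qed
      ultimately show ?thesis using pm pn by blast
    qed
  qed
  then show ?thesis using \<delta>(1) by blast
qed

section \<open>The determinant exponent under the central normalization\<close>

lemma root_distance_sum:
  assumes a: "a \<noteq> 0" "\<bar>a\<bar> < int q"
  shows "(\<Sum>x<q. (cmod (1 - rootp q x powi a))\<^sup>2) = 2 * real q"
proof -
  have e: "(cmod (1 - z))\<^sup>2 = 2 - 2 * Re z" if "cmod z = 1" for z
  proof -
    have "(Re z)\<^sup>2 + (Im z)\<^sup>2 = 1" using cmod_power2[of z] that by simp
    then show ?thesis unfolding cmod_power2 by (simp add: power2_eq_square algebra_simps)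
  qed
  have "(\<Sum>x<q. (cmod (1 - rootp q x powi a))\<^sup>2) = (\<Sum>x<q. 2 - 2 * Re (rootp q x powi a))"
    by (intro sum.cong refl e) (simp add: norm_power_int)
  also have "\<dots> = 2 * real q - 2 * Re (\<Sum>x<q. rootp q x powi a)"
    by (simp add: sum_subtractf sum_distrib_left)
  also have "(\<Sum>x<q. rootp q x powi a) = 0" using root_sum[OF a(2)] a(1) by simp
  finally show ?thesis by simp
qed

text \<open>Averaged over roots of unity of large order, |1 - z^a|^2 is 2 for every nonzero
  exponent, so the weighted sum has mean 2 (\<alpha> + \<beta>) and exceeds half of that
  somewhere.\<close>

lemma exists_far_point:
  assumes "a \<noteq> 0" "b \<noteq> 0" "0 \<le> \<alpha>" "0 \<le> \<beta>" "0 < \<alpha> + \<beta>"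
  shows "\<exists>z. cmod z = 1 \<and> \<alpha> + \<beta> < \<alpha> * (cmod (1 - z powi a))\<^sup>2 + \<beta> * (cmod (1 - z powi b))\<^sup>2"
proof (rule ccontr)
  assume no: "\<not> ?thesis"
  define q where "q = nat (\<bar>a\<bar> + \<bar>b\<bar>) + 1"
  have q: "\<bar>a\<bar> < int q" "\<bar>b\<bar> < int q" "0 < q" by (auto simp: q_def)
  have "(\<Sum>x<q. \<alpha> * (cmod (1 - rootp q x powi a))\<^sup>2 + \<beta> * (cmod (1 - rootp q x powi b))\<^sup>2) \<le> (\<Sum>x<q. \<alpha> + \<beta>)"
    using no by (intro sum_mono) (meson norm_rootp not_less)
  then have "\<alpha> * (2 * real q) + \<beta> * (2 * real q) \<le> real q * (\<alpha> + \<beta>)"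
    unfolding sum.distrib sum_distrib_left[symmetric] root_distance_sum[OF assms(1) q(1)] root_distance_sum[OF assms(2) q(2)]
    by (simp add: algebra_simps)
  then have "real q * (\<alpha> + \<beta>) \<le> 0" by (simp add: algebra_simps)
  moreover have "0 < real q * (\<alpha> + \<beta>)" using assms q by (intro mult_pos_pos) auto
  ultimately show False by linarith
qed

text \<open>In the basis given by \<open>u\<close> everything is diagonal: \<open>n\<close> entries
  compare \<open>z\<close> with \<open>d * y\<close>, the remaining \<open>m - n\<close> compare
  \<open>z\<close> with \<open>d\<close>.\<close>

lemma scalar_distance:
  assumes u: "u \<in> U m" and nm: "n \<le> m" "0 < m"
  shows "(hs_dist m (z \<cdot>\<^sub>m 1\<^sub>m m) (d \<cdot>\<^sub>m ad m u (pad m (y \<cdot>\<^sub>m 1\<^sub>m n))))\<^sup>2 =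
    (real n * (cmod (z - d * y))\<^sup>2 + real (m - n) * (cmod (z - d))\<^sup>2) / real m"
proof -
  note uc = U_carrier[OF u]
  let ?e = "\<lambda>i. if i < n then y else 1"
  have "pad m (y \<cdot>\<^sub>m 1\<^sub>m n) = bsum (diagm n (\<lambda>_. y)) (diagm (m - n) (\<lambda>_. 1))"
    by (simp add: pad_bsum diagm_const one_smult)
  then have pd: "pad m (y \<cdot>\<^sub>m 1\<^sub>m n) = diagm m ?e" using nm by (simp add: bsum_diagm)
  have G: "d \<cdot>\<^sub>m ad m u (pad m (y \<cdot>\<^sub>m 1\<^sub>m n)) = u * diagm m (\<lambda>i. d * ?e i) * adj u"
  proof -
    have "diagm m (\<lambda>i. d * ?e i) = d \<cdot>\<^sub>m diagm m ?e" by (rule eq_matI) auto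
    then show ?thesis unfolding pd ad_adj[OF u] using uc by (simp add: smult_mult_mult[of _ m])
  qed
  have Z: "z \<cdot>\<^sub>m 1\<^sub>m m = u * diagm m (\<lambda>_. z) * adj u"
    unfolding diagm_const using u by (simp add: smult_mult_mult[of _ m] right_mult_one_mat[of _ m m] U_right)
  have "z \<cdot>\<^sub>m 1\<^sub>m m - d \<cdot>\<^sub>m ad m u (pad m (y \<cdot>\<^sub>m 1\<^sub>m n)) = u * diagm m (\<lambda>i. z - d * ?e i) * adj u"
    unfolding G Z using uc by (simp add: mult_minus_right[of _ m m _ m] mult_minus_left[of _ m m _ _ m] flip: diagm_minus)
  then have "fr2 (z \<cdot>\<^sub>m 1\<^sub>m m - d \<cdot>\<^sub>m ad m u (pad m (y \<cdot>\<^sub>m 1\<^sub>m n))) = (\<Sum>i<m. (cmod (z - d * ?e i))\<^sup>2)"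
    using u by (simp add: fr2_U_right[of _ m _ m] fr2_U_left[of _ m _ m] fr2_diagm)
  also have "\<dots> = (\<Sum>i<n. (cmod (z - d * y))\<^sup>2) + (\<Sum>i\<in>{n..<m}. (cmod (z - d))\<^sup>2)"
  proof -
    have "{..<m} = {..<n} \<union> {n..<m}" using nm by auto
    then have "(\<Sum>i<m. (cmod (z - d * ?e i))\<^sup>2) = (\<Sum>i\<in>{..<n} \<union> {n..<m}. (cmod (z - d * ?e i))\<^sup>2)" by (simp only:)
    also have "\<dots> = (\<Sum>i<n. (cmod (z - d * ?e i))\<^sup>2) + (\<Sum>i\<in>{n..<m}. (cmod (z - d * ?e i))\<^sup>2)"
      by (rule sum.union_disjoint) auto
    also have "\<dots> = (\<Sum>i<n. (cmod (z - d * y))\<^sup>2) + (\<Sum>i\<in>{n..<m}. (cmod (z - d))\<^sup>2)"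
      by (intro arg_cong2[where f = "(+)"] sum.cong) auto
    finally show ?thesis .
  qed
  finally have f: "fr2 (z \<cdot>\<^sub>m 1\<^sub>m m - d \<cdot>\<^sub>m ad m u (pad m (y \<cdot>\<^sub>m 1\<^sub>m n))) =
    real n * (cmod (z - d * y))\<^sup>2 + real (m - n) * (cmod (z - d))\<^sup>2" by simp
  have "d \<cdot>\<^sub>m ad m u (pad m (y \<cdot>\<^sub>m 1\<^sub>m n)) \<in> carrier_mat m m" unfolding G using uc by simp
  then show ?thesis using f nm by (simp add: hs_dist_fr[of _ m] power_divide)
qed

lemma hs_norm_nonneg: "0 \<le> hs_norm k x"
  using fr2_tr(1)[of x "dim_row x" "dim_col x"] by (simp add: hs_norm_def)

text \<open>At the scalar z the model has the eigenvalues z^(nk+1) or z^(nk-1) on the large block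
  and z^(nk) on the rest, to be compared with z. If none of these exponents is 1, some z gives
  distance more than 1, which \<eta> < 1 excludes. On the large block the exponent 1 means k = 0 in
  the direct case and nk = 2 in the conjugate case, so n = 2 and k = 1; nk = 1 is impossible for n
  \<ge> 2.\<close>

lemma central_exponent:
  assumes nm: "n \<le> m" "2 \<le> m" "real m \<le> (1 + \<eta>) * real n" and \<eta>: "\<eta> < 1" and n1: "1 \<le> n"
    and cen: "centrally_normalized n m \<phi>" and u: "u \<in> U m" and near: "near_standard \<eta> n m \<phi> k u"
  shows "k = 0 \<or> (n, k) = (2, 1)"
proof (rule ccontr)
  assume neg: "\<not> ?thesis"
  \<comment> \<open>For \<open>n = 1\<close> the dimension bound with \<eta> < 1 would give
    \<open>m < 2\<close>.\<close>
  have n2: "2 \<le> n"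
  proof (rule ccontr)
    assume "\<not> 2 \<le> n"
    then have "n = 1" using n1 by simp
    then show False using nm \<eta> by simp
  qed
  have zU: "z \<cdot>\<^sub>m 1\<^sub>m n \<in> U n" if "cmod z = 1" for z by (rule smult_U[OF that])
  have dz: "det (z \<cdot>\<^sub>m 1\<^sub>m n) powi k = z powi (int n * k)" for z :: complex
  proof -
    have "det (z \<cdot>\<^sub>m 1\<^sub>m n) = z ^ n" unfolding diagm_const[symmetric] det_diagm by simp
    then show ?thesis by (simp add: power_int_mult)
  qed
  have nk1: "int n * k \<noteq> 1"
  proof
    assume "int n * k = 1"
    then have "int n dvd 1" by (metis dvd_triv_left)
    then show False using n2 by simp
  qed
  \<comment> \<open>The offset \<open>a\<close> is 0 in the direct and -2 in the conjugate case, so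
    that \<open>z powi (a + 1)\<close> is z or its conjugate.\<close>
  have no: False
    if a: "int n * k + a \<noteq> 0" and dist: "\<And>z. cmod z = 1 \<Longrightarrow>
      hs_dist m (z \<cdot>\<^sub>m 1\<^sub>m m) (z powi (int n * k) \<cdot>\<^sub>m ad m u (pad m (z powi (a + 1) \<cdot>\<^sub>m 1\<^sub>m n))) \<le> \<eta>" for a
  proof -
    have nb: "int n * k - 1 \<noteq> 0" using nk1 by simp
    obtain z where z: "cmod z = 1" and far: "real n + real (m - n) <
        real n * (cmod (1 - z powi (int n * k + a)))\<^sup>2 + real (m - n) * (cmod (1 - z powi (int n * k - 1)))\<^sup>2"
      using exists_far_point[OF a nb, of "real n" "real (m - n)"] n2 by auto
    have z0: "z \<noteq> 0" using z by auto
    let ?D = "hs_dist m (z \<cdot>\<^sub>m 1\<^sub>m m) (z powi (int n * k) \<cdot>\<^sub>m ad m u (pad m (z powi (a + 1) \<cdot>\<^sub>m 1\<^sub>m n)))"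
    have "z - z powi (int n * k) * z powi (a + 1) = z * (1 - z powi (int n * k + a))"
      using z0 by (simp add: right_diff_distrib power_int_add algebra_simps)
    then have e1: "cmod (z - z powi (int n * k) * z powi (a + 1)) = cmod (1 - z powi (int n * k + a))"
      using z by (simp only: norm_mult mult_1_left)
    have "z - z powi (int n * k) = z * (1 - z powi (int n * k - 1))"
      using z0 by (simp add: right_diff_distrib power_int_diff)
    then have e2: "cmod (z - z powi (int n * k)) = cmod (1 - z powi (int n * k - 1))"
      using z by (simp only: norm_mult mult_1_left)
    have m0: "0 < m" using nm by simp
    have D2: "?D\<^sup>2 > 1" unfolding scalar_distance[OF u nm(1) m0] e1 e2 using far nm m0 by (simp add: less_divide_eq of_nat_diff)
    have "0 \<le> ?D" unfolding hs_dist_def by (rule hs_norm_nonneg)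
    moreover have "?D < 1" using dist[OF z] \<eta> by linarith
    ultimately have "?D\<^sup>2 \<le> 1" by (simp add: power_le_one)
    then show False using D2 by linarith
  qed
  show False using near unfolding near_standard_def
  proof
    assume a: "\<forall>v\<in>U n. hs_dist m (\<phi> v) (det v powi k \<cdot>\<^sub>m ad m u (pad m v)) \<le> \<eta>"
    show False
    proof (rule no[of 0])
      show "int n * k + 0 \<noteq> 0" using neg n2 by auto
      fix z :: complex assume z: "cmod z = 1"
      then show "hs_dist m (z \<cdot>\<^sub>m 1\<^sub>m m) (z powi (int n * k) \<cdot>\<^sub>m ad m u (pad m (z powi (0 + 1) \<cdot>\<^sub>m 1\<^sub>m n))) \<le> \<eta>"
        using a zU[OF z] cen unfolding centrally_normalized_def by (metis dz power_int_1_right add_0)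
    qed
  next
    assume a: "\<forall>v\<in>U n. hs_dist m (\<phi> v) (det v powi k \<cdot>\<^sub>m ad m u (pad m (conj_mat v))) \<le> \<eta>"
    show False
    proof (rule no[of "-2"])
      show "int n * k + - 2 \<noteq> 0"
      proof
        assume "int n * k + - 2 = 0"
        then have nk: "int n * k = 2" by simp
        then have k0: "k > 0" using n2 by (smt (verit) mult_nonneg_nonpos of_nat_0_le_iff)
        moreover have "k < 2"
        proof (rule ccontr)
          assume "\<not> k < 2"
          then have "2 * 2 \<le> int n * k" using n2 by (intro mult_mono) auto
          then show False using nk by simp
        qed
        ultimately have "k = 1" by simp
        then show False using nk neg by simp
      qed
      fix z :: complex assume z: "cmod z = 1"
      have "conj_mat (z \<cdot>\<^sub>m 1\<^sub>m n) = z powi (- 2 + 1) \<cdot>\<^sub>m 1\<^sub>m n"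
        using cnj_powi[OF z, of 1] by (intro eq_matI) auto
      then show "hs_dist m (z \<cdot>\<^sub>m 1\<^sub>m m) (z powi (int n * k) \<cdot>\<^sub>m ad m u (pad m (z powi (- 2 + 1) \<cdot>\<^sub>m 1\<^sub>m n))) \<le> \<eta>"
        using a zU[OF z] z cen unfolding centrally_normalized_def by (metis dz)
    qed
  qed
qed

text \<open>In dimension one every unitary is a scalar, so the normalization makes \<phi> the
  identity, which the exponent 0 reproduces exactly.\<close>

lemma near_standard_one:
  assumes cen: "centrally_normalized 1 1 \<phi>" and \<epsilon>: "0 \<le> \<epsilon>"
  shows "near_standard \<epsilon> 1 1 \<phi> 0 (1\<^sub>m 1)"
proof -
  have "hs_dist 1 (\<phi> v) (det v powi 0 \<cdot>\<^sub>m ad 1 (1\<^sub>m 1) (pad 1 v)) \<le> \<epsilon>" if v: "v \<in> U 1" for v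
  proof -
    have vc: "v \<in> carrier_mat 1 1" using v by simp
    have ve: "v = v $$ (0, 0) \<cdot>\<^sub>m 1\<^sub>m 1" using vc by (intro eq_matI) auto
    have "cmod (v $$ (0, 0)) = 1" using U_row_sum[OF v, of 0] by (simp add: power2_eq_1_iff) (metis norm_ge_zero le_minus_one_simps(3))
    then have "\<phi> v = v $$ (0, 0) \<cdot>\<^sub>m 1\<^sub>m 1" using cen ve unfolding centrally_normalized_def by metis
    then have "\<phi> v = v" using ve by simp
    moreover have "pad 1 v = v" using vc by (intro eq_matI) (auto simp: pad_def Let_def)
    moreover have "ad 1 (1\<^sub>m 1) v = v" using vc by (simp add: ad_adj left_mult_one_mat[of _ 1 1] right_mult_one_mat[of _ 1 1])
    ultimately have "hs_dist 1 (\<phi> v) (det v powi 0 \<cdot>\<^sub>m ad 1 (1\<^sub>m 1) (pad 1 v)) = hs_dist 1 v v" by (simp add: one_smult)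
    also have "\<dots> = 0" unfolding hs_dist_fr[OF vc vc] using vc by (simp add: fr_def fr2_def)
    finally show ?thesis using \<epsilon> by simp
  qed
  then show ?thesis unfolding near_standard_def by blast
qed

text \<open>Unitaries are at normalized distance at most 2, so for large \<epsilon> the estimate
  holds with every exponent. The supplement therefore asserts that an admissible exponent exists,
  and it constrains all exponents only for \<epsilon> < 1. Dimension \<open>m = 1\<close> is left
  out there, because for n = m = 1 the square of det v times the conjugate of v is v itself.\<close>

theorem theorem3p2:
  shows "\<forall>\<epsilon>::real. \<epsilon> > 0 \<longrightarrow> (\<exists>\<delta>::real. \<delta> > 0 \<and>
    (\<forall>(n::nat) (m::nat) (\<phi> :: complex mat \<Rightarrow> complex mat).
      n \<ge> 1 \<longrightarrow> m \<ge> 1 \<longrightarrow>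
      \<phi> \<in> hom (unitary_group n) (unitary_group m) \<longrightarrow>
      continuous_map (unitary_topology n) (unitary_topology m) \<phi> \<longrightarrow>
      delta_surjective (U n) (U m) (hs_dist m) \<delta> \<phi> \<longrightarrow>
      ((m = 1 \<and> (\<exists>k::int. \<forall>v\<in>U n. \<phi> v = (det v powi k) \<cdot>\<^sub>m 1\<^sub>m 1))
       \<or> (n \<le> m \<and> real m \<le> (1 + \<epsilon>) * real n
          \<and> (\<exists>k::int. \<exists>u\<in>U m. near_standard \<epsilon> n m \<phi> k u)))
      \<and> (n \<le> m \<and> real m \<le> (1 + \<epsilon>) * real n
          \<and> (\<exists>k::int. \<exists>u\<in>U m. near_standard \<epsilon> n m \<phi> k u)
          \<and> centrally_normalized n m \<phi> \<longrightarrow>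
           (\<exists>k::int. \<exists>u\<in>U m. near_standard \<epsilon> n m \<phi> k u \<and> (k = 0 \<or> (n, k) = (2, 1)))
           \<and> (\<epsilon> < 1 \<and> m \<noteq> 1 \<longrightarrow>
               (\<forall>k::int. \<forall>u\<in>U m. near_standard \<epsilon> n m \<phi> k u \<longrightarrow> k = 0 \<or> (n, k) = (2, 1))))))"
proof (intro allI impI, goal_cases)
  case \<epsilon>: (1 \<epsilon>)
  \<comment> \<open>The structure result is applied to a bound below 1, as
    \<open>central_exponent\<close> demands; its estimates then hold for \<epsilon> as well.\<close>
  define \<eta> where "\<eta> = min \<epsilon> (1 / 2)"
  have \<eta>: "0 < \<eta>" "\<eta> \<le> \<epsilon>" "\<eta> < 1" using \<epsilon> by (auto simp: \<eta>_def)
  obtain \<delta> where \<delta>: "\<delta> > 0" and str: "\<forall>n m \<phi>. 1 \<le> n \<longrightarrow> 1 \<le> m \<longrightarrow> \<phi> \<in> hom (unitary_group n) (unitary_group m) \<longrightarrow>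
    continuous_map (unitary_topology n) (unitary_topology m) \<phi> \<longrightarrow> delta_surjective (U n) (U m) (hs_dist m) \<delta> \<phi> \<longrightarrow>
    (m = 1 \<and> (\<exists>k::int. \<forall>v\<in>U n. \<phi> v = (det v powi k) \<cdot>\<^sub>m 1\<^sub>m 1)) \<or>
    (n \<le> m \<and> real m \<le> (1 + \<eta>) * real n \<and> (\<exists>k::int. \<exists>u\<in>U m. near_standard \<eta> n m \<phi> k u))"
    using nearly_onto_structure[OF \<eta>(1)] by (elim exE conjE)
  show ?case
  proof (intro exI[of _ \<delta>] conjI \<delta> allI impI ballI)
    fix n m :: nat and \<phi> :: "complex mat \<Rightarrow> complex mat"
    assume n: "n \<ge> 1" and m: "m \<ge> 1"
      and "\<phi> \<in> hom (unitary_group n) (unitary_group m)"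
      and "continuous_map (unitary_topology n) (unitary_topology m) \<phi>"
      and "delta_surjective (U n) (U m) (hs_dist m) \<delta> \<phi>"
    then have main: "(m = 1 \<and> (\<exists>k::int. \<forall>v\<in>U n. \<phi> v = (det v powi k) \<cdot>\<^sub>m 1\<^sub>m 1)) \<or>
        (n \<le> m \<and> real m \<le> (1 + \<eta>) * real n \<and> (\<exists>k::int. \<exists>u\<in>U m. near_standard \<eta> n m \<phi> k u))"
      using str by blast
    have le: "(1 + \<eta>) * real n \<le> (1 + \<epsilon>) * real n" using \<eta> by (intro mult_right_mono) auto
    then show "(m = 1 \<and> (\<exists>k::int. \<forall>v\<in>U n. \<phi> v = (det v powi k) \<cdot>\<^sub>m 1\<^sub>m 1)) \<or>
        (n \<le> m \<and> real m \<le> (1 + \<epsilon>) * real n \<and> (\<exists>k::int. \<exists>u\<in>U m. near_standard \<epsilon> n m \<phi> k u))"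
      using main near_standard_mono[OF _ \<eta>(2)] by (meson order_trans)
    assume H: "n \<le> m \<and> real m \<le> (1 + \<epsilon>) * real n
          \<and> (\<exists>k::int. \<exists>u\<in>U m. near_standard \<epsilon> n m \<phi> k u) \<and> centrally_normalized n m \<phi>"
    show "\<exists>k::int. \<exists>u\<in>U m. near_standard \<epsilon> n m \<phi> k u \<and> (k = 0 \<or> (n, k) = (2, 1))"
    proof (cases "m = 1")
      case True
      then have "n = 1" using H n by simp
      then have "near_standard \<epsilon> n m \<phi> 0 (1\<^sub>m 1)" using near_standard_one[of \<phi> \<epsilon>] H True \<epsilon> by simp
      then show ?thesis using True U_one[of 1] by blast
    next
      case False
      then obtain k u where nm: "n \<le> m" "real m \<le> (1 + \<eta>) * real n" and u: "u \<in> U m" and near: "near_standard \<eta> n m \<phi> k u"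
        using main by blast
      have "k = 0 \<or> (n, k) = (2, 1)"
        using False m H by (intro central_exponent[OF nm(1) _ nm(2) \<eta>(3) n _ u near]) auto
      then show ?thesis using u near_standard_mono[OF near \<eta>(2)] by blast
    qed
    fix k :: int and u
    assume "\<epsilon> < 1 \<and> m \<noteq> 1" and u: "u \<in> U m" and near: "near_standard \<epsilon> n m \<phi> k u"
    then show "k = 0 \<or> (n, k) = (2, 1)"
      using m H n by (intro central_exponent[OF _ _ _ _ n _ u near]) auto
  qed
qed

end
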